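(* Let $r$ and $d$ be positive integers. For every positive integer $n$ with $w:=w(n)\in[0,\varepsilon_{r,d}]$ we have $$\mathrm{PL}(n)=\widehat{\mathrm{PL}}_r(w)+E_r(w),$$ where $$\widehat{\mathrm{PL}}_r(w)=\frac{e^{c+\frac{1}{w^2}}w^{\frac{25}{12}}}{2\pi}\sum_{s=0}^{r+1}\sum_{m=0}^{r+1}(-1)^m\beta_s b_{s,m}\Gamma\left(m+\tfrac12\right)3^{s+m+\frac{25}{24}}A^{s+\frac{13}{24}}w^{2s+2m},$$ and $$|E_r(w)|\leq e^{c+\frac{1}{w^2}}\cdot C_r\cdot 2^{r+8+\frac{1}{24}}\pi^2(3A)^{r+\frac{61}{24}}(r+2)\cdot w^{2r+5+\frac{1}{12}}.$$
   Context: $\mathrm{PL}(n)$ is the number of plane partitions of $n$, with $\sum_{n\ge0}\mathrm{PL}(n)x^n=\prod_{k\ge1}(1-x^k)^{-k}$. Let $A:=\zeta(3)$ and $c:=\zeta'(-1)=2\int_0^\infty\frac{y\log y}{e^{2\pi y}-1}dy$. For non-negative integers $s,m$ define $c_{s,m}(n)$ by $\sum_{n\ge0}c_{s,m}(n)y^n=\frac{(1+y)^{2s+2m+\frac{13}{12}}}{(3+2y)^{m+\frac12}}$ and set $b_{s,m}:=c_{s,m}(2m)$. For $s\ge1$ let $\alpha_s:=\frac{2\Gamma(2s+2)\zeta(2s)\zeta(2s+2)}{s(2\pi)^{4s+2}}$, and define $\beta_0,\beta_1,\dots$ by $\sum_{s\ge0}\beta_s y^s=\exp\left(-\sum_{i\ge1}\alpha_i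 y^i\right)$. Let $C_r:=2\max_{|z|=1}\left|e^{-\sum_{s=1}^{r+1}\alpha_s z^s}\right|$. Put $w(n):=\frac{2^{1/3}}{\sqrt3A^{1/6}n^{1/3}}$ and $$\varepsilon_{r,d}:=d^{-2d}2^{-d(d-1)}\left(\frac{4e}{\sqrt{3A}}\right)^{-d(d-1)}\left(e^{\frac{\Gamma(2d^2)}{(2\pi)^{2d^2+2}}}6^{2d-2}(6A)^r(r+1)\right)^{-\frac13}\left(0.1485\cdot2^{14}(3A)^3\pi^3\right)^{-\frac13}.$$ *)

theory Defs
  imports "HOL-Analysis.Analysis"
begin

text \<open>A plane partition is an array indexed by \<open>nat \<times> nat\<close> (from 0) and padded with zeros.
  The finiteness of the support is required explicitly, since \<open>sum\<close> over an infinite set is 0.\<close>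

definition plane_partition :: "nat \<Rightarrow> (nat \<Rightarrow> nat \<Rightarrow> nat) \<Rightarrow> bool" where
  "plane_partition n p \<longleftrightarrow>
     (\<forall>i j. p (Suc i) j \<le> p i j \<and> p i (Suc j) \<le> p i j) \<and>
     finite {(i, j). p i j \<noteq> 0} \<and>
     (\<Sum>(i, j)\<in>{(i, j). p i j \<noteq> 0}. p i j) = n"

definition PL :: "nat \<Rightarrow> nat" where
  "PL n = card {p. plane_partition n p}"

definition zeta_nat :: "nat \<Rightarrow> real" where
  "zeta_nat k = (\<Sum>n. 1 / real (Suc n) ^ k)"

definition A_const :: real where
  "A_const = zeta_nat 3"

text \<open>This is the integral form of \<open>\<zeta>'(-1)\<close>.\<close>

definition c_const :: real where
  "c_const = 2 * integral {0<..} (\<lambda>y. y * ln y / (exp (2 * pi * y) - 1))"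

text \<open>\<open>c_coeff s m n\<close> is the coefficient of \<open>y ^ n\<close> in the Taylor expansion at 0 of
  \<open>(1 + y) powr (2s + 2m + 13/12) / (3 + 2y) powr (m + 1/2)\<close>.\<close>

definition c_coeff :: "nat \<Rightarrow> nat \<Rightarrow> nat \<Rightarrow> real" where
  "c_coeff s m n =
     (deriv ^^ n) (\<lambda>y::real. (1 + y) powr (2 * real s + 2 * real m + 13 / 12)
                             / (3 + 2 * y) powr (real m + 1 / 2)) 0 / fact n"

definition b_coeff :: "nat \<Rightarrow> nat \<Rightarrow> real" where
  "b_coeff s m = c_coeff s m (2 * m)"

definition alpha :: "nat \<Rightarrow> real" where
  "alpha s = 2 * Gamma (2 * real s + 2) * zeta_nat (2 * s) * zeta_nat (2 * s + 2)
             / (real s * (2 * pi) ^ (4 * s + 2))"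

text \<open>The series \<open>\<Sum>i. alpha i * y ^ i\<close> has radius of convergence 0, so the exponential defining
  the \<open>\<beta>\<^sub>s\<close> is that of a formal power series.\<close>

definition beta :: "nat \<Rightarrow> real" where
  "beta s = fps_nth (fps_exp 1 oo (- Abs_fps (\<lambda>i. if i = 0 then 0 else alpha i))) s"

text \<open>The supremum is over a continuous function on a compact set, hence a maximum.\<close>

definition C_const :: "nat \<Rightarrow> real" where
  "C_const r = 2 * (SUP z\<in>{z::complex. cmod z = 1}.
     cmod (exp (- (\<Sum>s=1..r + 1. complex_of_real (alpha s) * z ^ s))))"

definition w_of :: "nat \<Rightarrow> real" where
  "w_of n = 2 powr (1 / 3) / (sqrt 3 * A_const powr (1 / 6) * real n powr (1 / 3))"

definition eps :: "nat \<Rightarrow> nat \<Rightarrow> real" where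
  "eps r d =
     real d powr (- 2 * real d) * 2 powr (- (real d * (real d - 1)))
     * (4 * exp 1 / sqrt (3 * A_const)) powr (- (real d * (real d - 1)))
     * (exp (Gamma (2 * real d ^ 2) / (2 * pi) ^ (2 * d ^ 2 + 2))
        * 6 powr (2 * real d - 2) * (6 * A_const) ^ r * (real r + 1)) powr (- 1 / 3)
     * (0.1485 * 2 ^ 14 * (3 * A_const) ^ 3 * pi ^ 3) powr (- 1 / 3)"

definition PL_hat :: "nat \<Rightarrow> real \<Rightarrow> real" where
  "PL_hat r w =
     exp (c_const + 1 / w ^ 2) * w powr (25 / 12) / (2 * pi)
     * (\<Sum>s=0..r + 1. \<Sum>m=0..r + 1.
          (- 1) ^ m * beta s * b_coeff s m * Gamma (real m + 1 / 2)
          * 3 powr (real s + real m + 25 / 24) * A_const powr (real s + 13 / 24)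
          * w ^ (2 * s + 2 * m))"

definition error_bound :: "nat \<Rightarrow> real \<Rightarrow> real" where
  "error_bound r w =
     exp (c_const + 1 / w ^ 2) * C_const r * 2 powr (real r + 8 + 1 / 24) * pi ^ 2
     * (3 * A_const) powr (real r + 61 / 24) * (real r + 2)
     * w powr (2 * real r + 5 + 1 / 12)"

end

theory Submission
  imports Defs "HOL-Complex_Analysis.Complex_Analysis" "HOL-Probability.Probability"
begin

text \<open>Let \<open>z0 = sqrt (3 A) w\<close>, so that \<open>n z0^3 = 2 A\<close>, and let \<open>L = A / z0^2 = 1 / (3 w^2)\<close>. By MacMahon's
  product formula, \<open>2 \<pi> PL n\<close> is the integral of \<open>exp (n z + f z)\<close> over the segment \<open>Re z = z0\<close>,
  \<open>\<bar>Im z\<bar> \<le> \<pi>\<close>, where \<open>f z = (\<Sum>j. 1 / (4 j sinh (j z / 2)^2))\<close>. Expanding the \<open>sinh^(-2)\<close> in partial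
  fractions turns \<open>f\<close> into a sum over \<open>k\<close> of functions of \<open>2 \<pi> i k / z\<close>, to which Euler--Maclaurin
  summation applies; this gives \<open>f z = A / z^2 + ln z / 12 + c - (\<Sum>s. alpha s z^(2 s))\<close> with an explicit
  remainder of size \<open>alpha (r + 2) z^(2 r + 4)\<close>.

  On \<open>z = z0 u\<close> the main part of the exponent is \<open>L (2 u + 1 / u^2) = 3 L + L v^2\<close> with
  \<open>v = (u - 1) sqrt (2 u + 1) / u\<close>. Expanding \<open>u^(2 s + 1/12) du / dv\<close> in powers of \<open>v\<close>, with coefficients
  given by Lagrange inversion, and integrating against \<open>exp (L v^2)\<close> yields the double sum; Cauchy
  estimates on a circle where \<open>\<bar>v\<bar> \<ge> 2\<close> bound the remainder. The part of the segment with
  \<open>\<bar>Im z\<bar> > z0 / 10\<close> is exponentially small.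

  The hypothesis makes \<open>z0\<close> at most of order \<open>(6 A)^(- r / 3)\<close>, which has to absorb the factor
  \<open>\<Gamma> (r + 5/2)\<close> of the Gaussian remainder. It does so up to \<open>r = 54\<close>. Beyond that the constant \<open>C_const r\<close>
  takes over, because it is at least \<open>2 exp (alpha (r + 1))\<close> and \<open>alpha\<close> grows factorially.\<close>

section \<open>MacMahon's product formula\<close>

text \<open>MacMahon's formula rests on Cauchy's identity for Schur polynomials. All counting is
  done in \<open>ennreal\<close>, so that the finiteness of the set of plane partitions of
  \<open>n\<close> comes out as a result instead of being an assumption. The analytic part is shaped
  by one budget: the claimed error offers the factors \<open>2 ^ r\<close> and
  \<open>C_const r\<close>, and everything else that grows geometrically in \<open>r\<close> has to
  fit in. Euler--Maclaurin summation in the sector \<open>\<bar>Im z\<bar> \<le> Re z / 10\<close>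
  loses \<open>10/9\<close> per order, the step from \<open>alpha (r + 1)\<close> to
  \<open>alpha (r + 2)\<close> costs at most a multiple of \<open>(16/9) ^ r\<close>, and
  \<open>\<bar>z\<bar>\<close> exceeding \<open>z0\<close> on the arc costs \<open>101/100\<close>
  per order; the product of the three ratios is just below 2. The Gaussian remainder has ratio
  \<open>(3/4) * 18 / 3.528\<close> once \<open>18 ^ r\<close> is split off the Gamma value. This is
  below \<open>2 * 1.93\<close>, and the surplus \<open>1.93 ^ r\<close> is cancelled by one factor
  \<open>z0\<close>: the hypothesis on \<open>w\<close> bounds \<open>z0 * 1.93 ^ r\<close>, because
  \<open>1.93 ^ 3\<close> is below \<open>6 A\<close>.\<close>

definition esum :: "'a set \<Rightarrow> ('a \<Rightarrow> ennreal) \<Rightarrow> ennreal" where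
  "esum A f = (\<integral>\<^sup>+ x. f x \<partial>count_space A)"

lemma esum_cong: "A = B \<Longrightarrow> (\<And>x. x \<in> B \<Longrightarrow> f x = g x) \<Longrightarrow> esum A f = esum B g"
  unfolding esum_def by (auto intro!: nn_integral_cong)

lemma esum_indicator: "esum A f = (\<integral>\<^sup>+ x. f x * indicator A x \<partial>count_space UNIV)"
  unfolding esum_def by (rule nn_integral_count_space_indicator) auto

lemma esum_bij: "bij_betw g A B \<Longrightarrow> esum A (\<lambda>x. f (g x)) = esum B f"
  unfolding esum_def by (rule nn_integral_bij_count_space)

lemma esum_cmult: "esum A (\<lambda>x. c * f x) = c * esum A f"
  unfolding esum_def by (rule nn_integral_cmult) auto

lemma esum_multc: "esum A (\<lambda>x. f x * c) = esum A f * c"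
  unfolding esum_def by (rule nn_integral_multc) auto

lemma esum_empty [simp]: "esum {} f = 0"
  unfolding esum_def by (simp add: nn_integral_empty)

lemma esum_single [simp]: "esum {a} f = f a"
  unfolding esum_def by (simp add: nn_integral_count_space_finite)

lemma esum_Sigma: "esum (Sigma A B) f = esum A (\<lambda>x. esum (B x) (\<lambda>y. f (x, y)))"
proof -
  have "esum (Sigma A B) f = (\<integral>\<^sup>+ x. \<integral>\<^sup>+ y. f (x, y) * indicator (Sigma A B) (x, y)
      \<partial>count_space UNIV \<partial>count_space UNIV)"
    unfolding esum_indicator by (rule nn_integral_fst_count_space [symmetric])
  also have "\<dots> = (\<integral>\<^sup>+ x. (\<integral>\<^sup>+ y. f (x, y) * indicator (B x) y \<partial>count_space UNIV) * indicator A x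
      \<partial>count_space UNIV)"
    by (intro nn_integral_cong) (auto simp: indicator_def intro!: nn_integral_cong)
  finally show ?thesis unfolding esum_indicator .
qed

text \<open>Tonelli for one relation sliced in two ways. As the values lie in
  \<open>ennreal\<close>, no summability has to be checked, which keeps the manipulation of Schur
  sums free of side conditions.\<close>

lemma esum_Sigma_swap:
  assumes "\<And>x y. x \<in> A \<and> y \<in> B x \<longleftrightarrow> y \<in> C \<and> x \<in> D y"
  shows "esum A (\<lambda>x. esum (B x) (\<lambda>y. f x y)) = esum C (\<lambda>y. esum (D y) (\<lambda>x. f x y))"
proof -
  have "esum A (\<lambda>x. esum (B x) (\<lambda>y. f x y)) = esum (Sigma A B) (\<lambda>p. f (fst p) (snd p))"
    by (simp add: esum_Sigma)
  also have "\<dots> = esum (Sigma C D) (\<lambda>p. f (fst (prod.swap p)) (snd (prod.swap p)))"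
  proof (rule esum_bij [symmetric])
    have "prod.swap ` Sigma C D = Sigma A B" using assms by (force simp: image_iff)
    thus "bij_betw prod.swap (Sigma C D) (Sigma A B)" by (simp add: bij_betw_def)
  qed
  finally show ?thesis by (simp add: esum_Sigma)
qed

section \<open>Partitions, interlacing and the skew Cauchy identity\<close>

definition Par :: "(nat \<Rightarrow> nat) set" where
  "Par = {l. (\<forall>i. l (Suc i) \<le> l i) \<and> finite {i. l i \<noteq> 0}}"

text \<open>In the language of Young diagrams: the skew shape of \<open>l\<close> over
  \<open>m\<close> is a horizontal strip.\<close>

definition interlaces :: "(nat \<Rightarrow> nat) \<Rightarrow> (nat \<Rightarrow> nat) \<Rightarrow> bool" (infix "\<prec>\<prec>" 50) where
  "m \<prec>\<prec> l \<longleftrightarrow> (\<forall>i. m i \<le> l i \<and> l (Suc i) \<le> m i)"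

definition psize :: "(nat \<Rightarrow> nat) \<Rightarrow> nat" where
  "psize l = (\<Sum>i | l i \<noteq> 0. l i)"

lemma psize_eq: "(\<And>i. i \<ge> M \<Longrightarrow> l i = 0) \<Longrightarrow> psize l = (\<Sum>i<M. l i)"
  unfolding psize_def
proof (rule sum.mono_neutral_left)
  assume *: "\<And>i. i \<ge> M \<Longrightarrow> l i = 0"
  show "{i. l i \<noteq> 0} \<subseteq> {..<M}"
  proof
    fix i assume "i \<in> {i. l i \<noteq> 0}"
    thus "i \<in> {..<M}" using *[of i] by (cases "i < M") auto
  qed
qed auto

lemma Par_bound: "l \<in> Par \<Longrightarrow> \<exists>M. \<forall>i\<ge>M. l i = 0"
proof -
  assume "l \<in> Par"
  hence "finite {i. l i \<noteq> 0}" by (simp add: Par_def)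
  then obtain M where M: "\<forall>i\<in>{i. l i \<noteq> 0}. i < M"
    using finite_nat_set_iff_bounded by blast
  have "l i = 0" if "i \<ge> M" for i
  proof (rule ccontr)
    assume "l i \<noteq> 0"
    hence "i < M" using M by blast
    thus False using that by simp
  qed
  thus ?thesis by blast
qed

lemma finite_support_bound: "(\<forall>i\<ge>M. l i = 0) \<Longrightarrow> finite {i::nat. l i \<noteq> (0::nat)}"
proof (rule finite_subset)
  assume *: "\<forall>i\<ge>M. l i = 0"
  show "{i. l i \<noteq> 0} \<subseteq> {..<M}"
  proof
    fix i assume "i \<in> {i. l i \<noteq> 0}"
    thus "i \<in> {..<M}" using spec [OF *, of i] by (cases "i < M") auto
  qed
qed auto

lemma interlaces_Par_down: "m \<prec>\<prec> l \<Longrightarrow> l \<in> Par \<Longrightarrow> m \<in> Par"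
proof -
  assume *: "m \<prec>\<prec> l" "l \<in> Par"
  have "{i. m i \<noteq> 0} \<subseteq> {i. l i \<noteq> 0}" using * by (auto simp: interlaces_def) (metis le_zero_eq gr0I less_irrefl)
  moreover have "m (Suc i) \<le> m i" for i using * unfolding interlaces_def by (meson le_trans)
  ultimately show "m \<in> Par" using * unfolding Par_def by (auto intro: finite_subset)
qed

lemma interlaces_Par_up: "m \<prec>\<prec> l \<Longrightarrow> m \<in> Par \<Longrightarrow> l \<in> Par"
proof -
  assume *: "m \<prec>\<prec> l" "m \<in> Par"
  obtain M where M: "\<forall>i\<ge>M. m i = 0" using Par_bound * by blast
  have "\<forall>i\<ge>Suc M. l i = 0"
  proof (intro allI impI)
    fix i assume "i \<ge> Suc M"
    then obtain j where j: "i = Suc j" "j \<ge> M" by (metis Suc_le_D Suc_le_mono)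
    thus "l i = 0" using M * by (auto simp: interlaces_def) (metis le_zero_eq)
  qed
  moreover have "l (Suc i) \<le> l i" for i using * unfolding interlaces_def by (meson le_trans)
  ultimately show "l \<in> Par" unfolding Par_def using finite_support_bound by blast
qed

lemma interlaces_psize: "m \<prec>\<prec> l \<Longrightarrow> l \<in> Par \<Longrightarrow> psize m \<le> psize l"
proof -
  assume *: "m \<prec>\<prec> l" "l \<in> Par"
  obtain M where M: "\<forall>i\<ge>M. l i = 0" using Par_bound * by blast
  have "\<forall>i\<ge>M. m i = 0" using M * by (auto simp: interlaces_def) (metis le_zero_eq)
  thus ?thesis using M * psize_eq[of M l] psize_eq[of M m] by (auto simp: interlaces_def intro!: sum_mono)
qed

text \<open>The piecewise-linear toggle that proves the skew Cauchy identity bijectively.\<close>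

definition toggle :: "(nat \<Rightarrow> nat) \<Rightarrow> (nat \<Rightarrow> nat) \<Rightarrow> (nat \<Rightarrow> nat) \<times> nat \<Rightarrow> nat \<Rightarrow> nat" where
  "toggle l m = (\<lambda>(k, a) i. case i of 0 \<Rightarrow> max (l 0) (m 0) + a
       | Suc j \<Rightarrow> max (l (Suc j)) (m (Suc j)) + min (l j) (m j) - k j)"

definition untoggle :: "(nat \<Rightarrow> nat) \<Rightarrow> (nat \<Rightarrow> nat) \<Rightarrow> (nat \<Rightarrow> nat) \<Rightarrow> (nat \<Rightarrow> nat) \<times> nat" where
  "untoggle l m n = ((\<lambda>j. max (l (Suc j)) (m (Suc j)) + min (l j) (m j) - n (Suc j)),
       n 0 - max (l 0) (m 0))"

text \<open>For \<open>k\<close> below and \<open>n\<close> above both \<open>l\<close> and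
  \<open>m\<close>, the entries \<open>k j\<close> and \<open>n (Suc j)\<close> range over the same
  interval, from \<open>max (l (Suc j)) (m (Suc j))\<close> to \<open>min (l j) (m j)\<close>, and
  the toggle reflects this interval. Only \<open>n 0\<close> has no upper bound; its excess is the
  free number \<open>a\<close>.\<close>

lemma toggle_bij:
  "bij_betw (toggle l m) ({k. k \<prec>\<prec> l \<and> k \<prec>\<prec> m} \<times> UNIV) {n. l \<prec>\<prec> n \<and> m \<prec>\<prec> n}"
proof (rule bij_betwI [where g = "untoggle l m"])
  show "toggle l m \<in> {k. k \<prec>\<prec> l \<and> k \<prec>\<prec> m} \<times> UNIV \<rightarrow> {n. l \<prec>\<prec> n \<and> m \<prec>\<prec> n}"
  proof (clarsimp, goal_cases)
    case (1 k a)
    have k: "k i \<le> l i" "k i \<le> m i" "l (Suc i) \<le> k i" "m (Suc i) \<le> k i" for i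
      using 1 by (auto simp: interlaces_def)
    have "l i \<le> toggle l m (k, a) i \<and> m i \<le> toggle l m (k, a) i" for i
      using k[of "i - 1"] by (cases i) (auto simp: toggle_def max_def min_def)
    moreover have "toggle l m (k, a) (Suc i) \<le> l i \<and> toggle l m (k, a) (Suc i) \<le> m i" for i
      using k[of i] by (auto simp: toggle_def max_def min_def)
    ultimately show ?case by (auto simp: interlaces_def)
  qed
  show "untoggle l m \<in> {n. l \<prec>\<prec> n \<and> m \<prec>\<prec> n} \<rightarrow> {k. k \<prec>\<prec> l \<and> k \<prec>\<prec> m} \<times> UNIV"
  proof (clarsimp simp: untoggle_def, goal_cases)
    case (1 n)
    have n: "l (Suc i) \<le> n (Suc i)" "m (Suc i) \<le> n (Suc i)" "n (Suc i) \<le> l i" "n (Suc i) \<le> m i" for i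
      using 1 by (auto simp: interlaces_def)
    show ?case unfolding interlaces_def
    proof (intro conjI allI)
      fix i
      show "max (l (Suc i)) (m (Suc i)) + min (l i) (m i) - n (Suc i) \<le> l i"
        "max (l (Suc i)) (m (Suc i)) + min (l i) (m i) - n (Suc i) \<le> m i"
        "l (Suc i) \<le> max (l (Suc i)) (m (Suc i)) + min (l i) (m i) - n (Suc i)"
        "m (Suc i) \<le> max (l (Suc i)) (m (Suc i)) + min (l i) (m i) - n (Suc i)"
        using n[of i] by (auto simp: max_def min_def)
    qed
  qed
  show "untoggle l m (toggle l m x) = x" if "x \<in> {k. k \<prec>\<prec> l \<and> k \<prec>\<prec> m} \<times> UNIV" for x
  proof -
    obtain k a where x: "x = (k, a)" by (cases x)
    have "k j \<le> l j \<and> k j \<le> m j" for j using that by (auto simp: x interlaces_def)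
    \<comment> \<open>Reflecting twice gives back \<open>k j\<close> only if the truncated
      subtraction on \<open>nat\<close> is exact.\<close>
    hence "k j \<le> max (l (Suc j)) (m (Suc j)) + min (l j) (m j)" for j by (simp add: trans_le_add2)
    thus ?thesis by (auto simp: x toggle_def untoggle_def)
  qed
  show "toggle l m (untoggle l m n) = n" if "n \<in> {n. l \<prec>\<prec> n \<and> m \<prec>\<prec> n}" for n
  proof
    fix i
    have *: "l j \<le> n j \<and> m j \<le> n j \<and> n (Suc j) \<le> l j \<and> n (Suc j) \<le> m j" for j
      using that by (auto simp: interlaces_def)
    show "toggle l m (untoggle l m n) i = n i"
    proof (cases i)
      case 0 with *[of 0] show ?thesis by (simp add: toggle_def untoggle_def)
    next
      case (Suc j)
      have "n (Suc j) \<le> max (l (Suc j)) (m (Suc j)) + min (l j) (m j)" using *[of j] by (simp add: trans_le_add2)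
      thus ?thesis by (simp add: Suc toggle_def untoggle_def)
    qed
  qed
qed

lemma max_add_min: "max a b + min a b = a + (b::nat)"
  by (simp add: max_def min_def)

text \<open>The reflection keeps \<open>n (Suc j) + k j\<close> equal to the sum of the two interval
  ends, and \<open>max_add_min\<close> turns the total of these ends into the sizes of
  \<open>l\<close> and \<open>m\<close>.\<close>

lemma psize_toggle:
  assumes "l \<in> Par" "m \<in> Par" "k \<prec>\<prec> l" "k \<prec>\<prec> m"
  shows "psize (toggle l m (k, a)) + psize k = psize l + psize m + a"
proof -
  obtain M1 M2 where M12: "\<forall>i\<ge>M1. l i = 0" "\<forall>i\<ge>M2. m i = 0" using Par_bound assms by blast
  define M where "M = max M1 M2"
  have M: "l i = 0" "m i = 0" "k i = 0" if "i \<ge> M" for i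
    using that M12 assms(3) by (auto simp: M_def interlaces_def) (metis le_zero_eq)
  have k: "k j \<le> min (l j) (m j)" for j using assms by (simp add: interlaces_def)
  have z: "toggle l m (k, a) i = 0" if "i \<ge> Suc M" for i
  proof -
    obtain j where j: "i = Suc j" "j \<ge> M" using \<open>i \<ge> Suc M\<close> by (metis Suc_le_D Suc_le_mono)
    thus ?thesis using M[of j] M[of "Suc j"] by (simp add: toggle_def)
  qed
  have "psize (toggle l m (k, a)) + psize k = (\<Sum>i<Suc M. toggle l m (k, a) i) + (\<Sum>i<M. k i)"
    using psize_eq[of "Suc M" "toggle l m (k, a)"] psize_eq[of M k] z M by simp
  also have "(\<Sum>i<Suc M. toggle l m (k, a) i) = max (l 0) (m 0) + a +
      (\<Sum>j<M. max (l (Suc j)) (m (Suc j)) + min (l j) (m j) - k j)"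
    by (subst sum.lessThan_Suc_shift) (simp add: toggle_def)
  also have "\<dots> + (\<Sum>i<M. k i) = max (l 0) (m 0) + a +
      (\<Sum>j<M. max (l (Suc j)) (m (Suc j)) + min (l j) (m j))"
    using k by (simp add: sum.distrib [symmetric] trans_le_add2)
  also have "\<dots> = a + (\<Sum>i<Suc M. max (l i) (m i)) + (\<Sum>j<M. min (l j) (m j))"
    by (subst sum.lessThan_Suc_shift) (simp add: sum.distrib)
  also have "\<dots> = a + (\<Sum>i<M. max (l i) (m i) + min (l i) (m i))"
    using M[of M] by (simp add: sum.distrib)
  also have "\<dots> = a + (\<Sum>i<M. l i + m i)" by (simp add: max_add_min)
  also have "\<dots> = psize l + psize m + a" using psize_eq[of M l] psize_eq[of M m] M by (simp add: sum.distrib)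
  finally show ?thesis .
qed

definition geo :: "ennreal \<Rightarrow> ennreal" where "geo x = esum UNIV (\<lambda>a::nat. x ^ a)"

text \<open>The commutation relation between adding and removing a horizontal strip. Replacing
  common lower neighbours by common upper ones costs the factor \<open>geo (x * y)\<close>, which
  the free number \<open>a\<close> of the toggle contributes.\<close>

lemma skew_Cauchy:
  assumes "l \<in> Par" "m \<in> Par"
  shows "esum {n. l \<prec>\<prec> n \<and> m \<prec>\<prec> n} (\<lambda>n. x ^ (psize n - psize l) * y ^ (psize n - psize m)) =
    geo (x * y) * esum {k. k \<prec>\<prec> l \<and> k \<prec>\<prec> m} (\<lambda>k. x ^ (psize m - psize k) * y ^ (psize l - psize k))"
    (is "esum ?A ?f = _ * esum ?B ?g")
proof -
  have "esum ?A ?f = esum (?B \<times> UNIV) (\<lambda>p. ?f (toggle l m p))"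
    by (rule esum_bij [OF toggle_bij, symmetric])
  also have "\<dots> = esum (?B \<times> UNIV) (\<lambda>(k, a). ?g k * (x * y) ^ a)"
  proof (rule esum_cong, simp, clarify)
    fix k a assume k: "k \<prec>\<prec> l" "k \<prec>\<prec> m"
    have "psize k \<le> psize l" "psize k \<le> psize m" using interlaces_psize k assms by auto
    with psize_toggle[OF assms k, of a]
    have "psize (toggle l m (k, a)) - psize l = psize m - psize k + a"
         "psize (toggle l m (k, a)) - psize m = psize l - psize k + a" by auto
    thus "?f (toggle l m (k, a)) = ?g k * (x * y) ^ a"
      by (simp add: power_add power_mult_distrib mult_ac)
  qed
  also have "\<dots> = esum ?B (\<lambda>k. ?g k * geo (x * y))"
    by (simp add: esum_Sigma esum_cmult geo_def)
  also have "\<dots> = geo (x * y) * esum ?B ?g" by (subst esum_multc) (rule mult.commute)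
  finally show ?thesis .
qed

text \<open>The Schur polynomial of shape \<open>l\<close> in the listed variables, built by the
  branching rule: each variable strips off one horizontal strip, until the empty shape is
  reached.\<close>

fun schur :: "ennreal list \<Rightarrow> (nat \<Rightarrow> nat) \<Rightarrow> ennreal" where
  "schur [] l = (if l = (\<lambda>_. 0) then 1 else 0)"
| "schur (x # xs) l = esum {m. m \<prec>\<prec> l} (\<lambda>m. schur xs m * x ^ (psize l - psize m))"

lemma zero_Par [simp]: "(\<lambda>_. 0) \<in> Par" by (simp add: Par_def)

lemma below_zero: "{m. m \<prec>\<prec> (\<lambda>_. 0)} = {\<lambda>_. 0}"
  by (auto simp: interlaces_def)

lemma schur_zero: "schur xs (\<lambda>_. 0) = 1"
  by (induction xs) (simp_all add: below_zero)

text \<open>The strip of weight \<open>y\<close> is moved past the variables of \<open>xs\<close>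
  one at a time by \<open>skew_Cauchy\<close>, and each exchange leaves a factor
  \<open>geo (x * y)\<close>. When no variable remains, only the empty shape contributes.\<close>

lemma schur_add_variable:
  assumes "m \<in> Par"
  shows "esum {l. m \<prec>\<prec> l} (\<lambda>l. schur xs l * y ^ (psize l - psize m)) =
    (\<Prod>x\<leftarrow>xs. geo (x * y)) * schur xs m"
  using assms
proof (induction xs arbitrary: m)
  case Nil
  have "esum {l. m \<prec>\<prec> l} (\<lambda>l. schur [] l * y ^ (psize l - psize m)) =
    esum UNIV (\<lambda>l. schur [] l * y ^ (psize l - psize m) * indicator {l. m \<prec>\<prec> l} l)"
    by (subst esum_indicator) (simp add: esum_def)
  also have "\<dots> = esum UNIV (\<lambda>l. (if m = (\<lambda>_. 0) then 1 else 0) * indicator {\<lambda>_::nat. 0::nat} l)"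
    by (intro esum_cong refl) (auto simp: indicator_def interlaces_def fun_eq_iff psize_def)
  also have "\<dots> = esum {\<lambda>_. 0} (\<lambda>l. if m = (\<lambda>_. 0) then 1 else 0)"
    by (subst (2) esum_indicator) (simp add: esum_def)
  finally show ?case by simp
next
  case (Cons x xs)
  have "esum {l. m \<prec>\<prec> l} (\<lambda>l. schur (x # xs) l * y ^ (psize l - psize m)) =
    esum {l. m \<prec>\<prec> l} (\<lambda>l. esum {r. r \<prec>\<prec> l} (\<lambda>r. schur xs r * (x ^ (psize l - psize r) * y ^ (psize l - psize m))))"
    by (simp only: esum_multc [symmetric] mult.assoc schur.simps)
  \<comment> \<open>For fixed \<open>r\<close> the inner sum now runs over the common upper
    neighbours of \<open>r\<close> and \<open>m\<close>, the left side of
    \<open>skew_Cauchy\<close>.\<close>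
  also have "\<dots> = esum Par (\<lambda>r. esum {l. r \<prec>\<prec> l \<and> m \<prec>\<prec> l} (\<lambda>l. schur xs r * (x ^ (psize l - psize r) * y ^ (psize l - psize m))))"
    by (rule esum_Sigma_swap) (use Cons.prems in \<open>metis (no_types, lifting) mem_Collect_eq interlaces_Par_up interlaces_Par_down\<close>)
  also have "\<dots> = esum Par (\<lambda>r. geo (x * y) * esum {k. k \<prec>\<prec> r \<and> k \<prec>\<prec> m} (\<lambda>k. schur xs r * (x ^ (psize m - psize k) * y ^ (psize r - psize k))))"
    by (intro esum_cong refl) (use Cons.prems in \<open>simp add: skew_Cauchy esum_cmult mult_ac\<close>)
  also have "\<dots> = geo (x * y) * esum {k. k \<prec>\<prec> m} (\<lambda>k. esum {r. k \<prec>\<prec> r} (\<lambda>r. schur xs r * (x ^ (psize m - psize k) * y ^ (psize r - psize k))))"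
    by (subst esum_cmult, rule arg_cong2 [where f = "(*)"], rule refl, rule esum_Sigma_swap)
       (use Cons.prems in \<open>metis (no_types, lifting) mem_Collect_eq interlaces_Par_up interlaces_Par_down\<close>)
  also have "\<dots> = geo (x * y) * esum {k. k \<prec>\<prec> m} (\<lambda>k. ((\<Prod>x\<leftarrow>xs. geo (x * y)) * schur xs k) * x ^ (psize m - psize k))"
  proof (rule arg_cong2 [where f = "(*)"], rule refl, rule esum_cong, rule refl)
    fix k assume "k \<in> {k. k \<prec>\<prec> m}"
    hence k: "k \<in> Par" using interlaces_Par_down [OF _ Cons.prems] by simp
    show "esum {r. k \<prec>\<prec> r} (\<lambda>r. schur xs r * (x ^ (psize m - psize k) * y ^ (psize r - psize k))) =
      ((\<Prod>x\<leftarrow>xs. geo (x * y)) * schur xs k) * x ^ (psize m - psize k)"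
      by (subst Cons.IH [OF k, symmetric]) (simp only: esum_multc [symmetric], simp only: mult_ac)
  qed
  also have "\<dots> = (\<Prod>x\<leftarrow>x # xs. geo (x * y)) * schur (x # xs) m"
    by (simp add: esum_cmult mult.assoc)
  finally show ?case .
qed

text \<open>Induction on \<open>ys\<close>: once the sum over the larger shape \<open>l\<close> is
  done first, with \<open>m\<close> fixed, the newest variable is a case of
  \<open>schur_add_variable\<close>.\<close>

lemma schur_Cauchy:
  "esum Par (\<lambda>l. schur xs l * schur ys l) = (\<Prod>y\<leftarrow>ys. \<Prod>x\<leftarrow>xs. geo (x * y))"
proof (induction ys)
  case Nil
  have "esum Par (\<lambda>l. schur xs l * schur [] l) = esum UNIV (\<lambda>l. schur xs (\<lambda>_. 0) * indicator {\<lambda>_::nat. 0::nat} l)"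
    unfolding esum_indicator [of Par] esum_def [of UNIV] by (intro nn_integral_cong) (auto simp: indicator_def)
  also have "\<dots> = esum {\<lambda>_. 0} (\<lambda>l. schur xs (\<lambda>_. 0))"
    by (subst (2) esum_indicator) (simp add: esum_def)
  finally show ?case by (simp add: schur_zero)
next
  case (Cons y ys)
  have "esum Par (\<lambda>l. schur xs l * schur (y # ys) l) =
     esum Par (\<lambda>l. esum {m. m \<prec>\<prec> l} (\<lambda>m. schur ys m * (schur xs l * y ^ (psize l - psize m))))"
    by (simp only: esum_cmult [symmetric] schur.simps) (simp only: mult_ac)
  also have "\<dots> = esum Par (\<lambda>m. esum {l. m \<prec>\<prec> l} (\<lambda>l. schur ys m * (schur xs l * y ^ (psize l - psize m))))"
    by (rule esum_Sigma_swap) (metis (no_types, lifting) mem_Collect_eq interlaces_Par_up interlaces_Par_down)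
  also have "\<dots> = esum Par (\<lambda>m. (\<Prod>x\<leftarrow>xs. geo (x * y)) * (schur xs m * schur ys m))"
  proof (rule esum_cong, rule refl)
    fix m assume "m \<in> Par"
    from schur_add_variable [OF this, of xs y]
    show "esum {l. m \<prec>\<prec> l} (\<lambda>l. schur ys m * (schur xs l * y ^ (psize l - psize m))) =
      (\<Prod>x\<leftarrow>xs. geo (x * y)) * (schur xs m * schur ys m)"
      by (simp only: esum_cmult) (simp add: mult_ac)
  qed
  finally show ?case by (simp add: esum_cmult Cons.IH)
qed

text \<open>Homogeneity. It shifts all exponents of \<open>q\<close> by one, both for a chain that
  is extended by one step and when the weight of the main diagonal is absorbed.\<close>

lemma schur_scale:
  assumes "l \<in> Par"
  shows "schur (map ((*) q) xs) l = q ^ psize l * schur xs l"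
  using assms
proof (induction xs arbitrary: l)
  case Nil thus ?case by (simp add: psize_def)
next
  case (Cons x xs)
  have "schur (map ((*) q) (x # xs)) l =
    esum {m. m \<prec>\<prec> l} (\<lambda>m. q ^ psize l * (schur xs m * x ^ (psize l - psize m)))"
    unfolding list.map schur.simps
  proof (rule esum_cong, rule refl)
    fix m assume "m \<in> {m. m \<prec>\<prec> l}"
    hence m: "m \<prec>\<prec> l" "m \<in> Par" using interlaces_Par_down [OF _ Cons.prems] by simp_all
    have "q ^ psize l = q ^ psize m * q ^ (psize l - psize m)"
      using interlaces_psize[OF m(1) Cons.prems] by (simp flip: power_add)
    thus "schur (map ((*) q) xs) m * (q * x) ^ (psize l - psize m) =
        q ^ psize l * (schur xs m * x ^ (psize l - psize m))"
      by (simp add: Cons.IH[OF m(2)] power_mult_distrib mult_ac)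
  qed
  thus ?case by (simp add: esum_cmult)
qed

section \<open>Plane partitions in a box, read along their diagonals\<close>

definition Strips :: "nat \<Rightarrow> (nat \<Rightarrow> nat) \<Rightarrow> (nat \<Rightarrow> nat \<Rightarrow> nat) set" where
  "Strips N l = {c. c 0 = l \<and> (\<forall>t. c (Suc t) \<prec>\<prec> c t) \<and> (\<forall>t\<ge>N. c t = (\<lambda>_. 0))}"

text \<open>The head \<open>c 0\<close> is left out of the weight: it is the main diagonal, shared
  by both halves of a plane partition, and has to be counted once.\<close>

definition chain_gf :: "ennreal \<Rightarrow> nat \<Rightarrow> (nat \<Rightarrow> nat) \<Rightarrow> ennreal" where
  "chain_gf q N l = esum (Strips N l) (\<lambda>c. q ^ (\<Sum>t<N. psize (c (Suc t))))"

lemma Strips_0: "Strips 0 l = (if l = (\<lambda>_. 0) then {\<lambda>_ _. 0} else {})"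
  by (auto simp: Strips_def interlaces_def fun_eq_iff)

lemma Strips_Suc_bij:
  "bij_betw (\<lambda>(m, c). case_nat l c) (Sigma {m. m \<prec>\<prec> l} (Strips N)) (Strips (Suc N) l)"
proof (rule bij_betwI [where g = "\<lambda>c. (c 1, \<lambda>t. c (Suc t))"])
  show "(\<lambda>(m, c). case_nat l c) \<in> Sigma {m. m \<prec>\<prec> l} (Strips N) \<rightarrow> Strips (Suc N) l"
    by (auto simp: Strips_def split: nat.split)
  show "(\<lambda>c. (c 1, \<lambda>t. c (Suc t))) \<in> Strips (Suc N) l \<rightarrow> Sigma {m. m \<prec>\<prec> l} (Strips N)"
    by (auto simp: Strips_def)
  show "(\<lambda>(m, c). case_nat l c) (c 1, \<lambda>t. c (Suc t)) = c" if "c \<in> Strips (Suc N) l" for c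
    using that by (auto simp: Strips_def fun_eq_iff split: nat.split)
qed (auto simp: Strips_def)

lemma chain_gf_Suc: "chain_gf q (Suc N) l = esum {m. m \<prec>\<prec> l} (\<lambda>m. q ^ psize m * chain_gf q N m)"
proof -
  have "chain_gf q (Suc N) l = esum (Sigma {m. m \<prec>\<prec> l} (Strips N))
      (\<lambda>p. q ^ (\<Sum>t<Suc N. psize ((case_nat l (snd p)) (Suc t))))"
    unfolding chain_gf_def
    by (subst esum_bij [OF Strips_Suc_bij, symmetric]) (simp add: case_prod_unfold)
  also have "\<dots> = esum {m. m \<prec>\<prec> l} (\<lambda>m. esum (Strips N m) (\<lambda>c. q ^ psize m * q ^ (\<Sum>t<N. psize (c (Suc t)))))"
    unfolding esum_Sigma
  proof (intro esum_cong refl)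
    fix m c assume "c \<in> Strips N m"
    hence "c 0 = m" by (simp add: Strips_def)
    thus "q ^ (\<Sum>t<Suc N. psize ((case_nat l (snd (m, c))) (Suc t))) =
        q ^ psize m * q ^ (\<Sum>t<N. psize (c (Suc t)))"
      by (simp only: sum.lessThan_Suc_shift) (simp add: power_add)
  qed
  finally show ?thesis by (simp add: esum_cmult chain_gf_def)
qed

text \<open>A box removed between \<open>c t\<close> and \<open>c (Suc t)\<close> belongs to
  \<open>c 1\<close>, ..., \<open>c t\<close> and so carries the weight \<open>q ^ t\<close>. Hence
  the variables are \<open>1\<close>, \<open>q\<close>, ..., \<open>q ^ (N - 1)\<close>.\<close>

lemma chain_gf_schur: "l \<in> Par \<Longrightarrow> chain_gf q N l = schur (map ((^) q) [0..<N]) l"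
proof (induction N arbitrary: l)
  case 0 thus ?case by (simp add: chain_gf_def Strips_0)
next
  case (Suc N)
  have 1: "map ((^) q) [0..<Suc N] = 1 # map ((*) q) (map ((^) q) [0..<N])"
    by (rule nth_equalityI) (auto simp: nth_Cons nth_append less_Suc_eq simp del: upt_Suc split: nat.split)
  have 2: "q ^ psize m * chain_gf q N m = schur (map ((*) q) (map ((^) q) [0..<N])) m * 1 ^ (psize l - psize m)"
    if "m \<prec>\<prec> l" for m
    using interlaces_Par_down[OF that Suc.prems] by (simp add: Suc.IH schur_scale del: map_map)
  show ?case unfolding chain_gf_Suc 1 schur.simps by (intro esum_cong refl 2) simp
qed

definition Box :: "nat \<Rightarrow> (nat \<Rightarrow> nat \<Rightarrow> nat) set" where
  "Box N = {p. (\<forall>i j. p (Suc i) j \<le> p i j \<and> p i (Suc j) \<le> p i j) \<and> (\<forall>i j. N \<le> i \<or> N \<le> j \<longrightarrow> p i j = 0)}"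

text \<open>Read along its diagonals, a plane partition is a pair of chains of interlacing partitions with a
  common head, the main diagonal.\<close>

definition glue :: "(nat \<Rightarrow> nat \<Rightarrow> nat) \<Rightarrow> (nat \<Rightarrow> nat \<Rightarrow> nat) \<Rightarrow> nat \<Rightarrow> nat \<Rightarrow> nat" where
  "glue c d = (\<lambda>i j. if i \<le> j then c (j - i) i else d (i - j) j)"

text \<open>By interlacing, an entry at index \<open>i\<close> is at most the entry at index
  \<open>i - 1\<close> of the next partition. After \<open>i\<close> steps index 0 is reached, and
  by then the chain has died out.\<close>

lemma Strips_zero:
  assumes "c \<in> Strips N l" "t + i \<ge> N"
  shows "c t i = 0"
proof -
  have "c t i \<le> c (t + k) (i - k)" if "k \<le> i" for k
    using that
  proof (induction k)
    case (Suc k)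
    have "i - k = Suc (i - Suc k)" using Suc.prems by simp
    moreover have "c (t + k) (Suc (i - Suc k)) \<le> c (Suc (t + k)) (i - Suc k)"
      using assms(1) unfolding Strips_def interlaces_def by blast
    ultimately show ?case using Suc by (metis Suc_leD add_Suc_right le_trans)
  qed simp
  from this[of i] show ?thesis using assms by (auto simp: Strips_def)
qed

lemma Box_bij:
  "bij_betw (\<lambda>(l, c, d). glue c d) (SIGMA l:Par. Strips N l \<times> Strips N l) (Box N)"
proof (rule bij_betwI [where g = "\<lambda>p. (\<lambda>i. p i i, \<lambda>t i. p i (i + t), \<lambda>t i. p (i + t) i)"])
  show "(\<lambda>(l, c, d). glue c d) \<in> (SIGMA l:Par. Strips N l \<times> Strips N l) \<rightarrow> Box N"
  proof (clarsimp)
    fix l c d assume *: "c \<in> Strips N l" "d \<in> Strips N l"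
    have il: "c (Suc t) i \<le> c t i" "c t (Suc i) \<le> c (Suc t) i" "c 0 = l"
      "d (Suc t) i \<le> d t i" "d t (Suc i) \<le> d (Suc t) i" "d 0 = l" for t i
      using * by (auto simp: Strips_def interlaces_def)
    have "glue c d (Suc i) j \<le> glue c d i j" for i j
    proof -
      \<comment> \<open>The case \<open>i = j\<close> crosses the main diagonal, where
        \<open>glue\<close> changes from \<open>c\<close> to \<open>d\<close>; there the common head
        \<open>l\<close> links the two chains.\<close>
      consider "Suc i \<le> j" | "i = j" | "i > j" by linarith
      thus ?thesis
      proof cases
        case 1
        then obtain k where "j = Suc i + k" using le_Suc_ex by blast
        thus ?thesis using il(2)[of k i] by (simp add: glue_def)
      next
        case 2 thus ?thesis using il(4)[of 0 j] il by (simp add: glue_def)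
      next
        case 3
        then obtain k where "i = Suc j + k" by (metis Suc_leI le_Suc_ex)
        thus ?thesis using il(4)[of "Suc k" j] by (simp add: glue_def)
      qed
    qed
    moreover have "glue c d i (Suc j) \<le> glue c d i j" for i j
    proof -
      consider "i \<le> j" | "i = Suc j" | "i > Suc j" by linarith
      thus ?thesis
      proof cases
        case 1
        then obtain k where "j = i + k" using le_Suc_ex by blast
        thus ?thesis using il(1)[of k i] by (simp add: glue_def Suc_diff_le)
      next
        case 2 thus ?thesis using il(5)[of 0 j] il by (simp add: glue_def)
      next
        case 3
        then obtain k where "i = Suc (Suc j) + k" by (metis Suc_leI le_Suc_ex)
        thus ?thesis using il(5)[of "Suc k" j] by (simp add: glue_def)
      qed
    qed
    moreover have "glue c d i j = 0" if "N \<le> i \<or> N \<le> j" for i j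
      using that Strips_zero[OF *(1), of "j - i" i] Strips_zero[OF *(2), of "i - j" j]
      by (auto simp: glue_def)
    ultimately show "glue c d \<in> Box N" by (auto simp: Box_def)
  qed
  show "(\<lambda>p. (\<lambda>i. p i i, \<lambda>t i. p i (i + t), \<lambda>t i. p (i + t) i)) \<in> Box N \<rightarrow> (SIGMA l:Par. Strips N l \<times> Strips N l)"
  proof (rule funcsetI)
    fix p assume p: "p \<in> Box N"
    hence m: "p (Suc i) j \<le> p i j" "p i (Suc j) \<le> p i j" "N \<le> i \<or> N \<le> j \<longrightarrow> p i j = 0" for i j
      by (auto simp: Box_def)
    have "p (Suc i) (Suc i) \<le> p i i" for i using m(1)[of i "Suc i"] m(2)[of i i] by linarith
    moreover have "\<forall>i\<ge>N. p i i = 0" using m by auto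
    ultimately have "(\<lambda>i. p i i) \<in> Par"
      unfolding Par_def using finite_support_bound[of N "\<lambda>i. p i i"] by blast
    moreover have "(\<lambda>t i. p i (i + t)) \<in> Strips N (\<lambda>i. p i i)" "(\<lambda>t i. p (i + t) i) \<in> Strips N (\<lambda>i. p i i)"
      using m by (auto simp: Strips_def interlaces_def fun_eq_iff)
    ultimately show "(\<lambda>i. p i i, \<lambda>t i. p i (i + t), \<lambda>t i. p (i + t) i) \<in> (SIGMA l:Par. Strips N l \<times> Strips N l)"
      by simp
  qed
  show "(\<lambda>p. (\<lambda>i. p i i, \<lambda>t i. p i (i + t), \<lambda>t i. p (i + t) i)) ((\<lambda>(l, c, d). glue c d) x) = x"
    if "x \<in> (SIGMA l:Par. Strips N l \<times> Strips N l)" for x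
    using that by (auto simp: glue_def Strips_def fun_eq_iff)
  show "(\<lambda>(l, c, d). glue c d) (\<lambda>i. p i i, \<lambda>t i. p i (i + t), \<lambda>t i. p (i + t) i) = p" for p
    by (auto simp: glue_def fun_eq_iff)
qed

lemma sum_diagonals:
  fixes p :: "nat \<Rightarrow> nat \<Rightarrow> nat"
  assumes "\<And>i j. N \<le> i \<or> N \<le> j \<Longrightarrow> p i j = 0"
  shows "(\<Sum>i<N. \<Sum>j<N. p i j) = (\<Sum>i<N. p i i) + (\<Sum>t<N. \<Sum>i<N. p i (i + Suc t)) + (\<Sum>t<N. \<Sum>i<N. p (i + Suc t) i)"
proof -
  have row: "(\<Sum>t<N. f (i + Suc t)) = (\<Sum>j\<in>{i<..<N}. f j)"
    if "\<And>j. j \<ge> N \<Longrightarrow> f j = 0" for f :: "nat \<Rightarrow> nat" and i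
  proof -
    have "(\<Sum>t<N. f (i + Suc t)) = (\<Sum>j\<in>{Suc i..<Suc i + N}. f j)"
      using sum.shift_bounds_nat_ivl[of f 0 "Suc i" N] by (simp add: atLeast0LessThan add.commute)
    also have "\<dots> = (\<Sum>j\<in>{i<..<N}. f j)"
      by (rule sum.mono_neutral_right) (auto simp: that)
    finally show ?thesis .
  qed
  have 1: "(\<Sum>t<N. \<Sum>i<N. p i (i + Suc t)) = (\<Sum>i<N. \<Sum>j\<in>{i<..<N}. p i j)"
    by (subst sum.swap) (intro sum.cong refl row, simp add: assms)
  have 2: "(\<Sum>t<N. \<Sum>i<N. p (i + Suc t) i) = (\<Sum>j<N. \<Sum>i\<in>{j<..<N}. p i j)"
    by (subst sum.swap) (intro sum.cong refl row, simp add: assms)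
  have 3: "(\<Sum>j<N. \<Sum>i\<in>{j<..<N}. p i j) = (\<Sum>i<N. \<Sum>j<i. p i j)"
    unfolding sum.Sigma[OF finite_lessThan ballI[OF finite_greaterThanLessThan]] sum.Sigma[OF finite_lessThan ballI[OF finite_lessThan]]
    by (rule sum.reindex_bij_witness [of _ "\<lambda>(i, j). (j, i)" "\<lambda>(j, i). (i, j)"]) auto
  have "(\<Sum>j<N. p i j) = p i i + (\<Sum>j\<in>{i<..<N}. p i j) + (\<Sum>j<i. p i j)" if "i < N" for i
  proof -
    have "{..<N} = {i} \<union> {i<..<N} \<union> {..<i}" using that by auto
    moreover have "sum (p i) ({i<..<N} \<union> {..<i}) = sum (p i) {i<..<N} + sum (p i) {..<i}"
      by (rule sum.union_disjoint) auto
    ultimately show ?thesis by simp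
  qed
  hence "(\<Sum>i<N. \<Sum>j<N. p i j) = (\<Sum>i<N. p i i + (\<Sum>j\<in>{i<..<N}. p i j) + (\<Sum>j<i. p i j))" by simp
  thus ?thesis unfolding 1 2 3 by (simp add: sum.distrib)
qed

text \<open>The weight \<open>q ^ psize l\<close> of the main diagonal turns one of the two sets of
  variables into \<open>q\<close>, ..., \<open>q ^ N\<close>, so that Cauchy's identity produces the
  exponents \<open>i + j + 1\<close>. As \<open>N\<close> grows, the exponent \<open>k\<close> comes
  to occur exactly \<open>k\<close> times.\<close>

lemma Box_gf:
  "esum (Box N) (\<lambda>p. q ^ (\<Sum>i<N. \<Sum>j<N. p i j)) = (\<Prod>j\<leftarrow>[0..<N]. \<Prod>i\<leftarrow>[0..<N]. geo (q ^ (i + j + 1)))"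
proof -
  have "esum (Box N) (\<lambda>p. q ^ (\<Sum>i<N. \<Sum>j<N. p i j)) =
    esum (SIGMA l:Par. Strips N l \<times> Strips N l) (\<lambda>x. q ^ (\<Sum>i<N. \<Sum>j<N. (\<lambda>(l, c, d). glue c d) x i j))"
    by (rule esum_bij [OF Box_bij, symmetric])
  also have "\<dots> = esum (SIGMA l:Par. Strips N l \<times> Strips N l)
    (\<lambda>(l, c, d). q ^ psize l * (q ^ (\<Sum>t<N. psize (c (Suc t))) * q ^ (\<Sum>t<N. psize (d (Suc t)))))"
  proof (rule esum_cong, rule refl, clarify)
    fix l c d assume *: "l \<in> Par" "c \<in> Strips N l" "d \<in> Strips N l"
    hence "glue c d \<in> Box N" using Box_bij[of N] unfolding bij_betw_def by force
    hence z: "N \<le> i \<or> N \<le> j \<Longrightarrow> glue c d i j = 0" for i j by (auto simp: Box_def)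
    have c0: "c 0 = l" "d 0 = l" using * by (auto simp: Strips_def)
    have "psize l = (\<Sum>i<N. glue c d i i)" using Strips_zero[OF *(2), of 0] c0
      by (subst psize_eq[of N]) (auto simp: glue_def)
    moreover have "psize (c (Suc t)) = (\<Sum>i<N. glue c d i (i + Suc t))" for t
      using Strips_zero[OF *(2), of "Suc t"] by (subst psize_eq[of N]) (auto simp: glue_def)
    moreover have "psize (d (Suc t)) = (\<Sum>i<N. glue c d (i + Suc t) i)" for t
      using Strips_zero[OF *(3), of "Suc t"] by (subst psize_eq[of N]) (auto simp: glue_def)
    ultimately show "q ^ (\<Sum>i<N. \<Sum>j<N. glue c d i j) =
       q ^ psize l * (q ^ (\<Sum>t<N. psize (c (Suc t))) * q ^ (\<Sum>t<N. psize (d (Suc t))))"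
      by (subst sum_diagonals[OF z]) (auto simp: power_add mult.assoc)
  qed
  also have "\<dots> = esum Par (\<lambda>l. q ^ psize l * (chain_gf q N l * chain_gf q N l))"
    by (simp add: esum_Sigma esum_cmult esum_multc chain_gf_def)
  also have "\<dots> = esum Par (\<lambda>l. schur (map ((*) q) (map ((^) q) [0..<N])) l * schur (map ((^) q) [0..<N]) l)"
    by (intro esum_cong refl) (simp only: chain_gf_schur schur_scale mult.assoc)
  also have "\<dots> = (\<Prod>j\<leftarrow>[0..<N]. \<Prod>i\<leftarrow>[0..<N]. geo (q ^ (i + j + 1)))"
    unfolding schur_Cauchy by (simp add: o_def power_add mult_ac)
  finally show ?thesis .
qed

section \<open>The infinite product, and the passage to complex arguments\<close>

lemma geo_ennreal: "0 \<le> x \<Longrightarrow> x < 1 \<Longrightarrow> geo (ennreal x) = ennreal (1 / (1 - x))"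
proof -
  assume x: "0 \<le> x" "x < 1"
  have "geo (ennreal x) = (\<Sum>a. ennreal (x ^ a))"
    using x unfolding geo_def esum_def by (simp add: nn_integral_count_space_nat ennreal_power)
  also have "\<dots> = ennreal (\<Sum>a. x ^ a)"
    using x by (intro suminf_ennreal2) (auto intro: summable_geometric)
  finally show ?thesis using x by (simp add: suminf_geometric)
qed

text \<open>The logarithm of the product of \<open>(1 - q ^ k) ^ (- k)\<close> is a double sum over
  \<open>k\<close> and the power \<open>m\<close> of the logarithm series. Summing over
  \<open>k\<close> first, with weight \<open>k\<close>, gives this term, in which
  \<open>Suc m\<close> plays the role of \<open>m\<close>.\<close>

definition log_term :: "nat \<Rightarrow> 'a \<Rightarrow> 'a::{real_normed_field, banach}" where
  "log_term m q = q ^ Suc m / (of_nat (Suc m) * (1 - q ^ Suc m)\<^sup>2)"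

definition log_gf :: "'a \<Rightarrow> 'a::{real_normed_field, banach}" where
  "log_gf q = (\<Sum>m. log_term m q)"

lemma norm_log_term_le:
  fixes q :: "'a::{real_normed_field, banach}"
  assumes "norm q \<le> r" "r < 1"
  shows "norm (log_term m q) \<le> r ^ Suc m / (1 - r)\<^sup>2"
proof -
  have r: "0 \<le> r" using norm_ge_zero assms(1) by (rule order_trans)
  have q: "norm q ^ Suc m \<le> r ^ Suc m" by (intro power_mono assms) auto
  also have "r ^ Suc m \<le> r" using r assms by (simp add: mult_le_one power_le_one mult_left_le)
  finally have qr: "norm q ^ Suc m \<le> r" .
  have "1 - r \<le> norm (1 - q ^ Suc m)"
    using norm_triangle_ineq2 [of 1 "q ^ Suc m"] qr by (simp add: norm_power norm_mult)
  hence "(1 - r)\<^sup>2 \<le> norm ((1 - q ^ Suc m)\<^sup>2)" using assms by (simp add: norm_power power_mono)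
  moreover have "norm ((1 - q ^ Suc m)\<^sup>2) \<le> norm (of_nat (Suc m) * (1 - q ^ Suc m)\<^sup>2)"
    by (subst norm_mult, subst norm_of_nat) (simp add: mult_le_cancel_right1 )
  ultimately have "(1 - r)\<^sup>2 \<le> norm (of_nat (Suc m) * (1 - q ^ Suc m)\<^sup>2)" by linarith
  thus ?thesis unfolding log_term_def norm_divide
    using q r assms by (intro frac_le) (auto simp: norm_power norm_mult)
qed

lemma summable_log_term:
  fixes q :: "'a::{real_normed_field, banach}"
  assumes "norm q < 1"
  shows "summable (\<lambda>m. norm (log_term m q))"
proof (rule summable_comparison_test')
  show "summable (\<lambda>m. norm q ^ Suc m / (1 - norm q)\<^sup>2)"
    using assms by (auto intro!: summable_divide summable_mult summable_geometric)
qed (use norm_log_term_le[OF order_refl assms] in auto)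

text \<open>For the finite box, the sums over \<open>i\<close> and \<open>j\<close> are two
  truncated geometric series in \<open>q ^ Suc m\<close>. The truncation only adds a factor between
  0 and 1, which later makes \<open>log_term\<close> a majorant for the limit.\<close>

lemma Box_product_eq:
  fixes q :: real
  assumes "0 < q" "q < 1"
  shows "(\<Prod>j<N. \<Prod>i<N. 1 / (1 - q ^ (i + j + 1))) =
    exp (\<Sum>m. log_term m q * (1 - q ^ (Suc m * N))\<^sup>2)"
proof -
  have lt: "q ^ (i + j + 1) < 1" "0 < q ^ (i + j + 1)" for i j
    using assms power_Suc_less_one[of q "i + j"] by auto
  have "(\<lambda>m. (q ^ (i + j + 1)) ^ Suc m / real (Suc m)) sums - ln (1 - q ^ (i + j + 1))" for i j
  proof -
    have "(\<lambda>n. - ((- (- (q ^ (i + j + 1)))) ^ n) / real n) sums ln (1 + - (q ^ (i + j + 1)))"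
      using lt[of i j] by (intro ln_series') auto
    hence "(\<lambda>n. - ((q ^ (i + j + 1)) ^ Suc n) / real (Suc n)) sums ln (1 - q ^ (i + j + 1))"
      by (subst sums_Suc_iff) simp
    from sums_minus[OF this] show ?thesis by simp
  qed
  hence "(\<lambda>m. \<Sum>j<N. \<Sum>i<N. (q ^ (i + j + 1)) ^ Suc m / real (Suc m)) sums (\<Sum>j<N. \<Sum>i<N. - ln (1 - q ^ (i + j + 1)))"
    by (intro sums_sum)
  moreover have "(\<Sum>j<N. \<Sum>i<N. (q ^ (i + j + 1)) ^ Suc m / real (Suc m)) = log_term m q * (1 - q ^ (Suc m * N))\<^sup>2" for m
  proof -
    define x where "x = q ^ Suc m"
    have x: "x \<noteq> 1" using assms power_Suc_less_one[of q m] by (simp add: x_def)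
    have "(\<Sum>j<N. \<Sum>i<N. (q ^ (i + j + 1)) ^ Suc m / real (Suc m)) = (\<Sum>j<N. \<Sum>i<N. x / real (Suc m) * (x ^ j * x ^ i))"
      unfolding x_def by (intro sum.cong refl) (simp add: power_mult [symmetric] power_add [symmetric] algebra_simps)
    also have "\<dots> = x / real (Suc m) * ((\<Sum>j<N. x ^ j) * (\<Sum>i<N. x ^ i))"
      by (simp only: sum_product) (simp only: sum_distrib_left)
    also have "\<dots> = x / real (Suc m) * ((1 - x ^ N) / (1 - x))\<^sup>2"
      using x by (simp add: sum_gp_strict power2_eq_square)
    finally have *: "(\<Sum>j<N. \<Sum>i<N. (q ^ (i + j + 1)) ^ Suc m / real (Suc m)) = x / real (Suc m) * ((1 - x ^ N) / (1 - x))\<^sup>2" .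
    show ?thesis unfolding * log_term_def power_mult x_def by (simp add: power_divide del: power_Suc of_nat_Suc)
  qed
  ultimately have "(\<Sum>m. log_term m q * (1 - q ^ (Suc m * N))\<^sup>2) = (\<Sum>j<N. \<Sum>i<N. - ln (1 - q ^ (i + j + 1)))"
    by (simp add: sums_iff)
  moreover have "exp (- ln (1 - q ^ (i + j + 1))) = 1 / (1 - q ^ (i + j + 1))" for i j
    using lt[of i j] by (simp add: exp_minus inverse_eq_divide)
  ultimately show ?thesis by (simp add: exp_sum)
qed

lemma Box_product_limit:
  fixes q :: real
  assumes "0 < q" "q < 1"
  shows "(\<lambda>N. \<Prod>j<N. \<Prod>i<N. 1 / (1 - q ^ (i + j + 1))) \<longlonglongrightarrow> exp (log_gf q)"
proof -
  have p: "(\<lambda>N. q ^ (Suc m * N)) \<longlonglongrightarrow> 0" for m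
    unfolding power_mult using assms by (intro LIMSEQ_power_zero) (simp add: power_Suc_less_one del: power_Suc)
  have lim: "((\<lambda>N. log_term m q * (1 - q ^ (Suc m * N))\<^sup>2) \<longlongrightarrow> log_term m q) sequentially" for m
    using tendsto_mult[OF tendsto_const[of "log_term m q"] tendsto_power[OF tendsto_diff[OF tendsto_const[of 1] p[of m]], of 2]]
    by simp
  have "norm (log_term m q * (1 - q ^ (Suc m * N))\<^sup>2) \<le> norm (log_term m q)" for m :: nat and N :: nat
  proof -
    have "0 \<le> q ^ (Suc m * N)" "q ^ (Suc m * N) \<le> 1" using assms by (auto intro: power_le_one simp del: mult_Suc)
    hence "(1 - q ^ (Suc m * N))\<^sup>2 \<le> 1" by (intro power_le_one) auto
    thus ?thesis unfolding norm_mult by (intro mult_left_le) (auto simp del: mult_Suc)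
  qed
  hence "((\<lambda>N. \<Sum>m. log_term m q * (1 - q ^ (Suc m * N))\<^sup>2) \<longlongrightarrow> log_gf q) sequentially"
    unfolding log_gf_def
    using tannerys_theorem[where a = "\<lambda>m N. log_term m q * (1 - q ^ (Suc m * N))\<^sup>2" and b = "\<lambda>m. log_term m q"
       and M = "\<lambda>m. norm (log_term m q)" and F = sequentially, OF lim] summable_log_term[of q] assms
    by (auto simp: case_prod_unfold simp del: mult_Suc)
  thus ?thesis unfolding Box_product_eq[OF assms] by (rule tendsto_exp)
qed

definition total :: "(nat \<Rightarrow> nat \<Rightarrow> nat) \<Rightarrow> nat" where
  "total p = (\<Sum>(i, j)\<in>{(i, j). p i j \<noteq> 0}. p i j)"

lemma Box_support: "p \<in> Box N \<Longrightarrow> {(i, j). p i j \<noteq> 0} \<subseteq> {..<N} \<times> {..<N}"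
proof clarsimp
  fix i j assume "p \<in> Box N" "0 < p i j"
  thus "i < N \<and> j < N" unfolding Box_def by (cases "N \<le> i"; cases "N \<le> j") auto
qed

lemma Box_total: "p \<in> Box N \<Longrightarrow> total p = (\<Sum>i<N. \<Sum>j<N. p i j)"
  unfolding total_def sum.cartesian_product
  by (rule sum.mono_neutral_left) (use Box_support in auto)

lemma plane_partition_iff: "plane_partition n p \<longleftrightarrow> (\<exists>N. p \<in> Box N) \<and> total p = n"
proof
  assume *: "plane_partition n p"
  hence "finite {(i, j). p i j \<noteq> 0}" by (simp add: plane_partition_def)
  then obtain N where N: "\<forall>x\<in>(\<lambda>(i, j). max i j) ` {(i, j). p i j \<noteq> 0}. x < N"
    using finite_nat_set_iff_bounded by (meson finite_imageI)
  have "p i j = 0" if "N \<le> i \<or> N \<le> j" for i j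
  proof (rule ccontr)
    assume "p i j \<noteq> 0"
    hence "max i j < N" using N by force
    thus False using that by simp
  qed
  hence "p \<in> Box N" using * by (auto simp: Box_def plane_partition_def)
  thus "(\<exists>N. p \<in> Box N) \<and> total p = n" using * by (auto simp: plane_partition_def total_def)
next
  assume *: "(\<exists>N. p \<in> Box N) \<and> total p = n"
  then obtain N where N: "p \<in> Box N" by blast
  have "finite {(i, j). p i j \<noteq> 0}" by (rule finite_subset[OF Box_support[OF N]]) auto
  thus "plane_partition n p" using * N by (auto simp: Box_def plane_partition_def total_def)
qed

lemma Box_mono: "N \<le> M \<Longrightarrow> Box N \<subseteq> Box M"
  by (auto simp: Box_def)

lemma prod_list_upt: "(\<Prod>j\<leftarrow>[0..<N]. f j) = (\<Prod>j<N. f j :: ennreal)"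
  by (induction N) (simp_all add: mult.commute)

lemma PL_sums_real:
  fixes q :: real
  assumes "0 < q" "q < 1"
  shows "(\<lambda>n. real (PL n) * q ^ n) sums exp (log_gf q)"
proof -
  define S where "S n = {p. plane_partition n p}" for n
  \<comment> \<open>The number of plane partitions as an element of \<open>ennreal\<close>, since it
    is not yet known to be finite.\<close>
  define E where "E n = emeasure (count_space (S n)) (S n)" for n
  have box: "esum (Box N) (\<lambda>p. ennreal q ^ total p) = ennreal (\<Prod>j<N. \<Prod>i<N. 1 / (1 - q ^ (i + j + 1)))" for N
  proof -
    have "esum (Box N) (\<lambda>p. ennreal q ^ total p) = esum (Box N) (\<lambda>p. ennreal q ^ (\<Sum>i<N. \<Sum>j<N. p i j))"
      by (intro esum_cong refl) (simp add: Box_total)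
    also have "\<dots> = (\<Prod>j<N. \<Prod>i<N. geo (ennreal (q ^ (i + j + 1))))"
      using assms unfolding Box_gf by (simp only: prod_list_upt ennreal_power less_imp_le)
    also have "\<dots> = (\<Prod>j<N. \<Prod>i<N. ennreal (1 / (1 - q ^ (i + j + 1))))"
    proof (intro prod.cong refl)
      fix i j
      have "q ^ (i + j + 1) < 1" using assms by (metis Suc_eq_plus1 less_eq_real_def power_Suc_less_one)
      thus "geo (ennreal (q ^ (i + j + 1))) = ennreal (1 / (1 - q ^ (i + j + 1)))" using assms by (intro geo_ennreal) auto
    qed
    also have "\<dots> = ennreal (\<Prod>j<N. \<Prod>i<N. 1 / (1 - q ^ (i + j + 1)))"
      using assms power_le_one[of q "Suc _"] by (subst prod_ennreal [symmetric]) (auto intro!: prod_nonneg prod.cong prod_ennreal power_le_one simp del: power_Suc)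
    finally show ?thesis .
  qed
  have "esum (\<Union>N. Box N) (\<lambda>p. ennreal q ^ total p) = (SUP N. esum (Box N) (\<lambda>p. ennreal q ^ total p))"
  proof -
    have "(SUP N. esum (Box N) (\<lambda>p. ennreal q ^ total p)) =
      (\<integral>\<^sup>+ p. (SUP N. ennreal q ^ total p * indicator (Box N) p) \<partial>count_space UNIV)"
      unfolding esum_indicator
      by (rule nn_integral_monotone_convergence_SUP [symmetric])
         (auto simp: incseq_def le_fun_def indicator_def dest: Box_mono intro!: mult_left_mono)
    also have "\<dots> = (\<integral>\<^sup>+ p. ennreal q ^ total p * indicator (\<Union>N. Box N) p \<partial>count_space UNIV)"
    proof (intro nn_integral_cong)
      fix p
      show "(SUP N. ennreal q ^ total p * indicator (Box N) p) = ennreal q ^ total p * indicator (\<Union>N. Box N) p"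
      proof (cases "\<exists>N. p \<in> Box N")
        case True
        then obtain N where "p \<in> Box N" by blast
        thus ?thesis by (intro antisym SUP_least) (auto intro!: SUP_upper2[of N] simp: indicator_def)
      qed (auto simp: indicator_def)
    qed
    finally show ?thesis unfolding esum_indicator ..
  qed
  moreover have "(\<lambda>N. esum (Box N) (\<lambda>p. ennreal q ^ total p)) \<longlonglongrightarrow> (SUP N. esum (Box N) (\<lambda>p. ennreal q ^ total p))"
  proof (rule LIMSEQ_SUP, rule incseq_SucI)
    fix N
    show "esum (Box N) (\<lambda>p. ennreal q ^ total p) \<le> esum (Box (Suc N)) (\<lambda>p. ennreal q ^ total p)"
      unfolding esum_indicator using Box_mono[of N "Suc N"]
      by (intro nn_integral_mono) (auto simp: indicator_def)
  qed
  moreover have "(\<lambda>N. esum (Box N) (\<lambda>p. ennreal q ^ total p)) \<longlonglongrightarrow> ennreal (exp (log_gf q))"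
    unfolding box by (intro tendsto_ennrealI Box_product_limit assms)
  ultimately have sup: "esum (\<Union>N. Box N) (\<lambda>p. ennreal q ^ total p) = ennreal (exp (log_gf q))"
    using LIMSEQ_unique by metis
  have "esum (\<Union>N. Box N) (\<lambda>p. ennreal q ^ total p) = esum (Sigma UNIV S) (\<lambda>x. ennreal q ^ total (snd x))"
    by (rule esum_bij [symmetric]) (auto simp: bij_betw_def inj_on_def S_def plane_partition_iff image_iff)
  also have "\<dots> = esum UNIV (\<lambda>n. ennreal q ^ n * E n)"
    unfolding esum_Sigma
  proof (intro esum_cong refl)
    fix n
    have "esum (S n) (\<lambda>p. ennreal q ^ total (snd (n, p))) = esum (S n) (\<lambda>p. ennreal q ^ n)"
      by (intro esum_cong refl) (auto simp: S_def plane_partition_iff)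
    thus "esum (S n) (\<lambda>p. ennreal q ^ total (snd (n, p))) = ennreal q ^ n * E n"
      by (simp add: esum_def E_def)
  qed
  finally have sum: "(\<Sum>n. ennreal q ^ n * E n) = ennreal (exp (log_gf q))"
    unfolding sup by (simp add: esum_def nn_integral_count_space_nat)
  \<comment> \<open>\<open>PL\<close> is a \<open>card\<close> and would be 0 for an infinite set.
    An infinite \<open>S n\<close> would make the generating function infinite at \<open>q\<close>,
    but its value is finite.\<close>
  have fin: "finite (S n)" for n
  proof (rule ccontr)
    assume "infinite (S n)"
    hence "E n = \<infinity>" by (simp add: E_def emeasure_count_space_infinite)
    hence "ennreal q ^ n * E n = \<infinity>" using assms by (simp add: ennreal_power ennreal_mult_top)
    moreover have "ennreal q ^ n * E n \<le> (\<Sum>n. ennreal q ^ n * E n)"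
      using sum_le_suminf[of "\<lambda>n. ennreal q ^ n * E n" "{n}"] by auto
    ultimately show False unfolding sum by (simp add: top_unique)
  qed
  have "E n = ennreal (real (PL n))" for n
    using fin[of n] by (simp add: E_def emeasure_count_space PL_def S_def ennreal_of_nat_eq_real_of_nat)
  hence gf: "(\<Sum>n. ennreal (real (PL n) * q ^ n)) = ennreal (exp (log_gf q))"
    using sum assms by (simp add: ennreal_power ennreal_mult'' mult.commute)
  have nonneg: "0 \<le> real (PL n) * q ^ n" for n using assms by simp
  have sm: "summable (\<lambda>n. real (PL n) * q ^ n)"
    by (rule summable_suminf_not_top [OF nonneg]) (simp only: gf, simp)
  have "ennreal (\<Sum>n. real (PL n) * q ^ n) = ennreal (exp (log_gf q))"
    using suminf_ennreal2 [OF nonneg sm] gf by simp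
  hence "(\<Sum>n. real (PL n) * q ^ n) = exp (log_gf q)"
    using suminf_nonneg [OF sm nonneg] by simp
  thus ?thesis using sm by (simp add: sums_iff)
qed

lemma log_gf_holomorphic: "log_gf holomorphic_on ball (0::complex) 1"
proof (rule holomorphic_uniform_sequence)
  show "open (ball (0::complex) 1)" by simp
  have nz: "1 - q ^ Suc m \<noteq> 0" if "norm q < 1" for q :: complex and m
  proof
    assume "1 - q ^ Suc m = 0"
    hence "norm (q ^ Suc m) = 1" by simp
    moreover have "norm (q ^ Suc m) < 1" unfolding norm_power using that by (cases "q = 0") (auto intro!: power_Suc_less_one simp del: power_Suc)
    ultimately show False by simp
  qed
  show "(\<lambda>q. \<Sum>m<n. log_term m q) holomorphic_on ball (0::complex) 1" for n
    unfolding log_term_def using nz by (intro holomorphic_intros) (auto simp del: power_Suc of_nat_Suc)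
  fix x :: complex assume x: "x \<in> ball 0 1"
  define d r where "d = (1 - norm x) / 2" and "r = (1 + norm x) / 2"
  have d: "d > 0" "r < 1" "0 \<le> r" using x by (auto simp: d_def r_def)
  have r: "norm y \<le> r" if "y \<in> cball x d" for y
    using that norm_triangle_ineq2[of y x] by (simp add: r_def d_def dist_norm norm_minus_commute field_simps)
  have sub: "cball x d \<subseteq> ball 0 1" using r d by fastforce
  have "uniform_limit (cball x d) (\<lambda>n q. \<Sum>m<n. log_term m q) (\<lambda>q. \<Sum>m. log_term m q) sequentially"
  proof (rule Weierstrass_m_test)
    show "norm (log_term n q) \<le> r ^ Suc n / (1 - r)\<^sup>2" if "q \<in> cball x d" for n q
      using norm_log_term_le[OF r[OF that] d(2)] .
    show "summable (\<lambda>n. r ^ Suc n / (1 - r)\<^sup>2)"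
      using d by (auto intro!: summable_divide summable_mult summable_geometric)
  qed
  thus "\<exists>d>0. cball x d \<subseteq> ball 0 1 \<and> uniform_limit (cball x d) (\<lambda>n q. \<Sum>m<n. log_term m q) log_gf sequentially"
    using d sub unfolding log_gf_def by blast
qed

text \<open>Both sides are holomorphic in the unit disc and agree on the real interval from 0 to 1,
  which accumulates at 1/2; the identity theorem does the rest.\<close>

theorem PL_sums:
  fixes q :: complex
  assumes "norm q < 1"
  shows "(\<lambda>n. of_nat (PL n) * q ^ n) sums exp (log_gf q)"
proof -
  define G where "G q = (\<Sum>n. of_nat (PL n) * q ^ n)" for q :: complex
  have sm: "(\<lambda>n. of_nat (PL n) * q ^ n) sums G q" if "norm q < 1" for q :: complex
  proof -
    have "summable (\<lambda>n. real (PL n) * (norm q) ^ n)"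
    proof (cases "q = 0")
      case True
      show ?thesis unfolding True by (rule summable_finite[of "{0}"]) auto
    next
      case False
      thus ?thesis using PL_sums_real[of "norm q"] that by (simp add: sums_iff)
    qed
    hence "summable (\<lambda>n. norm (of_nat (PL n) * q ^ n))" by (simp add: norm_mult norm_power)
    thus ?thesis unfolding G_def by (rule summable_sums [OF summable_norm_cancel])
  qed
  have hG: "G holomorphic_on ball 0 1"
    by (rule power_series_holomorphic [where a = "\<lambda>n. of_nat (PL n)"]) (use sm in auto)
  have hd: "(\<lambda>q. G q - exp (log_gf q)) holomorphic_on ball 0 1"
    by (intro holomorphic_intros hG log_gf_holomorphic)
  have real: "G (of_real x) - exp (log_gf (of_real x)) = 0" if "0 < x" "x < 1" for x :: real
  proof -
    have "(\<lambda>n. complex_of_real (real (PL n) * x ^ n)) sums of_real (exp (log_gf x))"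
      using PL_sums_real[OF that] by (rule sums_of_real)
    moreover have "(\<lambda>n. complex_of_real (real (PL n) * x ^ n)) sums G (of_real x)"
      using sm[of "of_real x"] that by simp
    moreover have "log_gf (complex_of_real x) = of_real (log_gf x)"
    proof -
      have "(\<lambda>m. log_term m x) sums log_gf x"
        unfolding log_gf_def by (rule summable_sums, rule summable_norm_cancel, rule summable_log_term) (use that in auto)
      hence "(\<lambda>m. complex_of_real (log_term m x)) sums of_real (log_gf x)" by (rule sums_of_real)
      thus ?thesis by (simp add: log_gf_def log_term_def sums_iff)
    qed
    ultimately show ?thesis using sums_unique2 by (auto simp: exp_of_real)
  qed
  have "G q - exp (log_gf q) = 0"
  proof (rule analytic_continuation [OF hd, of "of_real ` {0<..<1}" "of_real (1/2)"])
    show "complex_of_real (1/2) islimpt complex_of_real ` {0<..<1}"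
      unfolding islimpt_approachable
    proof (intro allI impI)
      fix e :: real assume "e > 0"
      define y where "y = 1/2 + min (e/2) (1/4)"
      have "y \<in> {0<..<1}" "y \<noteq> 1/2" "\<bar>y - 1/2\<bar> < e" using \<open>e > 0\<close> by (auto simp: y_def min_def)
      moreover from this have "dist (complex_of_real y) (of_real (1/2)) < e"
        unfolding dist_norm by (simp only: of_real_diff [symmetric] norm_of_real)
      moreover have "complex_of_real y \<noteq> of_real (1/2)" using \<open>y \<noteq> 1/2\<close> by (simp only: of_real_eq_iff) simp
      ultimately show "\<exists>x'\<in>complex_of_real ` {0<..<1}. x' \<noteq> of_real (1/2) \<and> dist x' (of_real (1/2)) < e"
        by blast
    qed
  qed (use assms real in \<open>auto intro: convex_connected\<close>)
  thus ?thesis using sm[OF assms] by simp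
qed

section \<open>Euler--Maclaurin summation\<close>

lemma summable_inverse_power: "k \<ge> 2 \<Longrightarrow> summable (\<lambda>m. 1 / real (Suc m) ^ k)"
  using inverse_power_summable[of k, where ?'a = real] summable_Suc_iff[of "\<lambda>n. inverse (real n ^ k)"]
  by (simp add: inverse_eq_divide)

text \<open>The damping \<open>r ^ Suc m\<close> makes the differentiated series converge uniformly,
  and that series is the imaginary part of the logarithm series. At \<open>r = 1\<close> it would
  converge only conditionally.\<close>

lemma cos_series_derivative:
  assumes "0 \<le> r" "r < 1"
  shows "((\<lambda>t. \<Sum>m. r ^ Suc m * cos (2 * pi * real (Suc m) * t) / real (Suc m) ^ 2) has_real_derivative
     2 * pi * Im (Ln (1 - of_real r * cis (2 * pi * t)))) (at t)"
proof -
  have "((\<lambda>t. \<Sum>m. r ^ Suc m * cos (2 * pi * real (Suc m) * t) / real (Suc m) ^ 2) has_real_derivative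
     (\<Sum>m. - (2 * pi * r ^ Suc m * sin (2 * pi * real (Suc m) * t) / real (Suc m)))) (at t)"
  proof (rule has_field_derivative_series' (2) [where S = UNIV])
    show "((\<lambda>t. r ^ Suc m * cos (2 * pi * real (Suc m) * t) / real (Suc m) ^ 2) has_real_derivative
       - (2 * pi * r ^ Suc m * sin (2 * pi * real (Suc m) * t) / real (Suc m))) (at t within UNIV)" for m t
      by (auto intro!: derivative_eq_intros simp: field_simps power2_eq_square simp del: of_nat_Suc)
    show "uniformly_convergent_on UNIV (\<lambda>n t. \<Sum>m<n. - (2 * pi * r ^ Suc m * sin (2 * pi * real (Suc m) * t) / real (Suc m)))"
    proof (rule Weierstrass_m_test')
      fix m t
      have "\<bar>2 * pi * r ^ Suc m * sin (2 * pi * real (Suc m) * t) / real (Suc m)\<bar>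
         = 2 * pi * r ^ Suc m * (\<bar>sin (2 * pi * real (Suc m) * t)\<bar> / real (Suc m))"
        using assms by (simp add: abs_mult del: of_nat_Suc)
      also have "\<dots> \<le> 2 * pi * r ^ Suc m * (1 / 1)"
        using assms by (intro mult_left_mono frac_le) auto
      finally show "norm (- (2 * pi * r ^ Suc m * sin (2 * pi * real (Suc m) * t) / real (Suc m))) \<le> 2 * pi * r ^ Suc m"
        by simp
    next
      show "summable (\<lambda>m. 2 * pi * r ^ Suc m)" using assms by (auto intro!: summable_mult summable_geometric)
    qed
    show "summable (\<lambda>m. r ^ Suc m * cos (2 * pi * real (Suc m) * 0) / real (Suc m) ^ 2)"
    proof (rule summable_comparison_test')
      show "summable (\<lambda>m. r ^ Suc m)" using assms by (auto intro!: summable_mult summable_geometric)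
      fix m
      have "r ^ Suc m / real (Suc m) ^ 2 \<le> r ^ Suc m / 1" using assms by (intro divide_left_mono) (auto simp del: power_Suc)
      thus "norm (r ^ Suc m * cos (2 * pi * real (Suc m) * 0) / real (Suc m) ^ 2) \<le> r ^ Suc m"
        using assms by (simp del: power_Suc of_nat_Suc)
    qed
  qed auto
  moreover have "(\<Sum>m. - (2 * pi * r ^ Suc m * sin (2 * pi * real (Suc m) * t) / real (Suc m)))
    = 2 * pi * Im (Ln (1 - of_real r * cis (2 * pi * t)))"
  proof -
    define z where "z = of_real r * cis (2 * pi * t)"
    have "norm (- z) < 1" using assms by (simp add: z_def norm_mult)
    from Ln_series[OF this] have "(\<lambda>n. (-1) ^ Suc n / of_nat n * (- z) ^ n) sums Ln (1 - z)" by simp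
    hence "(\<lambda>n. (-1) ^ Suc (Suc n) / of_nat (Suc n) * (- z) ^ (Suc n)) sums Ln (1 - z)"
      by (subst sums_Suc_iff) simp
    from sums_mult[OF sums_Im[OF this], of "2 * pi"]
    have "(\<lambda>n. 2 * pi * Im ((-1) ^ Suc (Suc n) / of_nat (Suc n) * (- z) ^ (Suc n))) sums (2 * pi * Im (Ln (1 - z)))" .
    moreover have "2 * pi * Im ((-1) ^ Suc (Suc n) / of_nat (Suc n) * (- z) ^ (Suc n)) =
       - (2 * pi * r ^ Suc n * sin (2 * pi * real (Suc n) * t) / real (Suc n))" for n
    proof -
      have "(-1) ^ Suc (Suc n) * (- z) ^ Suc n = - (z ^ Suc n)" by (simp add: power_minus [of z])
      moreover have "z ^ Suc n = of_real (r ^ Suc n) * cis (2 * pi * real (Suc n) * t)"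
      proof -
        have "real (Suc n) * (2 * pi * t) = 2 * pi * real (Suc n) * t" by simp
        thus ?thesis by (simp only: z_def power_mult_distrib Complex.DeMoivre of_real_power)
      qed
      ultimately have "(-1) ^ Suc (Suc n) / of_nat (Suc n) * (- z) ^ (Suc n) =
         of_real (- (r ^ Suc n / real (Suc n))) * cis (2 * pi * real (Suc n) * t)"
        by (simp add: field_simps del: power_Suc of_nat_Suc)
      thus ?thesis by (simp del: power_Suc of_nat_Suc)
    qed
    ultimately have "(\<lambda>n. - (2 * pi * r ^ Suc n * sin (2 * pi * real (Suc n) * t) / real (Suc n))) sums (2 * pi * Im (Ln (1 - z)))"
      by (simp only:)
    thus ?thesis unfolding z_def by (rule sums_unique [symmetric])
  qed
  ultimately show ?thesis by simp
qed

text \<open>The number factors as \<open>2 sin (pi t)\<close>, positive for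
  \<open>0 < t < 1\<close>, times the unit vector of angle \<open>pi t - pi / 2\<close>. The angle
  is linear in \<open>t\<close> and stays inside the principal branch.\<close>

lemma Im_Ln_one_minus_cis:
  assumes "0 < t" "t < 1"
  shows "1 - cis (2 * pi * t) \<notin> \<real>\<^sub>\<le>\<^sub>0" "Im (Ln (1 - cis (2 * pi * t))) = pi * (t - 1/2)"
proof -
  have s: "sin (pi * t) > 0" using assms by (intro sin_gt_zero) auto
  have e: "1 - cis (2 * pi * t) = of_real (2 * sin (pi * t)) * cis (pi * t - pi / 2)"
    using sin_double[of "pi * t"] cos_double_sin[of "pi * t"]
    by (auto simp: complex_eq_iff cos_diff sin_diff power2_eq_square algebra_simps)
  have L: "Ln (of_real (2 * sin (pi * t)) * cis (pi * t - pi / 2)) = of_real (ln (2 * sin (pi * t))) + \<i> * of_real (pi * t - pi / 2)"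
  proof -
    have "of_real (2 * sin (pi * t)) * cis (pi * t - pi / 2) = exp (of_real (ln (2 * sin (pi * t))) + \<i> * of_real (pi * t - pi / 2))"
      using s by (simp only: exp_add cis_conv_exp exp_of_real) simp
    moreover have "pi * t - pi / 2 \<le> pi" "- pi < pi * t - pi / 2"
      using assms pi_gt_zero mult_strict_left_mono[of t 1 pi] mult_pos_pos[of pi t] by linarith+
    ultimately show ?thesis by (simp add: Ln_exp)
  qed
  show "Im (Ln (1 - cis (2 * pi * t))) = pi * (t - 1/2)" unfolding e L by (simp add: algebra_simps)
  show "1 - cis (2 * pi * t) \<notin> \<real>\<^sub>\<le>\<^sub>0"
  proof
    assume *: "1 - cis (2 * pi * t) \<in> \<real>\<^sub>\<le>\<^sub>0"
    hence "Re (1 - cis (2 * pi * t)) \<le> 0" "Im (1 - cis (2 * pi * t)) = 0" by (auto simp: complex_nonpos_Reals_iff)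
    moreover have "Re (1 - cis (2 * pi * t)) = 2 * (sin (pi * t))\<^sup>2"
      using cos_double_sin[of "pi * t"] by (simp add: algebra_simps)
    ultimately have "2 * (sin (pi * t))\<^sup>2 \<le> 0" by linarith
    thus False using zero_less_power[OF s, of 2] by simp
  qed
qed

text \<open>The Fourier series of the second Bernoulli polynomial. The derivative is integrated at
  radius \<open>r n < 1\<close>, where it is harmless; then the radius tends to 1 under the bound
  \<open>pi\<close> for the imaginary part of the logarithm. This determines the sum up to a
  constant, which the value at 0 fixes.\<close>

lemma cos_squares_sum:
  assumes "0 \<le> t" "t \<le> 1"
  shows "(\<Sum>m. cos (2 * pi * real (Suc m) * t) / real (Suc m) ^ 2) = pi\<^sup>2 * (t\<^sup>2 - t + 1/6)"
proof -
  define C where "C t = (\<Sum>m. cos (2 * pi * real (Suc m) * t) / real (Suc m) ^ 2)" for t :: real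
  define r where "r n = 1 - 1 / real (n + 2)" for n :: nat
  have r: "0 \<le> r n" "r n < 1" for n by (auto simp: r_def)
  have rlim: "r \<longlonglongrightarrow> 1" unfolding r_def by real_asymp
  define f where "f n t = (\<Sum>m. r n ^ Suc m * cos (2 * pi * real (Suc m) * t) / real (Suc m) ^ 2)" for n t
  have flim: "(\<lambda>n. f n t) \<longlonglongrightarrow> C t" for t
  proof -
    have "((\<lambda>n. r n ^ Suc m * cos (2 * pi * real (Suc m) * t) / real (Suc m) ^ 2) \<longlongrightarrow>
        1 ^ Suc m * cos (2 * pi * real (Suc m) * t) / real (Suc m) ^ 2) sequentially" for m
      by (intro tendsto_intros rlim) auto
    hence lim: "((\<lambda>n. r n ^ Suc m * cos (2 * pi * real (Suc m) * t) / real (Suc m) ^ 2) \<longlongrightarrow>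
        cos (2 * pi * real (Suc m) * t) / real (Suc m) ^ 2) sequentially" for m by simp
    have "norm (r n ^ Suc m * cos (2 * pi * real (Suc m) * t) / real (Suc m) ^ 2) \<le> 1 / real (Suc m) ^ 2" for m n
    proof -
      have "\<bar>r n ^ Suc m * cos (2 * pi * real (Suc m) * t)\<bar> \<le> 1 * 1"
        unfolding abs_mult using r[of n] by (intro mult_mono) (auto simp: power_abs intro!: power_le_one simp del: power_Suc)
      thus ?thesis by (simp add: divide_right_mono del: power_Suc of_nat_Suc)
    qed
    thus ?thesis unfolding f_def C_def
      using tannerys_theorem[where F = sequentially and M = "\<lambda>m. 1 / real (Suc m) ^ 2", OF lim] summable_inverse_power[of 2]
      by (auto simp: case_prod_unfold)
  qed
  define B where "B t = pi\<^sup>2 * (t\<^sup>2 - t)" for t :: real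
  have step: "C b - C a = B b - B a" if "0 < a" "a \<le> b" "b < 1" for a b
  proof -
    define g where "g n t = 2 * pi * Im (Ln (1 - of_real (r n) * cis (2 * pi * t)))" for n t
    have gi: "(g n has_integral f n b - f n a) {a..b}" for n
    proof (rule fundamental_theorem_of_calculus [OF that(2)])
      fix t
      have "(f n has_real_derivative g n t) (at t within {a..b})"
        unfolding f_def[abs_def] g_def by (rule has_field_derivative_at_within [OF cos_series_derivative [OF r]])
      thus "(f n has_vector_derivative g n t) (at t within {a..b})"
        by (simp only: has_real_derivative_iff_has_vector_derivative)
    qed
    have "(\<lambda>n. integral {a..b} (g n)) \<longlonglongrightarrow> integral {a..b} (\<lambda>t. 2 * pi * (pi * (t - 1/2)))"
    proof (rule dominated_convergence (2))
      show "g n integrable_on {a..b}" for n using gi by blast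
      show "(\<lambda>_. 2 * pi * pi) integrable_on {a..b}" by (rule integrable_const_ivl)
      show "norm (g n t) \<le> 2 * pi * pi" if "t \<in> {a..b}" for n t
      proof -
        have "norm (of_real (r n) * cis (2 * pi * t)) < 1" using r[of n] by (simp add: norm_mult)
        hence "1 - of_real (r n) * cis (2 * pi * t) \<noteq> 0" by (metis eq_iff_diff_eq_0 less_irrefl norm_one)
        from mpi_less_Im_Ln[OF this] Im_Ln_le_pi[OF this]
        have "\<bar>Im (Ln (1 - of_real (r n) * cis (2 * pi * t)))\<bar> \<le> pi" by simp
        thus ?thesis by (simp add: g_def abs_mult)
      qed
      show "(\<lambda>n. g n t) \<longlonglongrightarrow> 2 * pi * (pi * (t - 1/2))" if "t \<in> {a..b}" for t
      proof -
        have t: "0 < t" "t < 1" using that \<open>0 < a\<close> \<open>b < 1\<close> by auto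
        have "(\<lambda>n. 1 - of_real (r n) * cis (2 * pi * t)) \<longlonglongrightarrow> 1 - of_real 1 * cis (2 * pi * t)"
          by (intro tendsto_intros rlim)
        hence lim: "(\<lambda>n. 1 - of_real (r n) * cis (2 * pi * t)) \<longlonglongrightarrow> 1 - cis (2 * pi * t)" by simp
        have "(\<lambda>n. Ln (1 - of_real (r n) * cis (2 * pi * t))) \<longlonglongrightarrow> Ln (1 - cis (2 * pi * t))"
          by (rule tendsto_Ln [OF lim Im_Ln_one_minus_cis(1)[OF t]])
        from tendsto_mult[OF tendsto_const tendsto_Im[OF this], of "2 * pi"]
        show ?thesis unfolding g_def Im_Ln_one_minus_cis(2)[OF t] .
      qed
    qed
    moreover have "integral {a..b} (g n) = f n b - f n a" for n using gi by (rule integral_unique)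
    moreover have "(\<lambda>n. f n b - f n a) \<longlonglongrightarrow> C b - C a" by (intro tendsto_diff flim)
    ultimately have "C b - C a = integral {a..b} (\<lambda>t. 2 * pi * (pi * (t - 1/2)))" by (metis (lifting) LIMSEQ_unique ext)
    also have "((\<lambda>t. 2 * pi * (pi * (t - 1/2))) has_integral B b - B a) {a..b}"
    proof (rule fundamental_theorem_of_calculus [OF that(2)])
      fix t
      have "(B has_real_derivative 2 * pi * (pi * (t - 1/2))) (at t within {a..b})"
        unfolding B_def[abs_def] by (auto intro!: derivative_eq_intros simp: algebra_simps power2_eq_square)
      thus "(B has_vector_derivative 2 * pi * (pi * (t - 1/2))) (at t within {a..b})"
        by (simp only: has_real_derivative_iff_has_vector_derivative)
    qed
    hence "integral {a..b} (\<lambda>t. 2 * pi * (pi * (t - 1/2))) = B b - B a" by (rule integral_unique)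
    finally show ?thesis .
  qed
  have step': "C t = B t + (C (1/2) - B (1/2))" if "t \<in> {0<..<1}" for t
    using step[of t "1/2"] step[of "1/2" t] that by (cases "t \<le> 1/2") auto
  have contC: "continuous_on UNIV C"
  proof -
    have "uniform_limit UNIV (\<lambda>n t. \<Sum>m<n. cos (2 * pi * real (Suc m) * t) / real (Suc m) ^ 2) C sequentially"
      unfolding C_def
      by (rule Weierstrass_m_test[OF _ summable_inverse_power[of 2]]) (auto intro!: divide_right_mono simp del: of_nat_Suc)
    thus ?thesis by (rule uniform_limit_theorem[rotated]) (auto intro!: always_eventually continuous_intros)
  qed
  have eq: "C t = B t + (C (1/2) - B (1/2))" if "t \<in> {0..1}" for t
  proof -
    have "C t - B t = C (1/2) - B (1/2)"
    proof (rule continuous_constant_on_closure [of "{0<..<1::real}" "\<lambda>t. C t - B t"])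
      show "continuous_on (closure {0<..<1}) (\<lambda>t. C t - B t)"
        unfolding B_def by (intro continuous_intros continuous_on_subset[OF contC]) auto
      show "t \<in> closure {0<..<1}" using that by simp
      show "C x - B x = C (1/2) - B (1/2)" if "x \<in> {0<..<1}" for x
        using step'[OF that] by linarith
    qed
    thus ?thesis by linarith
  qed
  \<comment> \<open>The constant of integration comes from the value of the zeta function at
    2.\<close>
  have "C 0 = pi\<^sup>2 / 6"
    using inverse_squares_sums by (simp add: C_def sums_iff add.commute)
  with eq[of 0] have "C (1/2) - B (1/2) = pi\<^sup>2 / 6" by (simp add: B_def)
  with eq[of t] assms show ?thesis by (simp add: C_def B_def algebra_simps)
qed

text \<open>The Fourier series of the periodic Bernoulli function of order \<open>2 n\<close>,
  divided by the factorial of \<open>2 n\<close>; \<open>pb_odd\<close> is the same for order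
  \<open>2 n + 1\<close>. In this normalisation differentiation just lowers the order by
  one.\<close>

definition pb_even :: "nat \<Rightarrow> real \<Rightarrow> real" where
  "pb_even n t = (-1) ^ Suc n * 2 * (\<Sum>m. cos (2 * pi * real (Suc m) * t) / (2 * pi * real (Suc m)) ^ (2 * n))"

definition pb_odd :: "nat \<Rightarrow> real \<Rightarrow> real" where
  "pb_odd n t = (-1) ^ Suc n * 2 * (\<Sum>m. sin (2 * pi * real (Suc m) * t) / (2 * pi * real (Suc m)) ^ (2 * n + 1))"

lemma summable_2pi: "k \<ge> 2 \<Longrightarrow> summable (\<lambda>m. 1 / (2 * pi * real (Suc m)) ^ k)"
  using summable_mult[OF summable_inverse_power[of k], of "1 / (2 * pi) ^ k"] by (simp add: power_mult_distrib)

lemma norm_trig_term: "\<bar>x\<bar> \<le> 1 \<Longrightarrow> norm (x / (2 * pi * real (Suc m)) ^ k) \<le> 1 / (2 * pi * real (Suc m)) ^ k"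
  by (simp add: abs_mult power_abs divide_right_mono del: of_nat_Suc)

lemma pb_odd_deriv:
  assumes "n \<ge> 1"
  shows "(pb_odd n has_real_derivative pb_even n t) (at t)"
proof -
  have "((\<lambda>t. \<Sum>m. sin (2 * pi * real (Suc m) * t) / (2 * pi * real (Suc m)) ^ (2 * n + 1)) has_real_derivative
     (\<Sum>m. cos (2 * pi * real (Suc m) * t) / (2 * pi * real (Suc m)) ^ (2 * n))) (at t)"
  proof (rule has_field_derivative_series' (2) [where S = UNIV])
    show "((\<lambda>t. sin (2 * pi * real (Suc m) * t) / (2 * pi * real (Suc m)) ^ (2 * n + 1)) has_real_derivative
       cos (2 * pi * real (Suc m) * t) / (2 * pi * real (Suc m)) ^ (2 * n)) (at t within UNIV)" for m t
      by (auto intro!: derivative_eq_intros simp del: of_nat_Suc)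
    show "uniformly_convergent_on UNIV (\<lambda>k t. \<Sum>m<k. cos (2 * pi * real (Suc m) * t) / (2 * pi * real (Suc m)) ^ (2 * n))"
      by (rule Weierstrass_m_test'[OF norm_trig_term summable_2pi]) (use assms in auto)
    show "summable (\<lambda>m. sin (2 * pi * real (Suc m) * 0) / (2 * pi * real (Suc m)) ^ (2 * n + 1))" by simp
  qed auto
  from DERIV_cmult[OF this, of "(-1) ^ Suc n * 2"] show ?thesis
    unfolding pb_odd_def[abs_def] pb_even_def .
qed

lemma pb_even_deriv:
  assumes "n \<ge> 1"
  shows "(pb_even (Suc n) has_real_derivative pb_odd n t) (at t)"
proof -
  have "((\<lambda>t. \<Sum>m. cos (2 * pi * real (Suc m) * t) / (2 * pi * real (Suc m)) ^ (2 * Suc n)) has_real_derivative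
     (\<Sum>m. - (sin (2 * pi * real (Suc m) * t) / (2 * pi * real (Suc m)) ^ (2 * n + 1)))) (at t)"
  proof (rule has_field_derivative_series' (2) [where S = UNIV])
    show "((\<lambda>t. cos (2 * pi * real (Suc m) * t) / (2 * pi * real (Suc m)) ^ (2 * Suc n)) has_real_derivative
       - (sin (2 * pi * real (Suc m) * t) / (2 * pi * real (Suc m)) ^ (2 * n + 1))) (at t within UNIV)" for m t
      by (auto intro!: derivative_eq_intros simp del: of_nat_Suc)
    show "uniformly_convergent_on UNIV (\<lambda>k t. \<Sum>m<k. - (sin (2 * pi * real (Suc m) * t) / (2 * pi * real (Suc m)) ^ (2 * n + 1)))"
      by (rule Weierstrass_m_test'[OF _ summable_2pi[of "2 * n + 1"]], subst norm_minus_cancel, rule norm_trig_term) (use assms in auto)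
    show "summable (\<lambda>m. cos (2 * pi * real (Suc m) * 0) / (2 * pi * real (Suc m)) ^ (2 * Suc n))"
      using summable_2pi[of "2 * Suc n"] by simp
  qed auto
  from DERIV_cmult[OF this, of "(-1) ^ Suc (Suc n) * 2"]
  have "(pb_even (Suc n) has_real_derivative (-1) ^ Suc (Suc n) * 2 * (\<Sum>m. - (sin (2 * pi * real (Suc m) * t) / (2 * pi * real (Suc m)) ^ (2 * n + 1)))) (at t)"
    unfolding pb_even_def[abs_def] .
  also have "(\<Sum>m. - (sin (2 * pi * real (Suc m) * t) / (2 * pi * real (Suc m)) ^ (2 * n + 1))) = - (\<Sum>m. (sin (2 * pi * real (Suc m) * t) / (2 * pi * real (Suc m)) ^ (2 * n + 1)))"
    by (rule suminf_minus, rule summable_comparison_test'[OF summable_2pi[of "2 * n + 1"]], use assms in simp, rule norm_trig_term) simp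
  finally show ?thesis by (simp add: pb_odd_def)
qed

lemma sin_cos_2pi_nat: "sin (2 * pi * real (Suc m) * real j) = 0" "cos (2 * pi * real (Suc m) * real j) = 1"
proof -
  have *: "2 * pi * real (Suc m) * real j = 2 * pi * of_int (int (Suc m * j))" by (simp add: algebra_simps)
  show "sin (2 * pi * real (Suc m) * real j) = 0" unfolding * by (rule sin_int_2pin)
  show "cos (2 * pi * real (Suc m) * real j) = 1" unfolding * by (rule cos_int_2pin)
qed

lemma pb_odd_nat: "pb_odd n (real j) = 0"
  unfolding pb_odd_def sin_cos_2pi_nat by simp

lemma pb_even_nat: "pb_even n (real j) = pb_even n 0"
  unfolding pb_even_def sin_cos_2pi_nat by simp

lemma pb_even_0: "n \<ge> 1 \<Longrightarrow> pb_even n 0 = (-1) ^ Suc n * 2 * zeta_nat (2 * n) / (2 * pi) ^ (2 * n)"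
  using suminf_mult[OF summable_inverse_power[of "2 * n"], of "1 / (2 * pi) ^ (2 * n)"]
  unfolding pb_even_def zeta_nat_def by (simp add: power_mult_distrib)

lemma pb_even_bound: "n \<ge> 1 \<Longrightarrow> \<bar>pb_even n t\<bar> \<le> 2 * zeta_nat (2 * n) / (2 * pi) ^ (2 * n)"
proof -
  assume n: "n \<ge> 1"
  have "norm (\<Sum>m. cos (2 * pi * real (Suc m) * t) / (2 * pi * real (Suc m)) ^ (2 * n)) \<le> (\<Sum>m. 1 / (2 * pi * real (Suc m)) ^ (2 * n))"
    by (rule norm_suminf_le[OF norm_trig_term summable_2pi]) (use n in auto)
  also have "\<dots> = zeta_nat (2 * n) / (2 * pi) ^ (2 * n)"
    using suminf_mult[OF summable_inverse_power[of "2 * n"], of "1 / (2 * pi) ^ (2 * n)"] n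
    unfolding zeta_nat_def by (simp add: power_mult_distrib)
  finally show ?thesis unfolding pb_even_def abs_mult by simp
qed

lemma pb_even_1:
  assumes "real j \<le> t" "t \<le> real (Suc j)"
  shows "pb_even 1 t = (t - real j)\<^sup>2 / 2 - (t - real j) / 2 + 1 / 12"
proof -
  have c: "cos (2 * pi * real (Suc m) * t) = cos (2 * pi * real (Suc m) * (t - real j))" for m
    using sin_cos_2pi_nat[of m j] by (simp add: algebra_simps cos_diff)
  have "pb_even 1 t = 2 / (2 * pi)\<^sup>2 * (\<Sum>m. cos (2 * pi * real (Suc m) * (t - real j)) / real (Suc m) ^ 2)"
  proof -
    have "summable (\<lambda>m. cos (2 * pi * real (Suc m) * (t - real j)) / real (Suc m) ^ 2)"
      by (rule summable_comparison_test'[OF summable_inverse_power[of 2]]) (auto intro!: divide_right_mono simp del: of_nat_Suc)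
    from suminf_mult[OF this, of "1 / (2 * pi)\<^sup>2"] show ?thesis
      unfolding pb_even_def c by (simp add: power_mult_distrib)
  qed
  also have "\<dots> = 2 / (2 * pi)\<^sup>2 * (pi\<^sup>2 * ((t - real j)\<^sup>2 - (t - real j) + 1/6))"
    using assms by (subst cos_squares_sum) auto
  also have "2 / (2 * pi)\<^sup>2 * (pi\<^sup>2 * ((t - real j)\<^sup>2 - (t - real j) + 1/6)) = (t - real j)\<^sup>2 / 2 - (t - real j) / 2 + 1 / 12"
  proof -
    have "2 / (2 * p)\<^sup>2 * (p\<^sup>2 * x) = x / 2" if "p \<noteq> 0" for p x :: real
      using that by (simp add: power2_eq_square)
    from this[of pi] show ?thesis by (simp add: add_divide_distrib diff_divide_distrib)
  qed
  finally show ?thesis .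
qed

text \<open>Euler--Maclaurin summation with the periodic Bernoulli functions in their Fourier form, so that
  zeta values appear directly.\<close>

lemma Euler_Maclaurin:
  fixes F :: "real \<Rightarrow> complex" and f :: "nat \<Rightarrow> real \<Rightarrow> complex"
  assumes F: "\<And>t. t \<ge> 0 \<Longrightarrow> (F has_vector_derivative f 0 t) (at t within {0..})"
    and f: "\<And>k t. t \<ge> 0 \<Longrightarrow> (f k has_vector_derivative f (Suc k) t) (at t within {0..})"
  shows "((\<lambda>t. pb_even (Suc N) t *\<^sub>R f (2 * Suc N) t) has_integral
    (F (real J) - F 0 + (f 0 (real J) - f 0 0) / 2
      + (\<Sum>s=1..Suc N. pb_even s 0 *\<^sub>R (f (2 * s - 1) (real J) - f (2 * s - 1) 0))
      - (\<Sum>j=1..J. f 0 (real j)))) {0..real J}"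
proof (induction N)
  case 0
  have unit: "((\<lambda>t. pb_even 1 t *\<^sub>R f 2 t) has_integral
    (F (real (Suc j)) - F (real j) - (f 0 (real (Suc j)) + f 0 (real j)) / 2 + (1/12) *\<^sub>R (f 1 (real (Suc j)) - f 1 (real j))))
    {real j..real (Suc j)}" for j
  proof -
    \<comment> \<open>Two integrations by parts on one cell: the coefficients are the Bernoulli
      polynomials of degree 1 and 2 in \<open>t - j\<close>, each divided by its factorial. At the
      ends they give the weights \<open>1/2\<close> and \<open>1/12\<close>.\<close>
    define X where "X t = F t - (t - real j - 1/2) *\<^sub>R f 0 t + ((t - real j)\<^sup>2 / 2 - (t - real j) / 2 + 1 / 12) *\<^sub>R f 1 t" for t
    have "((\<lambda>t. ((t - real j)\<^sup>2 / 2 - (t - real j) / 2 + 1 / 12) *\<^sub>R f 2 t) has_integral X (real (Suc j)) - X (real j)) {real j..real (Suc j)}"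
    proof (rule fundamental_theorem_of_calculus)
      fix t assume t: "t \<in> {real j..real (Suc j)}"
      have sub: "{real j..real (Suc j)} \<subseteq> {0..}" by auto
      have d: "(F has_vector_derivative f 0 t) (at t within {real j..real (Suc j)})"
        "(f 0 has_vector_derivative f 1 t) (at t within {real j..real (Suc j)})"
        "(f 1 has_vector_derivative f 2 t) (at t within {real j..real (Suc j)})"
        using F[of t] f[of t 0] f[of t 1] t has_vector_derivative_within_subset[OF _ sub] by (auto simp: numeral_2_eq_2)
      have "((\<lambda>t. t - real j - 1/2) has_real_derivative 1) (at t within {real j..real (Suc j)})"
        "((\<lambda>t. (t - real j)\<^sup>2 / 2 - (t - real j) / 2 + 1 / 12) has_real_derivative (t - real j - 1/2)) (at t within {real j..real (Suc j)})"
        by (auto intro!: derivative_eq_intros simp: field_simps)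
      note d2 = has_vector_derivative_scaleR[OF this(1) d(2)] has_vector_derivative_scaleR[OF this(2) d(3)]
      from has_vector_derivative_add[OF has_vector_derivative_diff[OF d(1) d2(1)] d2(2)]
      show "(X has_vector_derivative ((t - real j)\<^sup>2 / 2 - (t - real j) / 2 + 1 / 12) *\<^sub>R f 2 t) (at t within {real j..real (Suc j)})"
        unfolding X_def[abs_def] by (simp add: algebra_simps)
    qed simp
    moreover have "X (real (Suc j)) - X (real j) = F (real (Suc j)) - F (real j) - (f 0 (real (Suc j)) + f 0 (real j)) / 2 + (1/12) *\<^sub>R (f 1 (real (Suc j)) - f 1 (real j))"
      by (simp add: X_def scaleR_conv_of_real algebra_simps)
    ultimately have "((\<lambda>t. ((t - real j)\<^sup>2 / 2 - (t - real j) / 2 + 1 / 12) *\<^sub>R f 2 t) has_integral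
      (F (real (Suc j)) - F (real j) - (f 0 (real (Suc j)) + f 0 (real j)) / 2 + (1/12) *\<^sub>R (f 1 (real (Suc j)) - f 1 (real j)))) {real j..real (Suc j)}"
      by (simp only:)
    thus ?thesis by (rule has_integral_eq[rotated]) (metis atLeastAtMost_iff pb_even_1)
  qed
  have pb: "1 / 12 = pb_even 1 0" using pb_even_1[of 0 0] by simp
  have "((\<lambda>t. pb_even 1 t *\<^sub>R f 2 t) has_integral
    (F (real J) - F 0 + (f 0 (real J) - f 0 0) / 2 + (1/12) *\<^sub>R (f 1 (real J) - f 1 0) - (\<Sum>j=1..J. f 0 (real j)))) {0..real J}"
  proof (induction J)
    case (Suc J)
    have eq: "F (real J) - F 0 + (f 0 (real J) - f 0 0) / 2 + (1/12) *\<^sub>R (f 1 (real J) - f 1 0) - (\<Sum>j=1..J. f 0 (real j)) +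
       (F (real (Suc J)) - F (real J) - (f 0 (real (Suc J)) + f 0 (real J)) / 2 + (1/12) *\<^sub>R (f 1 (real (Suc J)) - f 1 (real J)))
       = F (real (Suc J)) - F 0 + (f 0 (real (Suc J)) - f 0 0) / 2 + (1/12) *\<^sub>R (f 1 (real (Suc J)) - f 1 0) - (\<Sum>j=1..Suc J. f 0 (real j))"
      by (simp add: field_simps scaleR_conv_of_real del: of_nat_Suc)
    from has_integral_combine[OF _ _ Suc unit[of J]] show ?case unfolding eq by simp
  next
    case 0
    show ?case using has_integral_refl(2)[of "\<lambda>t. pb_even 1 t *\<^sub>R f 2 t" "0::real"] by simp
  qed
  thus ?case unfolding pb by (simp add: numeral_2_eq_2)
next
  case (Suc N)
  define M where "M = Suc N"
  \<comment> \<open>A primitive for the difference of two consecutive remainders, which raises the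
    order by two. \<open>pb_odd\<close> vanishes at integers and \<open>pb_even\<close> takes its
    value at 0 there, so only one new boundary term survives.\<close>
  define X where "X t = pb_even (Suc M) t *\<^sub>R f (2 * M + 1) t - pb_odd M t *\<^sub>R f (2 * M) t" for t
  have "((\<lambda>t. pb_even (Suc M) t *\<^sub>R f (2 * Suc M) t - pb_even M t *\<^sub>R f (2 * M) t) has_integral X (real J) - X 0) {0..real J}"
  proof (rule fundamental_theorem_of_calculus)
    fix t assume t: "t \<in> {0..real J}"
    have d: "(f k has_vector_derivative f (Suc k) t) (at t within {0..real J})" for k
      using f[of t k] t by (auto intro: has_vector_derivative_within_subset)
    have "(pb_even (Suc M) has_real_derivative pb_odd M t) (at t within {0..real J})"
      "(pb_odd M has_real_derivative pb_even M t) (at t within {0..real J})"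
      by (rule has_field_derivative_at_within, rule pb_even_deriv pb_odd_deriv, simp add: M_def)+
    note d2 = has_vector_derivative_scaleR[OF this(1) d[of "2 * M + 1"]] has_vector_derivative_scaleR[OF this(2) d[of "2 * M"]]
    from has_vector_derivative_diff[OF d2]
    show "(X has_vector_derivative pb_even (Suc M) t *\<^sub>R f (2 * Suc M) t - pb_even M t *\<^sub>R f (2 * M) t) (at t within {0..real J})"
      unfolding X_def[abs_def] by (simp add: algebra_simps)
  qed simp
  from has_integral_add[OF this Suc[folded M_def]]
  have "((\<lambda>t. pb_even (Suc M) t *\<^sub>R f (2 * Suc M) t) has_integral
    (X (real J) - X 0 + (F (real J) - F 0 + (f 0 (real J) - f 0 0) / 2
      + (\<Sum>s=1..M. pb_even s 0 *\<^sub>R (f (2 * s - 1) (real J) - f (2 * s - 1) 0))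
      - (\<Sum>j=1..J. f 0 (real j))))) {0..real J}" by simp
  moreover have "X (real J) - X 0 = pb_even (Suc M) 0 *\<^sub>R (f (2 * M + 1) (real J) - f (2 * M + 1) 0)"
    using pb_odd_nat[of M 0] by (simp add: X_def pb_odd_nat pb_even_nat algebra_simps)
  ultimately show ?case by (simp add: M_def algebra_simps)
qed

text \<open>What remains for one fixed \<open>k\<close> after summation over \<open>j\<close>, with
  \<open>x\<close> equal to plus or minus \<open>2 pi i k / z\<close>. Splitting the summand gives
  the digamma function at \<open>1 + x\<close>, plus Euler's constant, minus \<open>x\<close> times
  the trigamma function at \<open>1 + x\<close>.\<close>

definition Dsum :: "complex \<Rightarrow> complex" where
  "Dsum x = (\<Sum>j. x\<^sup>2 / (of_nat (Suc j) * (of_nat (Suc j) + x)\<^sup>2))"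

text \<open>The \<open>n\<close>-th derivative in \<open>t\<close> of
  \<open>1 / (t + x) + x / (t + x)^2\<close>, the part of the summand of \<open>Dsum\<close> that is
  left after \<open>1 / j\<close> is split off.\<close>

definition em_kernel :: "complex \<Rightarrow> nat \<Rightarrow> real \<Rightarrow> complex" where
  "em_kernel x n t = (-1) ^ n * (fact n / (of_real t + x) ^ (n + 1) + fact (n + 1) * x / (of_real t + x) ^ (n + 2))"

text \<open>The points \<open>x\<close> lie close to the imaginary axis, possibly to its left.
  Allowing a negative real part of at most a tenth of the modulus costs only the factor
  \<open>9/10\<close>, since \<open>2 t \<bar>x\<bar>\<close> is at most
  \<open>t^2 + \<bar>x\<bar>^2\<close>.\<close>

lemma shifted_norm_lower:
  assumes "Re x \<ge> - cmod x / 10" "t \<ge> 0"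
  shows "9 / 10 * (t\<^sup>2 + (cmod x)\<^sup>2) \<le> (cmod (of_real t + x))\<^sup>2"
proof -
  have "(cmod (of_real t + x))\<^sup>2 = t\<^sup>2 + (cmod x)\<^sup>2 + 2 * t * Re x"
    unfolding cmod_power2 by (simp add: power2_eq_square algebra_simps)
  moreover have "2 * t * Re x \<ge> 2 * t * (- cmod x / 10)" using assms by (intro mult_left_mono) auto
  moreover have "2 * t * cmod x \<le> t\<^sup>2 + (cmod x)\<^sup>2" using sum_squares_bound[of t "cmod x"] by simp
  ultimately show ?thesis by (simp add: field_simps)
qed

lemma shifted_nonpos_Reals:
  assumes "Re x \<ge> - cmod x / 10" "t \<ge> 0" "x \<noteq> 0"
  shows "of_real t + x \<notin> \<real>\<^sub>\<le>\<^sub>0" "of_real t + x \<noteq> 0"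
proof -
  show "of_real t + x \<notin> \<real>\<^sub>\<le>\<^sub>0"
  proof
    assume "of_real t + x \<in> \<real>\<^sub>\<le>\<^sub>0"
    hence *: "Im x = 0" "t + Re x \<le> 0" by (auto simp: complex_nonpos_Reals_iff)
    hence "cmod x = - Re x" using assms(2) by (simp add: cmod_def)
    with assms(1) * assms(2) have "Re x = 0" by simp
    with * assms(3) show False by (simp add: complex_eq_iff)
  qed
  thus "of_real t + x \<noteq> 0" by force
qed

lemma inverse_power_deriv:
  fixes x u :: complex
  assumes "u + x \<noteq> 0"
  shows "((\<lambda>u. 1 / (u + x) ^ m) has_field_derivative - of_nat m / (u + x) ^ (m + 1)) (at u)"
proof -
  have "((\<lambda>u. inverse ((u + x) ^ m)) has_field_derivative - (of_nat m * (u + x) ^ (m - 1) * inverse ((u + x) ^ m) ^ 2)) (at u)"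
    using assms by (auto intro!: derivative_eq_intros simp: power2_eq_square)
  also have "of_nat m * (u + x) ^ (m - 1) * inverse ((u + x) ^ m) ^ 2 = of_nat m / (u + x) ^ (m + 1)"
  proof -
    have "of_nat m * a ^ (m - 1) * inverse (a ^ m) ^ 2 = of_nat m / a ^ (m + 1)" if "a \<noteq> 0" for a :: complex
      using that by (cases m) (simp_all add: field_simps power2_eq_square)
    from this[OF assms] show ?thesis .
  qed
  finally show ?thesis by (simp add: inverse_eq_divide)
qed

lemma em_kernel_deriv:
  assumes "of_real t + x \<noteq> 0"
  shows "(em_kernel x k has_vector_derivative em_kernel x (Suc k) t) (at t within S)"
proof -
  have "((\<lambda>u. (-1) ^ k * (fact k * (1 / (u + x) ^ (k + 1)) + fact (k + 1) * x * (1 / (u + x) ^ (k + 2)))) has_field_derivative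
    (-1) ^ k * (fact k * (- of_nat (k + 1) / (of_real t + x) ^ (k + 1 + 1)) + fact (k + 1) * x * (- of_nat (k + 2) / (of_real t + x) ^ (k + 2 + 1)))) (at (of_real t))"
    by (intro DERIV_cmult DERIV_add inverse_power_deriv assms)
  also have "(-1) ^ k * (fact k * (- of_nat (k + 1) / (of_real t + x) ^ (k + 1 + 1)) + fact (k + 1) * x * (- of_nat (k + 2) / (of_real t + x) ^ (k + 2 + 1)))
    = em_kernel x (Suc k) t"
  proof -
    have g: "p * (- c / d) = - (c * p / d)" for p c d :: complex by simp
    have f1: "(fact (k + 1) :: complex) = of_nat (k + 1) * fact k"
      and f2: "(fact (k + 2) :: complex) = of_nat (k + 2) * fact (k + 1)" by (simp_all add: fact_reduce)
    have "fact k * (- of_nat (k + 1) / a ^ (k + 1 + 1)) = - (fact (k + 1) / a ^ (Suc k + 1))" for a :: complex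
      unfolding g f1 by simp
    note A = this
    have B: "fact (k + 1) * x * (- of_nat (k + 2) / a ^ (k + 2 + 1)) = - (fact (k + 2) * x / a ^ (Suc k + 2))" for a :: complex
      unfolding g f2 by (simp add: mult.assoc)
    have h: "s * (- P + - Q) = (- 1 * s) * (P + Q)" for s P Q :: complex by (simp add: algebra_simps)
    show ?thesis unfolding em_kernel_def A B h by simp
  qed
  finally have "((\<lambda>u. (-1) ^ k * (fact k * (1 / (u + x) ^ (k + 1)) + fact (k + 1) * x * (1 / (u + x) ^ (k + 2)))) has_field_derivative
     em_kernel x (Suc k) t) (at (of_real t))" .
  from has_vector_derivative_real_field[OF this] show ?thesis
    by (simp add: em_kernel_def[abs_def])
qed

lemma em_kernel_bound:
  assumes "Re x \<ge> - cmod x / 10" "x \<noteq> 0" "t \<ge> 0" "N \<ge> 1"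
  shows "cmod (em_kernel x (2 * N) t) \<le> (fact (2 * N) + fact (2 * N + 1)) * (10 / 9) ^ (N + 1) * cmod x / cmod x ^ (2 * N) / (t\<^sup>2 + (cmod x)\<^sup>2)"
proof -
  define X where "X = cmod x"
  define Y where "Y = cmod (of_real t + x)"
  define S where "S = t\<^sup>2 + X\<^sup>2"
  have X: "X > 0" using assms by (simp add: X_def)
  have S: "S \<ge> X\<^sup>2" "S > 0" using X by (auto simp: S_def add_nonneg_pos)
  have YS: "9 / 10 * S \<le> Y\<^sup>2" using shifted_norm_lower[OF assms(1,3)] by (simp add: X_def Y_def S_def)
  have Y: "Y > 0" using shifted_nonpos_Reals(2)[OF assms(1,3,2)] by (simp add: Y_def)
  have P: "(9/10) ^ (N + 1) * (X ^ (2 * N) * S) \<le> Y ^ (2 * N + 2)"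
  proof -
    have "(9 / 10 * S) ^ (N + 1) \<le> (Y\<^sup>2) ^ (N + 1)" using YS S by (intro power_mono) auto
    moreover have "X ^ (2 * N) * S \<le> S ^ N * S"
      unfolding power_mult using S by (intro mult_right_mono power_mono) auto
    hence "(9/10) ^ (N + 1) * (X ^ (2 * N) * S) \<le> (9/10) ^ (N + 1) * S ^ (N + 1)"
      unfolding power_add[of S] power_one_right by (intro mult_left_mono) auto
    moreover have "(Y\<^sup>2) ^ (N + 1) = Y ^ (2 * N + 2)" unfolding power_mult[symmetric] by simp
    ultimately show ?thesis by (simp only: power_mult_distrib)
  qed
  \<comment> \<open>For the odd power, one square \<open>Y\<^sup>2\<close> keeps the factor
    \<open>S\<close>, and the other \<open>2 N - 1\<close> factors are bounded below by
    \<open>sqrt (9/10) * X\<close>.\<close>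
  have Q: "(9/10) ^ (N + 1) * (X ^ (2 * N) * S) \<le> X * Y ^ (2 * N + 1)"
  proof -
    define a where "a = sqrt (9 / 10)"
    have a: "0 < a" "a \<le> 1" "a\<^sup>2 = 9/10" by (simp_all add: a_def)
    have "(a * X)\<^sup>2 = 9 / 10 * X\<^sup>2" by (simp only: power_mult_distrib a(3))
    also have "\<dots> \<le> 9 / 10 * S" using S by simp
    also note YS
    finally have aX: "a * X \<le> Y" by (rule power2_le_imp_le) (use Y in simp)
    have "(9/10) ^ (N + 1) * (X ^ (2 * N) * S) = X * ((a * X) ^ (2 * N - 1) * (9/10 * S)) * a"
    proof -
      have 1: "(9/10::real) ^ (N + 1) = a ^ (2 * N - 1) * a * (9/10)"
        using assms(4) power_minus_mult[of "2 * N" a] by (simp flip: a(3) add: power_mult)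
      have 2: "X ^ (2 * N) = X ^ (2 * N - 1) * X" using assms(4) power_minus_mult[of "2 * N" X] by simp
      show ?thesis unfolding 1 2 power_mult_distrib by (simp only: mult_ac)
    qed
    also have "\<dots> \<le> X * (Y ^ (2 * N - 1) * Y\<^sup>2) * 1"
      using X Y S(2) a(1,2) YS aX by (intro mult_mono power_mono mult_nonneg_nonneg zero_le_power) simp_all
    also have "Y ^ (2 * N - 1) * Y\<^sup>2 = Y ^ (2 * N + 1)" using assms(4) by (simp flip: power_add)
    finally show ?thesis by simp
  qed
  have pos: "(9/10) ^ (N + 1) * (X ^ (2 * N) * S) > 0" using X S by simp
  define Z where "Z = X / ((9/10) ^ (N + 1) * (X ^ (2 * N) * S))"
  have "cmod (em_kernel x (2 * N) t) \<le> fact (2 * N) / Y ^ (2 * N + 1) + fact (2 * N + 1) * X / Y ^ (2 * N + 2)"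
  proof -
    have "cmod (em_kernel x (2 * N) t) = cmod (fact (2 * N) / (of_real t + x) ^ (2 * N + 1) + fact (2 * N + 1) * x / (of_real t + x) ^ (2 * N + 2))"
      unfolding em_kernel_def norm_mult norm_power by simp
    also have "\<dots> \<le> cmod (fact (2 * N) / (of_real t + x) ^ (2 * N + 1)) + cmod (fact (2 * N + 1) * x / (of_real t + x) ^ (2 * N + 2))"
      by (rule norm_triangle_ineq)
    finally show ?thesis by (simp only: norm_divide norm_mult norm_power norm_fact X_def Y_def)
  qed
  also have "\<dots> \<le> fact (2 * N) * Z + fact (2 * N + 1) * Z"
  proof (rule add_mono)
    have "1 / Y ^ (2 * N + 1) \<le> Z"
      unfolding Z_def using Q pos Y X by (simp add: divide_le_eq le_divide_eq mult.commute del: power_Suc power_Suc2 mult_Suc_right)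
    from mult_left_mono[OF this, of "fact (2 * N)"] show "fact (2 * N) / Y ^ (2 * N + 1) \<le> fact (2 * N) * Z" by simp
    have "X / Y ^ (2 * N + 2) \<le> Z"
      unfolding Z_def using P pos Y X S(2) by (intro divide_left_mono mult_pos_pos zero_less_power) simp_all
    from mult_left_mono[OF this, of "fact (2 * N + 1)"] show "fact (2 * N + 1) * X / Y ^ (2 * N + 2) \<le> fact (2 * N + 1) * Z" by simp
  qed
  also have "\<dots> = (fact (2 * N) + fact (2 * N + 1)) * Z" by (simp only: distrib_right)
  also have "Z = (10/9) ^ (N + 1) * X / X ^ (2 * N) / S"
  proof -
    have "(10/9::real) ^ (N + 1) = 1 / (9/10) ^ (N + 1)" by (simp add: power_divide)
    thus ?thesis unfolding Z_def by (simp only:) simp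
  qed
  finally show ?thesis by (simp add: X_def S_def)
qed

text \<open>The kernel bound retains one factor \<open>1 / (t^2 + \<bar>x\<bar>^2)\<close>, whose
  integral is at most \<open>pi / (2 \<bar>x\<bar>)\<close> however large \<open>J\<close> is.
  Uniformity in \<open>J\<close> is what lets the bound survive the limit.\<close>

lemma em_remainder_bound:
  assumes x: "Re x \<ge> - cmod x / 10" "x \<noteq> 0" "N \<ge> 1"
    and I: "((\<lambda>t. pb_even N t *\<^sub>R em_kernel x (2 * N) t) has_integral I) {0..real J}"
  shows "cmod I \<le> zeta_nat (2 * N) / (2 * pi) ^ (2 * N) * (fact (2 * N) + fact (2 * N + 1)) * (10 / 9) ^ (N + 1) * pi / cmod x ^ (2 * N)"
proof -
  define X where "X = cmod x"
  have X: "X > 0" using x by (simp add: X_def)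
  define P where "P = 2 * zeta_nat (2 * N) / (2 * pi) ^ (2 * N)"
  define K where "K = (fact (2 * N) + fact (2 * N + 1)) * (10 / 9) ^ (N + 1) * X / X ^ (2 * N)"
  have P: "P \<ge> 0" using pb_even_bound[OF x(3), of 0] by (simp add: P_def)
  have K: "K \<ge> 0" using X by (simp add: K_def)
  have "((\<lambda>t. (P * K) * (1 / (t\<^sup>2 + X\<^sup>2))) has_integral (P * K) * (arctan (real J / X) / X - arctan (0 / X) / X)) {0..real J}"
  proof (rule has_integral_mult_right, rule fundamental_theorem_of_calculus)
    fix t
    have "((\<lambda>t. arctan (t / X) / X) has_real_derivative 1 / (t\<^sup>2 + X\<^sup>2)) (at t within {0..real J})"
    proof -
      have "((\<lambda>t. arctan (t / X) / X) has_real_derivative inverse (1 + (t / X)\<^sup>2) * (1 / X) / X) (at t within {0..real J})"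
        using X by (auto intro!: derivative_eq_intros)
      also have "inverse (1 + (t / X)\<^sup>2) * (1 / X) / X = 1 / (t\<^sup>2 + X\<^sup>2)"
      proof -
        have "1 + (t / X)\<^sup>2 = (t\<^sup>2 + X\<^sup>2) / X\<^sup>2" using X by (simp add: power_divide add_divide_distrib)
        thus ?thesis using X by (simp add: power2_eq_square)
      qed
      finally show ?thesis .
    qed
    thus "((\<lambda>t. arctan (t / X) / X) has_vector_derivative 1 / (t\<^sup>2 + X\<^sup>2)) (at t within {0..real J})"
      by (simp only: has_real_derivative_iff_has_vector_derivative)
  qed simp
  note g = this
  have "cmod I = norm (integral {0..real J} (\<lambda>t. pb_even N t *\<^sub>R em_kernel x (2 * N) t))"
    using I by (simp add: integral_unique)
  also have "\<dots> \<le> integral {0..real J} (\<lambda>t. (P * K) * (1 / (t\<^sup>2 + X\<^sup>2)))"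
  proof (rule integral_norm_bound_integral)
    fix t assume "t \<in> {0..real J}"
    hence "cmod (em_kernel x (2 * N) t) \<le> K / (t\<^sup>2 + X\<^sup>2)"
      using em_kernel_bound[OF x(1,2) _ x(3), of t] unfolding K_def X_def by simp
    moreover have "\<bar>pb_even N t\<bar> \<le> P" unfolding P_def by (rule pb_even_bound[OF x(3)])
    ultimately have "\<bar>pb_even N t\<bar> * cmod (em_kernel x (2 * N) t) \<le> P * (K / (t\<^sup>2 + X\<^sup>2))"
      using P by (intro mult_mono) auto
    thus "norm (pb_even N t *\<^sub>R em_kernel x (2 * N) t) \<le> (P * K) * (1 / (t\<^sup>2 + X\<^sup>2))" by simp
  qed (use I g in \<open>auto simp: has_integral_integrable_integral\<close>)
  also have "\<dots> = (P * K) * (arctan (real J / X) / X)" using g by (simp add: integral_unique)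
  also have "\<dots> \<le> (P * K) * ((pi / 2) / X)"
    using P K X arctan_bounded[of "real J / X"] by (intro mult_left_mono divide_right_mono) auto
  also have "\<dots> = zeta_nat (2 * N) / (2 * pi) ^ (2 * N) * (fact (2 * N) + fact (2 * N + 1)) * (10 / 9) ^ (N + 1) * pi / X ^ (2 * N)"
    using X by (simp add: P_def K_def field_simps)
  finally show ?thesis by (simp add: X_def)
qed

lemma inverse_shift_tendsto_0: "(\<lambda>J. 1 / (of_nat J + x) ^ Suc k) \<longlonglongrightarrow> (0::complex)"
proof -
  have "filterlim (\<lambda>J. of_nat J + x) at_infinity sequentially"
    by (rule tendsto_add_filterlim_at_infinity'[OF tendsto_of_nat tendsto_const])
  hence "(\<lambda>J. 1 / (of_nat J + x)) \<longlonglongrightarrow> 0" by (rule tendsto_divide_0[OF tendsto_const])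
  from tendsto_power[OF this, of "Suc k"] show ?thesis by (simp add: power_divide)
qed

lemma em_kernel_tendsto_0: "(\<lambda>J. em_kernel x n (real J)) \<longlonglongrightarrow> 0"
proof -
  have "(\<lambda>J. (-1) ^ n * (fact n * (1 / (of_nat J + x) ^ Suc n) + fact (n + 1) * x * (1 / (of_nat J + x) ^ Suc (n + 1)))) \<longlonglongrightarrow> (-1) ^ n * (fact n * 0 + fact (n + 1) * x * 0)"
    by (intro tendsto_intros inverse_shift_tendsto_0)
  thus ?thesis by (simp add: em_kernel_def)
qed

lemma Dsum_sums:
  assumes x: "Re x \<ge> - cmod x / 10" "x \<noteq> 0"
  shows "(\<lambda>j. x\<^sup>2 / (of_nat (Suc j) * (of_nat (Suc j) + x)\<^sup>2)) sums Dsum x"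
proof -
  have *: "summable (\<lambda>j. cmod (x\<^sup>2 / (of_nat (Suc j) * (of_nat (Suc j) + x)\<^sup>2)))"
  proof (rule summable_comparison_test')
    show "summable (\<lambda>j. (cmod x)\<^sup>2 * (10 / 9) * (1 / real (Suc j) ^ 2))"
      by (intro summable_mult summable_inverse_power) simp
    fix j
    define s where "s = real (Suc j)"
    have s: "s \<ge> 1" by (simp add: s_def)
    have "9/10 * s\<^sup>2 \<le> 9/10 * (s\<^sup>2 + (cmod x)\<^sup>2)" by simp
    also have "\<dots> \<le> (cmod (of_real s + x))\<^sup>2" using s by (intro shifted_norm_lower x) auto
    finally have "9/10 * s\<^sup>2 \<le> (cmod (of_real s + x))\<^sup>2" .
    hence "1 * (9/10 * s\<^sup>2) \<le> s * (cmod (of_real s + x))\<^sup>2" using s by (intro mult_mono) auto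
    hence "(cmod x)\<^sup>2 / (s * (cmod (of_real s + x))\<^sup>2) \<le> (cmod x)\<^sup>2 / (9/10 * s\<^sup>2)"
      using s by (intro divide_left_mono mult_pos_pos) (auto intro: less_le_trans[of 0 "9/10 * s\<^sup>2"])
    moreover have sj: "(of_nat (Suc j) :: complex) = of_real s" by (simp add: s_def)
    have "norm (cmod (x\<^sup>2 / (of_nat (Suc j) * (of_nat (Suc j) + x)\<^sup>2))) = (cmod x)\<^sup>2 / (s * (cmod (of_real s + x))\<^sup>2)"
      unfolding sj using s by (simp add: norm_divide norm_mult norm_power)
    moreover have "(cmod x)\<^sup>2 / (9/10 * s\<^sup>2) = (cmod x)\<^sup>2 * (10 / 9) * (1 / s\<^sup>2)" using s by simp
    ultimately show "norm (cmod (x\<^sup>2 / (of_nat (Suc j) * (of_nat (Suc j) + x)\<^sup>2))) \<le> (cmod x)\<^sup>2 * (10 / 9) * (1 / real (Suc j) ^ 2)"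
      unfolding s_def by linarith
  qed
  show "(\<lambda>j. x\<^sup>2 / (of_nat (Suc j) * (of_nat (Suc j) + x)\<^sup>2)) sums Dsum x"
    unfolding Dsum_def by (rule summable_sums[OF summable_norm_cancel[OF *]])
qed

text \<open>The summand is \<open>1 / j\<close> minus \<open>em_kernel x 0 j\<close>, so a partial
  sum is a harmonic number minus an Euler--Maclaurin sum with primitive
  \<open>Ln (t + x) - x / (t + x)\<close>. All boundary terms at \<open>J\<close> vanish in the
  limit except this primitive.\<close>

lemma Dsum_asymptotic:
  assumes x: "Re x \<ge> - cmod x / 10" "x \<noteq> 0" and N: "N \<ge> 1"
  shows "cmod (Dsum x - (euler_mascheroni + Ln x - 1 + 1 / x
      - (\<Sum>s=1..N. of_real (pb_even s 0 * (fact (2 * s - 1) + fact (2 * s))) / x ^ (2 * s))))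
    \<le> zeta_nat (2 * N) / (2 * pi) ^ (2 * N) * (fact (2 * N) + fact (2 * N + 1)) * (10 / 9) ^ (N + 1) * pi / cmod x ^ (2 * N)"
    (is "cmod (_ - ?A) \<le> ?B")
proof -
  define F where "F t = Ln (of_real t + x) - x / (of_real t + x)" for t
  define g where "g = em_kernel x"
  have nz: "of_real t + x \<noteq> 0" "of_real t + x \<notin> \<real>\<^sub>\<le>\<^sub>0" if "t \<ge> 0" for t
    using shifted_nonpos_Reals[OF x(1) that x(2)] by auto
  have dF: "(F has_vector_derivative g 0 t) (at t within {0..})" if "t \<ge> 0" for t
  proof -
    have "((\<lambda>u. Ln (u + x) - x / (u + x)) has_field_derivative g 0 t) (at (of_real t))"
      using nz[OF that] by (auto intro!: derivative_eq_intros simp: g_def em_kernel_def field_simps power2_eq_square)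
    from has_vector_derivative_real_field[OF this] show ?thesis by (simp add: F_def[abs_def])
  qed
  have dg: "(g k has_vector_derivative g (Suc k) t) (at t within {0..})" if "t \<ge> 0" for k t
    unfolding g_def by (rule em_kernel_deriv[OF nz(1)[OF that]])
  define E where "E J = F (real J) - F 0 + (g 0 (real J) - g 0 0) / 2
      + (\<Sum>s=1..N. pb_even s 0 *\<^sub>R (g (2 * s - 1) (real J) - g (2 * s - 1) 0))" for J
  have EM: "((\<lambda>t. pb_even N t *\<^sub>R g (2 * N) t) has_integral (E J - (\<Sum>j=1..J. g 0 (real j)))) {0..real J}" for J
    using Euler_Maclaurin[of F g "N - 1" J, OF dF dg] N by (simp add: E_def)
  define D where "D J = (\<Sum>j<J. x\<^sup>2 / (of_nat (Suc j) * (of_nat (Suc j) + x)\<^sup>2))" for J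
  have D: "D J = of_real (harm J) - (\<Sum>j=1..J. g 0 (real j))" for J
  proof -
    have "x\<^sup>2 / (of_nat (Suc j) * (of_nat (Suc j) + x)\<^sup>2) = inverse (of_nat (Suc j)) - g 0 (real (Suc j))" for j
    proof -
      have "(a - n)\<^sup>2 / (n * a\<^sup>2) = inverse n - (1 / a + (a - n) / a\<^sup>2)" if "n \<noteq> 0" "a \<noteq> 0" for n a :: complex
        using that by (simp add: divide_simps power2_eq_square) (simp add: algebra_simps)
      from this[of n "n + x" for n] have "x\<^sup>2 / (n * (n + x)\<^sup>2) = inverse n - (1 / (n + x) + x / (n + x)\<^sup>2)"
        if "n \<noteq> 0" "n + x \<noteq> 0" for n using that by simp
      moreover have "of_nat (Suc j) + x \<noteq> 0" using nz(1)[of "real (Suc j)"] by simp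
      moreover have "(of_nat (Suc j) :: complex) \<noteq> 0" by (simp only: of_nat_eq_0_iff)
      ultimately show ?thesis unfolding g_def em_kernel_def by (simp add: power2_eq_square del: of_nat_Suc)
    qed
    hence "D J = (\<Sum>j<J. inverse (of_nat (Suc j)) - g 0 (real (Suc j)))" by (simp add: D_def)
    also have "\<dots> = (\<Sum>j=1..J. inverse (of_nat j) - g 0 (real j))"
      by (rule sum.reindex_bij_witness[of _ "\<lambda>j. j - 1" Suc]) auto
    finally show ?thesis by (simp add: sum_subtractf harm_def)
  qed
  have bound: "cmod (D J - (of_real (harm J) - E J)) \<le> ?B" for J
  proof -
    have "D J - (of_real (harm J) - E J) = E J - (\<Sum>j=1..J. g 0 (real j))" by (simp add: D)
    thus ?thesis using em_remainder_bound[OF x N EM[of J, unfolded g_def]] unfolding g_def by (simp only:)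
  qed
  \<comment> \<open>The primitive at \<open>J\<close> grows like \<open>ln J\<close> and cancels the
    growth of the harmonic numbers; what is left is Euler's constant.\<close>
  have harm_lim: "(\<lambda>J. of_real (harm J) - F (real J)) \<longlonglongrightarrow> euler_mascheroni"
  proof -
    have one: "(\<lambda>J. x * (1 / (of_nat J + x) ^ Suc 0)) \<longlonglongrightarrow> x * 0"
      by (intro tendsto_intros inverse_shift_tendsto_0)
    have "(\<lambda>J. 1 + x * (1 / of_nat J)) \<longlonglongrightarrow> 1 + x * 0"
      by (intro tendsto_intros lim_1_over_n)
    hence "(\<lambda>J. 1 + x * (1 / of_nat J)) \<longlonglongrightarrow> 1" by simp
    hence two: "(\<lambda>J. Ln (1 + x * (1 / of_nat J))) \<longlonglongrightarrow> Ln 1" by (rule tendsto_Ln) simp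
    have "(\<lambda>J. of_real (harm J - ln (real J)) - Ln (1 + x * (1 / of_nat J)) + x * (1 / (of_nat J + x) ^ Suc 0)) \<longlonglongrightarrow> euler_mascheroni - Ln 1 + x * 0"
      by (intro tendsto_intros one two euler_mascheroni_LIMSEQ_of_real)
    moreover have "\<forall>\<^sub>F J in sequentially. of_real (harm J - ln (real J)) - Ln (1 + x * (1 / of_nat J)) + x * (1 / (of_nat J + x) ^ Suc 0) = of_real (harm J) - F (real J)"
      using eventually_gt_at_top[of 0]
    proof eventually_elim
      case (elim J)
      have "of_real (real J) + x = of_real (real J) * (1 + x * (1 / of_nat J))" using elim by (simp add: field_simps)
      moreover from this nz(1)[of "real J"] have "1 + x * (1 / of_nat J) \<noteq> 0" by auto
      ultimately have "Ln (of_real (real J) + x) = of_real (ln (real J)) + Ln (1 + x * (1 / of_nat J))"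
        using elim by (simp only: Ln_times_of_real [of "real J"] of_nat_0_less_iff not_False_eq_True) (simp add: Ln_of_real')
      thus ?case by (simp add: F_def)
    qed
    ultimately have "(\<lambda>J. of_real (harm J) - F (real J)) \<longlonglongrightarrow> euler_mascheroni - Ln 1 + x * 0"
      by (rule Lim_transform_eventually)
    thus ?thesis by simp
  qed
  have "(\<lambda>J. D J - ((of_real (harm J) - F (real J)) + F 0 - (g 0 (real J) - g 0 0) / 2
      - (\<Sum>s=1..N. pb_even s 0 *\<^sub>R (g (2 * s - 1) (real J) - g (2 * s - 1) 0)))) \<longlonglongrightarrow>
     Dsum x - (euler_mascheroni + F 0 - (0 - g 0 0) / 2 - (\<Sum>s=1..N. pb_even s 0 *\<^sub>R (0 - g (2 * s - 1) 0)))"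
    unfolding D_def g_def using Dsum_sums[OF x]
    by (intro tendsto_intros harm_lim em_kernel_tendsto_0) (auto simp: sums_def)
  note L1 = this
  have E1: "of_real (harm J) - F (real J) + F 0 - (g 0 (real J) - g 0 0) / 2
      - (\<Sum>s=1..N. pb_even s 0 *\<^sub>R (g (2 * s - 1) (real J) - g (2 * s - 1) 0)) = of_real (harm J) - E J" for J
    unfolding E_def by (simp add: algebra_simps)
  have E2: "euler_mascheroni + F 0 - (0 - g 0 0) / 2 - (\<Sum>s=1..N. pb_even s 0 *\<^sub>R (0 - g (2 * s - 1) 0)) = ?A"
  proof -
    have "g 0 0 = 2 / x" using x(2) by (simp add: g_def em_kernel_def power2_eq_square)
    moreover have "F 0 = Ln x - 1" using x(2) by (simp add: F_def)
    moreover have "pb_even s 0 *\<^sub>R (0 - g (2 * s - 1) 0) = of_real (pb_even s 0 * (fact (2 * s - 1) + fact (2 * s))) / x ^ (2 * s)" if "s \<ge> 1" for s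
    proof -
      define k where "k = 2 * s - 1"
      have k: "2 * s = Suc k" using that by (simp add: k_def)
      hence "odd k" by presburger
      thus ?thesis using x(2) unfolding k g_def em_kernel_def
        by (simp add: scaleR_conv_of_real field_simps)
    qed
    ultimately show ?thesis by simp
  qed
  have "(\<lambda>J. D J - (of_real (harm J) - E J)) \<longlonglongrightarrow> Dsum x - ?A"
    using L1 unfolding E1 E2 .
  from tendsto_norm[OF this] show ?thesis
    by (rule LIMSEQ_le_const2) (use bound in auto)
qed

section \<open>Asymptotics of the logarithm of the generating function\<close>

lemma sin_nonzero_lower: "Im z < 0 \<Longrightarrow> sin (of_real pi * z) \<noteq> 0"
proof
  assume z: "Im z < 0" and "sin (of_real pi * z) = 0"
  then obtain n :: int where "of_real pi * z = of_real (of_int n * pi)" by (auto simp: sin_eq_0)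
  hence "Im (of_real pi * z) = 0" by simp
  thus False using z by simp
qed

text \<open>Two logarithmic derivatives of the reflection formula for Gamma. The lower half-plane
  contains no pole of either factor, and it is where \<open>x / (2 pi i)\<close> lies when
  \<open>Re x > 0\<close>.\<close>

lemma Polygamma_1_reflection:
  assumes "Im z < 0"
  shows "Polygamma 1 z + Polygamma 1 (1 - z) = of_real (pi\<^sup>2) / (sin (of_real pi * z))\<^sup>2"
proof -
  have nz: "w \<notin> \<int>\<^sub>\<le>\<^sub>0" "1 - w \<notin> \<int>\<^sub>\<le>\<^sub>0" if "Im w < 0" for w
    using that by (auto elim!: nonpos_Ints_cases simp: complex_eq_iff)
  define H where "H = {w. Im w < 0}"
  have H: "open H" by (simp add: H_def open_halfspace_Im_lt)
  have D1: "Digamma w - Digamma (1 - w) = - of_real pi * cot (of_real pi * w)" if w: "w \<in> H" for w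
  proof -
    have w': "Im w < 0" using w by (simp add: H_def)
    have s: "sin (of_real pi * w) \<noteq> 0" by (rule sin_nonzero_lower[OF w'])
    have "((\<lambda>w. Gamma w * Gamma (1 - w)) has_field_derivative Gamma w * Gamma (1 - w) * (Digamma w - Digamma (1 - w))) (at w)"
      using nz[OF w'] by (auto intro!: derivative_eq_intros simp: algebra_simps)
    moreover have "((\<lambda>w. Gamma w * Gamma (1 - w)) has_field_derivative - (of_real pi * (of_real pi * cos (of_real pi * w)) / (sin (of_real pi * w))\<^sup>2)) (at w)"
      unfolding Gamma_reflection_complex using s
      by (auto intro!: derivative_eq_intros simp: power2_eq_square)
    ultimately have "Gamma w * Gamma (1 - w) * (Digamma w - Digamma (1 - w)) = - (of_real pi * (of_real pi * cos (of_real pi * w)) / (sin (of_real pi * w))\<^sup>2)"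
      by (rule DERIV_unique)
    moreover have "d = - p * (c / q)" if "p / q * d = - (p * (p * c) / q\<^sup>2)" "p \<noteq> 0" "q \<noteq> 0" for p q c d :: complex
    proof -
      have "d = (q / p) * (p / q * d)" using that(2,3) by simp
      also have "\<dots> = - p * (c / q)" unfolding that(1) using that(2,3) by (simp add: power2_eq_square)
      finally show ?thesis .
    qed
    ultimately show ?thesis unfolding Gamma_reflection_complex cot_def using s by (metis of_real_eq_0_iff pi_neq_zero)
  qed
  have zH: "z \<in> H" using assms by (simp add: H_def)
  have s: "sin (of_real pi * z) \<noteq> 0" by (rule sin_nonzero_lower[OF assms])
  have d1: "((\<lambda>w. Digamma w - Digamma (1 - w)) has_field_derivative Polygamma 1 z + Polygamma 1 (1 - z)) (at z)"
    using nz[OF assms] by (auto intro!: derivative_eq_intros)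
  have "((\<lambda>w. - of_real pi * (cos (of_real pi * w) / sin (of_real pi * w))) has_field_derivative
     - of_real pi * ((- (of_real pi * sin (of_real pi * z)) * sin (of_real pi * z) - cos (of_real pi * z) * (of_real pi * cos (of_real pi * z))) / (sin (of_real pi * z) * sin (of_real pi * z)))) (at z)"
  proof (rule DERIV_cmult, rule DERIV_divide)
    show "sin (of_real pi * z) \<noteq> 0" by (rule s)
    show "((\<lambda>w. cos (of_real pi * w)) has_field_derivative - (of_real pi * sin (of_real pi * z))) (at z)"
      "((\<lambda>w. sin (of_real pi * w)) has_field_derivative of_real pi * cos (of_real pi * z)) (at z)"
      by (auto intro!: derivative_eq_intros)
  qed
  also have "- of_real pi * ((- (of_real pi * sin (of_real pi * z)) * sin (of_real pi * z) - cos (of_real pi * z) * (of_real pi * cos (of_real pi * z))) / (sin (of_real pi * z) * sin (of_real pi * z))) = of_real (pi\<^sup>2) / (sin (of_real pi * z))\<^sup>2"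
  proof -
    have "- p * ((- (p * sn) * sn - c * (p * c)) / (sn * sn)) = p\<^sup>2 / sn\<^sup>2" if "sn\<^sup>2 + c\<^sup>2 = 1" "sn \<noteq> 0" for p sn c :: complex
    proof -
      have "- (p * sn) * sn - c * (p * c) = - p * (sn\<^sup>2 + c\<^sup>2)" by (simp add: power2_eq_square algebra_simps)
      thus ?thesis using that by (simp add: power2_eq_square)
    qed
    from this[OF sin_cos_squared_add s] show ?thesis by simp
  qed
  finally have d2: "((\<lambda>w. - of_real pi * cot (of_real pi * w)) has_field_derivative of_real (pi\<^sup>2) / (sin (of_real pi * z))\<^sup>2) (at z)"
    by (simp add: cot_def[abs_def])
  have "((\<lambda>w. - of_real pi * cot (of_real pi * w)) has_field_derivative Polygamma 1 z + Polygamma 1 (1 - z)) (at z)"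
    by (rule has_field_derivative_transform_within_open[OF d1 H zH D1])
  thus ?thesis using d2 by (rule DERIV_unique)
qed

text \<open>The function on the right is \<open>1 / (4 sinh (x / 2)^2)\<close> without its pole at
  0. The terms for \<open>k\<close> and \<open>- k\<close> are paired so that the series runs over
  \<open>nat\<close>.\<close>

lemma partial_fractions_exp:
  assumes "Re x > 0"
  shows "(\<lambda>k. 1 / (x + 2 * pi * \<i> * of_nat (Suc k))\<^sup>2 + 1 / (x - 2 * pi * \<i> * of_nat (Suc k))\<^sup>2) sums
     (exp (- x) / (1 - exp (- x))\<^sup>2 - 1 / x\<^sup>2)"
proof -
  define z where "z = x / (2 * pi * \<i>)"
  have x: "x = 2 * pi * \<i> * z" by (simp add: z_def)
  have "Re x = - (2 * pi * Im z)" by (simp add: x)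
  with assms have z: "Im z < 0" by (simp add: mult_less_0_iff)
  have z0: "z \<noteq> 0" "1 - z \<noteq> 0" using z by (auto simp: complex_eq_iff)
  have "(\<lambda>k. inverse ((z + of_nat k) ^ Suc 1)) sums ((-1) ^ Suc 1 * Polygamma 1 z / fact 1)"
    using z0 by (intro Polygamma_LIMSEQ) auto
  hence p1: "(\<lambda>k. inverse ((z + of_nat k)\<^sup>2)) sums Polygamma 1 z" by (simp add: numeral_2_eq_2)
  have "(\<lambda>k. inverse ((1 - z + of_nat k) ^ Suc 1)) sums ((-1) ^ Suc 1 * Polygamma 1 (1 - z) / fact 1)"
    using z0 by (intro Polygamma_LIMSEQ) auto
  hence p2: "(\<lambda>k. inverse ((1 - z + of_nat k)\<^sup>2)) sums Polygamma 1 (1 - z)" by (simp add: numeral_2_eq_2)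
  have "(\<lambda>k. inverse ((z + of_nat (Suc k))\<^sup>2)) sums (Polygamma 1 z - inverse (z\<^sup>2))"
    using p1 by (subst sums_Suc_iff) simp
  from sums_add[OF this p2]
  have "(\<lambda>k. inverse ((z + of_nat (Suc k))\<^sup>2) + inverse ((1 - z + of_nat k)\<^sup>2)) sums (of_real (pi\<^sup>2) / (sin (of_real pi * z))\<^sup>2 - inverse (z\<^sup>2))"
    using Polygamma_1_reflection[OF z] by (simp add: algebra_simps)
  from sums_mult[OF this, of "1 / (2 * pi * \<i>)\<^sup>2"]
  have "(\<lambda>k. 1 / (2 * pi * \<i>)\<^sup>2 * (inverse ((z + of_nat (Suc k))\<^sup>2) + inverse ((1 - z + of_nat k)\<^sup>2))) sums
     (1 / (2 * pi * \<i>)\<^sup>2 * (of_real (pi\<^sup>2) / (sin (of_real pi * z))\<^sup>2 - inverse (z\<^sup>2)))" .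
  moreover have "1 / (2 * pi * \<i>)\<^sup>2 * (inverse ((z + of_nat (Suc k))\<^sup>2) + inverse ((1 - z + of_nat k)\<^sup>2)) =
      1 / (x + 2 * pi * \<i> * of_nat (Suc k))\<^sup>2 + 1 / (x - 2 * pi * \<i> * of_nat (Suc k))\<^sup>2" for k
  proof -
    have e1: "x + 2 * pi * \<i> * of_nat (Suc k) = (2 * pi * \<i>) * (z + of_nat (Suc k))" by (simp add: x algebra_simps)
    have e2: "x - 2 * pi * \<i> * of_nat (Suc k) = - (2 * pi * \<i>) * (1 - z + of_nat k)" by (simp add: x algebra_simps)
    have e3: "1 / (c * a)\<^sup>2 + 1 / (- c * b)\<^sup>2 = 1 / c\<^sup>2 * (inverse (a\<^sup>2) + inverse (b\<^sup>2))" for a b c :: complex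
      by (simp add: power_mult_distrib inverse_eq_divide add_divide_distrib distrib_left)
    show ?thesis unfolding e1 e2 by (rule e3 [symmetric])
  qed
  moreover have "1 / (2 * pi * \<i>)\<^sup>2 * (of_real (pi\<^sup>2) / (sin (of_real pi * z))\<^sup>2 - inverse (z\<^sup>2)) = exp (- x) / (1 - exp (- x))\<^sup>2 - 1 / x\<^sup>2"
  proof -
    define E where "E = exp (x / 2)"
    have E: "E \<noteq> 0" "exp (- x) = 1 / E\<^sup>2"
      by (simp_all add: E_def exp_minus inverse_eq_divide flip: exp_double)
    have "sin (of_real pi * z) = (E - 1 / E) / (2 * \<i>)"
      by (simp add: sin_exp_eq E_def x exp_minus inverse_eq_divide mult_ac)
    hence s2: "(sin (of_real pi * z))\<^sup>2 = - ((E - 1 / E)\<^sup>2 / 4)" by (simp add: power_divide power_mult_distrib)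
    have nz: "E - 1 / E \<noteq> 0" using sin_nonzero_lower[OF z] s2 by auto
    have "1 / (2 * pi * \<i>)\<^sup>2 * (of_real (pi\<^sup>2) / (sin (of_real pi * z))\<^sup>2) = 1 / (E - 1 / E)\<^sup>2"
      unfolding s2 by (simp add: power_mult_distrib)
    also have "\<dots> = exp (- x) / (1 - exp (- x))\<^sup>2"
    proof -
      have "E - 1 / E = E * (1 - 1 / E\<^sup>2)" using E(1) by (simp add: field_simps power2_eq_square)
      thus ?thesis unfolding E(2) by (simp add: power_mult_distrib)
    qed
    moreover have "1 / (2 * pi * \<i>)\<^sup>2 * inverse (z\<^sup>2) = 1 / x\<^sup>2" unfolding x by (simp add: power_mult_distrib inverse_eq_divide)
    ultimately show ?thesis by (simp only: right_diff_distrib)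
  qed
  ultimately show ?thesis by (simp only:)
qed

text \<open>Fubini for double series with a majorant of product form, returned as two ordinary
  series with a common sum.\<close>

lemma has_sum_interchange:
  fixes a :: "nat \<Rightarrow> nat \<Rightarrow> complex"
  assumes bound: "\<And>j k. cmod (a j k) \<le> C * (u j * v k)"
    and u: "summable u" "\<And>j. u j \<ge> 0" and v: "summable v" "\<And>k. v k \<ge> 0"
    and rows: "\<And>j. (\<lambda>k. a j k) sums R j" and cols: "\<And>k. (\<lambda>j. a j k) sums T k"
  shows "\<exists>S::complex. R sums S \<and> T sums S"
proof -
  have uv: "(\<lambda>(j, k). C * (u j * v k)) summable_on UNIV \<times> UNIV"
  proof -
    have "(\<lambda>(j, k). u j * v k) summable_on UNIV \<times> UNIV"
    proof (rule summable_on_SigmaI)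
      have "(v has_sum suminf v) UNIV" using v by (intro sums_nonneg_imp_has_sum) auto
      thus "((\<lambda>k. case (j, k) of (j, k) \<Rightarrow> u j * v k) has_sum u j * suminf v) UNIV" for j
        by (simp add: has_sum_cmult_right)
      have "(\<lambda>j. u j * suminf v) sums (suminf u * suminf v)" using u by (intro sums_mult2) auto
      moreover have "u j * suminf v \<ge> 0" for j using u v by (simp add: suminf_nonneg)
      ultimately have "((\<lambda>j. u j * suminf v) has_sum (suminf u * suminf v)) UNIV" by (rule sums_nonneg_imp_has_sum)
      thus "(\<lambda>j. u j * suminf v) summable_on UNIV" by (rule has_sum_imp_summable)
    qed (use u v in auto)
    from summable_on_cmult_right[OF this, of C] show ?thesis by (simp add: case_prod_unfold)
  qed
  have C: "C * (u j * v k) \<ge> 0" for j k using bound[of j k] norm_ge_zero order_trans by blast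
  have "(\<lambda>p. norm (case p of (j, k) \<Rightarrow> a j k)) summable_on UNIV \<times> UNIV"
    by (rule summable_on_comparison_test[OF uv]) (use bound in auto)
  hence "(\<lambda>(j, k). a j k) summable_on UNIV \<times> UNIV" by (rule abs_summable_summable)
  then obtain S :: complex where S: "((\<lambda>(j, k). a j k) has_sum S) (UNIV \<times> UNIV)" by (auto simp: summable_on_def)
  have rows': "((\<lambda>k. a j k) has_sum R j) UNIV" for j
  proof (rule norm_summable_imp_has_sum[OF _ rows])
    show "summable (\<lambda>k. norm (a j k))"
      by (rule summable_comparison_test'[OF summable_mult[OF summable_mult[OF v(1)]], of 0 _ C "u j"]) (use bound in auto)
  qed
  have cols': "((\<lambda>j. a j k) has_sum T k) UNIV" for k
  proof (rule norm_summable_imp_has_sum[OF _ cols])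
    show "summable (\<lambda>j. norm (a j k))"
      by (rule summable_comparison_test'[OF summable_mult[OF summable_mult2[OF u(1)]], of 0 _ C "v k"]) (use bound in auto)
  qed
  have "(R has_sum S) UNIV" by (rule has_sum_SigmaD[OF S]) (use rows' in auto)
  moreover have "((\<lambda>(k, j). a j k) has_sum S) (UNIV \<times> UNIV)" by (subst has_sum_swap) (use S in \<open>simp add: case_prod_unfold\<close>)
  hence "(T has_sum S) UNIV" by (rule has_sum_SigmaD) (use cols' in auto)
  ultimately show ?thesis using has_sum_imp_sums by blast
qed

text \<open>The exponents are chosen for the double series over \<open>j\<close> and
  \<open>k\<close>: together with the extra factor \<open>1 / j\<close> they leave
  \<open>j powr (- 3/2)\<close> and \<open>k powr (- 3/2)\<close>, both summable.\<close>

lemma weighted_square_bound: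
  fixes a b :: real
  assumes "a > 0" "b > 0"
  shows "a powr (1/2) * b powr (3/2) \<le> a\<^sup>2 + b\<^sup>2"
proof (cases "a \<le> b")
  case True
  have "a powr (1/2) * b powr (3/2) \<le> b powr (1/2) * b powr (3/2)"
    using assms True by (intro mult_right_mono powr_mono2) auto
  also have "\<dots> = b\<^sup>2" using assms by (simp add: powr_add[symmetric] powr_numeral)
  finally show ?thesis by (smt (verit) zero_le_power2)
next
  case False
  have "a powr (1/2) * b powr (3/2) \<le> a powr (1/2) * a powr (3/2)"
    using assms False by (intro mult_left_mono powr_mono2) auto
  also have "\<dots> = a\<^sup>2" using assms by (simp add: powr_add[symmetric] powr_numeral)
  finally show ?thesis by (smt (verit) zero_le_power2)
qed

definition dual_point :: "complex \<Rightarrow> nat \<Rightarrow> complex" where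
  "dual_point z k = 2 * pi * \<i> * of_nat (Suc k) / z"

lemma sector_Re_pos: "z \<noteq> 0 \<Longrightarrow> \<bar>Im z\<bar> \<le> Re z / 10 \<Longrightarrow> Re z > 0"
  by (cases "Re z = 0") (auto simp: complex_eq_iff)

text \<open>Multiplication by the imaginary unit exchanges real and imaginary part, so a narrow
  sector around the real axis becomes one around the imaginary axis, as
  \<open>shifted_norm_lower\<close> requires for both signs.\<close>

lemma dual_point_sector:
  assumes "z \<noteq> 0" "\<bar>Im z\<bar> \<le> Re z / 10"
  shows "cmod (dual_point z k) = 2 * pi * real (Suc k) / cmod z" "dual_point z k \<noteq> 0"
    "Re (dual_point z k) \<ge> - cmod (dual_point z k) / 10" "Re (- dual_point z k) \<ge> - cmod (- dual_point z k) / 10"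
proof -
  show c: "cmod (dual_point z k) = 2 * pi * real (Suc k) / cmod z"
    unfolding dual_point_def norm_divide norm_mult norm_of_nat by simp
  show "dual_point z k \<noteq> 0" using assms by (simp add: dual_point_def del: of_nat_Suc)
  have "\<bar>Im z\<bar> \<le> cmod z / 10" using assms(2) complex_Re_le_cmod[of z] by linarith
  hence i: "\<bar>Im z\<bar> / (cmod z)\<^sup>2 \<le> (cmod z / 10) / (cmod z)\<^sup>2" by (rule divide_right_mono) simp
  have "Re (dual_point z k) = 2 * pi * real (Suc k) * (Im z / (cmod z)\<^sup>2)"
    unfolding dual_point_def Re_divide cmod_power2 by (simp add: algebra_simps)
  hence "\<bar>Re (dual_point z k)\<bar> = 2 * pi * real (Suc k) * (\<bar>Im z\<bar> / (cmod z)\<^sup>2)"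
    by (simp add: abs_mult)
  also have "\<dots> \<le> 2 * pi * real (Suc k) * ((cmod z / 10) / (cmod z)\<^sup>2)" by (rule mult_left_mono[OF i]) simp
  also have "\<dots> = cmod (dual_point z k) / 10" using assms(1) unfolding c by (simp add: power2_eq_square)
  finally show "Re (dual_point z k) \<ge> - cmod (dual_point z k) / 10" "Re (- dual_point z k) \<ge> - cmod (- dual_point z k) / 10"
    by (auto simp: abs_le_iff)
qed

text \<open>The double series is summed by rows (partial fractions for fixed \<open>j\<close>) and
  by columns (\<open>Dsum\<close> for fixed \<open>k\<close>). The pole part
  \<open>1 / (j z)^2\<close> of each row, divided by \<open>j\<close>, adds up to the term with
  \<open>A_const\<close>.\<close>

lemma log_gf_dual:
  assumes z: "z \<noteq> 0" "\<bar>Im z\<bar> \<le> Re z / 10"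
  shows "(\<lambda>k. - (Dsum (dual_point z k) + Dsum (- dual_point z k)) / (2 * pi * of_nat (Suc k))\<^sup>2) sums
     (log_gf (exp (- z)) - of_real A_const / z\<^sup>2)"
proof -
  have Re: "Re z > 0" by (rule sector_Re_pos[OF z])
  define a where "a j k = (1 / (of_nat (Suc j) * z + 2 * pi * \<i> * of_nat (Suc k))\<^sup>2 + 1 / (of_nat (Suc j) * z - 2 * pi * \<i> * of_nat (Suc k))\<^sup>2) / of_nat (Suc j)" for j k
  have rows: "(\<lambda>k. a j k) sums (log_term j (exp (- z)) - 1 / (of_nat (Suc j) ^ 3 * z\<^sup>2))" for j
  proof -
    have "Re (of_nat (Suc j) * z) > 0" using Re by (simp del: of_nat_Suc)
    from sums_divide[OF partial_fractions_exp[OF this], of "of_nat (Suc j)"]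
    have "(\<lambda>k. a j k) sums ((exp (- (of_nat (Suc j) * z)) / (1 - exp (- (of_nat (Suc j) * z)))\<^sup>2 - 1 / (of_nat (Suc j) * z)\<^sup>2) / of_nat (Suc j))"
      unfolding a_def .
    moreover have "exp (- (of_nat (Suc j) * z)) = exp (- z) ^ Suc j" by (simp only: exp_of_nat_mult mult_minus_right [symmetric])
    moreover have "(P / Q - 1 / (s * z)\<^sup>2) / s = P / (s * Q) - 1 / (s ^ 3 * z\<^sup>2)" for P Q s :: complex
      by (simp add: diff_divide_distrib power_mult_distrib power3_eq_cube power2_eq_square mult_ac)
    ultimately show ?thesis unfolding log_term_def by (simp only:)
  qed
  have cols: "(\<lambda>j. a j k) sums (- (Dsum (dual_point z k) + Dsum (- dual_point z k)) / (2 * pi * of_nat (Suc k))\<^sup>2)" for k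
  proof -
    define x where "x = dual_point z k"
    note x = dual_point_sector[OF z, of k, folded x_def]
    have zx: "z * x = 2 * pi * \<i> * of_nat (Suc k)" using z(1) by (simp add: x_def dual_point_def)
    have K: "(2 * pi * of_nat (Suc k))\<^sup>2 = - ((z * x)\<^sup>2)" unfolding zx by (simp add: power_mult_distrib)
    from x(2) have "- x \<noteq> 0" by simp
    from sums_divide[OF sums_minus[OF sums_add[OF Dsum_sums[OF x(3,2)] Dsum_sums[OF x(4) this]]], of "(2 * pi * of_nat (Suc k))\<^sup>2"]
    have "(\<lambda>j. - (x\<^sup>2 / (of_nat (Suc j) * (of_nat (Suc j) + x)\<^sup>2) + (- x)\<^sup>2 / (of_nat (Suc j) * (of_nat (Suc j) + - x)\<^sup>2)) / (2 * pi * of_nat (Suc k))\<^sup>2)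
       sums (- (Dsum x + Dsum (- x)) / (2 * pi * of_nat (Suc k))\<^sup>2)" .
    moreover have "- (x\<^sup>2 / (s * (s + x)\<^sup>2) + (- x)\<^sup>2 / (s * (s + - x)\<^sup>2)) / - ((z * x)\<^sup>2) = (1 / (s * z + z * x)\<^sup>2 + 1 / (s * z - z * x)\<^sup>2) / s" for s
    proof -
      have e: "s * z + z * x = z * (s + x)" "s * z - z * x = z * (s - x)" by (simp_all add: algebra_simps)
      have g: "- (p / q + p / r) / - (w * p) = 1 / (q * w) + 1 / (r * w)" if "p \<noteq> 0" for p q r w :: complex
      proof -
        have "- (p / q + p / r) / - (w * p) = (p / q + p / r) / (w * p)" by (rule minus_divide_divide)
        also have "\<dots> = (p / q) / (w * p) + (p / r) / (w * p)" by (rule add_divide_distrib)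
        finally show ?thesis using that by simp
      qed
      show ?thesis unfolding e power_mult_distrib power2_minus add_divide_distrib [of _ _ s]
        using g[of "x\<^sup>2" "s * (s + x)\<^sup>2" "s * (s - x)\<^sup>2" "z\<^sup>2"] x(2) by (simp add: mult_ac)
    qed
    ultimately show ?thesis unfolding a_def K zx[symmetric] x_def[symmetric] by (simp only:)
  qed
  define C where "C = 2 * (10/9) / (cmod z powr (1/2) * (2 * pi) powr (3/2))"
  define u where "u j = real (Suc j) powr (- (3/2))" for j
  have us: "summable u"
    unfolding u_def by (subst summable_Suc_iff[of "\<lambda>n. real n powr (- (3/2))"]) (simp add: summable_real_powr_iff)
  have bound: "cmod (a j k) \<le> C * (u j * u k)" for j k
  proof -
    define J K where "J = real (Suc j)" and "K = real (Suc k)"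
    have JK: "J > 0" "K > 0" by (auto simp: J_def K_def)
    define P where "P = cmod z powr (1/2) * (2 * pi) powr (3/2) * (J powr (1/2) * K powr (3/2))"
    have P: "P > 0" using z JK by (simp add: P_def)
    have one: "cmod (1 / (of_nat (Suc j) * z + s * (2 * pi * \<i> * of_nat (Suc k)))\<^sup>2) \<le> (10/9) / P" if s: "s = 1 \<or> s = -1" for s
    proof -
      define x where "x = s * dual_point z k"
      have x: "cmod x = 2 * pi * K / cmod z" "Re x \<ge> - cmod x / 10"
      proof -
        have "x = dual_point z k \<or> x = - dual_point z k" using s by (auto simp: x_def)
        thus "cmod x = 2 * pi * K / cmod z" "Re x \<ge> - cmod x / 10"
          using dual_point_sector(1,3,4)[OF z, of k] unfolding K_def by (metis norm_minus_cancel)+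
      qed
      have "of_nat (Suc j) * z + s * (2 * pi * \<i> * of_nat (Suc k)) = z * (of_real J + x)"
      proof -
        have zx: "z * x = s * (2 * pi * \<i> * of_nat (Suc k))" using z(1) by (simp add: x_def dual_point_def)
        show ?thesis unfolding zx[symmetric] by (simp add: J_def algebra_simps)
      qed
      hence n1: "(cmod (of_nat (Suc j) * z + s * (2 * pi * \<i> * of_nat (Suc k))))\<^sup>2 = (cmod z)\<^sup>2 * (cmod (of_real J + x))\<^sup>2"
        by (simp add: norm_mult power_mult_distrib)
      have n2: "(cmod z)\<^sup>2 * (9/10 * (J\<^sup>2 + (cmod x)\<^sup>2)) \<le> (cmod z)\<^sup>2 * (cmod (of_real J + x))\<^sup>2"
        using shifted_norm_lower[OF x(2), of J] JK by (intro mult_left_mono) auto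
      have n3: "(cmod z)\<^sup>2 * (9/10 * (J\<^sup>2 + (cmod x)\<^sup>2)) = 9/10 * ((cmod z * J)\<^sup>2 + (2 * pi * K)\<^sup>2)"
        using z(1) unfolding x(1) by (simp add: field_simps power_mult_distrib)
      have A: "9/10 * ((cmod z * J)\<^sup>2 + (2 * pi * K)\<^sup>2) \<le> (cmod (of_nat (Suc j) * z + s * (2 * pi * \<i> * of_nat (Suc k))))\<^sup>2"
        unfolding n1 n3[symmetric] by (rule n2)
      have "P = (cmod z * J) powr (1/2) * (2 * pi * K) powr (3/2)"
        using z(1) JK by (simp add: P_def powr_mult)
      also have "\<dots> \<le> (cmod z * J)\<^sup>2 + (2 * pi * K)\<^sup>2" using z(1) JK by (intro weighted_square_bound) auto
      finally have "9/10 * P \<le> 9/10 * ((cmod z * J)\<^sup>2 + (2 * pi * K)\<^sup>2)" by (rule mult_left_mono) simp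
      from order_trans[OF this A] have "9/10 * P \<le> (cmod (of_nat (Suc j) * z + s * (2 * pi * \<i> * of_nat (Suc k))))\<^sup>2" .
      hence "1 / (cmod (of_nat (Suc j) * z + s * (2 * pi * \<i> * of_nat (Suc k))))\<^sup>2 \<le> 1 / (9/10 * P)"
        using P by (intro divide_left_mono) (auto intro!: mult_pos_pos)
      thus ?thesis by (simp add: norm_divide norm_power del: of_nat_Suc)
    qed
    have "cmod (a j k) = cmod (1 / (of_nat (Suc j) * z + 1 * (2 * pi * \<i> * of_nat (Suc k)))\<^sup>2 + 1 / (of_nat (Suc j) * z + (-1) * (2 * pi * \<i> * of_nat (Suc k)))\<^sup>2) / J"
      unfolding a_def norm_divide J_def by (simp only: norm_of_nat mult_1 mult_minus1 diff_conv_add_uminus)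
    also have "\<dots> \<le> ((10/9) / P + (10/9) / P) / J"
      using JK by (intro divide_right_mono order_trans[OF norm_triangle_ineq] add_mono one) auto
    also have "\<dots> = C * (u j * u k)"
    proof -
      have "J powr (- (3/2)) = 1 / (J powr (1/2) * J)"
        using JK powr_add[of J "1/2" 1] by (simp add: powr_minus_divide)
      moreover have "K powr (- (3/2)) = 1 / K powr (3/2)" by (simp add: powr_minus_divide)
      ultimately show ?thesis unfolding u_def C_def P_def J_def[symmetric] K_def[symmetric] by simp
    qed
    finally show ?thesis .
  qed
  obtain S where S: "(\<lambda>j. log_term j (exp (- z)) - 1 / (of_nat (Suc j) ^ 3 * z\<^sup>2)) sums S"
     "(\<lambda>k. - (Dsum (dual_point z k) + Dsum (- dual_point z k)) / (2 * pi * of_nat (Suc k))\<^sup>2) sums S"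
    using has_sum_interchange[OF bound us _ us _ rows cols] by (auto simp: u_def)
  have "(\<lambda>j. log_term j (exp (- z))) sums log_gf (exp (- z))"
    unfolding log_gf_def using Re by (intro summable_sums[OF summable_norm_cancel[OF summable_log_term]]) simp
  moreover have "(\<lambda>j. 1 / (of_nat (Suc j) ^ 3 * z\<^sup>2)) sums (of_real A_const / z\<^sup>2)"
  proof -
    have "(\<lambda>j. 1 / real (Suc j) ^ 3) sums A_const"
      unfolding A_const_def zeta_nat_def using summable_inverse_power[of 3] by (intro summable_sums) simp
    from sums_divide[OF sums_of_real[OF this], of "z\<^sup>2"] show ?thesis by simp
  qed
  ultimately have "(\<lambda>j. log_term j (exp (- z)) - 1 / (of_nat (Suc j) ^ 3 * z\<^sup>2)) sums (log_gf (exp (- z)) - of_real A_const / z\<^sup>2)"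
    by (rule sums_diff)
  with S(1) have "S = log_gf (exp (- z)) - of_real A_const / z\<^sup>2" by (rule sums_unique2)
  thus ?thesis using S(2) by simp
qed

section \<open>The constant c as a series\<close>

lemma Gamma_has_bochner_integral:
  fixes s :: real
  assumes "s > 0"
  shows "has_bochner_integral lborel (\<lambda>t. indicator {0..} t * t powr (s - 1) / exp t) (Gamma s)"
proof (rule has_bochner_integral_nn_integral)
  show "0 \<le> Gamma s" using assms by (intro Gamma_real_nonneg) simp
  show "(\<integral>\<^sup>+ t. ennreal (indicator {0..} t * t powr (s - 1) / exp t) \<partial>lborel) = ennreal (Gamma s)"
    using Gamma_conv_nn_integral_real[OF assms] by simp
qed (auto intro!: AE_I2)

lemma Gamma_scaled_has_bochner_integral:
  fixes s p :: real
  assumes "s > 0" "p > 0"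
  shows "has_bochner_integral lborel (\<lambda>t. indicator {0<..} t * t powr (s - 1) * exp (- (p * t))) (Gamma s / p powr s)"
proof -
  have "has_bochner_integral lborel (\<lambda>t. indicator {0..} (0 + p * t) * (0 + p * t) powr (s - 1) / exp (0 + p * t)) (Gamma s /\<^sub>R \<bar>p\<bar>)"
    using Gamma_has_bochner_integral[OF assms(1)] assms(2)
    by (subst lborel_has_bochner_integral_real_affine_iff[symmetric]) auto
  hence "has_bochner_integral lborel (\<lambda>t. (1 / p powr (s - 1)) * (indicator {0..} (0 + p * t) * (0 + p * t) powr (s - 1) / exp (0 + p * t))) ((1 / p powr (s - 1)) * (Gamma s /\<^sub>R \<bar>p\<bar>))"
    by (rule has_bochner_integral_mult_right)
  moreover have "(1 / p powr (s - 1)) * (indicator {0..} (0 + p * t) * (0 + p * t) powr (s - 1) / exp (0 + p * t))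
     = indicator {0<..} t * t powr (s - 1) * exp (- (p * t))" for t
  proof (cases "t > 0")
    case True
    thus ?thesis using assms by (simp add: powr_mult exp_minus field_simps)
  next
    case False
    thus ?thesis using assms by (cases "t = 0") (auto simp: indicator_def zero_le_mult_iff)
  qed
  moreover have "(1 / p powr (s - 1)) * (Gamma s /\<^sub>R \<bar>p\<bar>) = Gamma s / p powr s"
    using assms powr_add[of p "s - 1" 1] by (simp add: field_simps)
  ultimately show ?thesis by simp
qed

text \<open>A majorant, independent of \<open>h\<close>, for the difference quotient of
  \<open>t powr h\<close> at \<open>h = 0\<close>; it justifies differentiating the Gamma integral
  under the integral sign.\<close>

lemma powr_quotient_bound:
  assumes "0 < h" "h \<le> 1" "t > (0::real)"
  shows "\<bar>(t powr h - 1) / h\<bar> \<le> \<bar>ln t\<bar> * (1 + t)"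
proof (cases "t \<ge> 1")
  case True
  have "t powr h - 1 \<le> h * ln t * t powr h"
  proof -
    have "1 - h * ln t \<le> exp (- (h * ln t))" using exp_ge_add_one_self[of "- (h * ln t)"] by simp
    hence "(1 - h * ln t) * exp (h * ln t) \<le> exp (- (h * ln t)) * exp (h * ln t)" by (rule mult_right_mono) simp
    also have "\<dots> = 1" by (simp flip: exp_add)
    finally have "(1 - h * ln t) * exp (h * ln t) \<le> 1" .
    moreover have "t powr h = exp (h * ln t)" using assms by (simp add: powr_def)
    ultimately show ?thesis by (simp add: algebra_simps)
  qed
  also have "\<dots> \<le> h * ln t * t powr 1" using assms True by (intro mult_left_mono powr_mono) auto
  finally have "(t powr h - 1) / h \<le> ln t * t" using assms by (simp add: field_simps)
  moreover have "t powr h \<ge> 1" using True assms by (intro ge_one_powr_ge_zero) auto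
  hence "(t powr h - 1) / h \<ge> 0" using assms by simp
  moreover have "ln t \<ge> 0" using True by simp
  ultimately show ?thesis by (simp only: abs_of_nonneg distrib_left mult_1_right)
next
  case False
  have "1 + h * ln t \<le> t powr h" using exp_ge_add_one_self[of "h * ln t"] assms by (simp add: powr_def)
  hence "1 - t powr h \<le> h * (- ln t)" by simp
  hence "(1 - t powr h) / h \<le> - ln t" using assms by (simp add: field_simps)
  moreover have "t powr h \<le> 1" using False assms powr_mono2[of h t 1] by simp
  moreover have "ln t \<le> 0" using False assms by simp
  ultimately have "\<bar>(t powr h - 1) / h\<bar> \<le> \<bar>ln t\<bar> * 1"
    using assms by (simp add: abs_of_nonpos divide_nonpos_pos minus_divide_left)
  also have "\<dots> \<le> \<bar>ln t\<bar> * (1 + t)" using assms by (intro mult_left_mono) auto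
  finally show ?thesis .
qed

lemma t_ln_bound: "t > (0::real) \<Longrightarrow> t * \<bar>ln t\<bar> \<le> 1 + t\<^sup>2"
proof (cases "t \<ge> 1")
  case True
  assume "t > 0"
  have "ln t \<le> t" using ln_le_minus_one[OF \<open>t > 0\<close>] by simp
  hence "t * ln t \<le> t * t" using \<open>t > 0\<close> by simp
  also have "\<dots> \<le> 1 + t * t" by simp
  finally have "t * ln t \<le> 1 + t * t" .
  moreover have "\<bar>ln t\<bar> = ln t" using True by simp
  ultimately show ?thesis unfolding power2_eq_square by (simp only:)
next
  case False
  assume t: "t > 0"
  have "ln (1 / t) \<le> 1 / t - 1" using t by (intro ln_le_minus_one) simp
  hence "- ln t \<le> 1 / t - 1" using t by (simp add: ln_div)
  hence "t * (- ln t) \<le> t * (1 / t - 1)" using t by (intro mult_left_mono) auto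
  also have "\<dots> \<le> 1" using t by (simp add: algebra_simps)
  also have "1 \<le> 1 + t\<^sup>2" by simp
  finally have "t * (- ln t) \<le> 1 + t\<^sup>2" .
  moreover have "\<bar>ln t\<bar> = - ln t" using False t by simp
  ultimately show ?thesis by (simp only:)
qed

text \<open>The integral is the derivative of Gamma at 2, obtained by dominated convergence along
  \<open>h n = 1 / (n + 1)\<close>, and Digamma at 2 is 1 minus Euler's constant.\<close>

lemma t_ln_has_bochner_integral:
  "has_bochner_integral lborel (\<lambda>t. indicator {0<..} t * (t * ln t) * exp (- t)) (1 - euler_mascheroni :: real)"
proof -
  define h where "h n = 1 / real (n + 1)" for n :: nat
  have h: "0 < h n" "h n \<le> 1" for n by (auto simp: h_def)
  have hlim: "h \<longlonglongrightarrow> 0" unfolding h_def by real_asymp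
  define f where "f n t = indicator {0<..} t * (t powr (1 + h n) - t) / h n * exp (- t)" for n t
  have fi: "has_bochner_integral lborel (f n) ((Gamma (2 + h n) - Gamma 2) / h n)" for n
  proof -
    have "has_bochner_integral lborel (\<lambda>t. (indicator {0<..} t * t powr (2 + h n - 1) * exp (- (1 * t)) - indicator {0<..} t * t powr (2 - 1) * exp (- (1 * t))) / h n)
      ((Gamma (2 + h n) / 1 powr (2 + h n) - Gamma 2 / 1 powr 2) / h n)"
      using h[of n] by (intro has_bochner_integral_divide has_bochner_integral_diff Gamma_scaled_has_bochner_integral) auto
    moreover have "(indicator {0<..} t * t powr (2 + h n - 1) * exp (- (1 * t)) - indicator {0<..} t * t powr (2 - 1) * exp (- (1 * t))) / h n = f n t" for t
      by (simp add: f_def indicator_def field_simps)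
    ultimately show ?thesis by simp
  qed
  define g where "g t = indicator {0<..} t * (t * ln t) * exp (- t)" for t :: real
  define w where "w t = (\<Sum>k<4. indicator {0<..} t * t powr ((real k + 1) - 1) * exp (- (1 * t)))" for t :: real
  have w: "integrable lborel w" unfolding w_def
    by (intro Bochner_Integration.integrable_sum has_bochner_integral_integrable has_bochner_integral_integral_eq)
       (rule has_bochner_integral_iff[THEN iffD1, THEN conjunct1, OF Gamma_scaled_has_bochner_integral], auto)
  have w_eq: "w t = (1 + t + t\<^sup>2 + t ^ 3) * exp (- t)" if "t > 0" for t
    using that by (simp add: w_def eval_nat_numeral powr_realpow[symmetric] powr_one algebra_simps lessThan_Suc)
  have lim: "(\<lambda>n. f n t) \<longlonglongrightarrow> g t" for t
  proof (cases "t > 0")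
    case True
    have "((\<lambda>x. t powr x) has_real_derivative t powr 0 * ln t) (at 0)" using True by (auto intro!: derivative_eq_intros)
    hence "((\<lambda>x. (t powr (0 + x) - t powr 0) / x) \<longlongrightarrow> ln t) (at 0)" using True by (simp add: DERIV_def)
    moreover have "filterlim h (at 0) sequentially" unfolding filterlim_at using hlim h by (auto intro!: always_eventually simp: less_imp_neq[symmetric])
    ultimately have "(\<lambda>n. (t powr (0 + h n) - t powr 0) / h n) \<longlonglongrightarrow> ln t" by (rule filterlim_compose)
    hence "(\<lambda>n. t * ((t powr (0 + h n) - t powr 0) / h n) * exp (- t)) \<longlonglongrightarrow> t * ln t * exp (- t)" by (intro tendsto_intros)
    moreover have "f n t = t * ((t powr (0 + h n) - t powr 0) / h n) * exp (- t)" for n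
      using True by (simp add: f_def powr_add algebra_simps)
    ultimately show ?thesis using True by (simp add: g_def)
  qed (simp add: f_def g_def)
  have bd: "norm (f n t) \<le> w t" for n t
  proof (cases "t > 0")
    case True
    have "f n t = t * ((t powr h n - 1) / h n) * exp (- t)" using True by (simp add: f_def powr_add algebra_simps)
    hence "norm (f n t) = t * \<bar>(t powr h n - 1) / h n\<bar> * exp (- t)" using True by (simp add: abs_mult)
    also have "\<dots> \<le> t * (\<bar>ln t\<bar> * (1 + t)) * exp (- t)"
      using True powr_quotient_bound[OF h True, of n] by (intro mult_right_mono mult_left_mono) auto
    also have "\<dots> = (t * \<bar>ln t\<bar>) * (1 + t) * exp (- t)" by simp
    also have "\<dots> \<le> (1 + t\<^sup>2) * (1 + t) * exp (- t)" using True t_ln_bound[OF True] by (intro mult_right_mono) auto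
    also have "\<dots> = w t" unfolding w_eq[OF True] by (simp add: algebra_simps power2_eq_square power3_eq_cube)
    finally show ?thesis .
  qed (simp add: f_def w_def)
  have meas: "g \<in> borel_measurable lborel" "\<And>n. f n \<in> borel_measurable lborel" unfolding g_def f_def by measurable
  have gi: "integrable lborel g"
    by (rule integrable_dominated_convergence[OF meas w AE_I2[OF lim] AE_I2[OF bd]])
  have "(\<lambda>n. integral\<^sup>L lborel (f n)) \<longlonglongrightarrow> integral\<^sup>L lborel g"
    by (rule integral_dominated_convergence[OF meas w AE_I2[OF lim] AE_I2[OF bd]])
  moreover have "integral\<^sup>L lborel (f n) = (Gamma (2 + h n) - Gamma 2) / h n" for n
    using fi[of n] by (simp add: has_bochner_integral_iff)
  moreover have "(\<lambda>n. (Gamma (2 + h n) - Gamma 2) / h n) \<longlonglongrightarrow> 1 - euler_mascheroni"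
  proof -
    have "(Gamma has_real_derivative Gamma 2 * Digamma 2) (at 2)" by (rule has_field_derivative_Gamma) (auto elim!: nonpos_Ints_cases)
    moreover have "Gamma 2 * Digamma 2 = (1 - euler_mascheroni :: real)"
      using Digamma_of_nat[of 1, where ?'a = real] Gamma_fact[of 1, where ?'a = real] by (simp add: harm_def)
    ultimately have "((\<lambda>x. (Gamma (2 + x) - Gamma 2) / x) \<longlongrightarrow> 1 - euler_mascheroni) (at (0::real))" by (simp add: DERIV_def)
    moreover have "filterlim h (at 0) sequentially" unfolding filterlim_at using hlim h by (auto intro!: always_eventually simp: less_imp_neq[symmetric])
    ultimately show ?thesis by (rule filterlim_compose)
  qed
  ultimately have "integral\<^sup>L lborel g = 1 - euler_mascheroni" using LIMSEQ_unique by simp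
  with gi show ?thesis unfolding g_def by (simp add: has_bochner_integral_iff)
qed

lemma t_ln_scaled_has_bochner_integral:
  fixes p :: real
  assumes "p > 0"
  shows "has_bochner_integral lborel (\<lambda>t. indicator {0<..} t * (t * ln t) * exp (- (p * t))) ((1 - euler_mascheroni - ln p) / p\<^sup>2)"
proof -
  have "has_bochner_integral lborel (\<lambda>t. indicator {0<..} (0 + p * t) * ((0 + p * t) * ln (0 + p * t)) * exp (- (0 + p * t))) ((1 - euler_mascheroni) /\<^sub>R \<bar>p\<bar>)"
    using t_ln_has_bochner_integral assms
    by (subst lborel_has_bochner_integral_real_affine_iff[symmetric]) auto
  from has_bochner_integral_diff[OF has_bochner_integral_mult_right[OF this, of "1 / p"] has_bochner_integral_mult_right[OF Gamma_scaled_has_bochner_integral[of 2 p], of "ln p"]] assms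
  have "has_bochner_integral lborel (\<lambda>t. 1 / p * (indicator {0<..} (0 + p * t) * ((0 + p * t) * ln (0 + p * t)) * exp (- (0 + p * t))) - ln p * (indicator {0<..} t * t powr (2 - 1) * exp (- (p * t))))
    (1 / p * ((1 - euler_mascheroni) /\<^sub>R \<bar>p\<bar>) - ln p * (Gamma 2 / p powr 2))" by simp
  moreover have "1 / p * (indicator {0<..} (0 + p * t) * ((0 + p * t) * ln (0 + p * t)) * exp (- (0 + p * t))) - ln p * (indicator {0<..} t * t powr (2 - 1) * exp (- (p * t)))
     = indicator {0<..} t * (t * ln t) * exp (- (p * t))" for t
    using assms by (cases "t > 0") (auto simp: indicator_def ln_mult algebra_simps zero_less_mult_iff)
  moreover have "1 / p * ((1 - euler_mascheroni) /\<^sub>R \<bar>p\<bar>) - ln p * (Gamma 2 / p powr 2) = (1 - euler_mascheroni - ln p) / p\<^sup>2"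
    using assms Gamma_fact[of 1, where ?'a = real] by (simp add: powr_numeral field_simps power2_eq_square)
  ultimately show ?thesis by simp
qed

lemma abs_t_ln_bound: "t > (0::real) \<Longrightarrow> \<bar>t * ln t\<bar> \<le> 2 * t powr (1/2) + t powr 2"
proof -
  assume t: "t > 0"
  have "ln t \<le> t" using ln_le_minus_one[OF t] by simp
  hence "t * ln t \<le> t * t" using t by simp
  moreover have "- ln t \<le> 2 * t powr (- (1/2))"
  proof -
    have "ln (t powr (- (1/2))) \<le> t powr (- (1/2))" using ln_le_minus_one[of "t powr (- (1/2))"] t by simp
    thus ?thesis using t by (simp add: ln_powr)
  qed
  hence "t * (- ln t) \<le> t * (2 * t powr (- (1/2)))" using t by (intro mult_left_mono) auto
  moreover have "t * t powr (- (1/2)) = t powr (1/2)" using t powr_add[of t 1 "-(1/2)"] by simp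
  moreover have "t powr 2 = t * t" using t by (simp add: powr_numeral power2_eq_square)
  moreover have "t powr (1/2) > 0" "t * t > 0" using t by auto
  ultimately show ?thesis by (intro abs_leI) linarith+
qed

text \<open>\<open>1 / (exp (2 pi y) - 1)\<close> is expanded geometrically and integrated term by
  term. The resulting terms are exactly the part free of \<open>z\<close> that the expansion of
  \<open>Dsum\<close> contributes for each \<open>k\<close>, which is how \<open>c_const\<close>
  enters.\<close>

lemma c_const_sums:
  "(\<lambda>k. 2 / (2 * pi * real (Suc k))\<^sup>2 * (1 - euler_mascheroni - ln (2 * pi * real (Suc k)))) sums c_const"
proof -
  define p where "p k = 2 * pi * real (Suc k)" for k
  have p: "p k > 0" for k by (simp add: p_def)
  define f where "f k t = indicator {0<..} t * (t * ln t) * exp (- (p k * t))" for k t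
  have fi: "has_bochner_integral lborel (f k) ((1 - euler_mascheroni - ln (p k)) / (p k)\<^sup>2)" for k
    unfolding f_def by (rule t_ln_scaled_has_bochner_integral[OF p])
  have int: "integrable lborel (f k)" for k using fi by (simp add: has_bochner_integral_iff)
  define F where "F t = indicator {0<..} t *\<^sub>R (t * ln t / (exp (2 * pi * t) - 1))" for t :: real
  have sums: "(\<lambda>k. f k t) sums F t" and asums: "summable (\<lambda>k. norm (f k t))" for t
  proof -
    have *: "(\<lambda>k. exp (- (p k * t))) sums (1 / (exp (2 * pi * t) - 1))" if "t > 0"
    proof -
      define q where "q = exp (- (2 * pi * t))"
      have q: "0 < q" "q < 1" using that by (auto simp: q_def)
      have "exp (- (p k * t)) = q * q ^ k" for k
        unfolding q_def by (simp add: p_def algebra_simps flip: exp_of_nat_mult exp_add)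
      moreover have "(\<lambda>k. q * q ^ k) sums (q * (1 / (1 - q)))" using q by (intro sums_mult geometric_sums) auto
      moreover have "q * (1 / (1 - q)) = 1 / (exp (2 * pi * t) - 1)" using q by (simp add: q_def exp_minus field_simps)
      ultimately show ?thesis by simp
    qed
    show "(\<lambda>k. f k t) sums F t"
      using sums_mult[OF *, of "t * ln t"] by (cases "t > 0") (auto simp: f_def F_def)
    show "summable (\<lambda>k. norm (f k t))"
      using summable_mult[OF sums_summable[OF *], of "\<bar>t * ln t\<bar>"] by (cases "t > 0") (auto simp: f_def abs_mult)
  qed
  have norm_int: "summable (\<lambda>k. integral\<^sup>L lborel (\<lambda>t. norm (f k t)))"
  proof (rule summable_comparison_test')
    \<comment> \<open>The majorant of \<open>\<bar>t * ln t\<bar>\<close> by powers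
      \<open>1/2\<close> and \<open>2\<close> gives the orders \<open>- 3/2\<close> and
      \<open>- 3\<close> in \<open>k\<close>.\<close>
    show "summable (\<lambda>k. 2 * (Gamma (3/2) / (2 * pi) powr (3/2)) * real (Suc k) powr (- (3/2)) + Gamma 3 / (2 * pi) powr 3 * real (Suc k) powr (- 3))"
      by (intro summable_add summable_mult) (subst summable_Suc_iff[of "\<lambda>n. real n powr _"], simp add: summable_real_powr_iff)+
    fix k
    define B where "B t = 2 * (indicator {0<..} t * t powr (3/2 - 1) * exp (- (p k * t))) + indicator {0<..} t * t powr (3 - 1) * exp (- (p k * t))" for t
    have B: "has_bochner_integral lborel B (2 * (Gamma (3/2) / p k powr (3/2)) + Gamma 3 / p k powr 3)"
      unfolding B_def using p[of k] by (intro has_bochner_integral_add has_bochner_integral_mult_right Gamma_scaled_has_bochner_integral) auto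
    have "integral\<^sup>L lborel (\<lambda>t. norm (f k t)) \<le> integral\<^sup>L lborel B"
    proof (rule integral_mono)
      show "integrable lborel (\<lambda>t. norm (f k t))" using int by (rule integrable_norm)
      show "integrable lborel B" using B by (simp add: has_bochner_integral_iff)
      fix t
      show "norm (f k t) \<le> B t"
      proof (cases "t > 0")
        case True
        have "norm (f k t) = \<bar>t * ln t\<bar> * exp (- (p k * t))" using True by (simp add: f_def abs_mult)
        also have "\<dots> \<le> (2 * t powr (1/2) + t powr 2) * exp (- (p k * t))" by (intro mult_right_mono abs_t_ln_bound True) simp
        finally show ?thesis using True by (simp add: B_def algebra_simps)
      qed (simp add: f_def B_def)
    qed
    also have "integral\<^sup>L lborel B = 2 * (Gamma (3/2) / p k powr (3/2)) + Gamma 3 / p k powr 3"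
      using B by (simp add: has_bochner_integral_iff)
    also have "\<dots> = 2 * (Gamma (3/2) / (2 * pi) powr (3/2)) * real (Suc k) powr (- (3/2)) + Gamma 3 / (2 * pi) powr 3 * real (Suc k) powr (- 3)"
      unfolding p_def by (simp add: powr_mult powr_minus_divide del: of_nat_Suc)
    finally show "norm (integral\<^sup>L lborel (\<lambda>t. norm (f k t))) \<le> 2 * (Gamma (3/2) / (2 * pi) powr (3/2)) * real (Suc k) powr (- (3/2)) + Gamma 3 / (2 * pi) powr 3 * real (Suc k) powr (- 3)"
      by simp
  qed
  have Feq: "F = (\<lambda>t. \<Sum>k. f k t)" using sums by (auto simp: sums_iff fun_eq_iff)
  have Fi: "integrable lborel F"
    unfolding Feq by (rule integrable_suminf[OF int]) (use asums norm_int in auto)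
  have "(\<lambda>k. integral\<^sup>L lborel (f k)) sums integral\<^sup>L lborel F"
    unfolding Feq by (rule sums_integral[OF int]) (use asums norm_int in auto)
  moreover have "integral\<^sup>L lborel (f k) = (1 - euler_mascheroni - ln (p k)) / (p k)\<^sup>2" for k
    using fi by (simp add: has_bochner_integral_iff)
  moreover have "integral\<^sup>L lborel F = integral {0<..} (\<lambda>y. y * ln y / (exp (2 * pi * y) - 1))"
    using set_borel_integral_eq_integral(2)[of "{0<..}" "\<lambda>y. y * ln y / (exp (2 * pi * y) - 1)"] Fi
    unfolding set_integrable_def set_lebesgue_integral_def F_def by simp
  ultimately have "(\<lambda>k. (1 - euler_mascheroni - ln (p k)) / (p k)\<^sup>2) sums integral {0<..} (\<lambda>y. y * ln y / (exp (2 * pi * y) - 1))"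
    by simp
  from sums_mult[OF this, of 2] show ?thesis unfolding c_const_def p_def by simp
qed

text \<open>The arguments \<open>pi / 2\<close> and \<open>- pi / 2\<close> of the two points
  cancel. No branch is crossed, since \<open>Ln z\<close> has imaginary part below
  \<open>pi / 2\<close> in modulus.\<close>

lemma Ln_dual_point:
  assumes "z \<noteq> 0" "\<bar>Im z\<bar> \<le> Re z / 10"
  shows "Ln (dual_point z k) + Ln (- dual_point z k) = of_real (2 * ln (2 * pi * real (Suc k))) - 2 * Ln z"
proof -
  define p where "p = 2 * pi * real (Suc k)"
  have p: "p > 0" by (simp add: p_def)
  have Re: "Re z > 0" by (rule sector_Re_pos[OF assms])
  have im: "\<bar>Im (Ln z)\<bar> < pi / 2" using Re_Ln_pos_lt_imp[OF Re] by simp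
  have "Ln (of_real p * (s * \<i> / z)) = of_real (ln p) + (s * \<i> * of_real (pi / 2) - Ln z)" if s: "s = 1 \<or> s = - 1" for s :: complex
  proof -
    have "exp (s * \<i> * of_real (pi / 2)) = s * \<i>"
    proof -
      have "exp (\<i> * of_real (pi / 2)) = \<i>" "exp (\<i> * of_real (- (pi / 2))) = - \<i>"
        by (simp_all only: cis_conv_exp [symmetric]) (simp_all add: complex_eq_iff)
      thus ?thesis using s by auto
    qed
    hence "exp (of_real (ln p) + (s * \<i> * of_real (pi / 2) - Ln z)) = of_real p * (s * \<i> / z)"
      using p assms(1) by (simp only: exp_add exp_diff exp_of_real exp_ln exp_Ln not_False_eq_True)
    moreover have "Im (of_real (ln p) + (s * \<i> * of_real (pi / 2) - Ln z)) \<le> pi" "- pi < Im (of_real (ln p) + (s * \<i> * of_real (pi / 2) - Ln z))"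
      using s im by (auto simp: abs_less_iff)
    ultimately show ?thesis by (metis Ln_exp)
  qed
  from this[of 1] this[of "-1"] have "Ln (of_real p * (1 * \<i> / z)) + Ln (of_real p * (- 1 * \<i> / z)) = of_real (2 * ln p) - 2 * Ln z"
    by simp
  moreover have "of_real p * (1 * \<i> / z) = dual_point z k" "of_real p * (- 1 * \<i> / z) = - dual_point z k"
    by (simp_all add: p_def dual_point_def)
  ultimately show ?thesis by (simp add: p_def)
qed

text \<open>The two factorials are the ones that the derivatives of \<open>em_kernel\<close> at 0
  produce; this form is matched against the Euler--Maclaurin terms.\<close>

lemma alpha_eq:
  assumes "s \<ge> 1"
  shows "alpha s = 4 * zeta_nat (2 * s) * zeta_nat (2 * s + 2) * (fact (2 * s - 1) + fact (2 * s)) / (2 * pi) ^ (4 * s + 2)"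
proof -
  have "Gamma (2 * real s + 2) = fact (2 * s + 1)"
    using Gamma_fact[of "2 * s + 1", where ?'a = real] by (simp add: add.commute)
  also have "\<dots> = real s * 2 * (fact (2 * s - 1) + fact (2 * s))"
  proof -
    obtain k where k: "2 * s = Suc k" using assms by (metis Suc_pred' mult_pos_pos zero_less_numeral less_eq_Suc_le One_nat_def)
    have "real (Suc k) = 2 * real s" by (simp flip: k)
    hence "real s * 2 = real (Suc k)" by simp
    thus ?thesis unfolding k by (simp add: algebra_simps)
  qed
  finally show ?thesis using assms unfolding alpha_def by simp
qed

lemma alpha_pos: "s \<ge> 1 \<Longrightarrow> alpha s \<ge> 0"
proof -
  assume "s \<ge> 1"
  have "zeta_nat k \<ge> 0" if "k \<ge> 2" for k
    unfolding zeta_nat_def using summable_inverse_power[OF that] by (intro suminf_nonneg) auto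
  thus ?thesis using \<open>s \<ge> 1\<close> unfolding alpha_eq[OF \<open>s \<ge> 1\<close>] by (intro divide_nonneg_nonneg mult_nonneg_nonneg) auto
qed

lemma zeta_sums: "k \<ge> 2 \<Longrightarrow> (\<lambda>m. 1 / (2 * pi * real (Suc m)) ^ k) sums (zeta_nat k / (2 * pi) ^ k)"
proof -
  assume k: "k \<ge> 2"
  have "(\<lambda>m. 1 / real (Suc m) ^ k) sums zeta_nat k"
    unfolding zeta_nat_def by (rule summable_sums[OF summable_inverse_power[OF k]])
  from sums_mult[OF this, of "1 / (2 * pi) ^ k"] show ?thesis by (simp add: power_mult_distrib)
qed

text \<open>In \<open>Dsum x + Dsum (- x)\<close> the term \<open>1 / x\<close> cancels and the even
  powers double. Summation over \<open>k\<close> turns the powers of \<open>k\<close> into zeta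
  values; the value at 2 gives the \<open>1/12\<close> in front of \<open>Ln z\<close>.\<close>

lemma log_gf_asymptotic:
  assumes z: "z \<noteq> 0" "\<bar>Im z\<bar> \<le> Re z / 10" and N: "N \<ge> 1"
  shows "cmod (log_gf (exp (- z)) - (of_real A_const / z\<^sup>2 + Ln z / 12 + of_real c_const - (\<Sum>s=1..<N. of_real (alpha s) * z ^ (2 * s))))
    \<le> alpha N * (1 + 5 * real N * (10 / 9) ^ (N + 1)) * cmod z ^ (2 * N)"
proof -
  define p where "p k = 2 * pi * real (Suc k)" for k
  have p: "p k > 0" for k by (simp add: p_def)
  define T where "T k = - (Dsum (dual_point z k) + Dsum (- dual_point z k)) / (of_real (p k))\<^sup>2" for k
  have T: "T sums (log_gf (exp (- z)) - of_real A_const / z\<^sup>2)"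
    using log_gf_dual[OF z] by (simp add: T_def[abs_def] p_def)
  define P where "P s = pb_even s 0 * (fact (2 * s - 1) + fact (2 * s))" for s
  define B where "B = zeta_nat (2 * N) / (2 * pi) ^ (2 * N) * (fact (2 * N) + fact (2 * N + 1)) * (10 / 9) ^ (N + 1) * pi"
  define W where "W s k = of_real (2 * P s * (-1) ^ s) * z ^ (2 * s) * of_real (1 / p k ^ (2 * s + 2))" for s k
  define V where "V k = of_real (2 / (p k)\<^sup>2 * (1 - euler_mascheroni - ln (p k))) + Ln z * of_real (2 * (1 / (p k) ^ 2)) + (\<Sum>s=1..N. W s k)" for k
  have V: "V sums (of_real c_const + Ln z * of_real (2 * (zeta_nat 2 / (2 * pi) ^ 2)) + (\<Sum>s=1..N. of_real (2 * P s * (-1) ^ s) * z ^ (2 * s) * of_real (zeta_nat (2 * s + 2) / (2 * pi) ^ (2 * s + 2))))"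
    unfolding V_def[abs_def] W_def[abs_def] p_def
    by (intro sums_add sums_mult sums_of_real c_const_sums sums_sum zeta_sums) auto
  have zeta2: "zeta_nat 2 = pi\<^sup>2 / 6"
    using inverse_squares_sums by (simp add: zeta_nat_def sums_iff add.commute)
  have Wsum: "of_real (2 * P s * (-1) ^ s) * z ^ (2 * s) * of_real (zeta_nat (2 * s + 2) / (2 * pi) ^ (2 * s + 2)) = - (of_real (alpha s) * z ^ (2 * s))" if "s \<ge> 1" for s
  proof -
    have "(2 * P s * (-1) ^ s) * (zeta_nat (2 * s + 2) / (2 * pi) ^ (2 * s + 2)) = - alpha s"
    proof -
      have sg: "(-1) ^ Suc s * (-1 :: real) ^ s = - 1" by (simp flip: power_mult_distrib)
      have "4 * s + 2 = 2 * s + (2 * s + 2)" by simp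
      hence e: "(2 * pi) ^ (4 * s + 2) = (2 * pi) ^ (2 * s) * (2 * pi) ^ (2 * s + 2)" by (simp only: power_add)
      have "(2 * P s * (-1) ^ s) * (zeta_nat (2 * s + 2) / (2 * pi) ^ (2 * s + 2)) =
         ((-1) ^ Suc s * (-1) ^ s) * (4 * zeta_nat (2 * s) * zeta_nat (2 * s + 2) * (fact (2 * s - 1) + fact (2 * s)) / ((2 * pi) ^ (2 * s) * (2 * pi) ^ (2 * s + 2)))"
        unfolding P_def pb_even_0[OF that] by (simp add: mult_ac)
      thus ?thesis unfolding sg e[symmetric] alpha_eq[OF that] by simp
    qed
    hence "of_real ((2 * P s * (-1) ^ s) * (zeta_nat (2 * s + 2) / (2 * pi) ^ (2 * s + 2))) * z ^ (2 * s) = - (of_real (alpha s) * z ^ (2 * s))"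
      by (simp only: of_real_minus mult_minus_left)
    thus ?thesis by (simp only: of_real_mult mult_ac)
  qed
  have Veq: "of_real c_const + Ln z * of_real (2 * (zeta_nat 2 / (2 * pi) ^ 2)) + (\<Sum>s=1..N. of_real (2 * P s * (-1) ^ s) * z ^ (2 * s) * of_real (zeta_nat (2 * s + 2) / (2 * pi) ^ (2 * s + 2)))
     = of_real c_const + Ln z / 12 - (\<Sum>s=1..N. of_real (alpha s) * z ^ (2 * s))"
  proof -
    have "(\<Sum>s=1..N. of_real (2 * P s * (-1) ^ s) * z ^ (2 * s) * of_real (zeta_nat (2 * s + 2) / (2 * pi) ^ (2 * s + 2))) = (\<Sum>s=1..N. - (of_real (alpha s) * z ^ (2 * s)))"
      by (rule sum.cong[OF refl], rule Wsum) simp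
    moreover have "2 * (zeta_nat 2 / (2 * pi) ^ 2) = 1 / 12" unfolding zeta2 by (simp add: power2_eq_square)
    ultimately show ?thesis by (simp only:) (simp add: sum_negf)
  qed
  have diff: "cmod (T k - V k) \<le> 2 * B * cmod z ^ (2 * N) * (1 / p k ^ (2 * N + 2))" for k
  proof -
    define x where "x = dual_point z k"
    note x = dual_point_sector[OF z, of k, folded x_def]
    define A where "A x = euler_mascheroni + Ln x - 1 + 1 / x - (\<Sum>s=1..N. of_real (P s) / x ^ (2 * s))" for x :: complex
    have nx: "- x \<noteq> 0" using x(2) by simp
    have a1: "cmod (Dsum x - A x) \<le> B / cmod x ^ (2 * N)" "cmod (Dsum (- x) - A (- x)) \<le> B / cmod x ^ (2 * N)"
      using Dsum_asymptotic[OF x(3,2) N] Dsum_asymptotic[OF x(4) nx N] unfolding A_def B_def P_def by simp_all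
    have "A x + A (- x) = 2 * euler_mascheroni - 2 + (Ln x + Ln (- x)) - 2 * (\<Sum>s=1..N. of_real (P s) / x ^ (2 * s))"
      by (simp add: A_def)
    also have "Ln x + Ln (- x) = of_real (2 * ln (p k)) - 2 * Ln z" unfolding x_def p_def by (rule Ln_dual_point[OF z])
    finally have A: "A x + A (- x) = 2 * euler_mascheroni - 2 + (of_real (2 * ln (p k)) - 2 * Ln z) - 2 * (\<Sum>s=1..N. of_real (P s) / x ^ (2 * s))" .
    have W: "2 * (of_real (P s) / x ^ (2 * s)) / (of_real (p k))\<^sup>2 = W s k" for s
    proof -
      have "x = of_real (p k) * \<i> / z" by (simp add: x_def dual_point_def p_def)
      hence "x ^ (2 * s) = of_real (p k) ^ (2 * s) * \<i> ^ (2 * s) / z ^ (2 * s)" by (simp only: power_mult_distrib power_divide)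
      hence x2: "x ^ (2 * s) = of_real (p k) ^ (2 * s) * (-1) ^ s / z ^ (2 * s)" by (simp add: power_mult)
      have s1: "1 / (-1 :: complex) ^ s = (-1) ^ s" by (cases "even s") auto
      have "2 * (P' / (q * e / y)) / q2 = (2 * P' * (1 / e)) * y * (1 / (q * q2))" for P' q q2 y e :: complex
        by (simp add: mult_ac)
      hence "2 * (of_real (P s) / x ^ (2 * s)) / (of_real (p k))\<^sup>2 = (2 * of_real (P s) * (1 / (-1) ^ s)) * z ^ (2 * s) * (1 / (of_real (p k) ^ (2 * s) * (of_real (p k))\<^sup>2))"
        unfolding x2 .
      thus ?thesis unfolding W_def power_add s1 by simp
    qed
    have "V k = - (A x + A (- x)) / (of_real (p k))\<^sup>2"
    proof -
      have "(\<Sum>s=1..N. W s k) = 2 * (\<Sum>s=1..N. of_real (P s) / x ^ (2 * s)) / (of_real (p k))\<^sup>2"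
        unfolding W[symmetric] by (simp add: sum_distrib_left sum_divide_distrib)
      thus ?thesis unfolding V_def A
        by (simp add: add_divide_distrib diff_divide_distrib right_diff_distrib left_diff_distrib distrib_left mult.commute)
    qed
    hence "T k - V k = - ((Dsum x - A x) + (Dsum (- x) - A (- x))) / (of_real (p k))\<^sup>2"
      by (simp add: T_def x_def[symmetric] diff_divide_distrib add_divide_distrib)
    hence "cmod (T k - V k) = cmod ((Dsum x - A x) + (Dsum (- x) - A (- x))) / (p k)\<^sup>2"
      by (simp only: norm_divide norm_minus_cancel norm_power norm_of_real power2_abs)
    also have "\<dots> \<le> (B / cmod x ^ (2 * N) + B / cmod x ^ (2 * N)) / (p k)\<^sup>2"
      by (intro divide_right_mono norm_triangle_le add_mono a1) simp
    also have "\<dots> = 2 * B * cmod z ^ (2 * N) * (1 / p k ^ (2 * N + 2))"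
      unfolding x(1) p_def[symmetric] by (simp add: power_divide power_add power2_eq_square mult_ac)
    finally show ?thesis .
  qed
  have "(\<lambda>k. T k - V k) sums (log_gf (exp (- z)) - of_real A_const / z\<^sup>2 - (of_real c_const + Ln z / 12 - (\<Sum>s=1..N. of_real (alpha s) * z ^ (2 * s))))"
    using sums_diff[OF T V] unfolding Veq .
  moreover have bs: "(\<lambda>k. 2 * B * cmod z ^ (2 * N) * (1 / p k ^ (2 * N + 2))) sums (2 * B * cmod z ^ (2 * N) * (zeta_nat (2 * N + 2) / (2 * pi) ^ (2 * N + 2)))"
    unfolding p_def by (intro sums_mult zeta_sums) simp
  have "cmod (\<Sum>k. T k - V k) \<le> (\<Sum>k. 2 * B * cmod z ^ (2 * N) * (1 / p k ^ (2 * N + 2)))"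
    by (rule norm_suminf_le[OF diff sums_summable[OF bs]])
  ultimately have main: "cmod (log_gf (exp (- z)) - of_real A_const / z\<^sup>2 - (of_real c_const + Ln z / 12 - (\<Sum>s=1..N. of_real (alpha s) * z ^ (2 * s))))
     \<le> 2 * B * cmod z ^ (2 * N) * (zeta_nat (2 * N + 2) / (2 * pi) ^ (2 * N + 2))"
    using bs by (simp add: sums_iff)
  \<comment> \<open>Euler--Maclaurin is carried out to order \<open>N\<close>, but the last term is
    moved into the error; it accounts for the 1 in the final factor.\<close>
  have "{1..N} = insert N {1..<N}" using N by auto
  hence spl: "(\<Sum>s=1..N. of_real (alpha s) * z ^ (2 * s)) = of_real (alpha N) * z ^ (2 * N) + (\<Sum>s=1..<N. of_real (alpha s) * z ^ (2 * s))" by simp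
  have "cmod (log_gf (exp (- z)) - (of_real A_const / z\<^sup>2 + Ln z / 12 + of_real c_const - (\<Sum>s=1..<N. of_real (alpha s) * z ^ (2 * s))))
     = cmod ((log_gf (exp (- z)) - of_real A_const / z\<^sup>2 - (of_real c_const + Ln z / 12 - (\<Sum>s=1..N. of_real (alpha s) * z ^ (2 * s)))) - of_real (alpha N) * z ^ (2 * N))"
    unfolding spl by (simp add: algebra_simps)
  also have "\<dots> \<le> 2 * B * cmod z ^ (2 * N) * (zeta_nat (2 * N + 2) / (2 * pi) ^ (2 * N + 2)) + cmod (of_real (alpha N) * z ^ (2 * N))"
    by (rule order_trans[OF norm_triangle_ineq4 add_right_mono[OF main]])
  also have "cmod (of_real (alpha N) * z ^ (2 * N)) = alpha N * cmod z ^ (2 * N)"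
    using alpha_pos[OF N] by (simp add: norm_mult norm_power)
  also have "2 * B * cmod z ^ (2 * N) * (zeta_nat (2 * N + 2) / (2 * pi) ^ (2 * N + 2)) \<le> alpha N * (5 * real N * (10 / 9) ^ (N + 1)) * cmod z ^ (2 * N)"
  proof (rule order_trans[OF eq_refl mult_right_mono])
    define Z where "Z = zeta_nat (2 * N) * zeta_nat (2 * N + 2) / (2 * pi) ^ (4 * N + 2)"
    have fact_eq: "fact (2 * N) + fact (2 * N + 1) = (real (2 * N) + 2) * real (2 * N) * fact (2 * N - 1)"
      and fact_eq2: "fact (2 * N - 1) + fact (2 * N) = (real (2 * N) + 1) * (fact (2 * N - 1) :: real)"
    proof -
      obtain k where k: "2 * N = Suc k" using N by (metis Suc_pred' mult_pos_pos zero_less_numeral less_eq_Suc_le One_nat_def)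
      show "fact (2 * N) + fact (2 * N + 1) = (real (2 * N) + 2) * real (2 * N) * fact (2 * N - 1)"
         "fact (2 * N - 1) + fact (2 * N) = (real (2 * N) + 1) * (fact (2 * N - 1) :: real)"
        unfolding k by (simp_all add: algebra_simps)
    qed
    have Z: "Z \<ge> 0"
    proof -
      have "zeta_nat k \<ge> 0" if "k \<ge> 2" for k
        unfolding zeta_nat_def using summable_inverse_power[OF that] by (intro suminf_nonneg) auto
      thus ?thesis using N by (simp add: Z_def)
    qed
    show "2 * B * cmod z ^ (2 * N) * (zeta_nat (2 * N + 2) / (2 * pi) ^ (2 * N + 2)) =
      (2 * pi * (10 / 9) ^ (N + 1) * (fact (2 * N) + fact (2 * N + 1)) * Z) * cmod z ^ (2 * N)"
    proof -
      have "4 * N + 2 = 2 * N + (2 * N + 2)" by simp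
      hence "(2 * pi) ^ (4 * N + 2) = (2 * pi) ^ (2 * N) * (2 * pi) ^ (2 * N + 2)" by (simp only: power_add)
      thus ?thesis unfolding B_def Z_def by simp
    qed
    \<comment> \<open>The source of the factor \<open>5 N\<close>: the two pairs of factorials have
      ratio \<open>2 N (2 N + 2) / (2 N + 1)\<close>, and \<open>2 pi (2 N + 2)\<close> is at most
      \<open>10 (2 N + 1)\<close>.\<close>
    have "2 * pi * (real (2 * N) + 2) * real (2 * N) \<le> 20 * real N * (real (2 * N) + 1)"
    proof -
      have "2 * pi * (real (2 * N) + 2) \<le> 2 * (3.1416) * (real (2 * N) + 2)"
        using pi_approx(2) by (intro mult_right_mono) auto
      also have "\<dots> \<le> 10 * (real (2 * N) + 1)" using N by simp
      finally have "2 * pi * (real (2 * N) + 2) \<le> 10 * (real (2 * N) + 1)" .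
      from mult_right_mono[OF this, of "real (2 * N)"] show ?thesis by (simp add: algebra_simps)
    qed
    from mult_right_mono[OF this, of "(10 / 9) ^ (N + 1) * fact (2 * N - 1) * Z"] Z
    have "(2 * pi * (real (2 * N) + 2) * real (2 * N)) * ((10 / 9) ^ (N + 1) * fact (2 * N - 1) * Z) \<le> (20 * real N * (real (2 * N) + 1)) * ((10 / 9) ^ (N + 1) * fact (2 * N - 1) * Z)"
      by (simp only: mult_nonneg_nonneg zero_le_power fact_ge_zero zero_le_divide_iff zero_le_numeral simp_thms)
    moreover have "alpha N = 4 * Z * ((real (2 * N) + 1) * fact (2 * N - 1))"
      unfolding alpha_eq[OF N] fact_eq2 Z_def by simp
    moreover have "4 * Z * (a * f) * (5 * m * e) = (20 * m * a) * (e * f * Z)" "2 * pi * e * (b * m * f) * Z = (2 * pi * b * m) * (e * f * Z)" for a f m e b :: real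
      by simp_all
    ultimately show "2 * pi * (10 / 9) ^ (N + 1) * (fact (2 * N) + fact (2 * N + 1)) * Z \<le> alpha N * (5 * real N * (10 / 9) ^ (N + 1))"
      unfolding fact_eq by (simp only:)
  qed simp
  finally show ?thesis by (simp add: algebra_simps)
qed

section \<open>Extraction of the coefficient by integration over a period\<close>

lemma exp_int_integral:
  fixes x0 :: real and d :: int
  assumes "d \<noteq> 0"
  shows "((\<lambda>y. exp (of_int d * (of_real x0 + \<i> * of_real y))) has_integral 0) {- pi..pi}"
proof -
  define G where "G y = exp (of_int d * (of_real x0 + \<i> * of_real y)) / (of_int d * \<i>)" for y :: real
  have "((\<lambda>y. exp (of_int d * (of_real x0 + \<i> * of_real y))) has_integral G pi - G (- pi)) {- pi..pi}"
  proof (rule fundamental_theorem_of_calculus)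
    fix y
    have "((\<lambda>u. exp (of_int d * (of_real x0 + \<i> * u)) / (of_int d * \<i>)) has_field_derivative exp (of_int d * (of_real x0 + \<i> * of_real y))) (at (of_real y))"
      using assms by (auto intro!: derivative_eq_intros)
    from has_vector_derivative_real_field[OF this]
    show "(G has_vector_derivative exp (of_int d * (of_real x0 + \<i> * of_real y))) (at y within {- pi..pi})"
      by (simp add: G_def[abs_def])
  qed simp
  moreover have "exp (of_int d * (of_real x0 + \<i> * of_real pi)) = exp (of_int d * (of_real x0 + \<i> * of_real (- pi)))"
    unfolding exp_eq by (rule exI[of _ d]) (simp add: algebra_simps)
  ultimately show ?thesis by (simp add: G_def)
qed

lemma PL_integral:
  assumes x0: "x0 > 0"
  shows "((\<lambda>y. exp (of_nat n * (of_real x0 + \<i> * of_real y) + log_gf (exp (- (of_real x0 + \<i> * of_real y))))) has_integral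
     of_real (2 * pi * real (PL n))) {- pi..pi}"
proof -
  define z where "z y = of_real x0 + \<i> * of_real y" for y :: real
  have Re: "Re (z y) = x0" for y by (simp add: z_def)
  define f where "f M y = exp (of_nat n * z y) * (\<Sum>m<M. of_nat (PL m) * exp (- z y) ^ m)" for M y
  define g where "g y = exp (of_nat n * z y) * exp (log_gf (exp (- z y)))" for y
  have r: "exp (- x0) < 1" using x0 by simp
  have ul: "uniform_limit {- pi..pi} f g sequentially"
  proof -
    have "uniform_limit {- pi..pi} (\<lambda>M y. \<Sum>m<M. exp (of_nat n * z y) * (of_nat (PL m) * exp (- z y) ^ m)) (\<lambda>y. \<Sum>m. exp (of_nat n * z y) * (of_nat (PL m) * exp (- z y) ^ m)) sequentially"
    proof (rule Weierstrass_m_test)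
      show "norm (exp (of_nat n * z y) * (of_nat (PL m) * exp (- z y) ^ m)) \<le> exp (real n * x0) * (real (PL m) * exp (- x0) ^ m)" for m y
        by (simp add: norm_mult norm_power Re)
      show "summable (\<lambda>m. exp (real n * x0) * (real (PL m) * exp (- x0) ^ m))"
        using PL_sums_real[of "exp (- x0)"] r by (intro summable_mult) (simp add: sums_iff)
    qed
    moreover have "(\<Sum>m. exp (of_nat n * z y) * (of_nat (PL m) * exp (- z y) ^ m)) = g y" for y
      using PL_sums[of "exp (- z y)"] r by (simp add: sums_iff Re g_def suminf_mult)
    ultimately show ?thesis unfolding f_def[abs_def] by (simp add: sum_distrib_left)
  qed
  have fi: "(f M has_integral of_real (if n < M then 2 * pi * real (PL n) else 0)) {- pi..pi}" for M
  proof -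
    have eq: "f M y = (\<Sum>m<M. of_nat (PL m) * exp (of_int (int n - int m) * z y))" for y
      unfolding f_def sum_distrib_left
    proof (intro sum.cong refl)
      fix m
      have "exp (of_nat n * z y) * exp (- z y) ^ m = exp (of_int (int n - int m) * z y)"
        by (simp add: algebra_simps flip: exp_of_nat_mult exp_add)
      thus "exp (of_nat n * z y) * (of_nat (PL m) * exp (- z y) ^ m) = of_nat (PL m) * exp (of_int (int n - int m) * z y)"
        by (simp add: mult_ac)
    qed
    have "((\<lambda>y. of_nat (PL m) * exp (of_int (int n - int m) * z y)) has_integral (if m = n then of_real (2 * pi * real (PL n)) else 0)) {- pi..pi}" for m
    proof (cases "m = n")
      case True
      have "((\<lambda>y::real. of_nat (PL n) :: complex) has_integral (pi - (- pi)) *\<^sub>R of_nat (PL n)) {- pi..pi}"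
        using has_integral_const_real[of "of_nat (PL n) :: complex" "- pi" pi] by simp
      thus ?thesis using True by (simp add: scaleR_conv_of_real)
    next
      case False
      from has_integral_mult_right[OF exp_int_integral[of "int n - int m" x0], of "of_nat (PL m)"] False
      show ?thesis by (simp add: z_def)
    qed
    hence "(f M has_integral (\<Sum>m<M. if m = n then of_real (2 * pi * real (PL n)) else 0)) {- pi..pi}"
      unfolding eq[abs_def] by (intro has_integral_sum) auto
    moreover have "(\<Sum>m<M. if m = n then of_real (2 * pi * real (PL n)) else 0) = (of_real (if n < M then 2 * pi * real (PL n) else 0) :: complex)"
      by simp
    ultimately show ?thesis by (simp only:)
  qed
  obtain I J where IJ: "\<And>M. (f M has_integral I M) {- pi..pi}" "(g has_integral J) {- pi..pi}" "I \<longlonglongrightarrow> J"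
  proof (rule uniform_limit_integral[OF ul])
    show "continuous_on {- pi..pi} (f M)" for M
      unfolding f_def z_def by (intro continuous_intros)
  qed (use that in auto)
  have "I M = of_real (if n < M then 2 * pi * real (PL n) else 0)" for M
    using IJ(1) fi by (rule has_integral_unique)
  hence "eventually (\<lambda>M. of_real (2 * pi * real (PL n)) = I M) sequentially"
    by (intro eventually_sequentiallyI[of "Suc n"]) auto
  hence "I \<longlonglongrightarrow> of_real (2 * pi * real (PL n))"
    by (rule Lim_transform_eventually[OF tendsto_const])
  with IJ(3) have "J = of_real (2 * pi * real (PL n))" by (rule LIMSEQ_unique)
  thus ?thesis using IJ(2) unfolding g_def[abs_def] z_def[abs_def] by (simp add: exp_add)
qed

section \<open>The saddle point substitution\<close>

definition saddle_v :: "complex \<Rightarrow> complex" where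
  "saddle_v u = (u - 1) * csqrt (2 * u + 1) / u"

definition saddle_dv :: "complex \<Rightarrow> complex" where
  "saddle_dv u = (u\<^sup>2 + u + 1) / (u\<^sup>2 * csqrt (2 * u + 1))"

lemma right_half_plane:
  assumes "Re u > 0"
  shows "u \<noteq> 0" "2 * u + 1 \<notin> \<real>\<^sub>\<le>\<^sub>0" "2 * u + 1 \<noteq> 0" "csqrt (2 * u + 1) \<noteq> 0" "u \<notin> \<real>\<^sub>\<le>\<^sub>0"
proof -
  show "u \<noteq> 0" "2 * u + 1 \<notin> \<real>\<^sub>\<le>\<^sub>0" "u \<notin> \<real>\<^sub>\<le>\<^sub>0" using assms by (auto simp: complex_nonpos_Reals_iff)
  thus nz: "2 * u + 1 \<noteq> 0" by force
  show "csqrt (2 * u + 1) \<noteq> 0" unfolding csqrt_eq_0 by (rule nz)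
qed

lemma saddle_v_sq: "u \<noteq> 0 \<Longrightarrow> (saddle_v u)\<^sup>2 = 2 * u + 1 / u\<^sup>2 - 3"
proof -
  assume "u \<noteq> 0"
  have "(saddle_v u)\<^sup>2 = (u - 1)\<^sup>2 * (2 * u + 1) / u\<^sup>2"
    by (simp add: saddle_v_def power_mult_distrib power_divide)
  thus ?thesis using \<open>u \<noteq> 0\<close> by (simp add: field_simps power2_eq_square)
qed

lemma saddle_v_deriv:
  assumes "Re u > 0"
  shows "(saddle_v has_field_derivative saddle_dv u) (at u)"
proof -
  define s where "s = csqrt (2 * u + 1)"
  have s: "s \<noteq> 0" "s * s = 2 * u + 1" using right_half_plane[OF assms] power2_csqrt[of "2 * u + 1"] by (auto simp: s_def power2_eq_square)
  have "(saddle_v has_field_derivative ((1 * s + 2 / (2 * s) * (u - 1)) * u - (u - 1) * s * 1) / (u * u)) (at u)"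
    unfolding saddle_v_def[abs_def] s_def using right_half_plane[OF assms]
    by (auto intro!: derivative_eq_intros)
  also have "((1 * s + 2 / (2 * s) * (u - 1)) * u - (u - 1) * s * 1) / (u * u) = (s * s + u * u - u) / (u * u * s)"
  proof -
    have "(1 * s + 2 / (2 * s) * (u - 1)) * u - (u - 1) * s * 1 = (s * s + u * u - u) / s" using s(1) by (simp add: field_simps)
    thus ?thesis by simp
  qed
  also have "s * s + u * u - u = u\<^sup>2 + u + 1" unfolding s(2) by (simp add: power2_eq_square)
  finally show ?thesis by (simp add: saddle_dv_def s_def power2_eq_square)
qed

text \<open>Homogeneous in \<open>cmod u\<close>, so that \<open>1 / saddle_dv u\<close> is bounded
  by a multiple of the root of \<open>2 u + 1\<close>. With \<open>m = (cmod u)^2\<close>, the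
  squared modulus of the quadratic is at least \<open>m^2 - m + 1\<close>, and
  \<open>(m / 2 - 1)^2\<close> is nonnegative.\<close>

lemma quad_lower:
  assumes "Re u \<ge> 0"
  shows "3 * (cmod u) ^ 4 \<le> 4 * (cmod (u\<^sup>2 + u + 1))\<^sup>2"
proof -
  define x y where "x = Re u" and "y = Im u"
  have n: "(cmod u)\<^sup>2 = x\<^sup>2 + y\<^sup>2" by (simp add: cmod_power2 x_def y_def)
  define m where "m = x\<^sup>2 + y\<^sup>2"
  have "(cmod (u\<^sup>2 + u + 1))\<^sup>2 = (x\<^sup>2 - y\<^sup>2 + x + 1)\<^sup>2 + (2 * x * y + y)\<^sup>2"
    unfolding cmod_power2 by (simp add: x_def y_def power2_eq_square mult_ac)
  also have "\<dots> = m\<^sup>2 - m + 1 + 2 * m * x + 4 * x\<^sup>2 + 2 * x"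
    unfolding m_def by (simp add: power2_eq_square algebra_simps)
  also have "\<dots> \<ge> m\<^sup>2 - m + 1" using assms by (simp add: m_def x_def)
  finally have "m\<^sup>2 - m + 1 \<le> (cmod (u\<^sup>2 + u + 1))\<^sup>2" .
  moreover have "3 / 4 * m\<^sup>2 \<le> m\<^sup>2 - m + 1" using zero_le_power2[of "m / 2 - 1"] by (simp add: power2_eq_square algebra_simps)
  moreover have "(cmod u) ^ 4 = ((cmod u)\<^sup>2)\<^sup>2" by (simp flip: power_mult)
  hence "(cmod u) ^ 4 = m\<^sup>2" unfolding n m_def .
  ultimately show ?thesis by simp
qed

lemma saddle_dv_nonzero: "Re u > 0 \<Longrightarrow> saddle_dv u \<noteq> 0"
proof -
  assume u: "Re u > 0"
  have "(cmod u) ^ 4 > 0" using right_half_plane(1)[OF u] by simp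
  hence "u\<^sup>2 + u + 1 \<noteq> 0" using quad_lower[of u] u by auto
  thus ?thesis using right_half_plane[OF u] by (simp add: saddle_dv_def)
qed

lemma disk_Re_pos: "u \<in> cball 6 (599/100) \<Longrightarrow> Re u \<ge> 1 / 100" "u \<in> cball 6 (599/100) \<Longrightarrow> cmod u \<le> 12"
proof -
  assume u: "u \<in> cball 6 (599/100)"
  hence *: "cmod (6 - u) \<le> 599/100" by (simp add: dist_norm)
  thus "Re u \<ge> 1 / 100" using complex_Re_le_cmod[of "6 - u"] by simp
  show "cmod u \<le> 12" using * norm_triangle_ineq4[of 6 "6 - u"] by simp
qed

text \<open>The circle surrounds \<open>u = 1\<close>, the zero of \<open>v\<close>, and avoids the pole \<open>u = 0\<close> and the cut of the root.\<close>

lemma saddle_v_circle_lower: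
  assumes "u \<in> sphere 6 (599/100)"
  shows "2 \<le> cmod (saddle_v u)"
proof -
  define x where "x = Re u"
  have u: "Re u \<ge> 1/100" using assms by (intro disk_Re_pos) auto
  have x: "x > 0" using u by (simp add: x_def)
  have "(cmod (6 - u))\<^sup>2 = (599/100)\<^sup>2" using assms by (simp add: dist_norm)
  \<comment> \<open>On the circle the squared moduli of \<open>u\<close>, \<open>u - 1\<close> and
    \<open>2 u + 1\<close> are all affine in \<open>x = Re u\<close>, so that the claim becomes a
    cubic inequality in \<open>x\<close>.\<close>
  hence n: "(cmod u)\<^sup>2 = 12 * x - 1199 / 10000"
    unfolding cmod_power2 by (simp add: x_def power2_eq_square algebra_simps)
  have n1: "(cmod (u - 1))\<^sup>2 = 10 * x + 8801 / 10000"
    using n unfolding cmod_power2 by (simp add: x_def power2_eq_square algebra_simps)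
  have n2: "(cmod (2 * u + 1))\<^sup>2 = 52 * x + 5204 / 10000"
    using n unfolding cmod_power2 by (simp add: x_def power2_eq_square algebra_simps)
  have "16 * (12 * x - 1199 / 10000)\<^sup>2 \<le> (10 * x + 8801 / 10000)\<^sup>2 * (52 * x + 5204 / 10000)"
  proof -
    have "x \<le> 12" using complex_Re_le_cmod[of u] disk_Re_pos(2)[of u] assms by (simp add: x_def)
    \<comment> \<open>The cubic without its constant term, divided by \<open>x\<close>, and with its
      last coefficient rounded down to 95. The quadratic is positive because its discriminant is
      negative; the rounding is put back in the next step.\<close>
    hence "0 \<le> 5200 * x\<^sup>2 - (167082/125) * x + 95"
      using zero_le_power2[of "x - 12852/100000"] by (simp add: power2_eq_square algebra_simps)
    hence "0 \<le> x * (5200 * x\<^sup>2 - (167082/125) * x + 95)" by (rule mult_nonneg_nonneg[OF less_imp_le[OF x]])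
    with x have "0 \<le> x * (5200 * x\<^sup>2 - (167082/125) * x + 95) + (2386990833/25000000 - 95) * x + 43268298901/250000000000"
    proof -
      have aux: "0 \<le> q \<Longrightarrow> 0 \<le> q + (2386990833/25000000 - 95) * x + 43268298901/250000000000" for q using x by simp
      show ?thesis by (rule aux) fact
    qed
    also have "\<dots> = (10 * x + 8801 / 10000)\<^sup>2 * (52 * x + 5204 / 10000) - 16 * (12 * x - 1199 / 10000)\<^sup>2"
      by (simp add: power2_eq_square field_simps)
    finally show ?thesis by simp
  qed
  hence "16 * ((cmod u)\<^sup>2)\<^sup>2 \<le> ((cmod (u - 1))\<^sup>2)\<^sup>2 * (cmod (2 * u + 1))\<^sup>2" unfolding n n1 n2 .
  hence "(4 * (cmod u)\<^sup>2)\<^sup>2 \<le> ((cmod (u - 1))\<^sup>2 * cmod (2 * u + 1))\<^sup>2" by (simp add: power_mult_distrib)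
  hence "4 * (cmod u)\<^sup>2 \<le> (cmod (u - 1))\<^sup>2 * cmod (2 * u + 1)" by (rule power2_le_imp_le) simp
  moreover have u0: "cmod u > 0" using right_half_plane(1)[of u] u by simp
  ultimately have "4 \<le> (cmod (u - 1))\<^sup>2 * cmod (2 * u + 1) / (cmod u)\<^sup>2" by (simp add: field_simps)
  also have "\<dots> = (cmod (saddle_v u))\<^sup>2"
    by (simp add: saddle_v_def norm_mult norm_divide power_mult_distrib power_divide flip: norm_power)
  finally have "2\<^sup>2 \<le> (cmod (saddle_v u))\<^sup>2" by simp
  thus ?thesis by (rule power2_le_imp_le) simp
qed

text \<open>Division of \<open>h / v'\<close> by successive powers of \<open>v\<close>: \<open>saddle_H a k\<close> is the \<open>k\<close>-th remainder, for
  \<open>h u = u powr a\<close>.\<close>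

fun saddle_H :: "real \<Rightarrow> nat \<Rightarrow> complex \<Rightarrow> complex" where
  "saddle_H a 0 = (\<lambda>u. u powr of_real a / saddle_dv u)"
| "saddle_H a (Suc k) = (\<lambda>u. (if u = 1 then deriv (saddle_H a k) 1 else (saddle_H a k u - saddle_H a k 1) / (u - 1))
      * (u / csqrt (2 * u + 1)))"

text \<open>The Taylor coefficients at \<open>v = 0\<close> of \<open>u powr a\<close> times
  \<open>du / dv\<close>, as a function of \<open>v\<close>.\<close>

definition saddle_g :: "real \<Rightarrow> nat \<Rightarrow> complex" where
  "saddle_g a k = saddle_H a k 1"

definition RHP :: "complex set" where "RHP = {u. Re u > 0}"

lemma open_RHP: "open RHP" and convex_RHP: "convex RHP"
  by (auto simp: RHP_def open_halfspace_Re_gt convex_halfspace_Re_gt)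

lemma saddle_holo: "saddle_v holomorphic_on RHP" "saddle_dv holomorphic_on RHP"
   "(\<lambda>u. u powr of_real a) holomorphic_on RHP" "(\<lambda>u. u / csqrt (2 * u + 1)) holomorphic_on RHP"
  unfolding saddle_v_def[abs_def] saddle_dv_def[abs_def] RHP_def
  by (intro holomorphic_intros; use right_half_plane in force)+

text \<open>\<open>u / csqrt (2 * u + 1)\<close> is \<open>(u - 1) / v\<close>, and the value
  prescribed at \<open>u = 1\<close> is the one that removes the singularity of the difference
  quotient.\<close>

lemma saddle_H_holo: "saddle_H a k holomorphic_on RHP"
proof (induction k)
  case 0
  show ?case unfolding saddle_H.simps
    by (intro holomorphic_on_divide saddle_holo) (use saddle_dv_nonzero in \<open>auto simp: RHP_def\<close>)
next
  case (Suc k)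
  show ?case unfolding saddle_H.simps
    by (intro holomorphic_on_mult pole_lemma_open Suc open_RHP saddle_holo)
qed

lemma saddle_H_step:
  assumes "u \<in> RHP"
  shows "saddle_H a k u = saddle_g a k + saddle_v u * saddle_H a (Suc k) u"
proof (cases "u = 1")
  case True
  thus ?thesis by (simp add: saddle_g_def saddle_v_def)
next
  case False
  have r: "u \<noteq> 0" "csqrt (2 * u + 1) \<noteq> 0" using right_half_plane[of u] assms by (auto simp: RHP_def)
  have "(u - 1) * s / u * (d / (u - 1) * (u / s)) = d" if "s \<noteq> 0" for s d
    using that r False by simp
  from this[OF r(2), of "saddle_H a k u - saddle_H a k 1"] False show ?thesis
    by (simp add: saddle_g_def saddle_v_def)
qed

lemma saddle_expansion:
  assumes "u \<in> RHP"
  shows "u powr of_real a / saddle_dv u = (\<Sum>k<K. saddle_g a k * saddle_v u ^ k) + saddle_v u ^ K * saddle_H a K u"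
proof (induction K)
  case 0 show ?case by simp
next
  case (Suc K)
  show ?case unfolding Suc by (subst saddle_H_step[OF assms, of a K]) (simp add: algebra_simps)
qed

lemma saddle_circle_bound:
  assumes "a \<ge> 0" "u \<in> sphere 6 (599/100)"
  shows "cmod (u powr of_real a) \<le> 12 powr a" "cmod (u powr of_real a / saddle_dv u) \<le> 6 * 12 powr a"
proof -
  have u: "Re u \<ge> 1 / 100" "cmod u \<le> 12" using assms(2) disk_Re_pos[of u] by auto
  have u0: "u \<noteq> 0" "csqrt (2 * u + 1) \<noteq> 0" using right_half_plane[of u] u by auto
  have "cmod (u powr of_real a) = cmod u powr a" using u0 by (simp add: norm_powr_real_powr')
  also have "\<dots> \<le> 12 powr a" using u assms by (intro powr_mono2) auto
  finally show 1: "cmod (u powr of_real a) \<le> 12 powr a" .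
  have q: "u\<^sup>2 + u + 1 \<noteq> 0" using saddle_dv_nonzero[of u] u by (auto simp: saddle_dv_def)
  have "3 * ((cmod u)\<^sup>2)\<^sup>2 \<le> 4 * (cmod (u\<^sup>2 + u + 1))\<^sup>2" using quad_lower[of u] u by (simp flip: power_mult)
  moreover have "0 \<le> (cmod (u\<^sup>2 + u + 1))\<^sup>2" by simp
  ultimately have "25 * ((cmod u)\<^sup>2)\<^sup>2 \<le> 36 * (cmod (u\<^sup>2 + u + 1))\<^sup>2" by linarith
  hence "(5 * (cmod u)\<^sup>2)\<^sup>2 \<le> (6 * cmod (u\<^sup>2 + u + 1))\<^sup>2" by (simp add: power_mult_distrib)
  hence "5 * (cmod u)\<^sup>2 \<le> 6 * cmod (u\<^sup>2 + u + 1)" by (rule power2_le_imp_le) simp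
  moreover have "cmod (csqrt (2 * u + 1)) \<le> 5"
  proof -
    have "cmod (2 * u + 1) \<le> 25" using norm_triangle_ineq[of "2 * u" 1] u by (simp add: norm_mult)
    thus ?thesis by (simp add: norm_csqrt real_le_lsqrt)
  qed
  hence "(cmod u)\<^sup>2 * cmod (csqrt (2 * u + 1)) \<le> (cmod u)\<^sup>2 * 5" by (intro mult_left_mono) auto
  ultimately have "(cmod u)\<^sup>2 * cmod (csqrt (2 * u + 1)) \<le> 6 * cmod (u\<^sup>2 + u + 1)" by linarith
  hence "(cmod u)\<^sup>2 * cmod (csqrt (2 * u + 1)) / cmod (u\<^sup>2 + u + 1) \<le> 6" using q by (simp add: divide_le_eq)
  hence "cmod (u powr of_real a) * ((cmod u)\<^sup>2 * cmod (csqrt (2 * u + 1)) / cmod (u\<^sup>2 + u + 1)) \<le> 12 powr a * 6"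
    using 1 by (intro mult_mono) auto
  thus "cmod (u powr of_real a / saddle_dv u) \<le> 6 * 12 powr a"
    by (simp add: saddle_dv_def norm_divide norm_mult norm_power)
qed

lemma circle_in_RHP: "sphere 6 (599/100) \<subseteq> RHP" "cball 6 (599/100) \<subseteq> RHP" "sphere 6 (599/100) \<subseteq> RHP - {1}"
proof -
  show c: "cball 6 (599/100) \<subseteq> RHP" using disk_Re_pos(1) by (force simp: RHP_def)
  show s: "sphere 6 (599/100) \<subseteq> RHP" using c sphere_cball by (rule order_trans[rotated])
  have "(1::complex) \<notin> sphere 6 (599/100)" by (simp add: dist_norm)
  thus "sphere 6 (599/100) \<subseteq> RHP - {1}" using s by blast
qed

lemma saddle_v_nonzero: "u \<in> RHP - {1} \<Longrightarrow> saddle_v u \<noteq> 0"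
  using right_half_plane[of u] by (auto simp: saddle_v_def RHP_def)

lemma saddle_g_contour:
  "((\<lambda>u. u powr of_real a / saddle_v u ^ Suc k) has_contour_integral 2 * pi * \<i> * saddle_g a k) (circlepath 6 (599/100))"
proof -
  let ?C = "circlepath 6 (599/100)"
  have img: "path_image ?C = sphere 6 (599/100)" by simp
  have one: "((\<lambda>u. saddle_dv u * inverse (saddle_v u ^ Suc (Suc n))) has_contour_integral 0) ?C" for n
  proof -
    have d: "((\<lambda>u. - inverse (of_nat (Suc n)) * inverse (saddle_v u) ^ Suc n) has_field_derivative saddle_dv u * inverse (saddle_v u ^ Suc (Suc n))) (at u within RHP - {1})"
      if "u \<in> RHP - {1}" for u
    proof -
      have "Re u > 0" using that by (simp add: RHP_def)
      note D = has_field_derivative_at_within[OF saddle_v_deriv[OF this], of "RHP - {1}"]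
      have "((\<lambda>u. - inverse (of_nat (Suc n)) * inverse (saddle_v u) ^ Suc n) has_field_derivative
         - inverse (of_nat (Suc n)) * (of_nat (Suc n) * (- (inverse (saddle_v u) * saddle_dv u * inverse (saddle_v u)) * inverse (saddle_v u) ^ (Suc n - Suc 0)))) (at u within RHP - {1})"
        using D saddle_v_nonzero[OF that] by (intro DERIV_cmult DERIV_power DERIV_inverse')
      moreover have "- inverse c * (c * (- (i * d * i) * i ^ n)) = d * (i ^ Suc (Suc n))" if "c \<noteq> 0" for c d i :: complex
        using that by (simp add: mult_ac)
      from this[of "of_nat (Suc n)" "inverse (saddle_v u)" "saddle_dv u"]
      have "- inverse (of_nat (Suc n)) * (of_nat (Suc n) * (- (inverse (saddle_v u) * saddle_dv u * inverse (saddle_v u)) * inverse (saddle_v u) ^ n)) = saddle_dv u * inverse (saddle_v u ^ Suc (Suc n))"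
        unfolding power_inverse by (simp del: of_nat_Suc power_Suc)
      ultimately show ?thesis by (simp only: diff_Suc_Suc diff_zero)
    qed
    from contour_integral_primitive[OF d, of ?C] circle_in_RHP(3) show ?thesis by simp
  qed
  \<comment> \<open>The logarithmic derivative of \<open>v\<close> is
    \<open>1 / (u - 1) + 1 / (2 u + 1) - 1 / u\<close>. Only the first part has a pole in the right
    half-plane.\<close>
  have two: "((\<lambda>u. saddle_dv u * inverse (saddle_v u)) has_contour_integral 2 * pi * \<i>) ?C"
  proof -
    have "((\<lambda>u. 1 / (u - 1)) has_contour_integral 2 * pi * \<i>) ?C"
      using Cauchy_integral_circlepath_simple[of "\<lambda>_. 1" 6 "599/100" 1] by (simp add: dist_norm)
    moreover have "((\<lambda>u. 1 / (2 * u + 1) - 1 / u) has_contour_integral 0) ?C"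
    proof (rule Cauchy_theorem_convex_simple[OF _ convex_RHP])
      show "(\<lambda>u. 1 / (2 * u + 1) - 1 / u) holomorphic_on RHP"
        unfolding RHP_def by (intro holomorphic_intros) (use right_half_plane in auto)
    qed (use circle_in_RHP in auto)
    ultimately have "((\<lambda>u. 1 / (u - 1) + (1 / (2 * u + 1) - 1 / u)) has_contour_integral 2 * pi * \<i> + 0) ?C"
      by (rule has_contour_integral_add)
    moreover have "1 / (u - 1) + (1 / (2 * u + 1) - 1 / u) = saddle_dv u * inverse (saddle_v u)" if "u \<in> path_image ?C" for u
    proof -
      have u: "u \<in> RHP - {1}" using that circle_in_RHP(3) by auto
      hence r: "u \<noteq> 0" "2 * u + 1 \<noteq> 0" "csqrt (2 * u + 1) \<noteq> 0" "u - 1 \<noteq> 0" using right_half_plane[of u] by (auto simp: RHP_def)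
      have "saddle_dv u * inverse (saddle_v u) = (u\<^sup>2 + u + 1) / (u * (u - 1) * (csqrt (2 * u + 1))\<^sup>2)"
        using r by (simp add: saddle_dv_def saddle_v_def power2_eq_square)
      also have "\<dots> = 1 / (u - 1) + (1 / (2 * u + 1) - 1 / u)"
        using r unfolding power2_csqrt by (simp add: divide_simps) (simp add: algebra_simps power2_eq_square)
      finally show ?thesis ..
    qed
    ultimately show ?thesis using has_contour_integral_eq by fastforce
  qed
  have three: "((\<lambda>u. saddle_dv u * saddle_H a (Suc k) u) has_contour_integral 0) ?C"
    by (rule Cauchy_theorem_convex_simple[OF holomorphic_on_mult[OF saddle_holo(2) saddle_H_holo] convex_RHP]) (use circle_in_RHP in auto)
  have "((\<lambda>u. (\<Sum>j<k. saddle_g a j * (saddle_dv u * inverse (saddle_v u ^ Suc (Suc (k - j - 1))))) + saddle_g a k * (saddle_dv u * inverse (saddle_v u)) + saddle_dv u * saddle_H a (Suc k) u)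
     has_contour_integral (\<Sum>j<k. saddle_g a j * 0) + saddle_g a k * (2 * pi * \<i>) + 0) ?C"
    by (intro has_contour_integral_add has_contour_integral_sum has_contour_integral_lmul one two three) auto
  moreover have "(\<Sum>j<k. saddle_g a j * (saddle_dv u * inverse (saddle_v u ^ Suc (Suc (k - j - 1))))) + saddle_g a k * (saddle_dv u * inverse (saddle_v u)) + saddle_dv u * saddle_H a (Suc k) u
     = u powr of_real a / saddle_v u ^ Suc k" if "u \<in> path_image ?C" for u
  proof -
    have u: "u \<in> RHP - {1}" using that circle_in_RHP(3) by auto
    have v: "saddle_v u \<noteq> 0" by (rule saddle_v_nonzero[OF u])
    have dv: "saddle_dv u \<noteq> 0" using saddle_dv_nonzero[of u] u by (simp add: RHP_def)
    have vpow: "saddle_v u ^ j * inverse (saddle_v u ^ Suc k) = inverse (saddle_v u ^ Suc (Suc (k - j - 1)))" if "j < k" for j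
    proof -
      have "Suc k = j + Suc (Suc (k - j - 1))" using that by simp
      hence "saddle_v u ^ Suc k = saddle_v u ^ j * saddle_v u ^ Suc (Suc (k - j - 1))" by (metis power_add)
      thus ?thesis using v by simp
    qed
    have "(\<Sum>j<k. saddle_g a j * (saddle_dv u * inverse (saddle_v u ^ Suc (Suc (k - j - 1))))) = (\<Sum>j<k. saddle_g a j * saddle_v u ^ j) * (saddle_dv u * inverse (saddle_v u ^ Suc k))"
      unfolding sum_distrib_right
    proof (intro sum.cong refl)
      fix j assume "j \<in> {..<k}"
      hence "j < k" by simp
      show "saddle_g a j * (saddle_dv u * inverse (saddle_v u ^ Suc (Suc (k - j - 1)))) = saddle_g a j * saddle_v u ^ j * (saddle_dv u * inverse (saddle_v u ^ Suc k))"
        unfolding vpow[OF \<open>j < k\<close>, symmetric] by (simp only: mult_ac)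
    qed
    moreover have "saddle_dv u * inverse (saddle_v u) = saddle_v u ^ k * (saddle_dv u * inverse (saddle_v u ^ Suc k))" using v by simp
    moreover have "saddle_dv u * saddle_H a (Suc k) u = saddle_v u ^ Suc k * saddle_H a (Suc k) u * (saddle_dv u * inverse (saddle_v u ^ Suc k))"
    proof -
      have "d * h = w * h * (d * inverse w)" if "w \<noteq> 0" for d h w :: complex using that by simp
      from this[of "saddle_v u ^ Suc k"] v show ?thesis by (simp del: saddle_H.simps power_Suc)
    qed
    moreover have "u powr of_real a / saddle_v u ^ Suc k = (u powr of_real a / saddle_dv u) * (saddle_dv u * inverse (saddle_v u ^ Suc k))"
      using dv by (simp add: divide_inverse)
    moreover have "u powr of_real a / saddle_dv u = (\<Sum>j<k. saddle_g a j * saddle_v u ^ j) + saddle_g a k * saddle_v u ^ k + saddle_v u ^ Suc k * saddle_H a (Suc k) u"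
      using saddle_expansion[of u a "Suc k"] u by simp
    ultimately show ?thesis by (simp only: distrib_right mult.assoc)
  qed
  ultimately have "((\<lambda>u. u powr of_real a / saddle_v u ^ Suc k) has_contour_integral (\<Sum>j<k. saddle_g a j * 0) + saddle_g a k * (2 * pi * \<i>) + 0) ?C"
    by (rule has_contour_integral_eq)
  thus ?thesis by (simp add: mult_ac)
qed

text \<open>Direct estimate of the contour integral: \<open>\<bar>v\<bar> \<ge> 2\<close> on the
  circle yields \<open>2 ^ Suc k\<close>, and half the radius is below 3.\<close>

lemma saddle_g_bound:
  assumes "a \<ge> 0"
  shows "cmod (saddle_g a k) \<le> 3 * 12 powr a / 2 ^ k"
proof -
  have "cmod (2 * pi * \<i> * saddle_g a k) \<le> (12 powr a / 2 ^ Suc k) * (2 * pi * (599/100))"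
  proof (rule has_contour_integral_bound_circlepath[OF saddle_g_contour])
    fix u :: complex assume "norm (u - 6) = 599 / 100"
    hence u: "u \<in> sphere 6 (599/100)" by (simp add: dist_norm norm_minus_commute)
    have "2 ^ Suc k \<le> cmod (saddle_v u ^ Suc k)" unfolding norm_power using saddle_v_circle_lower[OF u] by (intro power_mono) auto
    thus "cmod (u powr of_real a / saddle_v u ^ Suc k) \<le> 12 powr a / 2 ^ Suc k"
      unfolding norm_divide using saddle_circle_bound(1)[OF assms u] by (intro frac_le) auto
  qed auto
  hence "2 * pi * cmod (saddle_g a k) \<le> 2 * pi * (599/100 / 2 * 12 powr a / 2 ^ k)" by (simp add: norm_mult mult_ac)
  hence "cmod (saddle_g a k) \<le> 599/100 / 2 * 12 powr a / 2 ^ k" by (subst (asm) mult_le_cancel_left_pos) simp_all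
  also have "\<dots> \<le> 3 * 12 powr a / 2 ^ k" by (intro divide_right_mono mult_right_mono) auto
  finally show ?thesis .
qed

text \<open>Lagrange inversion: since \<open>v = (u - 1) csqrt (2 u + 1) / u\<close>, the contour
  integrand is an explicit holomorphic function over \<open>(u - 1) ^ Suc k\<close>, and Cauchy's
  formula for derivatives applies.\<close>

lemma saddle_g_deriv:
  "saddle_g a k = (deriv ^^ k) (\<lambda>u. u powr of_real (a + real k + 1) / csqrt (2 * u + 1) ^ Suc k) 1 / fact k"
proof -
  define P where "P = (\<lambda>u::complex. u powr of_real (a + real k + 1) / csqrt (2 * u + 1) ^ Suc k)"
  have hol: "P holomorphic_on RHP"
    unfolding P_def RHP_def by (intro holomorphic_intros; use right_half_plane in force)
  have "((\<lambda>u. P u / (u - 1) ^ Suc k) has_contour_integral (2 * pi * \<i> / fact k * (deriv ^^ k) P 1)) (circlepath 6 (599/100))"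
    by (rule Cauchy_has_contour_integral_higher_derivative_circlepath)
       (use holomorphic_on_subset[OF hol circle_in_RHP(2)] holomorphic_on_imp_continuous_on ball_subset_cball holomorphic_on_subset in \<open>auto simp: dist_norm\<close>)
  moreover have "P u / (u - 1) ^ Suc k = u powr of_real a / saddle_v u ^ Suc k" if "u \<in> path_image (circlepath 6 (599/100))" for u
  proof -
    have "u \<in> RHP - {1}" using that circle_in_RHP(3) by auto
    hence u: "u \<noteq> 0" using right_half_plane(1)[of u] by (auto simp: RHP_def)
    have "u powr of_real (a + real k + 1) = u powr of_real a * u ^ Suc k"
    proof -
      have "u powr of_real (a + real k + 1) = u powr (of_real a + of_nat (Suc k))" by (simp add: add_ac)
      also have "\<dots> = u powr of_real a * u powr of_nat (Suc k)" by (rule powr_add)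
      also have "u powr of_nat (Suc k) = u ^ Suc k" by (rule powr_nat') simp
      finally show ?thesis .
    qed
    thus ?thesis by (simp add: P_def saddle_v_def power_mult_distrib power_divide del: power_Suc)
  qed
  ultimately have "((\<lambda>u. u powr of_real a / saddle_v u ^ Suc k) has_contour_integral (2 * pi * \<i> / fact k * (deriv ^^ k) P 1)) (circlepath 6 (599/100))"
    by (rule has_contour_integral_eq)
  with saddle_g_contour[of a k] have "2 * pi * \<i> * saddle_g a k = 2 * pi * \<i> / fact k * (deriv ^^ k) P 1"
    by (rule has_contour_integral_unique)
  hence "2 * pi * \<i> * saddle_g a k = 2 * pi * \<i> * ((deriv ^^ k) P 1 / fact k)" by simp
  thus ?thesis unfolding P_def by (subst (asm) mult_cancel_left) simp
qed

text \<open>By the maximum principle the bound is needed only on the circle, where dividing by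
  \<open>v ^ K\<close> is harmless. Each of the \<open>K\<close> removed terms is estimated there by
  \<open>(\<bar>v\<bar> / 2) ^ K\<close>, hence the linear factor in \<open>K\<close>.\<close>

lemma saddle_H_bound:
  assumes "a \<ge> 0" "u \<in> cball 6 (599/100)"
  shows "cmod (saddle_H a K u) \<le> 12 powr a * (6 + 3 * real K) / 2 ^ K"
proof (rule maximum_modulus_frontier[of "saddle_H a K" "cball 6 (599/100)"])
  show "saddle_H a K holomorphic_on interior (cball 6 (599/100))" "continuous_on (closure (cball 6 (599/100))) (saddle_H a K)"
    using circle_in_RHP(2) ball_subset_cball[of "6::complex" "599/100"]
    by (auto intro!: holomorphic_on_imp_continuous_on holomorphic_on_subset[OF saddle_H_holo])
  fix u :: complex assume "u \<in> frontier (cball 6 (599/100))"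
  hence u: "u \<in> sphere 6 (599/100)" by simp
  have v: "2 \<le> cmod (saddle_v u)" by (rule saddle_v_circle_lower[OF u])
  define w where "w = cmod (saddle_v u)"
  have w: "2 \<le> w" using v by (simp add: w_def)
  have "u \<in> RHP" using u circle_in_RHP by blast
  from saddle_expansion[OF this, of a K]
  have "saddle_v u ^ K * saddle_H a K u = u powr of_real a / saddle_dv u - (\<Sum>k<K. saddle_g a k * saddle_v u ^ k)" by simp
  hence "w ^ K * cmod (saddle_H a K u) = cmod (u powr of_real a / saddle_dv u - (\<Sum>k<K. saddle_g a k * saddle_v u ^ k))"
    by (metis norm_mult norm_power w_def)
  also have "\<dots> \<le> cmod (u powr of_real a / saddle_dv u) + (\<Sum>k<K. cmod (saddle_g a k * saddle_v u ^ k))"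
    by (rule order_trans[OF norm_triangle_ineq4 add_left_mono[OF norm_sum]])
  also have "\<dots> \<le> 6 * 12 powr a * (w / 2) ^ K + (\<Sum>k<K. 3 * 12 powr a * (w / 2) ^ K)"
  proof (intro add_mono sum_mono)
    have "cmod (u powr of_real a / saddle_dv u) \<le> 6 * 12 powr a * 1" using saddle_circle_bound(2)[OF assms(1) u] by simp
    also have "\<dots> \<le> 6 * 12 powr a * (w / 2) ^ K" using w by (intro mult_left_mono one_le_power) auto
    finally show "cmod (u powr of_real a / saddle_dv u) \<le> 6 * 12 powr a * (w / 2) ^ K" .
    fix k assume k: "k \<in> {..<K}"
    have "cmod (saddle_g a k * saddle_v u ^ k) \<le> 3 * 12 powr a / 2 ^ k * w ^ k"
      unfolding norm_mult norm_power w_def by (intro mult_right_mono saddle_g_bound assms) auto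
    also have "\<dots> = 3 * 12 powr a * (w / 2) ^ k" by (simp add: power_divide)
    also have "\<dots> \<le> 3 * 12 powr a * (w / 2) ^ K" using w k by (intro mult_left_mono power_increasing) auto
    finally show "cmod (saddle_g a k * saddle_v u ^ k) \<le> 3 * 12 powr a * (w / 2) ^ K" .
  qed
  also have "\<dots> = w ^ K * (12 powr a * (6 + 3 * real K) / 2 ^ K)" by (simp add: power_divide field_simps)
  finally show "cmod (saddle_H a K u) \<le> 12 powr a * (6 + 3 * real K) / 2 ^ K"
    using w by (subst (asm) mult_le_cancel_left_pos) auto
qed (use assms in auto)

section \<open>Gaussian moments along the image of the segment in the v-plane\<close>

lemma Gamma_half_fact: "Gamma (real k + 1/2) = sqrt pi * (fact (2 * k) / (2 ^ (2 * k) * fact k))"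
proof (induction k)
  case 0 show ?case by (simp add: Gamma_one_half_real)
next
  case (Suc k)
  have "Gamma (real (Suc k) + 1/2) = Gamma ((real k + 1/2) + 1)" by (simp add: add_ac)
  also have "\<dots> = (real k + 1/2) * Gamma (real k + 1/2)" by (rule Gamma_plus1) (auto elim!: nonpos_Ints_cases)
  also have "\<dots> = sqrt pi * (fact (2 * Suc k) / (2 ^ (2 * Suc k) * fact (Suc k)))"
  proof -
    have alg: "(x + 1/2) * (s * (f / (p * g))) = s * ((2 * x + 2) * ((2 * x + 1) * f) / (4 * p * ((x + 1) * g)))"
      if "p > 0" "g > 0" "x \<ge> 0" for x s f p g :: real
    proof -
      have "(2 * x + 2) * ((2 * x + 1) * f) / (4 * p * ((x + 1) * g)) = ((4 * (x + 1)) * ((x + 1/2) * f)) / ((4 * (x + 1)) * (p * g))"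
        by (simp add: algebra_simps)
      also have "\<dots> = (x + 1/2) * f / (p * g)" by (rule mult_divide_mult_cancel_left) (use that in simp)
      finally show ?thesis by simp
    qed
    have "fact (2 * Suc k) = (2 * real k + 2) * ((2 * real k + 1) * fact (2 * k))"
      by (simp add: algebra_simps)
    moreover have "(2::real) ^ (2 * Suc k) = 4 * 2 ^ (2 * k)" by simp
    moreover have "fact (Suc k) = (real k + 1) * fact k" by (simp add: add_ac)
    ultimately show ?thesis unfolding Suc by (simp only:) (rule alg, auto)
  qed
  finally show ?case .
qed

lemma Gamma_half_pos: "Gamma (real k + 1/2) > 0"
  by (intro Gamma_real_pos) simp

lemma Gamma_half_bound: "m \<le> M \<Longrightarrow> Gamma (real m + 1/2) \<le> 2 * real M ^ m"
proof (induction m)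
  case 0
  have "sqrt pi \<le> 2" using pi_less_4 by (intro real_le_lsqrt) auto
  thus ?case by (simp add: Gamma_one_half_real)
next
  case (Suc k)
  have "Gamma (real (Suc k) + 1/2) = Gamma ((real k + 1/2) + 1)" by (simp add: add_ac)
  also have "\<dots> = (real k + 1/2) * Gamma (real k + 1/2)" by (rule Gamma_plus1) (auto elim!: nonpos_Ints_cases)
  also have "\<dots> \<le> real M * (2 * real M ^ k)" using Suc Gamma_half_pos[of k] by (intro mult_mono) auto
  finally show ?case by simp
qed

text \<open>The even Gaussian moments, see \<open>gauss_has_integral\<close>.\<close>

definition gauss :: "real \<Rightarrow> nat \<Rightarrow> real" where
  "gauss L k = Gamma (real k + 1/2) * L powr (- (real k + 1/2))"

lemma powr_minus_half_nat: "L > 0 \<Longrightarrow> L powr (- (real k + 1/2)) = 1 / (L ^ k * sqrt L)"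
  unfolding powr_minus powr_add by (simp add: powr_realpow powr_half_sqrt inverse_eq_divide)

lemma gauss_has_integral:
  assumes "L > 0"
  shows "((\<lambda>x. exp (- (L * x\<^sup>2)) * x ^ (2 * k)) has_integral gauss L k) UNIV"
proof -
  define c where "c = sqrt L"
  have c: "c > 0" "c\<^sup>2 = L" using assms by (auto simp: c_def)
  have "has_bochner_integral lborel (\<lambda>x. exp (- x\<^sup>2) * x ^ (2 * k)) (2 *\<^sub>R (sqrt pi / 2 * (fact (2 * k) / (2 ^ (2 * k) * fact k))))"
    by (rule has_bochner_integral_even_function[OF gaussian_moment_even_pos]) simp
  hence "has_bochner_integral lborel (\<lambda>x. exp (- x\<^sup>2) * x ^ (2 * k)) (Gamma (real k + 1/2))"
    by (simp add: Gamma_half_fact)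
  hence "has_bochner_integral lborel (\<lambda>x. exp (- (0 + c * x)\<^sup>2) * (0 + c * x) ^ (2 * k)) (Gamma (real k + 1/2) /\<^sub>R \<bar>c\<bar>)"
    using c by (subst lborel_has_bochner_integral_real_affine_iff[symmetric]) auto
  from has_bochner_integral_mult_right[OF this, of "1 / L ^ k"]
  have A: "has_bochner_integral lborel (\<lambda>x. 1 / L ^ k * (exp (- (0 + c * x)\<^sup>2) * (0 + c * x) ^ (2 * k))) (1 / L ^ k * (Gamma (real k + 1/2) /\<^sub>R \<bar>c\<bar>))" by simp
  have B: "1 / L ^ k * (exp (- (0 + c * x)\<^sup>2) * (0 + c * x) ^ (2 * k)) = exp (- (L * x\<^sup>2)) * x ^ (2 * k)" for x
  proof -
    have "(0 + c * x) ^ (2 * k) = L ^ k * x ^ (2 * k)" unfolding add_0 power_mult_distrib by (subst power_mult[of c]) (simp only: c(2))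
    moreover have "(0 + c * x)\<^sup>2 = L * x\<^sup>2" using c(2) by (simp add: power_mult_distrib)
    ultimately show ?thesis using assms by (simp only:) simp
  qed
  have C: "1 / L ^ k * (Gamma (real k + 1/2) /\<^sub>R \<bar>c\<bar>) = gauss L k"
  proof -
    have "L powr (- (real k + 1/2)) = 1 / (L ^ k * c)"
      unfolding powr_minus_half_nat[OF assms] c_def ..
    moreover have "1 / x * (g /\<^sub>R \<bar>c\<bar>) = g * (1 / (x * c))" for x g
      using c(1) by (simp add: divide_inverse)
    ultimately show ?thesis by (simp only: gauss_def)
  qed
  have "has_bochner_integral lborel (\<lambda>x. exp (- (L * x\<^sup>2)) * x ^ (2 * k)) (gauss L k)"
    using A unfolding B C .
  from has_integral_integral_lborel[OF integrable.intros[OF this], unfolded has_bochner_integral_integral_eq[OF this]]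
  show ?thesis .
qed

text \<open>Outside the interval half of the exponent is traded for
  \<open>exp (- (L * b\<^sup>2 / 2))\<close>, and the other half still gives a complete
  moment.\<close>

lemma gauss_tail:
  assumes "L > 0" "b > 0" "((\<lambda>x. exp (- (L * x\<^sup>2)) * x ^ (2 * k)) has_integral J) {- b..b}"
  shows "\<bar>gauss L k - J\<bar> \<le> exp (- (L * b\<^sup>2 / 2)) * gauss (L / 2) k"
proof -
  define f where "f x = exp (- (L * x\<^sup>2)) * x ^ (2 * k)" for x
  have r: "((\<lambda>x. if x \<in> {- b..b} then f x else 0) has_integral J) UNIV"
    using assms(3) by (subst has_integral_restrict_UNIV) (simp add: f_def[abs_def])
  have "(f has_integral gauss L k) UNIV" unfolding f_def[abs_def] by (rule gauss_has_integral[OF assms(1)])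
  from has_integral_diff[OF this r]
  have d: "((\<lambda>x. f x - (if x \<in> {- b..b} then f x else 0)) has_integral gauss L k - J) UNIV" .
  have pw: "0 \<le> f x" "x \<notin> {- b..b} \<Longrightarrow> f x \<le> exp (- (L * b\<^sup>2 / 2)) * (exp (- (L / 2 * x\<^sup>2)) * x ^ (2 * k))" for x
  proof -
    show "0 \<le> f x" by (simp add: f_def)
    assume "x \<notin> {- b..b}"
    hence "b \<le> \<bar>x\<bar>" by auto
    hence "b\<^sup>2 \<le> x\<^sup>2" using assms(2) by (metis abs_le_square_iff abs_of_pos)
    hence "L * b\<^sup>2 \<le> L * x\<^sup>2" using assms(1) by simp
    hence "exp (- (L * x\<^sup>2)) \<le> exp (- (L * b\<^sup>2 / 2) + - (L / 2 * x\<^sup>2))" by simp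
    also have "\<dots> = exp (- (L * b\<^sup>2 / 2)) * exp (- (L / 2 * x\<^sup>2))" by (rule exp_add)
    finally have "exp (- (L * x\<^sup>2)) * x ^ (2 * k) \<le> exp (- (L * b\<^sup>2 / 2)) * exp (- (L / 2 * x\<^sup>2)) * x ^ (2 * k)"
      by (rule mult_right_mono) simp
    thus "f x \<le> exp (- (L * b\<^sup>2 / 2)) * (exp (- (L / 2 * x\<^sup>2)) * x ^ (2 * k))" by (simp add: f_def mult.assoc)
  qed
  have g: "((\<lambda>x. exp (- (L * b\<^sup>2 / 2)) * (exp (- (L / 2 * x\<^sup>2)) * x ^ (2 * k))) has_integral exp (- (L * b\<^sup>2 / 2)) * gauss (L / 2) k) UNIV"
    by (intro has_integral_mult_right gauss_has_integral) (use assms in simp)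
  have "gauss L k - J \<le> exp (- (L * b\<^sup>2 / 2)) * gauss (L / 2) k"
    by (rule has_integral_le[OF d g]) (use pw in \<open>auto intro!: mult_nonneg_nonneg\<close>)
  moreover have "0 \<le> gauss L k - J" by (rule has_integral_nonneg[OF d]) (use pw in auto)
  ultimately show ?thesis by simp
qed

text \<open>With \<open>s = \<tau>\<^sup>2\<close>, the real part of \<open>v^2\<close> is
  \<open>(1 - s) / (1 + s)^2 - 1\<close>, about \<open>- 3 s\<close>; for
  \<open>s \<le> 1/100\<close> the slope \<open>2.94\<close> is safe. The centre and radius of the
  circle are such that this piece of the line lies inside.\<close>

lemma saddle_v_line:
  fixes \<tau> :: real
  assumes "\<bar>\<tau>\<bar> \<le> 1/10"
  defines "u \<equiv> 1 + \<i> * of_real \<tau>"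
  shows "Re ((saddle_v u)\<^sup>2) \<le> - (294/100 * \<tau>\<^sup>2)" "(cmod (saddle_v u))\<^sup>2 \<le> 3 * \<tau>\<^sup>2" "cmod (saddle_dv u) \<le> 2" "u \<in> RHP" "u \<in> cball 6 (599/100)"
proof -
  have u: "Re u = 1" "Im u = \<tau>" by (auto simp: u_def)
  have t2: "\<tau>\<^sup>2 \<le> 1/100" using assms(1) abs_le_square_iff[of \<tau> "1/10"] by (simp add: power2_eq_square)
  show "u \<in> RHP" by (simp add: RHP_def u)
  have nz: "u \<noteq> 0" using u by auto
  have cu: "(cmod u)\<^sup>2 = 1 + \<tau>\<^sup>2" by (simp add: cmod_power2 u)
  have "Re (1 / u\<^sup>2) = (1 - \<tau>\<^sup>2) / (1 + \<tau>\<^sup>2)\<^sup>2"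
  proof -
    have "Re (1 / u\<^sup>2) = Re (u\<^sup>2) / (cmod (u\<^sup>2))\<^sup>2" unfolding Re_divide cmod_power2 by simp
    also have "Re (u\<^sup>2) = 1 - \<tau>\<^sup>2" by (simp add: power2_eq_square u)
    also have "cmod (u\<^sup>2) = 1 + \<tau>\<^sup>2" unfolding norm_power by (rule cu)
    finally show ?thesis .
  qed
  hence "Re ((saddle_v u)\<^sup>2) = (1 - \<tau>\<^sup>2) / (1 + \<tau>\<^sup>2)\<^sup>2 - 1" unfolding saddle_v_sq[OF nz] by (simp add: u)
  also have "\<dots> \<le> - (294/100 * \<tau>\<^sup>2)"
  proof -
    define s where "s = \<tau>\<^sup>2"
    have s: "0 \<le> s" "s \<le> 1/100" using t2 by (auto simp: s_def)
    have "(1 + s)\<^sup>2 * (1 - 294/100 * s) - (1 - s) = s * (6/100 - 488/100 * s - 294/100 * s\<^sup>2)"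
      by (simp add: power2_eq_square algebra_simps)
    moreover have "s\<^sup>2 \<le> 1/100 * (1/100)" unfolding power2_eq_square using s by (intro mult_mono) auto
    hence "0 \<le> s * (6/100 - 488/100 * s - 294/100 * s\<^sup>2)" using s by (intro mult_nonneg_nonneg) auto
    ultimately have "0 \<le> (1 + s)\<^sup>2 * (1 - 294/100 * s) - (1 - s)" by (simp only:)
    hence "1 - s \<le> (1 + s)\<^sup>2 * (1 - 294/100 * s)" by (rule diff_ge_0_iff_ge[THEN iffD1])
    hence "1 - s \<le> (1 - 294/100 * s) * (1 + s)\<^sup>2" by (simp only: mult.commute)
    hence "(1 - s) / (1 + s)\<^sup>2 \<le> 1 - 294/100 * s" using s by (subst divide_le_eq) (auto simp: add_nonneg_pos)
    thus ?thesis by (simp add: s_def)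
  qed
  finally show "Re ((saddle_v u)\<^sup>2) \<le> - (294/100 * \<tau>\<^sup>2)" .
  have c2: "(cmod (2 * u + 1))\<^sup>2 = 9 + 4 * \<tau>\<^sup>2" unfolding cmod_power2 by (simp add: u power2_eq_square)
  have "(cmod (saddle_v u))\<^sup>2 = \<tau>\<^sup>2 * (cmod (2 * u + 1) / (1 + \<tau>\<^sup>2))"
  proof -
    have "cmod (u - 1) = \<bar>\<tau>\<bar>" by (simp add: u_def norm_mult)
    thus ?thesis by (simp add: saddle_v_def norm_mult norm_divide power_mult_distrib power_divide cu norm_csqrt)
  qed
  also have "\<dots> \<le> \<tau>\<^sup>2 * 3"
  proof (intro mult_left_mono)
    have "(cmod (2 * u + 1))\<^sup>2 \<le> (3 * (1 + \<tau>\<^sup>2))\<^sup>2" unfolding c2 using zero_le_power2[of "\<tau>"] zero_le_power2[of "\<tau>\<^sup>2"] by (simp add: power2_eq_square algebra_simps del: zero_le_power2)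
    hence "cmod (2 * u + 1) \<le> 3 * (1 + \<tau>\<^sup>2)" by (rule power2_le_imp_le) (simp add: add_nonneg_nonneg)
    thus "cmod (2 * u + 1) / (1 + \<tau>\<^sup>2) \<le> 3" by (simp add: divide_le_eq add_pos_nonneg)
  qed simp
  finally show "(cmod (saddle_v u))\<^sup>2 \<le> 3 * \<tau>\<^sup>2" by simp
  have "cmod (u\<^sup>2 + u + 1) \<le> 10/3"
  proof -
    have "u\<^sup>2 + u + 1 = 3 + (\<i> * of_real (3 * \<tau>) + of_real (- \<tau>\<^sup>2))" by (simp add: u_def power2_eq_square algebra_simps)
    also have "cmod \<dots> \<le> 3 + (cmod (\<i> * of_real (3 * \<tau>)) + cmod (of_real (- \<tau>\<^sup>2)))"
      by (intro norm_triangle_le add_mono norm_triangle_ineq) simp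
    also have "\<dots> \<le> 3 + (3/10 + 1/100)" using assms(1) t2 by (intro add_mono) (simp_all add: norm_mult norm_power)
    finally show ?thesis by simp
  qed
  moreover have "5/3 \<le> cmod (csqrt (2 * u + 1))"
  proof -
    have "3\<^sup>2 \<le> (cmod (2 * u + 1))\<^sup>2" unfolding c2 by simp
    hence "3 \<le> cmod (2 * u + 1)" by (rule power2_le_imp_le) simp
    hence "(5/3)\<^sup>2 \<le> (cmod (csqrt (2 * u + 1)))\<^sup>2" by (simp add: norm_csqrt power2_eq_square)
    thus ?thesis by (rule power2_le_imp_le) simp
  qed
  moreover have "1 \<le> (cmod u)\<^sup>2" unfolding cu by simp
  ultimately have "cmod (u\<^sup>2 + u + 1) \<le> 2 * ((cmod u)\<^sup>2 * cmod (csqrt (2 * u + 1)))"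
    using mult_mono[of 1 "(cmod u)\<^sup>2" "5/3" "cmod (csqrt (2 * u + 1))"] by simp
  moreover have "(cmod u)\<^sup>2 * cmod (csqrt (2 * u + 1)) > 0" using right_half_plane[of u] u by simp
  ultimately show "cmod (saddle_dv u) \<le> 2" by (simp add: saddle_dv_def norm_divide norm_mult norm_power divide_le_eq)
  show "u \<in> cball 6 (599/100)"
  proof -
    have "6 - u = 5 - \<i> * of_real \<tau>" by (simp add: u_def)
    also have "cmod \<dots> \<le> 5 + \<bar>\<tau>\<bar>" by (rule order_trans[OF norm_triangle_ineq4]) (simp add: norm_mult)
    finally show ?thesis using assms(1) by (simp add: dist_norm)
  qed
qed

text \<open>The image of the segment is a curve with conjugate end points, not a piece of the
  imaginary axis. The numbers are \<open>2.94 / 100\<close> and a bound for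
  \<open>sqrt 3 / 10\<close>.\<close>

lemma saddle_v_endpoint:
  defines "p \<equiv> saddle_v (1 + \<i> * of_real (1/10))"
  shows "saddle_v (1 - \<i> * of_real (1/10)) = cnj p" "Im p > 0" "(Im p)\<^sup>2 \<ge> 294 / 10000" "cmod p \<le> 18/100" "Re (p\<^sup>2) \<le> - (294/10000)"
proof -
  define u :: complex where "u = 1 + \<i> * of_real (1/10)"
  have u: "Re u = 1" "Im u = 1/10" by (auto simp: u_def)
  note line = saddle_v_line[of "1/10", folded u_def]
  have p: "p = saddle_v u" by (simp add: p_def u_def)
  show Rep: "Re (p\<^sup>2) \<le> - (294/10000)" using line(1) unfolding p by (simp add: power2_eq_square)
  have "(cmod p)\<^sup>2 \<le> (18/100)\<^sup>2" using line(2) unfolding p by (simp add: power2_eq_square)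
  thus "cmod p \<le> 18/100" by (rule power2_le_imp_le) simp
  have "Re (p\<^sup>2) = (Re p)\<^sup>2 - (Im p)\<^sup>2" by (simp add: power2_eq_square)
  thus I: "(Im p)\<^sup>2 \<ge> 294 / 10000" using Rep zero_le_power2[of "Re p"] by linarith
  have "1 - \<i> * of_real (1/10) = cnj u" by (simp add: u_def)
  moreover have "cnj (csqrt (2 * u + 1)) = csqrt (cnj (2 * u + 1))" by (rule cnj_csqrt) (use right_half_plane[of u] u in auto)
  ultimately show "saddle_v (1 - \<i> * of_real (1/10)) = cnj p" by (simp add: p saddle_v_def)
  define s where "s = csqrt (2 * u + 1)"
  have s2: "s\<^sup>2 = 2 * u + 1" by (simp add: s_def)
  \<comment> \<open>The sign of \<open>Im p\<close> cannot be read off from \<open>p^2\<close>. It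
    comes from the principal root \<open>s\<close>, whose real and imaginary part have the positive
    product \<open>1/10\<close>.\<close>
  have "Re s \<ge> 0" using csqrt_principal[of "2 * u + 1"] by (auto simp: s_def)
  moreover have "2 * Re s * Im s = 1/5" using arg_cong[OF s2, of Im] by (simp add: u power2_eq_square mult_ac)
  ultimately have s: "Re s > 0" "Im s > 0"
  proof -
    assume R: "Re s \<ge> 0" and RI: "2 * Re s * Im s = 1/5"
    have "0 < Re s * Im s" using RI by simp
    thus "Re s > 0" "Im s > 0" using R by (auto simp: zero_less_mult_iff)
  qed
  have "p = \<i> * of_real (1/10) * s * cnj u / of_real ((cmod u)\<^sup>2)"
  proof -
    have "p = \<i> * of_real (1/10) * s / u" by (simp add: p saddle_v_def s_def u_def)
    moreover have "x / u = x * cnj u / of_real ((cmod u)\<^sup>2)" for x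
      using right_half_plane(1)[of u] u unfolding complex_norm_square by simp
    ultimately show ?thesis by simp
  qed
  hence "Im p = Im (\<i> * of_real (1/10) * s * cnj u) / (cmod u)\<^sup>2" by (simp only: Im_divide_of_real)
  also have "Im (\<i> * of_real (1/10) * s * cnj u) = (Re s + Im s / 10) / 10" by (simp add: u field_simps)
  finally show "Im p > 0" using s right_half_plane(1)[of u] u by simp
qed

lemma entire_primitive:
  assumes "f holomorphic_on UNIV"
  shows "\<exists>F. \<forall>z. (F has_field_derivative f z) (at z)"
proof -
  obtain F where "\<And>z. z \<in> UNIV \<Longrightarrow> (F has_field_derivative f z) (at z)"
    by (rule holomorphic_convex_primitive'[OF convex_UNIV open_UNIV assms]) blast
  thus ?thesis by blast
qed

text \<open>From \<open>p\<close> the path goes horizontally to the imaginary axis. The imaginary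
  part is constant and the real part shrinks, so the integrand is largest in modulus at
  \<open>p\<close>.\<close>

lemma gauss_moment_endpoint:
  fixes L :: real and k :: nat
  assumes L: "L > 0" and F: "\<And>z. (F has_field_derivative exp (of_real L * z\<^sup>2) * z ^ k) (at z)"
    and p: "cmod p \<le> 1"
  shows "cmod (F p - F (\<i> * of_real (Im p))) \<le> exp (L * Re (p\<^sup>2)) * cmod p ^ Suc k"
proof -
  define q where "q = \<i> * of_real (Im p)"
  have "((\<lambda>z. exp (of_real L * z\<^sup>2) * z ^ k) has_contour_integral F p - F q) (linepath q p)"
    using contour_integral_primitive[of UNIV F _ "linepath q p"] F by simp
  hence "cmod (F p - F q) \<le> (exp (L * Re (p\<^sup>2)) * cmod p ^ k) * cmod (p - q)"
  proof (rule has_contour_integral_bound_linepath)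
    fix x assume x: "x \<in> closed_segment q p"
    then obtain t where t: "0 \<le> t" "t \<le> 1" "x = (1 - t) *\<^sub>R q + t *\<^sub>R p" by (auto simp: in_segment)
    have x: "Re x = t * Re p" "Im x = Im p" by (auto simp: t q_def algebra_simps)
    have "(t * Re p)\<^sup>2 \<le> (Re p)\<^sup>2" using t unfolding power_mult_distrib by (intro mult_left_le_one_le power_le_one) auto
    hence "Re (x\<^sup>2) \<le> Re (p\<^sup>2)" "(cmod x)\<^sup>2 \<le> (cmod p)\<^sup>2" unfolding cmod_power2 by (auto simp: x power2_eq_square)
    from this(1) power2_le_imp_le[OF this(2)] show "cmod (exp (of_real L * x\<^sup>2) * x ^ k) \<le> exp (L * Re (p\<^sup>2)) * cmod p ^ k"
      unfolding norm_mult norm_power using L by (intro mult_mono power_mono) auto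
  qed (auto)
  also have "p - q = of_real (Re p)" by (simp add: q_def complex_eq_iff)
  hence "cmod (p - q) \<le> cmod p" using abs_Re_le_cmod[of p] by simp
  hence "(exp (L * Re (p\<^sup>2)) * cmod p ^ k) * cmod (p - q) \<le> (exp (L * Re (p\<^sup>2)) * cmod p ^ k) * cmod p" by (intro mult_left_mono) auto
  finally show ?thesis by (simp add: q_def mult_ac)
qed

lemma gauss_moment_middle:
  fixes L :: real and k :: nat
  assumes F: "\<And>z. (F has_field_derivative exp (of_real L * z\<^sup>2) * z ^ k) (at z)" and b: "b > 0"
  shows "((\<lambda>x. of_real (exp (- (L * x\<^sup>2)) * x ^ k)) has_integral ((F (\<i> * of_real b) - F (- (\<i> * of_real b))) / \<i> ^ Suc k)) {- b..b}"
proof -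
  have "((\<lambda>z. exp (of_real L * z\<^sup>2) * z ^ k) has_contour_integral F (\<i> * of_real b) - F (- (\<i> * of_real b))) (linepath (- (\<i> * of_real b)) (\<i> * of_real b))"
    using contour_integral_primitive[of UNIV F _ "linepath (- (\<i> * of_real b)) (\<i> * of_real b)"] F by simp
  hence "((\<lambda>x. exp (of_real L * (Complex 0 x)\<^sup>2) * (Complex 0 x) ^ k) has_integral (- \<i> * (F (\<i> * of_real b) - F (- (\<i> * of_real b))))) {- b..b}"
    using b by (subst (asm) has_contour_integral_linepath_same_Re_iff[where c = 0 and a = "- b" and b = b]) auto
  from has_integral_mult_right[OF this, of "1 / \<i> ^ k"]
  have "((\<lambda>x. 1 / \<i> ^ k * (exp (of_real L * (Complex 0 x)\<^sup>2) * (Complex 0 x) ^ k)) has_integral (1 / \<i> ^ k * (- \<i> * (F (\<i> * of_real b) - F (- (\<i> * of_real b)))))) {- b..b}" .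
  moreover have "1 / \<i> ^ k * (exp (of_real L * (Complex 0 x)\<^sup>2) * (Complex 0 x) ^ k) = of_real (exp (- (L * x\<^sup>2)) * x ^ k)" for x
  proof -
    have "Complex 0 x = \<i> * of_real x" by (simp add: complex_eq_iff)
    thus ?thesis by (simp add: power_mult_distrib exp_of_real flip: of_real_power of_real_mult of_real_minus)
  qed
  moreover have "1 / \<i> ^ k * (- \<i> * d) = d / \<i> ^ Suc k" for d by (simp add: field_simps)
  ultimately show ?thesis by (simp only:)
qed

text \<open>The integrand is entire, so the curve from \<open>cnj p\<close> to \<open>p\<close> may
  be replaced by two short horizontal pieces and a stretch of the imaginary axis. There the odd
  moments vanish and the even ones are completed to the whole line.\<close>

lemma gauss_moment:
  fixes L :: real and k :: nat
  assumes L: "L > 0" and F: "\<And>z. (F has_field_derivative exp (of_real L * z\<^sup>2) * z ^ k) (at z)"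
    and p: "cmod p \<le> 1" "Im p > 0"
  shows "cmod (F p - F (cnj p) - \<i> ^ Suc k * of_real (if even k then gauss L (k div 2) else 0))
    \<le> 2 * exp (L * Re (p\<^sup>2)) * cmod p ^ Suc k + (if even k then exp (- (L * (Im p)\<^sup>2 / 2)) * gauss (L / 2) (k div 2) else 0)"
proof -
  define b where "b = Im p"
  define g where "g = (\<lambda>x. exp (- (L * x\<^sup>2)) * x ^ k)"
  define J where "J = integral {- b..b} g"
  have J: "(g has_integral J) {- b..b}"
    unfolding J_def by (intro integrable_integral integrable_continuous_interval) (auto simp: g_def intro!: continuous_intros)
  hence "((\<lambda>x. complex_of_real (g x)) has_integral of_real J) {- b..b}"
    using has_integral_linear[OF J bounded_linear_of_real] by (simp add: o_def)
  moreover have "((\<lambda>x. complex_of_real (g x)) has_integral ((F (\<i> * of_real b) - F (- (\<i> * of_real b))) / \<i> ^ Suc k)) {- b..b}"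
    unfolding g_def by (rule gauss_moment_middle[OF F]) (use p in \<open>simp add: b_def\<close>)
  ultimately have "of_real J = (F (\<i> * of_real b) - F (- (\<i> * of_real b))) / \<i> ^ Suc k" by (rule has_integral_unique)
  hence mid: "F (\<i> * of_real b) - F (- (\<i> * of_real b)) = \<i> ^ Suc k * of_real J" by simp
  have e1: "cmod (F p - F (\<i> * of_real b)) \<le> exp (L * Re (p\<^sup>2)) * cmod p ^ Suc k"
    unfolding b_def by (rule gauss_moment_endpoint[OF L F p(1)])
  have e2: "cmod (F (cnj p) - F (- (\<i> * of_real b))) \<le> exp (L * Re (p\<^sup>2)) * cmod p ^ Suc k"
    using gauss_moment_endpoint[OF L F, of "cnj p"] p by (simp add: b_def power2_eq_square)
  define G where "G = (if even k then gauss L (k div 2) else 0)"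
  have e3: "\<bar>J - G\<bar> \<le> (if even k then exp (- (L * (Im p)\<^sup>2 / 2)) * gauss (L / 2) (k div 2) else 0)"
  proof (cases "even k")
    case True
    then obtain m where m: "k = 2 * m" by blast
    have "\<bar>gauss L m - J\<bar> \<le> exp (- (L * b\<^sup>2 / 2)) * gauss (L / 2) m"
      by (rule gauss_tail[OF L]) (use J p in \<open>simp_all add: b_def g_def m\<close>)
    thus ?thesis by (simp add: G_def m b_def abs_minus_commute)
  next
    case False
    have "((\<lambda>x. g (- x)) has_integral J) {- b..- (- b)}" unfolding has_integral_reflect_real using J by simp
    moreover have "g (- x) = - g x" for x using False by (simp add: g_def)
    ultimately have "((\<lambda>x. - g x) has_integral J) {- b..b}" by simp
    moreover have "((\<lambda>x. - g x) has_integral - J) {- b..b}" using J by (rule has_integral_neg)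
    ultimately have "J = - J" by (rule has_integral_unique)
    thus ?thesis using False by (simp add: G_def)
  qed
  have "F p - F (cnj p) - \<i> ^ Suc k * of_real G = (F p - F (\<i> * of_real b)) - (F (cnj p) - F (- (\<i> * of_real b))) + \<i> ^ Suc k * of_real (J - G)"
    unfolding of_real_diff right_diff_distrib mid[symmetric] by simp
  also have "cmod \<dots> \<le> exp (L * Re (p\<^sup>2)) * cmod p ^ Suc k + exp (L * Re (p\<^sup>2)) * cmod p ^ Suc k + \<bar>J - G\<bar>"
    by (intro norm_triangle_le add_mono order_trans[OF norm_triangle_ineq4] e1 e2) (simp add: norm_mult norm_power del: power_Suc)
  finally have bd: "cmod (F p - F (cnj p) - \<i> ^ Suc k * of_real G) \<le> exp (L * Re (p\<^sup>2)) * cmod p ^ Suc k + exp (L * Re (p\<^sup>2)) * cmod p ^ Suc k + \<bar>J - G\<bar>" .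
  have aux: "x \<le> 2 * a * c + z" if "x \<le> a * c + a * c + y" "y \<le> z" for x y z a c :: real using that by simp
  show ?thesis using aux[OF bd e3] unfolding G_def .
qed

lemma sum_even_index:
  fixes f :: "nat \<Rightarrow> 'a::comm_monoid_add"
  shows "(\<Sum>k<2 * M. if even k then f (k div 2) else 0) = (\<Sum>m<M. f m)"
proof (induction M)
  case (Suc M)
  have "{..<2 * Suc M} = insert (Suc (2 * M)) (insert (2 * M) {..<2 * M})" by auto
  thus ?case using Suc by (simp add: add.commute)
qed simp

text \<open>\<open>L \<ge> M\<close> compensates the growth of Gamma, which is bounded by
  \<open>2 * M ^ m\<close>. The coarse bound suffices because it is multiplied by an exponentially
  small number.\<close>

lemma gauss_half_bound:
  assumes "m \<le> M" "M \<ge> 1" "L \<ge> real M"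
  shows "gauss (L / 2) m \<le> 3 * 2 ^ m"
proof -
  have L: "L \<ge> 1" "L > 0" using assms by auto
  have "(L / 2) powr (- (real m + 1/2)) = (2 / L) ^ m * sqrt (2 / L)"
    using L by (subst powr_minus_half_nat) (auto simp: power_divide real_sqrt_divide)
  also have "\<dots> \<le> (2 / L) ^ m * (3/2)"
  proof (intro mult_left_mono real_le_lsqrt)
    show "2 / L \<le> (3/2)\<^sup>2" using L by (simp add: divide_le_eq power2_eq_square)
  qed (use L in auto)
  finally have 1: "(L / 2) powr (- (real m + 1/2)) \<le> (2 / L) ^ m * (3/2)" .
  have "gauss (L / 2) m \<le> (2 * real M ^ m) * ((2 / L) ^ m * (3/2))"
    unfolding gauss_def using Gamma_half_bound[OF assms(1)] 1 by (intro mult_mono) auto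
  also have "\<dots> = 3 * 2 ^ m * (real M / L) ^ m" by (simp add: power_divide)
  also have "\<dots> \<le> 3 * 2 ^ m * 1" using L assms by (intro mult_left_mono power_le_one) auto
  finally show ?thesis by simp
qed

lemma saddle_integral:
  fixes L a :: real and M :: nat
  assumes a: "a \<ge> 0" and M: "M \<ge> 1" and LM: "L \<ge> real M"
  defines "f \<equiv> (\<lambda>\<tau>::real. exp (of_real L * (saddle_v (1 + \<i> * of_real \<tau>))\<^sup>2) * (1 + \<i> * of_real \<tau>) powr of_real a)"
  shows "cmod (integral {- (1/10)..1/10} f - (\<Sum>m<M. (- 1) ^ m * saddle_g a (2 * m) * of_real (gauss L m)))
    \<le> 12 powr a * (12 * (real M + 1) * (3/4) ^ M * gauss (294/100 * L) M + 20 * exp (- (147/10000 * L)))"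
proof -
  have L: "L > 0" "L \<ge> 1" using M LM by auto
  define u where "u \<tau> = 1 + \<i> * complex_of_real \<tau>" for \<tau>
  define v where "v \<tau> = saddle_v (u \<tau>)" for \<tau>
  define E where "E \<tau> = exp (of_real L * (v \<tau>)\<^sup>2)" for \<tau>
  define I where "I = {- (1/10::real)..1/10}"
  have uR: "u \<tau> \<in> RHP" for \<tau> by (simp add: u_def RHP_def)
  have cu: "continuous_on I u" unfolding u_def by (intro continuous_intros)
  have holc: "continuous_on I (\<lambda>\<tau>. h (u \<tau>))" if "h holomorphic_on RHP" for h
    by (rule continuous_on_compose2[OF holomorphic_on_imp_continuous_on[OF that] cu]) (use uR in auto)
  have cont: "continuous_on I v" "continuous_on I (\<lambda>\<tau>. u \<tau> powr of_real a)" "continuous_on I (\<lambda>\<tau>. saddle_dv (u \<tau>))" "continuous_on I (\<lambda>\<tau>. saddle_H a (2 * M) (u \<tau>))"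
    unfolding v_def by (intro holc saddle_holo saddle_H_holo)+
  have cE: "continuous_on I E" unfolding E_def by (intro continuous_intros cont)
  have "\<exists>F. \<forall>z. (F has_field_derivative exp (of_real L * z\<^sup>2) * z ^ k) (at (z::complex))" for k :: nat
    by (rule entire_primitive[where f = "\<lambda>z. exp (of_real L * z\<^sup>2) * z ^ k"]) (intro holomorphic_intros)
  then obtain F where F: "\<And>k z. (F k has_field_derivative exp (of_real L * z\<^sup>2) * z ^ k) (at (z::complex))" by metis
  \<comment> \<open>The polynomial part in \<open>v\<close>: after the substitution it has an
    explicit primitive, whereas \<open>R\<close> is merely estimated.\<close>
  define S where "S \<tau> = (\<Sum>k<2 * M. saddle_g a k * (E \<tau> * v \<tau> ^ k)) * saddle_dv (u \<tau>)" for \<tau>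
  define R where "R \<tau> = E \<tau> * v \<tau> ^ (2 * M) * saddle_H a (2 * M) (u \<tau>) * saddle_dv (u \<tau>)" for \<tau>
  have fSR: "f \<tau> = S \<tau> + R \<tau>" for \<tau>
  proof -
    have nz: "saddle_dv (u \<tau>) \<noteq> 0" using saddle_dv_nonzero uR by (simp add: RHP_def)
    have "u \<tau> powr of_real a = ((\<Sum>k<2 * M. saddle_g a k * v \<tau> ^ k) + v \<tau> ^ (2 * M) * saddle_H a (2 * M) (u \<tau>)) * saddle_dv (u \<tau>)"
      unfolding v_def saddle_expansion[OF uR, of \<tau> a "2 * M", symmetric] using nz by simp
    hence "f \<tau> = E \<tau> * (((\<Sum>k<2 * M. saddle_g a k * v \<tau> ^ k) + v \<tau> ^ (2 * M) * saddle_H a (2 * M) (u \<tau>)) * saddle_dv (u \<tau>))"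
      by (simp add: f_def E_def v_def u_def)
    also have "\<dots> = E \<tau> * (\<Sum>k<2 * M. saddle_g a k * v \<tau> ^ k) * saddle_dv (u \<tau>) + R \<tau>" by (simp add: R_def algebra_simps)
    also have "E \<tau> * (\<Sum>k<2 * M. saddle_g a k * v \<tau> ^ k) = (\<Sum>k<2 * M. saddle_g a k * (E \<tau> * v \<tau> ^ k))"
      by (simp add: sum_distrib_left mult_ac)
    finally show ?thesis by (simp add: S_def)
  qed
  define p where "p = v (1/10)"
  have p': "p = saddle_v (1 + \<i> * of_real (1/10))" by (simp add: p_def v_def u_def)
  note pe = saddle_v_endpoint[folded p']
  have q: "v (- (1/10)) = cnj p" using pe(1) by (simp add: v_def u_def)
  define D where "D = (\<Sum>k<2 * M. saddle_g a k * (F k p - F k (cnj p)))"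
  have "((\<lambda>\<tau>. \<i> * S \<tau>) has_integral (\<Sum>k<2 * M. saddle_g a k * F k (v (1/10))) - (\<Sum>k<2 * M. saddle_g a k * F k (v (- (1/10))))) {- (1/10)..1/10}"
  proof (rule fundamental_theorem_of_calculus)
    fix \<tau> :: real
    have "(saddle_v has_field_derivative saddle_dv (u \<tau>)) (at (u \<tau>) within u ` I)"
      by (rule has_field_derivative_at_within, rule saddle_v_deriv) (use uR[of \<tau>] in \<open>simp add: RHP_def\<close>)
    moreover have "(u has_vector_derivative \<i>) (at \<tau> within I)"
      unfolding u_def[abs_def] has_vector_derivative_def
      by (rule derivative_eq_intros refl | simp add: scaleR_conv_of_real mult.commute)+
    ultimately have v': "(v has_vector_derivative \<i> * saddle_dv (u \<tau>)) (at \<tau> within I)"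
      using field_vector_diff_chain_within[of u \<i> \<tau> I saddle_v "saddle_dv (u \<tau>)"] by (simp add: v_def[abs_def] o_def)
    have "((\<lambda>z. \<Sum>k<2 * M. saddle_g a k * F k z) has_field_derivative (\<Sum>k<2 * M. saddle_g a k * (exp (of_real L * (v \<tau>)\<^sup>2) * v \<tau> ^ k))) (at (v \<tau>) within v ` I)"
      by (intro DERIV_sum DERIV_cmult has_field_derivative_at_within[OF F])
    from field_vector_diff_chain_within[OF v' this]
    show "((\<lambda>\<tau>. \<Sum>k<2 * M. saddle_g a k * F k (v \<tau>)) has_vector_derivative \<i> * S \<tau>) (at \<tau> within {- (1/10)..1/10})"
      by (simp add: o_def S_def E_def I_def mult_ac)
  qed simp
  hence "((\<lambda>\<tau>. \<i> * S \<tau>) has_integral D) I" unfolding q by (simp add: p_def[symmetric] I_def D_def sum_subtractf right_diff_distrib)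
  from has_integral_mult_right[OF this, of "- \<i>"] have S: "(S has_integral - \<i> * D) I" by simp
  have R: "R integrable_on I" unfolding I_def
    by (rule integrable_continuous_interval, fold I_def) (unfold R_def, intro continuous_intros cont cE)
  \<comment> \<open>Here \<open>3 ^ M\<close> bounds the growth of \<open>v ^ (2 * M)\<close>,
    \<open>4 ^ M\<close> in the denominator comes from the bound for \<open>saddle_H\<close>, and
    the 12 contains the bound 2 for \<open>saddle_dv\<close>.\<close>
  define B where "B = 12 powr a * (12 * (real M + 1) * (3/4) ^ M)"
  have B0: "B \<ge> 0" by (simp add: B_def)
  define h where "h \<tau> = B * (exp (- (294/100 * L * \<tau>\<^sup>2)) * \<tau> ^ (2 * M))" for \<tau>
  have h: "(h has_integral B * gauss (294/100 * L) M) UNIV"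
    unfolding h_def by (intro has_integral_mult_right gauss_has_integral) (use L in simp)
  have hI: "h integrable_on I" unfolding I_def
    by (rule integrable_continuous_interval) (unfold h_def, intro continuous_intros)
  have bound: "cmod (R \<tau>) \<le> h \<tau>" if "\<tau> \<in> I" for \<tau>
  proof -
    have t: "\<bar>\<tau>\<bar> \<le> 1/10" using that by (auto simp: I_def)
    note line = saddle_v_line[OF t, folded u_def v_def]
    have "cmod (E \<tau>) \<le> exp (- (294/100 * L * \<tau>\<^sup>2))"
      using mult_left_mono[OF line(1), of L] L by (simp add: E_def algebra_simps)
    moreover have "cmod (v \<tau> ^ (2 * M)) \<le> 3 ^ M * \<tau> ^ (2 * M)"
    proof -
      have "cmod (v \<tau> ^ (2 * M)) = ((cmod (v \<tau>))\<^sup>2) ^ M" by (simp add: norm_power power_mult)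
      also have "\<dots> \<le> (3 * \<tau>\<^sup>2) ^ M" using line(2) by (intro power_mono) auto
      finally show ?thesis by (simp add: power_mult_distrib power_mult)
    qed
    moreover have "cmod (saddle_H a (2 * M) (u \<tau>)) \<le> 12 powr a * (6 + 3 * real (2 * M)) / 2 ^ (2 * M)"
      by (rule saddle_H_bound[OF a line(5)])
    ultimately have "cmod (R \<tau>) \<le> exp (- (294/100 * L * \<tau>\<^sup>2)) * (3 ^ M * \<tau> ^ (2 * M)) * (12 powr a * (6 + 3 * real (2 * M)) / 2 ^ (2 * M)) * 2"
      unfolding R_def norm_mult using line(3) by (intro mult_mono) auto
    also have "\<dots> = h \<tau>"
    proof -
      have alg: "e * (x * t) * (w * (6 + 3 * (2 * n)) / y) * 2 = w * (12 * (n + 1) * (x / y)) * (e * t)" for e x t w n y :: real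
        by (simp add: algebra_simps add_divide_distrib)
      have "(3/4::real) ^ M = 3 ^ M / 2 ^ (2 * M)" by (simp add: power_divide power_mult)
      thus ?thesis unfolding h_def B_def of_nat_mult of_nat_numeral alg by simp
    qed
    finally show ?thesis .
  qed
  have "cmod (integral I R) \<le> integral I h" by (rule integral_norm_bound_integral[OF R hI bound])
  also have "\<dots> \<le> integral UNIV h"
    by (rule integral_subset_le) (use hI h B0 in \<open>auto simp: h_def intro!: mult_nonneg_nonneg\<close>)
  also have "\<dots> = B * gauss (294/100 * L) M" using h by (rule integral_unique)
  finally have R_bound: "cmod (integral I R) \<le> B * gauss (294/100 * L) M" .
  define e where "e = exp (- (147/10000 * L))"
  have mom: "cmod (- \<i> * D - (\<Sum>m<M. (- 1) ^ m * saddle_g a (2 * m) * of_real (gauss L m))) \<le> 12 powr a * (20 * e)"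
  proof -
    define G where "G k = (if even k then gauss L (k div 2) else 0)" for k
    have "(\<Sum>m<M. (- 1) ^ m * saddle_g a (2 * m) * of_real (gauss L m)) = (\<Sum>k<2 * M. if even k then (- 1) ^ (k div 2) * saddle_g a (2 * (k div 2)) * of_real (gauss L (k div 2)) else 0)"
      by (rule sum_even_index[symmetric])
    also have "\<dots> = (\<Sum>k<2 * M. - \<i> * (saddle_g a k * (\<i> ^ Suc k * of_real (G k))))"
    proof (intro sum.cong refl)
      fix k :: nat
      show "(if even k then (- 1) ^ (k div 2) * saddle_g a (2 * (k div 2)) * of_real (gauss L (k div 2)) else 0) = - \<i> * (saddle_g a k * (\<i> ^ Suc k * of_real (G k)))"
      proof (cases "even k")
        case True
        then obtain m where m: "k = 2 * m" by blast
        have "\<i> ^ k = (- 1) ^ m" by (simp add: m power_mult)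
        have B: "x * y * z = - \<i> * (y * (\<i> * x * z))" for x y z :: complex
        proof -
          have "- j * (y * (j * x * z)) = - (j * j) * (x * y * z)" for j :: complex by (simp add: mult_ac)
          from this[of \<i>] have "- \<i> * (y * (\<i> * x * z)) = - (\<i> * \<i>) * (x * y * z)" .
          also have "- (\<i> * \<i>) * w = w" for w by simp
          finally show ?thesis by (rule sym)
        qed
        have "\<i> ^ Suc k = \<i> * (- 1) ^ m" "G k = gauss L m" "k div 2 = m"
          using \<open>\<i> ^ k = (- 1) ^ m\<close> by (simp_all add: G_def m)
        with B[of "(- 1) ^ m" "saddle_g a k" "of_real (gauss L m)"] True show ?thesis by (simp only: m if_True)
      qed (simp add: G_def)
    qed
    finally have "- \<i> * D - (\<Sum>m<M. (- 1) ^ m * saddle_g a (2 * m) * of_real (gauss L m)) = - \<i> * (\<Sum>k<2 * M. saddle_g a k * (F k p - F k (cnj p) - \<i> ^ Suc k * of_real (G k)))"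
      by (simp add: D_def right_diff_distrib sum_subtractf sum_distrib_left)
    hence "cmod (- \<i> * D - (\<Sum>m<M. (- 1) ^ m * saddle_g a (2 * m) * of_real (gauss L m))) = cmod (\<Sum>k<2 * M. saddle_g a k * (F k p - F k (cnj p) - \<i> ^ Suc k * of_real (G k)))"
      by (simp add: norm_mult)
    \<comment> \<open>The coefficient bound \<open>3 / 2 ^ k\<close> meets
      \<open>2 * (18/100) ^ Suc k\<close> from the end points and \<open>3 * 2 ^ (k div 2)\<close>
      from the tails. Both resulting series are geometric, with total below 20.\<close>
    also have "\<dots> \<le> (\<Sum>k<2 * M. 12 powr a * e * (108/100 * (9/100) ^ k) + (if even k then 12 powr a * e * (9 * (1/2) ^ (k div 2)) else 0))"
    proof (rule sum_norm_le)
      fix k assume k: "k \<in> {..<2 * M}"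
      have e1: "exp (L * Re (p\<^sup>2)) \<le> e" unfolding e_def using mult_left_mono[OF pe(5), of L] L by simp
      have e2: "exp (- (L * (Im p)\<^sup>2 / 2)) \<le> e" unfolding e_def using mult_left_mono[OF pe(3), of L] L by simp
      have g: "cmod (saddle_g a k) \<le> 3 * 12 powr a / 2 ^ k" by (rule saddle_g_bound[OF a])
      have "cmod (F k p - F k (cnj p) - \<i> ^ Suc k * of_real (G k)) \<le> 2 * exp (L * Re (p\<^sup>2)) * cmod p ^ Suc k + (if even k then exp (- (L * (Im p)\<^sup>2 / 2)) * gauss (L / 2) (k div 2) else 0)"
        unfolding G_def by (rule gauss_moment[OF L(1) F]) (use pe in auto)
      also have "\<dots> \<le> 2 * e * (18/100) ^ Suc k + (if even k then e * (3 * 2 ^ (k div 2)) else 0)"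
      proof (intro add_mono mult_mono power_mono)
        show "(if even k then exp (- (L * (Im p)\<^sup>2 / 2)) * gauss (L / 2) (k div 2) else 0) \<le> (if even k then e * (3 * 2 ^ (k div 2)) else 0)"
        proof -
          have "k div 2 \<le> M" using k by auto
          note g2 = gauss_half_bound[OF this M LM]
          have "0 \<le> gauss (L / 2) (k div 2)" unfolding gauss_def by (intro mult_nonneg_nonneg less_imp_le[OF Gamma_half_pos]) simp
          moreover have "0 \<le> e" by (simp add: e_def)
          ultimately show ?thesis using mult_mono[OF e2 g2] by simp
        qed
      qed (use e1 pe in \<open>auto simp: e_def\<close>)
      finally have "cmod (saddle_g a k * (F k p - F k (cnj p) - \<i> ^ Suc k * of_real (G k))) \<le> (3 * 12 powr a / 2 ^ k) * (2 * e * (18/100) ^ Suc k + (if even k then e * (3 * 2 ^ (k div 2)) else 0))"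
        unfolding norm_mult using g by (intro mult_mono) auto
      also have "\<dots> = 12 powr a * e * (108/100 * (9/100) ^ k) + (if even k then 12 powr a * e * (9 * (1/2) ^ (k div 2)) else 0)"
      proof -
        define y t where "y = (2::real) ^ k" and "t = (9/100::real) ^ k"
        have y: "y > 0" by (simp add: y_def)
        have pw: "(18/100::real) ^ Suc k = 18/100 * (t * y)" by (simp add: y_def t_def flip: power_mult_distrib)
        have 1: "(3 * 12 powr a / y) * (2 * e * (18/100) ^ Suc k) = 12 powr a * e * (108/100 * t)"
        proof -
          have "(3 * w / x) * (2 * c * (18/100 * (d * x))) = w * c * (108/100 * d)" if "x > 0" for w x c d :: real
            using that by simp
          from this[OF y] show ?thesis unfolding pw .
        qed
        have 2: "(3 * 12 powr a / y) * (if even k then e * (3 * 2 ^ (k div 2)) else 0) = (if even k then 12 powr a * e * (9 * (1/2) ^ (k div 2)) else 0)"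
        proof (cases "even k")
          case True
          hence "y = 2 ^ (k div 2) * 2 ^ (k div 2)" unfolding y_def by (simp flip: power_add mult_2)
          moreover have "(3 * w / (h * h)) * (e * (3 * h)) = w * e * (9 * (1 / h))" if "h > 0" for w h :: real using that by simp
          ultimately show ?thesis using True by (simp add: power_divide)
        qed simp
        show ?thesis unfolding distrib_left 1[unfolded y_def] 2[unfolded y_def] t_def ..
      qed
      finally show "cmod (saddle_g a k * (F k p - F k (cnj p) - \<i> ^ Suc k * of_real (G k))) \<le> \<dots>" .
    qed
    also have "\<dots> = 12 powr a * e * (108/100 * (\<Sum>k<2 * M. (9/100) ^ k) + 9 * (\<Sum>k<M. (1/2) ^ k))"
      unfolding sum.distrib sum_even_index[of "\<lambda>m. 12 powr a * e * (9 * (1/2) ^ m)"] by (simp add: sum_distrib_left distrib_left)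
    also have "\<dots> \<le> 12 powr a * e * 20"
    proof (intro mult_left_mono)
      have g: "(\<Sum>k<n. x ^ k) \<le> 1 / (1 - x)" if "0 \<le> x" "x < 1" for n and x :: real
        using that by (simp add: sum_gp_strict divide_right_mono)
      from g[of "9/100" "2 * M"] g[of "1/2" M]
      show "108/100 * (\<Sum>k<2 * M. (9/100::real) ^ k) + 9 * (\<Sum>k<M. (1/2) ^ k) \<le> 20" by simp
    qed (simp add: e_def)
    finally show ?thesis by (simp add: mult_ac)
  qed
  have "integral I f = - \<i> * D + integral I R"
    unfolding fSR[abs_def] using S R by (subst integral_add) (auto simp: integral_unique has_integral_integrable)
  hence eq: "integral I f - (\<Sum>m<M. (- 1) ^ m * saddle_g a (2 * m) * of_real (gauss L m)) = (- \<i> * D - (\<Sum>m<M. (- 1) ^ m * saddle_g a (2 * m) * of_real (gauss L m))) + integral I R" by simp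
  have "cmod (integral I f - (\<Sum>m<M. (- 1) ^ m * saddle_g a (2 * m) * of_real (gauss L m))) \<le> 12 powr a * (20 * e) + B * gauss (294/100 * L) M"
    unfolding eq by (rule norm_triangle_mono[OF mom R_bound])
  moreover have "12 powr a * (20 * e) + B * gauss (294/100 * L) M = 12 powr a * (12 * (real M + 1) * (3/4) ^ M * gauss (294/100 * L) M + 20 * e)"
    unfolding B_def by (simp only: distrib_left mult.assoc add.commute)
  ultimately show ?thesis unfolding I_def e_def by (simp only:)
qed

text \<open>\<open>c_coeff\<close> is defined by iterated real derivatives and Lagrange inversion
  produces complex ones; this is the bridge between them.\<close>

lemma higher_deriv_of_real:
  fixes F :: "complex \<Rightarrow> complex" and f :: "real \<Rightarrow> real"
  assumes S: "open S" "F holomorphic_on S" and T: "open T" "\<And>x. x \<in> T \<Longrightarrow> of_real x \<in> S"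
    and eq: "\<And>x. x \<in> T \<Longrightarrow> F (of_real x) = of_real (f x)" and x: "x \<in> T"
  shows "(deriv ^^ n) F (of_real x) = of_real ((deriv ^^ n) f x)"
  using x
proof (induction n arbitrary: x)
  case 0
  thus ?case by (simp add: eq)
next
  case (Suc n)
  define G g where "G = (deriv ^^ n) F" and "g = (deriv ^^ n) f"
  have Gg: "G (of_real y) = of_real (g y)" if "y \<in> T" for y using Suc.IH[OF that] by (simp add: G_def g_def)
  have "G holomorphic_on S" unfolding G_def by (rule holomorphic_higher_deriv[OF S(2,1)])
  hence "(G has_field_derivative deriv G (of_real x)) (at (of_real x))"
    using holomorphic_derivI[OF _ S(1) T(2)[OF Suc.prems]] by blast
  hence "((\<lambda>y. G (of_real y)) has_vector_derivative deriv G (of_real x)) (at x)"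
    by (rule has_vector_derivative_real_field)
  hence *: "((\<lambda>y. of_real (g y)) has_vector_derivative deriv G (of_real x)) (at x)"
    by (rule has_vector_derivative_transform_within_open[OF _ T(1) Suc.prems Gg])
  have "(g has_vector_derivative Re (deriv G (of_real x))) (at x)"
    using bounded_linear.has_vector_derivative[OF bounded_linear_Re *] by simp
  hence "deriv g x = Re (deriv G (of_real x))"
    by (intro DERIV_imp_deriv) (simp add: has_real_derivative_iff_has_vector_derivative)
  moreover have "((\<lambda>y::real. 0) has_vector_derivative Im (deriv G (of_real x))) (at x)"
    using bounded_linear.has_vector_derivative[OF bounded_linear_Im *] by simp
  hence "Im (deriv G (of_real x)) = 0"
    using vector_derivative_unique_at[OF _ has_vector_derivative_const[of "0::real" "at x"]] by simp
  ultimately have "deriv G (of_real x) = of_real (deriv g x)" by (simp add: complex_eq_iff)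
  thus ?case by (simp add: G_def g_def)
qed

text \<open>Lagrange inversion at \<open>u = 1 + y\<close> with \<open>k = 2 m\<close>: the exponent
  \<open>2 s + 1/12 + 2 m + 1\<close> is the one in \<open>c_coeff\<close>, and the odd power of the
  root becomes \<open>(3 + 2 y) powr (m + 1/2)\<close>.\<close>

lemma saddle_g_b_coeff: "saddle_g (2 * real s + 1/12) (2 * m) = of_real (b_coeff s m)"
proof -
  define p where "p = 2 * real s + 2 * real m + 13/12"
  define F where "F = (\<lambda>u. u powr of_real p / csqrt (2 * u + 1) ^ Suc (2 * m))"
  define f where "f = (\<lambda>y::real. (1 + y) powr p / (3 + 2 * y) powr (real m + 1/2))"
  have F: "F holomorphic_on RHP" unfolding F_def RHP_def by (intro holomorphic_intros; use right_half_plane in force)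
  define S where "S = {w. Re w > -1}"
  have S: "open S" unfolding S_def by (rule open_halfspace_Re_gt)
  have sh: "(1::complex) * w + 1 \<in> RHP" if "w \<in> S" for w using that by (simp add: S_def RHP_def)
  have "(\<lambda>w. F (1 * w + 1)) holomorphic_on S"
    by (rule holomorphic_on_compose_gen[OF _ F, unfolded o_def]) (use sh in \<open>auto intro!: holomorphic_intros\<close>)
  hence hol: "(\<lambda>w. F (w + 1)) holomorphic_on S" by simp
  have "(deriv ^^ (2 * m)) (\<lambda>w. F (1 * w + 1)) 0 = 1 ^ (2 * m) * (deriv ^^ (2 * m)) F (1 * 0 + 1)"
    by (rule higher_deriv_compose_linear'[OF F S open_RHP _ sh]) (simp_all add: S_def)
  hence "(deriv ^^ (2 * m)) F 1 = (deriv ^^ (2 * m)) (\<lambda>w. F (w + 1)) (of_real 0)" by simp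
  also have "\<dots> = of_real ((deriv ^^ (2 * m)) f 0)"
  proof (rule higher_deriv_of_real[OF S hol, of "{-1<..}"])
    fix y :: real assume y: "y \<in> {-1<..}"
    have "csqrt (2 * (of_real y + 1) + 1) = of_real (sqrt (3 + 2 * y))"
    proof -
      have "2 * (of_real y + 1) + 1 = complex_of_real (3 + 2 * y)" by simp
      thus ?thesis using y by (simp only:) (rule of_real_sqrt[symmetric], simp)
    qed
    moreover have "sqrt (3 + 2 * y) ^ Suc (2 * m) = (3 + 2 * y) powr (real m + 1/2)"
    proof -
      have "sqrt (3 + 2 * y) ^ (2 * m) = (3 + 2 * y) ^ m" using y by (simp add: power_mult)
      thus ?thesis using y by (simp add: powr_add powr_realpow powr_half_sqrt mult.commute)
    qed
    moreover have "(of_real y + 1) powr complex_of_real p = of_real ((1 + y) powr p)"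
    proof -
      have "of_real y + 1 = complex_of_real (1 + y)" by simp
      thus ?thesis using y by (simp only:) (rule powr_of_real, auto)
    qed
    ultimately show "F (of_real y + 1) = of_real (f y)" unfolding F_def f_def by (metis of_real_divide of_real_power)
  qed (auto simp: S_def)
  finally have "(deriv ^^ (2 * m)) F 1 = of_real ((deriv ^^ (2 * m)) f 0)" .
  moreover have "2 * real s + 1/12 + real (2 * m) + 1 = p" by (simp add: p_def)
  ultimately show ?thesis
    unfolding saddle_g_deriv b_coeff_def c_coeff_def by (simp only:) (simp only: F_def f_def p_def of_real_divide of_real_fact)
qed

section \<open>The coefficients beta and the constant C\<close>

text \<open>A polynomial, so that its exponential is an entire function. The ring is left open since
  coefficients are compared between \<open>real\<close> and \<open>complex\<close>.\<close>

definition trunc_fps :: "nat \<Rightarrow> (nat \<Rightarrow> real) \<Rightarrow> 'a::{real_algebra_1,comm_ring_1} fps" where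
  "trunc_fps K p = Abs_fps (\<lambda>i. if i = 0 \<or> i > K then 0 else of_real (p i))"

definition exp_coeff :: "nat \<Rightarrow> (nat \<Rightarrow> real) \<Rightarrow> nat \<Rightarrow> real" where
  "exp_coeff K p n = fps_nth (fps_exp 1 oo trunc_fps K p) n"

lemma fps_power_nth_of_real:
  fixes a :: "'a::{real_algebra_1,comm_ring_1} fps"
  assumes "\<And>j. j \<le> n \<Longrightarrow> fps_nth a j = of_real (fps_nth b j)" "k \<le> n"
  shows "fps_nth (a ^ i) k = of_real (fps_nth (b ^ i) k)"
  using assms(2)
proof (induction i arbitrary: k)
  case 0 thus ?case by simp
next
  case (Suc i)
  have "fps_nth (a ^ Suc i) k = (\<Sum>j=0..k. fps_nth a j * fps_nth (a ^ i) (k - j))" by (simp add: fps_mult_nth)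
  also have "\<dots> = (\<Sum>j=0..k. of_real (fps_nth b j) * of_real (fps_nth (b ^ i) (k - j)))"
    by (intro sum.cong refl arg_cong2[of _ _ _ _ "(*)"] assms(1) Suc.IH) (use Suc.prems in auto)
  finally show ?case by (simp add: fps_mult_nth)
qed

lemma fps_exp_compose_nth_of_real:
  fixes a :: "'a::{real_normed_field} fps"
  assumes "\<And>j. j \<le> n \<Longrightarrow> fps_nth a j = of_real (fps_nth b j)"
  shows "fps_nth (fps_exp 1 oo a) n = of_real (fps_nth (fps_exp 1 oo b) n)"
  unfolding fps_compose_nth of_real_sum
  by (intro sum.cong refl) (simp add: fps_power_nth_of_real[OF assms])

text \<open>Coefficient \<open>s\<close> of the composition involves only the first \<open>s\<close>
  coefficients of the inner series; hence the divergent series may be cut off and analytic estimates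
  become available.\<close>

lemma beta_eq: "s \<le> K \<Longrightarrow> beta s = exp_coeff K (\<lambda>i. - alpha i) s"
  unfolding beta_def exp_coeff_def
  by (subst fps_exp_compose_nth_of_real[of s _ "trunc_fps K (\<lambda>i. - alpha i)"]) (auto simp: trunc_fps_def)

text \<open>With nonnegative coefficients, all powers of the inner series are nonnegative. Changing
  its sign only changes signs of whole powers in the exponential.\<close>

lemma exp_coeff_abs_le: "(\<And>i. i \<ge> 1 \<Longrightarrow> p i \<ge> 0) \<Longrightarrow> \<bar>exp_coeff K (\<lambda>i. - p i) n\<bar> \<le> exp_coeff K p n"
proof -
  assume p: "\<And>i. i \<ge> 1 \<Longrightarrow> p i \<ge> 0"
  define a :: "real fps" where "a = trunc_fps K p"
  have a: "trunc_fps K (\<lambda>i. - p i) = - a" by (simp add: a_def trunc_fps_def fps_eq_iff)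
  have pos: "fps_nth (a ^ i) k \<ge> 0" for i k
  proof (induction i arbitrary: k)
    case (Suc i)
    thus ?case using p by (auto simp: fps_mult_nth a_def trunc_fps_def intro!: sum_nonneg mult_nonneg_nonneg)
  qed simp
  have "\<bar>fps_nth (fps_exp 1 oo - a) n\<bar> \<le> (\<Sum>i=0..n. \<bar>fps_nth (fps_exp 1) i * fps_nth ((- a) ^ i) n\<bar>)"
    unfolding fps_compose_nth by (rule sum_abs)
  also have "\<dots> = (\<Sum>i=0..n. fps_nth (fps_exp 1) i * fps_nth (a ^ i) n)"
  proof (intro sum.cong refl)
    fix i
    have "\<bar>fps_nth ((- a) ^ i) n\<bar> = fps_nth (a ^ i) n"
    proof (cases "even i")
      case False
      hence "(- a) ^ i = - (a ^ i)" by simp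
      thus ?thesis using pos[of i n] by simp
    qed (use pos[of i n] in simp)
    thus "\<bar>fps_nth (fps_exp 1) i * fps_nth ((- a) ^ i) n\<bar> = fps_nth (fps_exp 1) i * fps_nth (a ^ i) n" by (simp add: abs_mult)
  qed
  finally show ?thesis by (simp add: exp_coeff_def a fps_compose_nth a_def)
qed

lemma exp_coeff_deriv:
  "of_real (exp_coeff K p n) = (deriv ^^ n) (\<lambda>z. exp (\<Sum>s=1..K. complex_of_real (p s) * z ^ s)) 0 / fact n"
proof -
  define P :: "complex fps" where "P = (\<Sum>s=1..K. fps_const (of_real (p s)) * fps_X ^ s)"
  have P: "P = trunc_fps K p"
    by (auto simp: P_def trunc_fps_def fps_eq_iff fps_sum_nth if_distrib[of "\<lambda>x. _ * x"] cong: if_cong)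
  have "(\<lambda>z. \<Sum>s=1..K. complex_of_real (p s) * z ^ s) has_fps_expansion P"
    unfolding P_def by (intro fps_expansion_intros)
  moreover have "exp has_fps_expansion fps_exp (1::complex)" using has_fps_expansion_exp[of 1] by simp
  moreover have "fps_nth P 0 = 0" by (simp add: P trunc_fps_def)
  ultimately have "(exp \<circ> (\<lambda>z. \<Sum>s=1..K. complex_of_real (p s) * z ^ s)) has_fps_expansion (fps_exp 1 oo P)"
    by (intro has_fps_expansion_compose)
  from fps_nth_fps_expansion[OF this, of n]
  have "fps_nth (fps_exp 1 oo P) n = (deriv ^^ n) (\<lambda>z. exp (\<Sum>s=1..K. complex_of_real (p s) * z ^ s)) 0 / fact n" by (simp add: o_def)
  moreover have "fps_nth (fps_exp 1 oo P) n = of_real (exp_coeff K p n)"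
    unfolding exp_coeff_def P by (rule fps_exp_compose_nth_of_real) (simp add: trunc_fps_def)
  ultimately show ?thesis by simp
qed

lemma exp_coeff_sums:
  "(\<lambda>n. of_real (exp_coeff K p n) * z ^ n) sums exp (\<Sum>s=1..K. complex_of_real (p s) * z ^ s)"
proof -
  have "(\<lambda>z. exp (\<Sum>s=1..K. complex_of_real (p s) * z ^ s)) holomorphic_on ball 0 (cmod z + 1)"
    by (intro holomorphic_intros)
  from holomorphic_power_series[OF this, of z] show ?thesis by (simp add: exp_coeff_deriv)
qed

lemma exp_coeff_partial_le:
  assumes "\<And>i. i \<ge> 1 \<Longrightarrow> p i \<ge> 0" "Y \<ge> 0"
  shows "(\<Sum>n<N. exp_coeff K p n * Y ^ n) \<le> exp (\<Sum>s=1..K. p s * Y ^ s)"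
proof -
  have "(\<lambda>n. complex_of_real (exp_coeff K p n * Y ^ n)) sums of_real (exp (\<Sum>s=1..K. p s * Y ^ s))"
    using exp_coeff_sums[of K p "of_real Y"] by (simp flip: exp_of_real)
  hence S: "(\<lambda>n. exp_coeff K p n * Y ^ n) sums exp (\<Sum>s=1..K. p s * Y ^ s)" by (simp only: sums_of_real_iff)
  have "0 \<le> exp_coeff K p n * Y ^ n" for n
    using exp_coeff_abs_le[of p K n] assms by (intro mult_nonneg_nonneg) auto
  thus ?thesis using sum_le_suminf[OF sums_summable[OF S], of "{..<N}"] sums_unique[OF S] by simp
qed

definition exp_P :: "nat \<Rightarrow> complex \<Rightarrow> complex" where
  "exp_P r z = exp (- (\<Sum>s=1..r + 1. complex_of_real (alpha s) * z ^ s))"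

lemma exp_P_alt: "exp_P r z = exp (\<Sum>s=1..r + 1. complex_of_real (- alpha s) * z ^ s)"
  by (simp add: exp_P_def sum_negf)

lemma C_const_upper: "cmod z = 1 \<Longrightarrow> cmod (exp_P r z) \<le> C_const r / 2"
proof -
  assume z: "cmod z = 1"
  have "compact ((\<lambda>z. cmod (exp_P r z)) ` sphere 0 1)"
    unfolding exp_P_def by (intro compact_continuous_image continuous_intros compact_sphere)
  hence "bdd_above ((\<lambda>z. cmod (exp_P r z)) ` {z. cmod z = 1})"
    by (simp add: compact_imp_bounded bounded_imp_bdd_above sphere_def dist_norm)
  from cSUP_upper[OF _ this, of z] z show ?thesis by (simp add: C_const_def exp_P_def)
qed

text \<open>Cauchy's inequality on the unit circle, where \<open>C_const r\<close> is twice the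
  maximum of \<open>exp_P r\<close>.\<close>

lemma exp_coeff_le_C: "\<bar>exp_coeff (r + 1) (\<lambda>i. - alpha i) n\<bar> \<le> C_const r / 2"
proof -
  have "cmod ((deriv ^^ n) (exp_P r) 0) \<le> fact n * (C_const r / 2) / 1 ^ n"
  proof (rule Cauchy_inequality)
    show "exp_P r holomorphic_on ball 0 1" unfolding exp_P_def[abs_def] by (intro holomorphic_intros)
    show "continuous_on (cball 0 1) (exp_P r)" unfolding exp_P_def[abs_def] by (intro continuous_intros)
    show "cmod (exp_P r z) \<le> C_const r / 2" if "cmod (0 - z) = 1" for z using that by (intro C_const_upper) simp
  qed simp
  moreover have "of_real (exp_coeff (r + 1) (\<lambda>i. - alpha i) n) = (deriv ^^ n) (exp_P r) 0 / fact n"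
    unfolding exp_coeff_deriv exp_P_alt[abs_def] ..
  hence "\<bar>exp_coeff (r + 1) (\<lambda>i. - alpha i) n\<bar> = cmod ((deriv ^^ n) (exp_P r) 0) / fact n"
    by (metis norm_of_real norm_divide norm_fact)
  ultimately show ?thesis by (simp add: divide_le_eq mult.commute)
qed

text \<open>All coefficients share the bound \<open>C_const r / 2\<close>, so the tail is dominated
  by a geometric series.\<close>

lemma exp_P_tail:
  assumes "cmod x < 1"
  shows "cmod (exp_P r x - (\<Sum>n<N. of_real (exp_coeff (r + 1) (\<lambda>i. - alpha i) n) * x ^ n)) \<le> C_const r / 2 * cmod x ^ N / (1 - cmod x)"
proof -
  define t where "t n = complex_of_real (exp_coeff (r + 1) (\<lambda>i. - alpha i) n) * x ^ n" for n
  have S: "t sums exp_P r x" unfolding t_def exp_P_alt by (rule exp_coeff_sums)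
  hence "(\<lambda>n. t (n + N)) sums (exp_P r x - (\<Sum>n<N. t n))" by (rule sums_split_initial_segment)
  moreover have G: "(\<lambda>n. C_const r / 2 * cmod x ^ N * cmod x ^ n) sums (C_const r / 2 * cmod x ^ N * (1 / (1 - cmod x)))"
    by (intro sums_mult geometric_sums) (use assms in simp)
  moreover have "cmod (t (n + N)) \<le> C_const r / 2 * cmod x ^ N * cmod x ^ n" for n
    unfolding t_def norm_mult norm_power power_add using mult_right_mono[OF exp_coeff_le_C[of r "n + N"], of "cmod x ^ n * cmod x ^ N"]
    by (simp add: mult_ac)
  ultimately have "cmod (exp_P r x - (\<Sum>n<N. t n)) \<le> C_const r / 2 * cmod x ^ N * (1 / (1 - cmod x))"
    by (metis norm_suminf_le sums_summable sums_unique)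
  thus ?thesis by (simp add: t_def)
qed

text \<open>Averaging over the roots of \<open>z^K = -1\<close> isolates the leading coefficient.\<close>

lemma exp_average_roots:
  fixes p :: "nat \<Rightarrow> real"
  assumes K: "K \<ge> 1"
  shows "\<exists>z. cmod z = 1 \<and> Re (- (\<Sum>s=1..K. of_real (p s) * z ^ s)) \<ge> p K"
proof (rule ccontr)
  define \<omega> where "\<omega> j = exp (\<i> * of_real (pi * (2 * real j + 1) / real K))" for j :: nat
  assume "\<not> ?thesis"
  moreover have "cmod (\<omega> j) = 1" for j by (simp add: \<omega>_def)
  ultimately have lt: "Re (- (\<Sum>s=1..K. of_real (p s) * \<omega> j ^ s)) < p K" for j by (meson not_le)
  have pw: "(\<Sum>j<K. \<omega> j ^ s) = (if s = K then - of_nat K else 0)" if s: "s \<in> {1..K}" for s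
  proof -
    define q where "q = exp (\<i> * of_real (2 * pi * real s / real K))"
    have wq: "\<omega> j ^ s = exp (\<i> * of_real (pi * real s / real K)) * q ^ j" for j
    proof -
      have "\<omega> j ^ s = exp (of_nat s * (\<i> * of_real (pi * (2 * real j + 1) / real K)))" unfolding \<omega>_def by (rule exp_of_nat_mult[symmetric])
      also have "of_nat s * (\<i> * of_real (pi * (2 * real j + 1) / real K)) = \<i> * of_real (pi * real s / real K) + of_nat j * (\<i> * of_real (2 * pi * real s / real K))"
        using K by (simp add: field_simps)
      finally show ?thesis unfolding exp_add q_def exp_of_nat_mult .
    qed
    have "q ^ K = exp (of_nat K * (\<i> * of_real (2 * pi * real s / real K)))" unfolding q_def by (rule exp_of_nat_mult[symmetric])
    also have "of_nat K * (\<i> * of_real (2 * pi * real s / real K)) = 2 * of_nat s * of_real pi * \<i>" using K by (simp add: field_simps)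
    finally have qK: "q ^ K = 1" by (simp add: exp_eq_1) (rule exI[of _ "int s"], simp)
    show ?thesis
    proof (cases "s = K")
      case True
      have "q = 1" unfolding q_def True using K exp_two_pi_i by (simp add: mult_ac)
      moreover have "exp (\<i> * of_real (pi * real s / real K)) = -1" using K True exp_pi_i by (simp add: mult_ac)
      ultimately show ?thesis unfolding wq using True by simp
    next
      case False
      have "q \<noteq> 1"
      proof
        assume "q = 1"
        then obtain n :: int where n: "2 * pi * real s / real K = of_int (2 * n) * pi" unfolding q_def by (auto simp: exp_eq_1)
        hence "real s = of_int n * real K" using K by (simp add: field_simps)
        hence "of_int (int s) = (of_int (n * int K) :: real)" by simp
        hence "int s = n * int K" by (simp only: of_int_eq_iff)
        moreover have sK: "0 < int s" "int s < int K" using s False by auto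
        ultimately have "0 < n * int K" "n * int K < int K" by simp_all
        from this(1) have "1 \<le> n" using sK by (auto simp: zero_less_mult_iff)
        hence "1 * int K \<le> n * int K" by (rule mult_right_mono) simp
        with \<open>n * int K < int K\<close> show False by simp
      qed
      hence "(\<Sum>j<K. q ^ j) = 0" by (simp add: geometric_sum qK)
      thus ?thesis unfolding wq sum_distrib_left[symmetric] using False by simp
    qed
  qed
  have "(\<Sum>j<K. \<Sum>s=1..K. of_real (p s) * \<omega> j ^ s) = (\<Sum>s=1..K. of_real (p s) * (\<Sum>j<K. \<omega> j ^ s))"
    by (subst sum.swap) (simp add: sum_distrib_left)
  also have "\<dots> = (\<Sum>s=1..K. of_real (p s) * (if s = K then - of_nat K else 0))"
    by (intro sum.cong refl arg_cong2[of _ _ _ _ "(*)"] pw)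
  also have "\<dots> = - (of_real (p K) * of_nat K)" using K by (simp add: if_distrib[of "\<lambda>x. _ * x"] sum.delta cong: if_cong)
  finally have "(\<Sum>j<K. Re (- (\<Sum>s=1..K. of_real (p s) * \<omega> j ^ s))) = p K * real K"
    by (simp add: sum_negf flip: Re_sum)
  moreover have "(\<Sum>j<K. Re (- (\<Sum>s=1..K. of_real (p s) * \<omega> j ^ s))) < (\<Sum>j<K. p K)"
  proof (intro sum_strict_mono lt)
    have "0 \<in> {..<K}" using K by simp
    thus "{..<K} \<noteq> {}" by blast
  qed simp
  ultimately show False by simp
qed

lemma C_const_lower: "C_const r \<ge> 2 * exp (alpha (r + 1))"
proof -
  obtain z where z: "cmod z = 1" "Re (- (\<Sum>s=1..r + 1. of_real (alpha s) * z ^ s)) \<ge> alpha (r + 1)"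
    using exp_average_roots[of "r + 1" alpha] by auto
  have "exp (alpha (r + 1)) \<le> cmod (exp_P r z)" unfolding exp_P_def norm_exp_eq_Re using z(2) by simp
  thus ?thesis using C_const_upper[OF z(1), of r] by simp
qed

lemma C_const_ge_2: "C_const r \<ge> 2"
  using C_const_lower[of r] alpha_pos[of "r + 1"] one_le_exp_iff[of "alpha (r + 1)"] by linarith

section \<open>Numerical bounds\<close>

lemma zeta_nat_bounds:
  assumes "k \<ge> 2"
  shows "1 \<le> zeta_nat k" "zeta_nat k \<le> 2" "zeta_nat (k + j) \<le> zeta_nat k"
proof -
  have S: "summable (\<lambda>n. 1 / real (Suc n) ^ i)" if "i \<ge> 2" for i by (rule summable_inverse_power[OF that])
  show "1 \<le> zeta_nat k"
    using sum_le_suminf[OF S[OF assms], of "{..<1}"] by (simp add: zeta_nat_def)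
  have mono: "1 / real (Suc n) ^ j \<le> 1 / real (Suc n) ^ i" if "i \<le> j" for i j n
    using that by (intro divide_left_mono power_increasing) auto
  show "zeta_nat (k + j) \<le> zeta_nat k"
    unfolding zeta_nat_def using assms by (intro suminf_le S mono) auto
  have "zeta_nat k \<le> zeta_nat 2"
    unfolding zeta_nat_def using assms by (intro suminf_le S mono) auto
  also have "zeta_nat 2 = pi\<^sup>2 / 6"
    using inverse_squares_sums unfolding zeta_nat_def by (simp add: sums_iff add.commute)
  also have "pi\<^sup>2 \<le> (32/10)\<^sup>2" using pi_approx by (intro power_mono) auto
  hence "pi\<^sup>2 / 6 \<le> 2" by (simp add: power2_eq_square)
  finally show "zeta_nat k \<le> 2" .
qed

text \<open>The value 1.2 has to be reached because \<open>(193/100) ^ 3 \<le> 6 * A_const\<close>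
  is deduced from it later.\<close>

lemma A_const_ge: "A_const \<ge> 12 / 10"
proof -
  have "12/10 \<le> (\<Sum>n<16. 1 / real (Suc n) ^ 3)" by (simp add: lessThan_nat_numeral power3_eq_cube)
  also have "\<dots> \<le> A_const" unfolding A_const_def zeta_nat_def by (intro sum_le_suminf summable_inverse_power) auto
  finally show ?thesis .
qed

lemma two_pi_sq: "39 \<le> (2 * pi)\<^sup>2" "(2 * pi)\<^sup>2 \<le> 3948/100"
proof -
  have "(6283/1000)\<^sup>2 \<le> (2 * pi)\<^sup>2" "(2 * pi)\<^sup>2 \<le> (62832/10000)\<^sup>2" using pi_approx by (intro power_mono; simp)+
  thus "39 \<le> (2 * pi)\<^sup>2" "(2 * pi)\<^sup>2 \<le> 3948/100" by (simp_all add: power2_eq_square)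
qed

lemma two_pi_power: "(2 * pi) ^ (4 * s + 2) = ((2 * pi)\<^sup>2) ^ (2 * s + 1)"
  by (subst power_mult[symmetric]) (rule arg_cong[where f = "power (2 * pi)"], simp)

lemma alpha_upper:
  assumes "s \<ge> 1"
  shows "alpha s \<le> 42/100 * ((2 * real s + 1) / 39) ^ (2 * s)"
proof -
  have "fact (2 * s - 1) + fact (2 * s) = fact (2 * s - 1) * (2 * real s + 1)"
    using assms by (cases s) (simp_all add: algebra_simps)
  moreover have "fact (2 * s - 1) \<le> (2 * real s + 1) ^ (2 * s - 1)"
  proof -
    have "fact (2 * s - 1) \<le> real (2 * s - 1) ^ (2 * s - 1)" by (metis fact_le_power of_nat_fact of_nat_le_iff of_nat_power)
    also have "\<dots> \<le> (2 * real s + 1) ^ (2 * s - 1)" by (intro power_mono) auto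
    finally show ?thesis .
  qed
  ultimately have "fact (2 * s - 1) + fact (2 * s) \<le> (2 * real s + 1) ^ (2 * s - 1) * (2 * real s + 1)" by (simp add: mult_right_mono)
  also have "\<dots> = (2 * real s + 1) ^ (2 * s)" using assms by (cases s) simp_all
  finally have f: "fact (2 * s - 1) + fact (2 * s) \<le> (2 * real s + 1) ^ (2 * s)" .
  have z: "zeta_nat (2 * s) \<le> 2" "zeta_nat (2 * s + 2) \<le> 2" "1 \<le> zeta_nat (2 * s)" "1 \<le> zeta_nat (2 * s + 2)"
    using assms by (intro zeta_nat_bounds; simp)+
  have "alpha s \<le> 4 * 2 * 2 * (2 * real s + 1) ^ (2 * s) / 39 ^ (2 * s + 1)"
    unfolding alpha_eq[OF assms] two_pi_power
  proof (intro frac_le mult_mono power_mono f z two_pi_sq)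
    show "(0::real) < 39 ^ (2 * s + 1)" by simp
  qed (use z in auto)
  also have "\<dots> = 16/39 * ((2 * real s + 1) / 39) ^ (2 * s)" by (simp add: power_divide)
  also have "\<dots> \<le> 42/100 * ((2 * real s + 1) / 39) ^ (2 * s)" by (intro mult_right_mono) auto
  finally show ?thesis .
qed

lemma fact_pair: "s \<ge> 1 \<Longrightarrow> fact (2 * s + 1) + fact (2 * s + 2) = 2 * real s * (2 * real s + 3) * (fact (2 * s - 1) + fact (2 * s))"
  by (cases s) (simp_all add: algebra_simps)

text \<open>Up to zeta values, the ratio is that of the factorials divided by
  \<open>(2 pi)^4\<close>, which lies between 1521 and 1559. The zeta values decrease, which helps
  the upper bound; the lower one concedes a factor 2, whence 3118.\<close>

lemma alpha_Suc:
  assumes "s \<ge> 1"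
  shows "alpha (Suc s) \<le> alpha s * (2 * real s * (2 * real s + 3) / 1521)"
    and "alpha s * (2 * real s * (2 * real s + 3) / 3118) \<le> alpha (Suc s)"
proof -
  define Z where "Z k = zeta_nat (2 * k) * zeta_nat (2 * k + 2)" for k
  define F where "F = (fact (2 * s - 1) + fact (2 * s) :: real)"
  define T where "T = (2 * pi) ^ (4 * s + 2)"
  define R where "R = 2 * real s * (2 * real s + 3)"
  have T: "T > 0" by (simp add: T_def)
  have F: "F > 0" by (simp add: F_def add_pos_pos)
  have R: "R > 0" using assms by (simp add: R_def)
  have a0: "alpha s = Z s * (4 * F / T)" unfolding alpha_eq[OF assms] F_def[symmetric] T_def[symmetric] Z_def by simp
  have "alpha (Suc s) = 4 * zeta_nat (2 * Suc s) * zeta_nat (2 * Suc s + 2) * (fact (2 * Suc s - 1) + fact (2 * Suc s)) / (2 * pi) ^ (4 * Suc s + 2)"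
    by (rule alpha_eq) simp
  moreover have "fact (2 * Suc s - 1) + fact (2 * Suc s) = R * F" using fact_pair[OF assms] by (simp add: R_def F_def)
  moreover have "(2 * pi) ^ (4 * Suc s + 2) = T * ((2 * pi)\<^sup>2)\<^sup>2" unfolding T_def power_mult[symmetric] power_add[symmetric] by simp
  ultimately have "alpha (Suc s) = 4 * zeta_nat (2 * Suc s) * zeta_nat (2 * Suc s + 2) * (R * F) / (T * ((2 * pi)\<^sup>2)\<^sup>2)" by (simp only:)
  hence a1: "alpha (Suc s) = Z (Suc s) * (4 * F / T) * (R / ((2 * pi)\<^sup>2)\<^sup>2)" by (simp add: Z_def mult_ac)
  have z: "zeta_nat (2 * s) \<le> 2" "1 \<le> zeta_nat (2 * s)" "1 \<le> zeta_nat (2 * s + 2)" "1 \<le> zeta_nat (2 * s + 4)"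
     "zeta_nat (2 * s + 2) \<le> zeta_nat (2 * s)" "zeta_nat (2 * s + 4) \<le> zeta_nat (2 * s + 2)"
  proof -
    have "2 * s + 2 + 2 = 2 * s + 4" by simp
    from zeta_nat_bounds(3)[of "2 * s + 2" 2, unfolded this]
    show "zeta_nat (2 * s + 4) \<le> zeta_nat (2 * s + 2)" by simp
    show "zeta_nat (2 * s + 2) \<le> zeta_nat (2 * s)" by (rule zeta_nat_bounds(3)) (use assms in simp)
  qed (rule zeta_nat_bounds, use assms in simp)+
  have Zs: "Z (Suc s) \<le> Z s" "Z s \<le> 2 * Z (Suc s)" "0 \<le> Z s" "0 \<le> Z (Suc s)"
  proof -
    have e: "Z (Suc s) = zeta_nat (2 * s + 2) * zeta_nat (2 * s + 4)"
    proof -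
      have "2 * Suc s = 2 * s + 2" "2 * s + 2 + 2 = 2 * s + 4" by simp_all
      thus ?thesis unfolding Z_def by (simp only:)
    qed
    show "Z (Suc s) \<le> Z s" unfolding e unfolding Z_def using z by (intro mult_mono) auto
    have "Z s \<le> 2 * zeta_nat (2 * s + 2)" unfolding Z_def using z by (intro mult_right_mono) auto
    also have "\<dots> \<le> 2 * Z (Suc s)" unfolding e using z by simp
    finally show "Z s \<le> 2 * Z (Suc s)" .
    show "0 \<le> Z s" "0 \<le> Z (Suc s)" unfolding e unfolding Z_def using z by (auto intro!: mult_nonneg_nonneg)
  qed
  have p: "1521 \<le> ((2 * pi)\<^sup>2)\<^sup>2" "((2 * pi)\<^sup>2)\<^sup>2 \<le> 1559"
    using power_mono[OF two_pi_sq(1), of 2] power_mono[OF two_pi_sq(2), of 2] by (simp_all add: power2_eq_square)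
  have "alpha (Suc s) \<le> Z s * (4 * F / T) * (R / 1521)"
    unfolding a1 using Zs p F T R by (intro mult_mono divide_left_mono) auto
  thus "alpha (Suc s) \<le> alpha s * (2 * real s * (2 * real s + 3) / 1521)" unfolding a0 R_def .
  have "R / 1559 \<le> R / ((2 * pi)\<^sup>2)\<^sup>2" using p R by (intro divide_left_mono) auto
  hence "Z s / 2 * (4 * F / T) * (R / 1559) \<le> alpha (Suc s)"
    unfolding a1 using Zs F T R by (intro mult_mono) auto
  thus "alpha s * (2 * real s * (2 * real s + 3) / 3118) \<le> alpha (Suc s)" unfolding a0 R_def[symmetric] by (simp add: mult_ac)
qed

text \<open>From \<open>s = 55\<close> on, the lower ratio of \<open>alpha_Suc\<close> exceeds 3.
  The comparison with \<open>(s - 1) / 18\<close> is what one step of \<open>gamma_ratio\<close>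
  needs.\<close>

lemma alpha_growth: "s \<ge> 55 \<Longrightarrow> alpha s \<ge> (real s - 1) / 18 \<and> alpha (Suc s) \<ge> 3 * alpha s"
proof (induction s rule: dec_induct)
  have step: "alpha (Suc s) \<ge> 3 * alpha s" if "s \<ge> 55" for s
  proof -
    have "2 * 55 * (2 * 55 + 3) \<le> 2 * real s * (2 * real s + 3)" using that by (intro mult_mono) auto
    hence "3 \<le> 2 * real s * (2 * real s + 3) / 3118" by simp
    hence "alpha s * 3 \<le> alpha s * (2 * real s * (2 * real s + 3) / 3118)" using that by (intro mult_left_mono alpha_pos) auto
    thus ?thesis using alpha_Suc(2)[of s] that by simp
  qed
  case base
  \<comment> \<open>\<open>alpha 55\<close> is at least 4 times the factorial of 110 over
    \<open>(2 pi) ^ 222\<close>, and \<open>(2 pi)^2\<close> is below 40.\<close>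
  have "3 * 40 ^ 111 \<le> (4 * fact 110 :: real)" by (simp add: fact_numeral)
  hence "3 * ((2 * pi)\<^sup>2) ^ 111 \<le> (4 * fact 110 :: real)"
    using power_mono[of "(2 * pi)\<^sup>2" 40 111] two_pi_sq(2) by (auto intro: order_trans[rotated])
  hence "3 \<le> 4 * fact 110 / ((2 * pi)\<^sup>2) ^ 111" by (simp add: field_simps)
  also have "\<dots> \<le> alpha 55"
  proof -
    have "4 * 1 * 1 * (0 + fact 110) \<le> 4 * zeta_nat (2 * 55) * zeta_nat (2 * 55 + 2) * (fact (2 * 55 - 1) + fact (2 * 55))"
      using zeta_nat_bounds(1)[of 110] zeta_nat_bounds(1)[of 112] by (intro mult_mono add_mono) auto
    hence "4 * 1 * 1 * (0 + fact 110) / ((2 * pi)\<^sup>2) ^ 111 \<le> 4 * zeta_nat (2 * 55) * zeta_nat (2 * 55 + 2) * (fact (2 * 55 - 1) + fact (2 * 55)) / ((2 * pi)\<^sup>2) ^ 111"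
      by (rule divide_right_mono) simp
    moreover have "alpha 55 = 4 * zeta_nat (2 * 55) * zeta_nat (2 * 55 + 2) * (fact (2 * 55 - 1) + fact (2 * 55)) / (2 * pi) ^ (4 * 55 + 2)"
      by (rule alpha_eq) simp
    moreover have "(2 * pi) ^ (4 * 55 + 2) = ((2 * pi)\<^sup>2) ^ 111" by (subst two_pi_power) simp
    ultimately show ?thesis by (simp only:) simp
  qed
  finally show ?case using step[of 55] by simp
  case (step s)
  have "2 * ((real s - 1) / 18) \<ge> 2 * 3" using step by simp
  hence "(real (Suc s) - 1) / 18 \<le> alpha (Suc s)" using step by (simp add: field_simps)
  thus ?case using \<open>\<And>s. s \<ge> 55 \<Longrightarrow> alpha (Suc s) \<ge> 3 * alpha s\<close>[of "Suc s"] step by simp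
qed

text \<open>The Gamma value is that of the moment of order \<open>2 (r + 2)\<close> in the Gaussian
  remainder. The base 18 is as large as the rest of the estimate allows:
  \<open>(3/4) * 18 / 3.528\<close> must not exceed \<open>2 * 1.93\<close>.\<close>

definition gamma_ratio :: "nat \<Rightarrow> real" where
  "gamma_ratio r = Gamma (real r + 5/2) / 18 ^ r"

lemma gamma_ratio_Suc: "gamma_ratio (Suc r) = gamma_ratio r * ((real r + 5/2) / 18)"
proof -
  have "Gamma (real (Suc r) + 5/2) = Gamma ((real r + 5/2) + 1)" by (simp add: add_ac)
  also have "\<dots> = (real r + 5/2) * Gamma (real r + 5/2)" by (rule Gamma_plus1) (auto elim!: nonpos_Ints_cases)
  finally have G: "Gamma (real (Suc r) + 5/2) = (real r + 5/2) * Gamma (real r + 5/2)" .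
  show ?thesis unfolding gamma_ratio_def G by (simp add: mult.commute)
qed

lemma gamma_ratio_pos: "gamma_ratio r > 0"
  unfolding gamma_ratio_def by (intro divide_pos_pos Gamma_real_pos) auto

lemma gamma_ratio_0: "gamma_ratio 0 \<le> 3/2"
proof -
  have "Gamma (5/2::real) = 3/4 * sqrt pi" using Gamma_half_fact[of 2] by (simp add: fact_numeral)
  also have "\<dots> \<le> 3/4 * 2" using pi_less_4 by (intro mult_left_mono real_le_lsqrt) auto
  finally show ?thesis by (simp add: gamma_ratio_def)
qed

lemma gamma_ratio_54: "gamma_ratio 54 \<le> 2 * 10 ^ 6"
proof -
  have "gamma_ratio n = gamma_ratio 0 * (\<Prod>k<n. (real k + 5/2) / 18)" for n
    by (induction n) (simp_all add: gamma_ratio_Suc)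
  hence "gamma_ratio 54 = gamma_ratio 0 * (\<Prod>k<54. (real k + 5/2) / 18)" .
  also have "\<dots> \<le> 3/2 * (\<Prod>k<54. (real k + 5/2) / 18)" by (intro mult_right_mono gamma_ratio_0 prod_nonneg) auto
  also have "\<dots> \<le> 2 * 10 ^ 6" by (simp add: lessThan_nat_numeral)
  finally show ?thesis .
qed

text \<open>The quotient of consecutive values, \<open>(r + 5/2) / 18\<close>, passes 1 at
  \<open>r = 15.5\<close>. The sequence first falls and then rises, so its end points at 0 and 54
  control it.\<close>

lemma gamma_ratio_le: "r \<le> 54 \<Longrightarrow> gamma_ratio r \<le> 2 * 10 ^ 6"
proof (cases "r \<le> 16")
  case True
  hence "gamma_ratio r \<le> gamma_ratio 0"
  proof (induction r)
    case (Suc r)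
    have "gamma_ratio (Suc r) \<le> gamma_ratio r * 1"
      unfolding gamma_ratio_Suc using gamma_ratio_pos[of r] Suc.prems by (intro mult_left_mono) auto
    thus ?case using Suc by simp
  qed simp
  thus ?thesis using gamma_ratio_0 by simp
next
  case False
  assume "r \<le> 54"
  have "gamma_ratio r \<le> gamma_ratio 54"
    using \<open>r \<le> 54\<close>
  proof (induction r rule: inc_induct)
    case (step n)
    have "gamma_ratio n * 1 \<le> gamma_ratio (Suc n)"
      unfolding gamma_ratio_Suc using gamma_ratio_pos[of n] step.hyps False by (intro mult_left_mono) auto
    thus ?case using step by simp
  qed simp
  thus ?thesis using gamma_ratio_54 by simp
qed

text \<open>The factorial growth of the left side is only beaten for large \<open>r\<close> because \<open>alpha\<close> itself
  grows factorially; the two regimes overlap at \<open>r = 54\<close>.\<close>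

lemma gamma_ratio_exp_alpha: "gamma_ratio r \<le> 2 * 10 ^ 6 * exp (alpha (r + 1))"
proof (cases "r \<le> 54")
  case True
  show ?thesis by (rule order_trans[OF gamma_ratio_le[OF True]]) (use alpha_pos[of "r + 1"] in simp)
next
  case False
  hence "54 \<le> r" by simp
  thus ?thesis
  proof (induction r rule: dec_induct)
    case base
    show ?case by (rule order_trans[OF gamma_ratio_54]) (use alpha_pos[of "54 + 1"] in simp)
  next
    case (step r)
    have a: "real r / 18 \<le> alpha (Suc r)" "3 * alpha (Suc r) \<le> alpha (Suc (Suc r))"
      using alpha_growth[of "Suc r"] step by auto
    \<comment> \<open>The growth of one step of \<open>gamma_ratio\<close> is paid by
      \<open>exp (2 * alpha (Suc r))\<close>, which tripling of \<open>alpha\<close> leaves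
      available.\<close>
    have "(real r + 5/2) / 18 \<le> 1 + 2 * alpha (Suc r)" using a by simp
    also have "\<dots> \<le> exp (2 * alpha (Suc r))" by (rule exp_ge_add_one_self)
    finally have "gamma_ratio (Suc r) \<le> (2 * 10 ^ 6 * exp (alpha (r + 1))) * exp (2 * alpha (Suc r))"
      unfolding gamma_ratio_Suc using step.IH gamma_ratio_pos[of r] by (intro mult_mono) auto
    also have "\<dots> = 2 * 10 ^ 6 * exp (3 * alpha (Suc r))" by (simp flip: exp_add)
    also have "\<dots> \<le> 2 * 10 ^ 6 * exp (alpha (Suc r + 1))" using a by simp
    finally show ?case .
  qed
qed

text \<open>Only the first term of the logarithmic series is used for the gain \<open>g\<close>; all
  further terms are bounded by their values at the real point \<open>q0\<close>.\<close>

lemma minor_arc_bound: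
  fixes q :: complex
  assumes "0 < q0" "q0 < 1" "cmod q = q0" "q0 / (cmod (1 - q))\<^sup>2 \<le> q0 / (1 - q0)\<^sup>2 - g"
  shows "cmod (exp (log_gf q)) \<le> exp (log_gf q0 - g)"
proof -
  have S: "summable (\<lambda>m. norm (log_term m q))" "summable (\<lambda>m. norm (log_term m q0))"
    by (rule summable_log_term, use assms in simp)+
  have S': "summable (\<lambda>m. norm (log_term (Suc m) q))" "summable (\<lambda>m. norm (log_term (Suc m) q0))"
    using S by (subst summable_Suc_iff; simp)+
  have nn: "norm (log_term m q0) = log_term m q0" for m
    using assms by (simp add: log_term_def)
  have "log_gf q = log_term 0 q + (\<Sum>m. log_term (Suc m) q)"
    unfolding log_gf_def using suminf_split_head[OF summable_norm_cancel[OF S(1)]] by simp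
  hence "Re (log_gf q) \<le> cmod (log_term 0 q) + cmod (\<Sum>m. log_term (Suc m) q)"
    by (metis complex_Re_le_cmod norm_triangle_mono order_refl order_trans norm_triangle_ineq)
  also have "cmod (\<Sum>m. log_term (Suc m) q) \<le> (\<Sum>m. cmod (log_term (Suc m) q))" by (rule summable_norm[OF S'(1)])
  also have "\<dots> \<le> (\<Sum>m. norm (log_term (Suc m) q0))"
  proof (intro suminf_le S')
    fix m
    define k where "k = Suc (Suc m)"
    have "1 - q0 ^ k \<le> cmod (1 - q ^ k)" using norm_triangle_ineq2[of 1 "q ^ k"] assms by (simp add: norm_power)
    moreover have qk: "q0 ^ k < 1" unfolding k_def by (rule power_Suc_less_one) (use assms in auto)
    ultimately have "(1 - q0 ^ k)\<^sup>2 \<le> (cmod (1 - q ^ k))\<^sup>2" by (intro power_mono) auto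
    moreover have "0 < (1 - q0 ^ k)\<^sup>2" using qk by simp
    moreover have "cmod (log_term (Suc m) q) = q0 ^ k / (real k * (cmod (1 - q ^ k))\<^sup>2)"
      unfolding log_term_def k_def[symmetric] by (simp add: norm_divide norm_mult norm_power assms)
    moreover have "norm (log_term (Suc m) q0) = q0 ^ k / (real k * (1 - q0 ^ k)\<^sup>2)"
      unfolding nn unfolding log_term_def k_def[symmetric] by simp
    ultimately show "cmod (log_term (Suc m) q) \<le> norm (log_term (Suc m) q0)"
      using assms by (auto intro!: divide_left_mono mult_left_mono mult_pos_pos simp: k_def simp del: of_nat_Suc power_Suc)
  qed
  also have "(\<Sum>m. norm (log_term (Suc m) q0)) = log_gf q0 - log_term 0 q0"
    unfolding log_gf_def nn using suminf_split_head[OF summable_norm_cancel[OF S(2)]] by simp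
  also have "cmod (log_term 0 q) \<le> log_term 0 q0 - g"
    using assms by (simp add: log_term_def norm_divide norm_power)
  finally show ?thesis by simp
qed

text \<open>It suffices that \<open>t^2 \<le> exp (0.375 t)\<close>, true from 150 on: the
  \<open>N\<close>-th power has exponent \<open>0.375 N t\<close>, and \<open>t \<ge> 50 N\<close>
  makes this at most \<open>0.0075 t^2\<close>.\<close>

lemma exp_beats_power:
  assumes "t \<ge> 50 * real N" "t \<ge> 150"
  shows "exp (- (75/10000 * t\<^sup>2)) \<le> (1 / t) ^ (2 * N)"
proof -
  have t: "t > 0" using assms by simp
  have "t\<^sup>2 \<le> exp (375/1000 * t)"
  proof -
    have "1 \<le> (9375/100000) ^ 4 * (150::real)\<^sup>2" by (simp add: power2_eq_square power4_eq_xxxx)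
    also have "\<dots> \<le> (9375/100000) ^ 4 * t\<^sup>2" using assms by (intro mult_left_mono power_mono) auto
    finally have "1 * t\<^sup>2 \<le> (9375/100000) ^ 4 * t\<^sup>2 * t\<^sup>2" by (rule mult_right_mono) simp
    also have "\<dots> = (9375/100000 * t) ^ 4" by (simp add: power_mult_distrib power2_eq_square power4_eq_xxxx)
    also have "\<dots> \<le> exp (9375/100000 * t) ^ 4"
    proof (rule power_mono)
      show "9375/100000 * t \<le> exp (9375/100000 * t)" using exp_ge_add_one_self[of "9375/100000 * t"] by linarith
    qed (use t in simp)
    also have "\<dots> = exp (375/1000 * t)" by (simp flip: exp_of_nat_mult)
    finally show ?thesis by simp
  qed
  hence "(t\<^sup>2) ^ N \<le> exp (375/1000 * t) ^ N" by (intro power_mono) auto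
  also have "\<dots> = exp (375/1000 * (real N * t))" by (simp add: mult_ac flip: exp_of_nat_mult)
  also have "\<dots> \<le> exp (75/10000 * t\<^sup>2)"
  proof -
    have "50 * (real N * t) \<le> t\<^sup>2"
      unfolding power2_eq_square mult.assoc[symmetric] using assms t by (intro mult_right_mono) auto
    hence "375/1000 * (real N * t) \<le> 75/10000 * t\<^sup>2" by linarith
    thus ?thesis by (rule exp_le_cancel_iff[THEN iffD2])
  qed
  finally have "t ^ (2 * N) \<le> exp (75/10000 * t\<^sup>2)" by (simp add: power_mult)
  hence "1 / exp (75/10000 * t\<^sup>2) \<le> 1 / t ^ (2 * N)" using t by (intro divide_left_mono) auto
  thus ?thesis by (simp add: exp_minus power_one_over inverse_eq_divide)
qed

lemma cos_upper: "cos x \<le> 1 - x\<^sup>2 / 2 + x ^ 4 / 24" for x :: real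
proof -
  obtain t where "cos x = (\<Sum>m<4. cos_coeff m * x ^ m) + cos (t + 1/2 * real 4 * pi) / fact 4 * x ^ 4"
    using Maclaurin_cos_expansion[of x 4] by auto
  also have "(\<Sum>m<4. cos_coeff m * x ^ m) = 1 - x\<^sup>2 / 2"
    by (simp add: lessThan_nat_numeral cos_coeff_def fact_numeral)
  also have "cos (t + 1/2 * real 4 * pi) / fact 4 * x ^ 4 \<le> 1 / fact 4 * x ^ 4"
    by (intro mult_right_mono divide_right_mono) auto
  finally show ?thesis by (simp add: fact_numeral)
qed

text \<open>With \<open>D = (1 - q0)\<^sup>2\<close>, the squared distance from \<open>q\<close> to
  1 is \<open>D + S\<close>, so the gain is \<open>S / (D + S)\<close> times \<open>q0 / D\<close>.
  For \<open>\<bar>y\<bar> \<ge> z0 / 10\<close> the ratio \<open>S / D\<close> is about one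
  hundredth.\<close>

lemma minor_arc_gain:
  assumes z0: "0 < z0" "z0 \<le> 1 / 150" and y: "z0 / 10 \<le> \<bar>y\<bar>" "\<bar>y\<bar> \<le> pi"
  defines "q0 \<equiv> exp (- z0)"
  shows "q0 / (cmod (1 - exp (- (of_real z0 + \<i> * of_real y))))\<^sup>2 \<le> q0 / (1 - q0)\<^sup>2 - 85/10000 * (1 / z0)\<^sup>2"
proof -
  define D where "D = (1 - q0)\<^sup>2"
  define S where "S = 2 * q0 * (1 - cos y)"
  define X where "X = z0\<^sup>2"
  have q0: "149/150 \<le> q0" "q0 < 1" using exp_ge_add_one_self[of "- z0"] z0 by (auto simp: q0_def)
  have X: "X > 0" using z0 by (simp add: X_def)
  have D: "0 < D" "D \<le> X"
  proof -
    show "0 < D" using q0 by (simp add: D_def)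
    have "1 - q0 \<le> z0" using exp_ge_add_one_self[of "- z0"] by (simp add: q0_def)
    thus "D \<le> X" unfolding D_def X_def using q0 by (intro power_mono) auto
  qed
  have abs: "(cmod (1 - exp (- (of_real z0 + \<i> * of_real y))))\<^sup>2 = D + S"
  proof -
    have "(cmod (1 - exp (- (of_real z0 + \<i> * of_real y))))\<^sup>2 = (1 - q0 * cos y)\<^sup>2 + (q0 * sin y)\<^sup>2"
      unfolding cmod_power2 by (simp add: Re_exp Im_exp q0_def)
    also have "(1 - a * c)\<^sup>2 + (a * s)\<^sup>2 = 1 - 2 * a * c + a\<^sup>2 * (s\<^sup>2 + c\<^sup>2)" for a c s :: real
      by (simp add: power2_eq_square algebra_simps)
    finally show ?thesis unfolding sin_cos_squared_add D_def S_def by (simp add: power2_eq_square algebra_simps)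
  qed
  \<comment> \<open>Near 0 the function \<open>1 - cos y\<close> is about \<open>y^2 / 2\<close>,
    and by monotonicity of the cosine up to \<open>pi\<close> it is enough to look at
    \<open>y = z0 / 10\<close>.\<close>
  have S: "99/10000 * X \<le> S"
  proof -
    have "cos y = cos \<bar>y\<bar>" by simp
    also have "\<dots> \<le> cos (z0 / 10)" using z0 y by (intro cos_monotone_0_pi_le) auto
    also have "\<dots> \<le> 1 - (z0 / 10)\<^sup>2 / 2 + (z0 / 10) ^ 4 / 24" by (rule cos_upper)
    finally have 1: "X / 200 - X\<^sup>2 / 240000 \<le> 1 - cos y"
      by (simp add: X_def power2_eq_square power4_eq_xxxx)
    have "X \<le> 1" using z0 unfolding X_def by (intro power_le_one) auto
    hence "X\<^sup>2 \<le> X" using X by (simp add: power2_eq_square mult_left_le)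
    hence "4995/1000000 * X \<le> 1 - cos y" using 1 X by simp
    hence "149/150 * (4995/1000000 * X) \<le> q0 * (1 - cos y)" using q0 X by (intro mult_mono) auto
    thus ?thesis using X by (simp add: S_def)
  qed
  hence Sp: "S > 0" using X by simp
  have "98/10000 \<le> S / (D + S)"
  proof -
    have "98/10000 * (D + S) \<le> S" using S D X by simp
    thus ?thesis using D Sp by (simp add: pos_le_divide_eq)
  qed
  moreover have "(149/150) / X \<le> q0 / D" using q0 D X by (intro frac_le) auto
  ultimately have "98/10000 * ((149/150) / X) \<le> S / (D + S) * (q0 / D)" using X Sp D by (intro mult_mono) auto
  hence "85/10000 * (1 / X) \<le> S / (D + S) * (q0 / D)"
    by (rule order_trans[rotated]) (use X in \<open>simp add: field_simps\<close>)
  also have "\<dots> = q0 / D - q0 / (D + S)" using D Sp by (simp add: field_simps)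
  finally show ?thesis unfolding abs D_def X_def by (simp add: power_divide)
qed

text \<open>\<open>small\<close> is all that the estimates use of the hypothesis on
  \<open>w\<close>. The base 1.93 is just below the cube root of \<open>6 * 1.2\<close>.\<close>

locale saddle_scale =
  fixes r :: nat and z0 :: real
  assumes z0: "z0 > 0" and small: "z0 * (193/100) ^ r \<le> 1 / 80" and r: "r \<ge> 1"
begin

text \<open>\<open>r + 2\<close> is at once the first index omitted from both sums of the main term
  and the order of the Euler--Maclaurin expansion.\<close>

definition N :: nat where "N = r + 2"

text \<open>The case \<open>r = 1\<close> leaves little room: the two comparisons are 7 with 7.72
  and 150 with 154.4. From there on the right sides grow much faster.\<close>

lemma growth: "2 * real r + 5 \<le> 4 * (193/100) ^ r" "50 * (real r + 2) \<le> 80 * (193/100) ^ r"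
proof -
  have "2 * real r + 5 \<le> 4 * (193/100) ^ r \<and> 50 * (real r + 2) \<le> 80 * (193/100) ^ r"
    using r
  proof (induction r rule: dec_induct)
    case (step n)
    define p where "p = (193/100::real) ^ n"
    have "(193/100::real) ^ Suc n = 193/100 * p" by (simp add: p_def)
    with step.IH[folded p_def] show ?case by simp
  qed simp
  thus "2 * real r + 5 \<le> 4 * (193/100) ^ r" "50 * (real r + 2) \<le> 80 * (193/100) ^ r" by auto
qed

lemma z0_small: "(2 * real r + 5) * z0 \<le> 1 / 20" "50 * real N \<le> 1 / z0" "150 \<le> 1 / z0" "z0 \<le> 1/150"
proof -
  have "(2 * real r + 5) * z0 \<le> 4 * (193/100) ^ r * z0" using growth z0 by (intro mult_right_mono) auto
  also have "\<dots> = 4 * (z0 * (193/100) ^ r)" by simp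
  also have "\<dots> \<le> 4 * (1/80)" using small by (rule mult_left_mono) simp
  finally show "(2 * real r + 5) * z0 \<le> 1 / 20" by simp
  have "50 * (real r + 2) * z0 \<le> 80 * (193/100) ^ r * z0" using growth z0 by (intro mult_right_mono) auto
  also have "\<dots> = 80 * (z0 * (193/100) ^ r)" by simp
  also have "\<dots> \<le> 80 * (1/80)" using small by (rule mult_left_mono) simp
  finally have *: "50 * (real r + 2) * z0 \<le> 1" by simp
  thus 50: "50 * real N \<le> 1 / z0" using z0 by (simp add: N_def field_simps)
  thus 150: "150 \<le> 1 / z0" using r by (simp add: N_def)
  thus "z0 \<le> 1/150" using z0 by (simp add: field_simps)
qed

text \<open>For indices up to \<open>N\<close> the factorial growth of \<open>alpha s\<close> is
  defeated by \<open>z0 ^ (2 * s)\<close>, because \<open>(2 s + 1) z0\<close> is at most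
  \<open>1/20\<close>. The number 600000 is below \<open>400 * 1521\<close>.\<close>

lemma alpha_small:
  assumes "1 \<le> s" "s \<le> N" "0 \<le> c"
  shows "alpha s * (c * z0\<^sup>2) ^ s \<le> 42/100 * (c / 600000) ^ s"
proof -
  have "(2 * real s + 1) * z0 \<le> (2 * real r + 5) * z0" using assms z0 by (intro mult_right_mono) (auto simp: N_def)
  also have "\<dots> \<le> 1/20" by (rule z0_small)
  finally have "((2 * real s + 1) * z0)\<^sup>2 \<le> (1/20)\<^sup>2" using z0 by (intro power_mono) auto
  also have "(1/20::real)\<^sup>2 = 1/400" by (simp add: power2_eq_square)
  finally have "((2 * real s + 1) * z0)\<^sup>2 / 1521 \<le> 1 / 600000" by linarith
  hence b: "c * (((2 * real s + 1) * z0)\<^sup>2 / 1521) \<le> c * (1 / 600000)" using assms by (intro mult_left_mono) auto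
  have "alpha s * (c * z0\<^sup>2) ^ s \<le> 42/100 * ((2 * real s + 1) / 39) ^ (2 * s) * (c * z0\<^sup>2) ^ s"
    using alpha_upper[OF assms(1)] assms by (intro mult_right_mono) auto
  also have "((2 * real s + 1) / 39) ^ (2 * s) = (((2 * real s + 1) / 39)\<^sup>2) ^ s" by (rule power_mult)
  also have "42/100 * \<dots> * (c * z0\<^sup>2) ^ s = 42/100 * (((2 * real s + 1) / 39)\<^sup>2 * (c * z0\<^sup>2)) ^ s"
    by (simp only: power_mult_distrib mult.assoc)
  also have "((2 * real s + 1) / 39)\<^sup>2 * (c * z0\<^sup>2) = c * (((2 * real s + 1) * z0)\<^sup>2 / 1521)"
    by (simp add: power_divide power_mult_distrib)
  also have "42/100 * \<dots> ^ s \<le> 42/100 * (c * (1 / 600000)) ^ s"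
    by (rule mult_left_mono[OF power_mono[OF b]]) (use assms in auto)
  finally show ?thesis by simp
qed

text \<open>The factor 144 provides for the bound \<open>12 powr (2 s + 1/12)\<close> of
  \<open>u powr (2 s + 1/12)\<close> on the circle around the saddle point.\<close>

lemma alpha_sum_small:
  assumes "0 \<le> Y" "Y \<le> 144 * z0\<^sup>2"
  shows "(\<Sum>s=1..r + 1. alpha s * Y ^ s) \<le> 1 / 1000"
proof -
  have "(\<Sum>s=1..r + 1. alpha s * Y ^ s) \<le> (\<Sum>s=1..r + 1. 42/100 * (1/1000) ^ s)"
  proof (intro sum_mono)
    fix s assume s: "s \<in> {1..r + 1}"
    have "alpha s * Y ^ s \<le> alpha s * (144 * z0\<^sup>2) ^ s" using assms s alpha_pos[of s] by (intro mult_left_mono power_mono) auto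
    also have "\<dots> \<le> 42/100 * (144 / 600000) ^ s" by (rule alpha_small) (use s in \<open>auto simp: N_def\<close>)
    also have "\<dots> \<le> 42/100 * (1/1000) ^ s" by (intro mult_left_mono power_mono) auto
    finally show "alpha s * Y ^ s \<le> 42/100 * (1/1000) ^ s" .
  qed
  also have "\<dots> = 42/100 * ((\<Sum>s<r + 2. (1/1000) ^ s) - 1)"
  proof -
    have "{..<r + 2} = insert 0 {1..r + 1}" by auto
    hence "(\<Sum>s<r + 2. (1/1000::real) ^ s) = 1 + (\<Sum>s=1..r + 1. (1/1000) ^ s)" by (simp only:) (subst sum.insert, auto)
    thus ?thesis unfolding sum_distrib_left[symmetric] by simp
  qed
  also have "(\<Sum>s<r + 2. (1/1000::real) ^ s) \<le> 1 / (1 - 1/1000)" by (subst sum_gp_strict) (simp_all add: divide_right_mono)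
  finally show ?thesis by simp
qed

lemma exp_small: "exp (1/1000::real) \<le> 101/100"
proof -
  have "1 - 1/1000 \<le> exp (- (1/1000::real))" using exp_ge_add_one_self[of "- (1/1000)"] by simp
  hence "(1 - 1/1000) * exp (1/1000) \<le> exp (- (1/1000::real)) * exp (1/1000)" by (intro mult_right_mono) auto
  also have "\<dots> = 1" by (simp flip: exp_add)
  finally show ?thesis by simp
qed

lemma exp_P_small: "cmod x \<le> 144 * z0\<^sup>2 \<Longrightarrow> cmod (exp_P r x) \<le> 2"
proof -
  assume x: "cmod x \<le> 144 * z0\<^sup>2"
  have "cmod (exp_P r x) \<le> exp (cmod (- (\<Sum>s=1..r + 1. of_real (alpha s) * x ^ s)))"
    unfolding exp_P_def by (rule norm_exp)
  also have "cmod (- (\<Sum>s=1..r + 1. of_real (alpha s) * x ^ s)) \<le> (\<Sum>s=1..r + 1. alpha s * cmod x ^ s)"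
    unfolding norm_minus_cancel by (rule sum_norm_le) (simp add: norm_mult norm_power alpha_pos)
  also have "\<dots> \<le> 1/1000" by (rule alpha_sum_small) (use x in auto)
  also have "exp (1/1000::real) \<le> 2" using exp_small by simp
  finally show ?thesis by simp
qed

lemma beta_sum_small: "(\<Sum>s\<le>r + 1. \<bar>beta s\<bar> * (144 * z0\<^sup>2) ^ s) \<le> 101/100"
proof -
  have "(\<Sum>s\<le>r + 1. \<bar>beta s\<bar> * (144 * z0\<^sup>2) ^ s) \<le> (\<Sum>s<r + 2. exp_coeff (r + 1) alpha s * (144 * z0\<^sup>2) ^ s)"
  proof -
    have "{..r + 1} = {..<r + 2}" by auto
    thus ?thesis by (simp only:) (intro sum_mono mult_right_mono, use exp_coeff_abs_le[of alpha "r + 1"] beta_eq[of _ "r + 1"] alpha_pos in auto)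
  qed
  also have "\<dots> \<le> exp (\<Sum>s=1..r + 1. alpha s * (144 * z0\<^sup>2) ^ s)"
    by (rule exp_coeff_partial_le) (auto intro: alpha_pos)
  also have "\<dots> \<le> exp (1/1000)" using alpha_sum_small[of "144 * z0\<^sup>2"] by simp
  also have "\<dots> \<le> 101/100" by (rule exp_small)
  finally show ?thesis .
qed

text \<open>The error of \<open>log_gf_asymptotic\<close> on the arc, where
  \<open>\<bar>z\<bar>^2\<close> is at most \<open>101/100 * z0\<^sup>2\<close>.\<close>

definition rem_bound :: real where
  "rem_bound = alpha N * (1 + 5 * real N * (10 / 9) ^ (N + 1)) * (101/100 * z0\<^sup>2) ^ N"

text \<open>Relative to \<open>z0 * scale\<close>, the bound to be proved is \<open>2^(9 + 1/24) * \<pi>^3\<close> of these units for \<open>2 * \<pi> * PL n\<close>.\<close>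

definition unit_err :: real where
  "unit_err = C_const r * real N * 2 ^ r * z0 ^ (2 * N)"

lemma unit_err_ge: "z0 ^ (2 * N) \<le> unit_err"
proof -
  have "1 * 1 * 1 \<le> C_const r * real N * 2 ^ r" using C_const_ge_2[of r] by (intro mult_mono) (auto simp: N_def)
  from mult_right_mono[OF this, of "z0 ^ (2 * N)"] show ?thesis using z0 by (simp add: unit_err_def)
qed

lemma unit_err_nonneg: "0 \<le> unit_err"
  by (rule order_trans[OF _ unit_err_ge]) (use z0 in simp)

lemma N_factor: "1 + 5 * real N * (10 / 9) ^ (N + 1) \<le> 6 * real N * (10/9) ^ (N + 1)"
proof -
  have "1 * 1 \<le> real N * (10/9) ^ (N + 1)" by (intro mult_mono one_le_power) (auto simp: N_def)
  thus ?thesis by simp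
qed

lemma rem_bound_le_1: "rem_bound \<le> 1"
proof -
  have "rem_bound = (1 + 5 * real N * (10 / 9) ^ (N + 1)) * (alpha N * (101/100 * z0\<^sup>2) ^ N)" by (simp add: rem_bound_def)
  also have "\<dots> \<le> (6 * real N * (10/9) ^ (N + 1)) * (42/100 * ((101/100) / 600000) ^ N)"
    by (intro mult_mono N_factor alpha_small mult_nonneg_nonneg alpha_pos) (auto simp: N_def)
  also have "\<dots> \<le> (6 * 2 ^ N * (10/9) ^ (N + 1)) * (42/100 * ((101/100) / 600000) ^ N)"
    using of_nat_less_two_power[of N, where ?'a = real] by (intro mult_right_mono mult_left_mono) auto
  also have "\<dots> = 28/10 * (2 * (10/9) * ((101/100) / 600000)) ^ N"
  proof -
    have "(6 * a * (10/9 * b)) * (42/100 * c) = 28/10 * (a * b * c)" for a b c :: real by simp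
    from this[of "2 ^ N" "(10/9) ^ N"] show ?thesis unfolding power_mult_distrib Suc_eq_plus1[symmetric] power_Suc .
  qed
  also have "\<dots> \<le> 28/10 * (1/2) ^ N" by (intro mult_left_mono power_mono) auto
  also have "(1/2::real) ^ N \<le> (1/2) ^ 2" by (intro power_decreasing) (auto simp: N_def)
  finally show ?thesis by (simp add: power2_eq_square)
qed

text \<open>\<open>alpha (r + 1)\<close> is below \<open>C_const r / 2\<close> because the constant
  contains its exponential. The step to \<open>alpha (r + 2)\<close> costs a quadratic in
  \<open>r\<close>, which Bernoulli's inequality converts into \<open>(16/9) ^ r\<close>.\<close>

lemma rem_bound_le: "rem_bound \<le> unit_err / 10"
proof -
  have C: "alpha (r + 1) \<le> C_const r / 2"
    using C_const_lower[of r] exp_ge_add_one_self[of "alpha (r + 1)"] by linarith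
  have C0: "0 \<le> C_const r" using C_const_ge_2[of r] by simp
  have "(2 * real (r + 1)) * (2 * real (r + 1) + 3) \<le> 36 * (16/9) ^ r"
  proof -
    have "(2 * real (r + 1)) * (2 * real (r + 1) + 3) \<le> 4 * (real r + 3)\<^sup>2" by (simp add: power2_eq_square algebra_simps)
    also have "real r + 3 = 3 * (1 + real r * (1/3))" by simp
    also have "1 + real r * (1/3) \<le> (1 + 1/3) ^ r" by (rule Bernoulli_inequality) simp
    hence "4 * (3 * (1 + real r * (1/3)))\<^sup>2 \<le> 4 * (3 * (1 + 1/3) ^ r)\<^sup>2" by (intro mult_left_mono power_mono) auto
    also have "\<dots> = 36 * ((4/3)\<^sup>2) ^ r" by (simp add: power_mult_distrib flip: power_mult)
    finally show ?thesis by (simp add: power2_eq_square)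
  qed
  hence "(2 * real (r + 1)) * (2 * real (r + 1) + 3) / 1521 \<le> 36 * (16/9) ^ r / 1521" by (rule divide_right_mono) simp
  moreover have "alpha N \<le> alpha (r + 1) * (2 * real (r + 1) * (2 * real (r + 1) + 3) / 1521)"
    using alpha_Suc(1)[of "r + 1"] by (simp add: N_def)
  ultimately have a: "alpha N \<le> C_const r / 2 * (36 * (16/9) ^ r / 1521)"
    using C C0 by (elim order_trans) (intro mult_mono, auto)
  have "rem_bound \<le> (C_const r / 2 * (36 * (16/9) ^ r / 1521)) * (6 * real N * (10/9) ^ (N + 1)) * (101/100 * z0\<^sup>2) ^ N"
    unfolding rem_bound_def using C0 by (intro mult_mono a N_factor mult_nonneg_nonneg) auto
  also have "\<dots> = C_const r * real N * z0 ^ (2 * N) * (108/1521 * ((10/9) ^ 3 * (101/100)\<^sup>2)) * ((16/9) ^ r * (10/9) ^ r * (101/100) ^ r)"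
  proof -
    have p: "(10/9::real) ^ (N + 1) = (10/9) ^ 3 * (10/9) ^ r" "(101/100 * z0\<^sup>2) ^ N = z0 ^ (2 * N) * ((101/100)\<^sup>2 * (101/100) ^ r)"
      unfolding power_mult_distrib power_mult[symmetric] by (simp_all add: N_def power2_eq_square power3_eq_cube)
    have "(C / 2 * (36 * a / 1521)) * (6 * n * (t * b)) * (z * (u * c)) = C * n * z * (108/1521 * (t * u)) * (a * b * c)" for C a n t b z u c :: real
      by simp
    thus ?thesis unfolding p .
  qed
  also have "(16/9::real) ^ r * (10/9) ^ r * (101/100) ^ r = (16/9 * (10/9) * (101/100)) ^ r" by (simp only: power_mult_distrib)
  also have "C_const r * real N * z0 ^ (2 * N) * (108/1521 * ((10/9) ^ 3 * (101/100)\<^sup>2)) * (16/9 * (10/9) * (101/100)) ^ r \<le> C_const r * real N * z0 ^ (2 * N) * (1/10) * 2 ^ r"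
  proof (intro mult_mono mult_left_mono power_mono)
    show "108/1521 * ((10/9) ^ 3 * (101/100)\<^sup>2) \<le> (1/10::real)" by (simp add: power2_eq_square power3_eq_cube)
  qed (use C0 z0 in \<open>auto intro!: mult_nonneg_nonneg\<close>)
  finally show ?thesis by (simp add: unit_err_def mult_ac)
qed

lemma gauss_remainder_bound:
  assumes L: "L = A_const * (1 / z0)\<^sup>2"
  shows "12 * (real N + 1) * (3/4) ^ N * gauss (294/100 * L) N + 20 * exp (- (147/10000 * L)) \<le> 4920 * unit_err"
proof -
  define X where "X = 294/100 * L"
  have z: "z0 > 0" "z0 * (193/100) ^ r \<le> 1/80" by (fact z0, fact small)
  have A: "12/10 * (1 / z0)\<^sup>2 \<le> L" unfolding L by (rule mult_right_mono[OF A_const_ge]) simp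
  \<comment> \<open>The number is \<open>2.94\<close> from the decay along the line times the lower
    bound 1.2 for \<open>A_const\<close>.\<close>
  hence X: "3528/1000 * (1 / z0)\<^sup>2 \<le> X" unfolding X_def by simp
  hence Xp: "X > 0" by (rule less_le_trans[rotated]) (use z in simp)
  have "185/100 * (1 / z0) \<le> sqrt X"
  proof (rule real_le_rsqrt)
    have "(185/100 * (1 / z0))\<^sup>2 = (185/100)\<^sup>2 * (1 / z0)\<^sup>2" by (rule power_mult_distrib)
    also have "\<dots> \<le> 3528/1000 * (1 / z0)\<^sup>2" by (intro mult_right_mono) (auto simp: power2_eq_square)
    finally show "(185/100 * (1 / z0))\<^sup>2 \<le> X" using X by simp
  qed
  moreover have "(3528/1000 * (1 / z0)\<^sup>2) ^ N \<le> X ^ N" using X by (intro power_mono) auto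
  ultimately have den: "(3528/1000 * (1 / z0)\<^sup>2) ^ N * (185/100 * (1 / z0)) \<le> X ^ N * sqrt X"
    using z Xp by (intro mult_mono) auto
  have Ga: "Gamma (real N + 1/2) = gamma_ratio r * 18 ^ r"
  proof -
    have "real N + 1/2 = real r + 5/2" by (simp add: N_def)
    thus ?thesis by (simp only: gamma_ratio_def) simp
  qed
  have "gauss X N = gamma_ratio r * 18 ^ r * (1 / (X ^ N * sqrt X))"
    unfolding gauss_def powr_minus_half_nat[OF Xp] Ga ..
  also have "\<dots> \<le> gamma_ratio r * 18 ^ r * (1 / ((3528/1000 * (1 / z0)\<^sup>2) ^ N * (185/100 * (1 / z0))))"
    using den z Xp gamma_ratio_pos[of r] by (intro mult_left_mono divide_left_mono mult_pos_pos) auto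
  also have "\<dots> = gamma_ratio r * 18 ^ r * (z0 ^ (2 * N) * z0 / ((3528/1000) ^ N * (185/100)))"
    using z by (simp add: power_mult_distrib power_divide power_mult)
  finally have g: "gauss X N \<le> gamma_ratio r * 18 ^ r * (z0 ^ (2 * N) * z0 / ((3528/1000) ^ N * (185/100)))" .
  have gr: "gamma_ratio r \<le> 10 ^ 6 * C_const r"
    by (rule order_trans[OF gamma_ratio_exp_alpha]) (use C_const_lower[of r] in simp)
  have g': "gauss X N \<le> 10 ^ 6 * C_const r * 18 ^ r * (z0 ^ (2 * N) * z0 / ((3528/1000) ^ N * (185/100)))"
    by (rule order_trans[OF g]) (use gr z in \<open>intro mult_right_mono, auto\<close>)
  have "12 * (real N + 1) * (3/4) ^ N * gauss X N \<le> (16 * real N) * (3/4) ^ N * (10 ^ 6 * C_const r * 18 ^ r * (z0 ^ (2 * N) * z0 / ((3528/1000) ^ N * (185/100))))"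
  proof (rule mult_mono[OF mult_right_mono g'])
    show "12 * (real N + 1) \<le> 16 * real N" using r by (simp add: N_def)
    show "0 \<le> gauss X N" unfolding gauss_def by (intro mult_nonneg_nonneg less_imp_le[OF Gamma_half_pos]) simp
  qed auto
  also have "\<dots> = 16 * 10 ^ 6 / (185/100) * ((3/4) / (3528/1000))\<^sup>2 * (C_const r * real N * z0 ^ (2 * N)) * (((3/4) * 18 / (3528/1000)) ^ r * z0)"
  proof -
    have p: "(3/4::real) ^ N = (3/4)\<^sup>2 * (3/4) ^ r" "(3528/1000::real) ^ N = (3528/1000)\<^sup>2 * (3528/1000) ^ r"
      by (simp_all add: N_def power2_eq_square)
    have "(16 * n) * ((3/4)\<^sup>2 * a) * (K * C * b * (z * y / ((3528/1000)\<^sup>2 * c * (185/100)))) = 16 * K / (185/100) * ((3/4) / (3528/1000))\<^sup>2 * (C * n * z) * (a * b / c * y)"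
      for n a K C b z y c :: real by (simp add: power2_eq_square)
    thus ?thesis unfolding p power_divide[of "3/4 * 18"] power_mult_distrib[of "3/4" 18] .
  qed
  \<comment> \<open>The base is about 3.83, below \<open>2 * 1.93\<close>: the power of 2 goes into
    \<open>unit_err\<close>, and the power of 1.93 is compensated by the one spare factor
    \<open>z0\<close>.\<close>
  also have "((3/4) * 18 / (3528/1000)) ^ r * z0 \<le> 2 ^ r * (1/80)"
  proof -
    have "((3/4) * 18 / (3528/1000)) ^ r * z0 \<le> (2 * (193/100)) ^ r * z0" using z by (intro mult_right_mono power_mono) auto
    also have "\<dots> = 2 ^ r * (z0 * (193/100) ^ r)" unfolding power_mult_distrib by (simp only: mult_ac)
    also have "\<dots> \<le> 2 ^ r * (1/80)" using z by (intro mult_left_mono) auto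
    finally show ?thesis .
  qed
  hence "16 * 10 ^ 6 / (185/100) * ((3/4) / (3528/1000))\<^sup>2 * (C_const r * real N * z0 ^ (2 * N)) * (((3/4) * 18 / (3528/1000)) ^ r * z0)
     \<le> 16 * 10 ^ 6 / (185/100) * ((3/4) / (3528/1000))\<^sup>2 * (C_const r * real N * z0 ^ (2 * N)) * (2 ^ r * (1/80))"
    using C_const_ge_2[of r] z by (intro mult_left_mono mult_nonneg_nonneg) auto
  also have "\<dots> = 16 * 10 ^ 6 / (185/100) * ((3/4) / (3528/1000))\<^sup>2 / 80 * unit_err" by (simp add: unit_err_def)
  also have "\<dots> \<le> 4900 * unit_err"
  proof (rule mult_right_mono)
    show "0 \<le> unit_err" by (rule unit_err_nonneg)
  qed (simp add: power2_eq_square)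
  finally have 1: "12 * (real N + 1) * (3/4) ^ N * gauss X N \<le> 4900 * unit_err" .
  have "exp (- (147/10000 * L)) \<le> exp (- (75/10000 * (1 / z0)\<^sup>2))"
  proof -
    have "75/10000 * (1 / z0)\<^sup>2 \<le> 147/10000 * L" using A zero_le_power2[of "1 / z0"] by linarith
    thus ?thesis by simp
  qed
  also have "\<dots> \<le> (1 / (1 / z0)) ^ (2 * N)" by (rule exp_beats_power) (fact z0_small)+
  also have "\<dots> \<le> unit_err" using unit_err_ge by simp
  finally show ?thesis using 1 by (simp add: X_def)
qed

text \<open>Of the rate \<open>0.0085\<close>, the part \<open>0.0075\<close> beats
  \<open>z0 ^ (2 * N)\<close>, and the remaining \<open>0.001\<close> absorbs the factor
  \<open>1 / z0\<close>.\<close>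

lemma minor_arc_small: "40 * (1 / z0) * exp (- (85/10000 * (1 / z0)\<^sup>2)) \<le> 280 * unit_err"
proof -
  define t where "t = 1 / z0"
  have t: "t \<ge> 150" "t > 0" using z0_small z0 by (auto simp: t_def)
  have "exp (- (85/10000 * t\<^sup>2)) = exp (- (75/10000 * t\<^sup>2)) * exp (- (1/1000 * t\<^sup>2))" by (simp flip: exp_add)
  also have "\<dots> \<le> unit_err * (1000 / t\<^sup>2)"
  proof (intro mult_mono)
    have "exp (- (75/10000 * t\<^sup>2)) \<le> (1 / t) ^ (2 * N)" unfolding t_def by (rule exp_beats_power) (fact z0_small)+
    thus "exp (- (75/10000 * t\<^sup>2)) \<le> unit_err" using unit_err_ge by (simp add: t_def)
    have "1/1000 * t\<^sup>2 \<le> exp (1/1000 * t\<^sup>2)" using exp_ge_add_one_self[of "1/1000 * t\<^sup>2"] by linarith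
    hence "1 / exp (1/1000 * t\<^sup>2) \<le> 1 / (1/1000 * t\<^sup>2)" using t by (intro divide_left_mono) auto
    thus "exp (- (1/1000 * t\<^sup>2)) \<le> 1000 / t\<^sup>2" by (simp add: exp_minus inverse_eq_divide)
    show "0 \<le> unit_err" by (rule unit_err_nonneg)
  qed simp
  finally have "40 * t * exp (- (85/10000 * t\<^sup>2)) \<le> 40 * t * (unit_err * (1000 / t\<^sup>2))" using t by (intro mult_left_mono) auto
  also have "\<dots> = 40000 / t * unit_err" using t by (simp add: power2_eq_square)
  also have "\<dots> \<le> 280 * unit_err"
  proof (rule mult_right_mono)
    show "40000 / t \<le> 280" using t by (simp add: divide_le_eq)
    show "0 \<le> unit_err" by (rule unit_err_nonneg)
  qed
  finally show ?thesis by (simp add: t_def)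
qed

end

section \<open>The integral over the segment\<close>

lemma log_gf_of_real:
  assumes "0 \<le> q" "q < 1"
  shows "log_gf (complex_of_real q) = of_real (log_gf q)"
proof -
  have S: "summable (\<lambda>m. norm (log_term m q))" by (rule summable_log_term) (use assms in simp)
  have "complex_of_real (\<Sum>m. log_term m q) = (\<Sum>m. of_real (log_term m q))"
    by (rule suminf_of_real[OF summable_norm_cancel[OF S]])
  thus ?thesis by (simp add: log_gf_def log_term_def)
qed

lemma has_integral_norm_bound:
  fixes f :: "real \<Rightarrow> complex"
  assumes "(f has_integral i) {a..b}" "a \<le> b" "0 \<le> B" "\<And>x. x \<in> {a..b} \<Longrightarrow> cmod (f x) \<le> B"
  shows "cmod i \<le> B * (b - a)"
  using has_integral_bound_real[of B "{}" f i a b] assms by simp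

locale saddle_arc = saddle_scale +
  fixes n :: nat
  assumes n: "real n * z0 ^ 3 = 2 * A_const"
begin

definition L :: real where "L = A_const * (1 / z0)\<^sup>2"

definition vline :: "real \<Rightarrow> complex" where "vline \<tau> = 1 + \<i> * of_real \<tau>"

text \<open>The size of the integrand at the saddle point, apart from \<open>correction\<close>; all
  errors on the segment are measured relative to it.\<close>

definition scale :: real where "scale = exp (c_const + 3 * L) * z0 powr (1/12)"

definition remainder :: "real \<Rightarrow> complex" where
  "remainder \<tau> = log_gf (exp (- (of_real z0 * vline \<tau>))) - (of_real A_const / (of_real z0 * vline \<tau>)\<^sup>2 + Ln (of_real z0 * vline \<tau>) / 12 + of_real c_const
     - (\<Sum>s=1..<N. of_real (alpha s) * (of_real z0 * vline \<tau>) ^ (2 * s)))"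

text \<open>The factor that the polynomial with coefficients \<open>beta\<close> approximates;
  everything else on the arc is in \<open>scale\<close> and \<open>kernel\<close>.\<close>

definition correction :: "real \<Rightarrow> complex" where
  "correction \<tau> = exp_P r ((of_real z0 * vline \<tau>)\<^sup>2) * exp (remainder \<tau>)"

definition kernel :: "real \<Rightarrow> complex" where
  "kernel \<tau> = exp (of_real L * (saddle_v (vline \<tau>))\<^sup>2) * vline \<tau> powr of_real (1/12)"

definition integrand :: "real \<Rightarrow> complex" where
  "integrand y = exp (of_nat n * (of_real z0 + \<i> * of_real y) + log_gf (exp (- (of_real z0 + \<i> * of_real y))))"

definition main_sum :: real where
  "main_sum = (\<Sum>s\<le>r + 1. \<Sum>m<N. (- 1) ^ m * beta s * b_coeff s m * z0 ^ (2 * s) * gauss L m)"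

lemma arc_facts: "vline \<tau> \<noteq> 0" "Re (vline \<tau>) = 1" "Im (vline \<tau>) = \<tau>" "vline \<tau> \<in> RHP"
  by (auto simp: vline_def RHP_def complex_eq_iff)

lemma arc_norm:
  assumes "\<bar>\<tau>\<bar> \<le> 1/10"
  shows "(cmod (of_real z0 * vline \<tau>))\<^sup>2 \<le> 101/100 * z0\<^sup>2" "cmod (vline \<tau>) \<le> 2" "1 \<le> cmod (vline \<tau>)"
proof -
  have t2: "\<tau>\<^sup>2 \<le> 1/100" using assms abs_le_square_iff[of \<tau> "1/10"] by (simp add: power2_eq_square)
  have c: "(cmod (vline \<tau>))\<^sup>2 = 1 + \<tau>\<^sup>2" unfolding cmod_power2 by (simp add: arc_facts)
  have "(cmod (of_real z0 * vline \<tau>))\<^sup>2 = (1 + \<tau>\<^sup>2) * z0\<^sup>2" by (simp add: norm_mult power_mult_distrib c)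
  also have "\<dots> \<le> 101/100 * z0\<^sup>2" using t2 by (intro mult_right_mono) auto
  finally show "(cmod (of_real z0 * vline \<tau>))\<^sup>2 \<le> 101/100 * z0\<^sup>2" .
  show "cmod (vline \<tau>) \<le> 2" by (rule power2_le_imp_le) (use c t2 in auto)
  show "1 \<le> cmod (vline \<tau>)" by (rule power2_le_imp_le) (use c in auto)
qed

lemma remainder_le:
  assumes "\<bar>\<tau>\<bar> \<le> 1/10"
  shows "cmod (remainder \<tau>) \<le> rem_bound"
proof -
  have "cmod (remainder \<tau>) \<le> alpha N * (1 + 5 * real N * (10 / 9) ^ (N + 1)) * cmod (of_real z0 * vline \<tau>) ^ (2 * N)"
    unfolding remainder_def
  proof (rule log_gf_asymptotic)
    have "z0 * \<bar>\<tau>\<bar> \<le> z0 * (1/10)" using assms z0 by (intro mult_left_mono) auto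
    thus "\<bar>Im (of_real z0 * vline \<tau>)\<bar> \<le> Re (of_real z0 * vline \<tau>) / 10" using z0 by (simp add: arc_facts abs_mult)
  qed (use z0 arc_facts in \<open>auto simp: N_def\<close>)
  also have "\<dots> \<le> rem_bound"
    unfolding rem_bound_def power_mult using arc_norm(1)[OF assms] alpha_pos[of N]
    by (intro mult_left_mono power_mono mult_nonneg_nonneg) (auto simp: N_def)
  finally show ?thesis .
qed

lemma integrand_arc: "integrand (z0 * \<tau>) = of_real scale * (kernel \<tau> * correction \<tau>)"
proof -
  define u where "u = vline \<tau>"
  have u: "u \<noteq> 0" by (simp add: u_def arc_facts)
  have z: "of_real z0 + \<i> * of_real (z0 * \<tau>) = of_real z0 * u" by (simp add: u_def vline_def algebra_simps)
  have P: "(\<Sum>s=1..<N. of_real (alpha s) * (of_real z0 * u) ^ (2 * s)) = (\<Sum>s=1..r + 1. of_real (alpha s) * ((of_real z0 * u)\<^sup>2) ^ s)"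
    by (intro sum.cong) (auto simp: N_def power_mult)
  have "real n * z0 = 2 * L"
  proof -
    have "real n * z0 ^ 3 / z0\<^sup>2 = 2 * A_const / z0\<^sup>2" unfolding n ..
    thus ?thesis using z0 by (simp add: L_def power_divide power3_eq_cube power2_eq_square)
  qed
  hence "of_real (real n * z0) = (of_real (2 * L) :: complex)" by (rule arg_cong)
  hence nz: "of_nat n * (of_real z0 * u) = 2 * of_real L * u" by simp
  have A: "of_real A_const / (of_real z0 * u)\<^sup>2 = of_real L * (1 / u\<^sup>2)"
    by (simp add: L_def power_mult_distrib power_divide)
  have Ln: "Ln (of_real z0 * u) = of_real (ln z0) + Ln u" using Ln_times_of_real[OF z0 u] Ln_of_real[OF z0] by simp
  have v: "of_real L * (saddle_v u)\<^sup>2 = 2 * of_real L * u + of_real L * (1 / u\<^sup>2) - 3 * of_real L"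
    unfolding saddle_v_sq[OF u] by (simp add: algebra_simps)
  have E: "of_nat n * (of_real z0 * u) + log_gf (exp (- (of_real z0 * u))) =
     of_real (c_const + 3 * L) + of_real (ln z0 * (1/12)) + of_real L * (saddle_v u)\<^sup>2 + of_real (1/12) * Ln u
     + - (\<Sum>s=1..r + 1. of_real (alpha s) * ((of_real z0 * u)\<^sup>2) ^ s) + remainder \<tau>"
    unfolding remainder_def u_def[symmetric] P nz A Ln v by (simp add: add_divide_distrib)
  have "exp (complex_of_real (c_const + 3 * L)) * exp (of_real (ln z0 * (1/12))) = of_real scale"
    unfolding exp_of_real scale_def powr_def using z0 by (simp add: mult.commute)
  moreover have "exp (of_real (1/12) * Ln u) = u powr of_real (1/12)" using u by (simp add: powr_def)
  ultimately show ?thesis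
    unfolding integrand_def z kernel_def correction_def exp_P_def u_def[symmetric] E exp_add
    by (simp only: mult_ac)
qed

lemma correction_le: "\<bar>\<tau>\<bar> \<le> 1/10 \<Longrightarrow> cmod (correction \<tau>) \<le> 6"
proof -
  assume t: "\<bar>\<tau>\<bar> \<le> 1/10"
  have "cmod (exp (remainder \<tau>)) \<le> exp (cmod (remainder \<tau>))" by (rule norm_exp)
  also have "\<dots> \<le> exp 1" using remainder_le[OF t] rem_bound_le_1 by simp
  also have "\<dots> \<le> 3" by (rule exp_le)
  finally have "cmod (exp (remainder \<tau>)) \<le> 3" .
  moreover have "cmod (exp_P r ((of_real z0 * vline \<tau>)\<^sup>2)) \<le> 2"
    unfolding norm_power by (rule exp_P_small, unfold norm_power, rule order_trans[OF arc_norm(1)[OF t]]) simp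
  ultimately have "cmod (exp_P r ((of_real z0 * vline \<tau>)\<^sup>2)) * cmod (exp (remainder \<tau>)) \<le> 2 * 3" by (intro mult_mono) auto
  thus ?thesis by (simp add: correction_def norm_mult)
qed

lemma correction_approx:
  assumes t: "\<bar>\<tau>\<bar> \<le> 1/10"
  shows "cmod (correction \<tau> - (\<Sum>s\<le>r + 1. of_real (beta s) * ((of_real z0 * vline \<tau>)\<^sup>2) ^ s)) \<le> 2 * unit_err"
proof -
  define x where "x = (of_real z0 * vline \<tau>)\<^sup>2"
  have x: "cmod x \<le> 101/100 * z0\<^sup>2" using arc_norm(1)[OF t] by (simp add: x_def norm_power)
  have "z0\<^sup>2 \<le> (1/150)\<^sup>2" using z0_small z0 by (intro power_mono) auto
  hence x2: "cmod x \<le> 1/2" using x by (simp add: power2_eq_square)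
  have C: "C_const r \<ge> 0" using C_const_ge_2[of r] by simp
  have sum_eq: "(\<Sum>n<N. of_real (exp_coeff (r + 1) (\<lambda>i. - alpha i) n) * x ^ n) = (\<Sum>s\<le>r + 1. of_real (beta s) * x ^ s)"
    by (rule sum.cong) (auto simp: N_def beta_eq[of _ "r + 1"])
  have "cmod (exp_P r x - (\<Sum>s\<le>r + 1. of_real (beta s) * x ^ s)) \<le> C_const r / 2 * cmod x ^ N / (1 - cmod x)"
    unfolding sum_eq[symmetric] by (rule exp_P_tail) (use x2 in simp)
  also have "\<dots> \<le> C_const r / 2 * cmod x ^ N / (1/2)" using x2 C by (intro divide_left_mono) auto
  also have "\<dots> = C_const r * cmod x ^ N" by simp
  also have "\<dots> \<le> C_const r * (101/100 * z0\<^sup>2) ^ N" using x C by (intro mult_left_mono power_mono) auto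
  also have "\<dots> = C_const r * ((101/100)\<^sup>2 * (101/100) ^ r * z0 ^ (2 * N))"
    unfolding power_mult_distrib power_mult[symmetric] by (simp add: N_def power2_eq_square)
  also have "\<dots> \<le> C_const r * (real N * 2 ^ r * z0 ^ (2 * N))"
  proof (intro mult_left_mono mult_right_mono mult_mono power_mono)
    show "(101/100)\<^sup>2 \<le> real N" by (simp add: N_def power2_eq_square)
  qed (use C z0 in auto)
  finally have 1: "cmod (exp_P r x - (\<Sum>s\<le>r + 1. of_real (beta s) * x ^ s)) \<le> unit_err"
    by (simp add: unit_err_def mult.assoc)
  have "cmod (exp (remainder \<tau>) - 1) \<le> exp (cmod (remainder \<tau>)) * cmod (remainder \<tau>)"
    using Taylor_exp_field[of "remainder \<tau>" 0] by simp
  also have "\<dots> \<le> 3 * rem_bound"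
  proof (intro mult_mono remainder_le t)
    have "exp (cmod (remainder \<tau>)) \<le> exp 1" using remainder_le[OF t] rem_bound_le_1 by simp
    also have "\<dots> \<le> 3" by (rule exp_le)
    finally show "exp (cmod (remainder \<tau>)) \<le> 3" .
  qed auto
  also have "\<dots> \<le> 3 * (unit_err / 10)" using rem_bound_le by simp
  finally have e: "cmod (exp (remainder \<tau>) - 1) \<le> 3 * (unit_err / 10)" .
  have "cmod (exp_P r x) \<le> 2" by (rule exp_P_small) (rule order_trans[OF x], simp)
  with e have 2: "cmod (exp_P r x * (exp (remainder \<tau>) - 1)) \<le> 2 * (3 * (unit_err / 10))"
    unfolding norm_mult by (intro mult_mono) auto
  have "correction \<tau> - (\<Sum>s\<le>r + 1. of_real (beta s) * x ^ s) = (exp_P r x - (\<Sum>s\<le>r + 1. of_real (beta s) * x ^ s)) + exp_P r x * (exp (remainder \<tau>) - 1)"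
    by (simp add: correction_def x_def algebra_simps)
  also have "cmod \<dots> \<le> unit_err + 2 * (3 * (unit_err / 10))" by (rule norm_triangle_mono[OF 1 2])
  finally show ?thesis using unit_err_nonneg by (simp add: x_def)
qed

lemma kernel_le: "\<bar>\<tau>\<bar> \<le> 1/10 \<Longrightarrow> cmod (kernel \<tau>) \<le> 2"
proof -
  assume t: "\<bar>\<tau>\<bar> \<le> 1/10"
  have "0 \<le> L" using A_const_ge by (simp add: L_def)
  moreover have "Re ((saddle_v (vline \<tau>))\<^sup>2) \<le> 0"
    by (rule order_trans[OF saddle_v_line(1)[OF t, folded vline_def]]) simp
  ultimately have "L * Re ((saddle_v (vline \<tau>))\<^sup>2) \<le> 0" by (rule mult_nonneg_nonpos)
  hence 1: "cmod (exp (of_real L * (saddle_v (vline \<tau>))\<^sup>2)) \<le> 1" by simp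
  have "cmod (vline \<tau> powr of_real (1/12)) = cmod (vline \<tau>) powr (1/12)"
    using arc_facts by (simp add: norm_powr_real_powr')
  also have "\<dots> \<le> cmod (vline \<tau>) powr 1" using arc_norm(3)[OF t] by (intro powr_mono) auto
  also have "\<dots> \<le> 2" using arc_norm[OF t] by simp
  finally have "cmod (vline \<tau> powr of_real (1/12)) \<le> 2" .
  with 1 have "cmod (exp (of_real L * (saddle_v (vline \<tau>))\<^sup>2)) * cmod (vline \<tau> powr of_real (1/12)) \<le> 1 * 2" by (intro mult_mono) auto
  thus ?thesis by (simp add: kernel_def norm_mult)
qed

lemma continuous_kernel: "continuous_on S kernel" "continuous_on S vline"
  "continuous_on S (\<lambda>\<tau>. exp (of_real L * (saddle_v (vline \<tau>))\<^sup>2) * vline \<tau> powr of_real a)"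
proof -
  show c: "continuous_on S vline" unfolding vline_def[abs_def] by (intro continuous_intros)
  have "continuous_on S (\<lambda>\<tau>. h (vline \<tau>))" if "h holomorphic_on RHP" for h
    by (rule continuous_on_compose2[OF holomorphic_on_imp_continuous_on[OF that] c]) (use arc_facts in auto)
  note hol = this[OF saddle_holo(1)] this[OF saddle_holo(3)]
  show "continuous_on S (\<lambda>\<tau>. exp (of_real L * (saddle_v (vline \<tau>))\<^sup>2) * vline \<tau> powr of_real a)" for a
    by (intro continuous_intros hol)
  thus "continuous_on S kernel" unfolding kernel_def[abs_def] .
qed

lemma L_ge_N: "L \<ge> real N"
proof -
  define t where "t = 1 / z0"
  have t: "50 * real N \<le> t" "150 \<le> t" using z0_small by (simp_all add: t_def)
  have "1 * (real N * 1) \<le> A_const * (t * t)" using t A_const_ge by (intro mult_mono) auto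
  thus ?thesis by (simp add: L_def t_def power2_eq_square)
qed

lemma main_term_integral:
  "cmod (integral {- (1/10)..1/10} (\<lambda>\<tau>. kernel \<tau> * (\<Sum>s\<le>r + 1. of_real (beta s) * ((of_real z0 * vline \<tau>)\<^sup>2) ^ s)) - of_real main_sum) \<le> 6300 * unit_err"
proof -
  define I where "I = {- (1/10::real)..1/10}"
  define a where "a s = 2 * real s + 1/12" for s :: nat
  define f where "f s \<tau> = exp (of_real L * (saddle_v (vline \<tau>))\<^sup>2) * vline \<tau> powr of_real (a s)" for s \<tau>
  define G where "G = 12 * (real N + 1) * (3/4) ^ N * gauss (294/100 * L) N + 20 * exp (- (147/10000 * L))"
  have fi: "f s integrable_on I" for s
    unfolding I_def f_def by (intro integrable_continuous_interval continuous_kernel)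
  have "kernel \<tau> * (\<Sum>s\<le>r + 1. of_real (beta s) * ((of_real z0 * vline \<tau>)\<^sup>2) ^ s) = (\<Sum>s\<le>r + 1. of_real (beta s * z0 ^ (2 * s)) * f s \<tau>)" for \<tau>
    unfolding sum_distrib_left
  proof (intro sum.cong refl)
    fix s
    have "vline \<tau> powr of_real (a s) = vline \<tau> powr (of_nat (2 * s) + of_real (1/12))" by (simp add: a_def)
    also have "\<dots> = vline \<tau> powr of_nat (2 * s) * vline \<tau> powr of_real (1/12)" by (rule powr_add)
    also have "vline \<tau> powr of_nat (2 * s) = vline \<tau> ^ (2 * s)" by (rule powr_nat') (simp add: arc_facts)
    finally have "f s \<tau> = kernel \<tau> * vline \<tau> ^ (2 * s)" by (simp add: f_def kernel_def mult_ac)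
    moreover have "((of_real z0 * vline \<tau>)\<^sup>2) ^ s = of_real (z0 ^ (2 * s)) * vline \<tau> ^ (2 * s)"
      by (simp add: power_mult_distrib power_mult)
    ultimately show "kernel \<tau> * (of_real (beta s) * ((of_real z0 * vline \<tau>)\<^sup>2) ^ s) = of_real (beta s * z0 ^ (2 * s)) * f s \<tau>"
      by simp
  qed
  note eq = this
  have "integral I (\<lambda>\<tau>. kernel \<tau> * (\<Sum>s\<le>r + 1. of_real (beta s) * ((of_real z0 * vline \<tau>)\<^sup>2) ^ s)) = (\<Sum>s\<le>r + 1. integral I (\<lambda>\<tau>. of_real (beta s * z0 ^ (2 * s)) * f s \<tau>))"
    unfolding eq by (rule integral_sum) (auto intro: integrable_on_mult_right fi)
  also have "\<dots> = (\<Sum>s\<le>r + 1. of_real (beta s * z0 ^ (2 * s)) * integral I (f s))"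
    by (intro sum.cong refl integral_mult_right)
  finally have "integral I (\<lambda>\<tau>. kernel \<tau> * (\<Sum>s\<le>r + 1. of_real (beta s) * ((of_real z0 * vline \<tau>)\<^sup>2) ^ s)) = (\<Sum>s\<le>r + 1. of_real (beta s * z0 ^ (2 * s)) * integral I (f s))" .
  moreover have "of_real main_sum = (\<Sum>s\<le>r + 1. of_real (beta s * z0 ^ (2 * s)) * (\<Sum>m<N. (- 1) ^ m * saddle_g (a s) (2 * m) * of_real (gauss L m)))"
    unfolding main_sum_def a_def saddle_g_b_coeff by (simp add: sum_distrib_left mult_ac)
  ultimately have "cmod (integral I (\<lambda>\<tau>. kernel \<tau> * (\<Sum>s\<le>r + 1. of_real (beta s) * ((of_real z0 * vline \<tau>)\<^sup>2) ^ s)) - of_real main_sum)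
    = cmod (\<Sum>s\<le>r + 1. of_real (beta s * z0 ^ (2 * s)) * (integral I (f s) - (\<Sum>m<N. (- 1) ^ m * saddle_g (a s) (2 * m) * of_real (gauss L m))))"
    by (simp only: right_diff_distrib sum_subtractf)
  also have "\<dots> \<le> (\<Sum>s\<le>r + 1. 5/4 * G * (\<bar>beta s\<bar> * (144 * z0\<^sup>2) ^ s))"
  proof (rule sum_norm_le)
    fix s
    have "cmod (integral I (f s) - (\<Sum>m<N. (- 1) ^ m * saddle_g (a s) (2 * m) * of_real (gauss L m))) \<le> 12 powr a s * G"
      unfolding I_def f_def[abs_def] vline_def G_def
      by (rule saddle_integral) (use L_ge_N in \<open>auto simp: a_def N_def\<close>)
    \<comment> \<open>The part \<open>144 ^ s\<close> joins \<open>z0 ^ (2 * s)\<close>, as foreseen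
      in \<open>beta_sum_small\<close>; the rest is \<open>12 powr (1/12)\<close>, below
      \<open>5/4\<close> since \<open>(5/4) ^ 12\<close> exceeds 12.\<close>
    also have "12 powr a s \<le> 144 ^ s * (5/4)"
    proof -
      have "12 powr (2 * real s) = 12 powr real (2 * s)" by simp
      also have "\<dots> = 12 ^ (2 * s)" by (rule powr_realpow) simp
      also have "\<dots> = 144 ^ s" by (simp add: power_mult)
      finally have as: "12 powr a s = 144 ^ s * 12 powr (1/12)" by (simp add: a_def powr_add)
      have "(12::real) \<le> (5/4) ^ 12" by (simp add: power_numeral_reduce)
      hence "12 powr (1/12) \<le> ((5/4) ^ 12) powr (1/12::real)" by (intro powr_mono2) auto
      also have "(5/4::real) ^ 12 = (5/4) powr real 12" by (rule powr_realpow[symmetric]) simp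
      also have "((5/4::real) powr real 12) powr (1/12) = (5/4) powr (real 12 * (1/12))" by (rule powr_powr)
      finally have "12 powr (1/12) \<le> (5/4::real)" by simp
      thus ?thesis unfolding as by simp
    qed
    finally have *: "cmod (integral I (f s) - (\<Sum>m<N. (- 1) ^ m * saddle_g (a s) (2 * m) * of_real (gauss L m))) \<le> 144 ^ s * (5/4) * G"
      by (simp add: G_def gauss_def mult_right_mono add_nonneg_nonneg less_imp_le[OF Gamma_half_pos])
    have "cmod (of_real (beta s * z0 ^ (2 * s)) * (integral I (f s) - (\<Sum>m<N. (- 1) ^ m * saddle_g (a s) (2 * m) * of_real (gauss L m)))) \<le> (\<bar>beta s\<bar> * z0 ^ (2 * s)) * (144 ^ s * (5/4) * G)"
      unfolding norm_mult norm_of_real abs_mult using * z0 by (intro mult_mono) auto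
    also have "\<dots> = 5/4 * G * (\<bar>beta s\<bar> * (144 * z0\<^sup>2) ^ s)" by (simp add: power_mult_distrib power_mult)
    finally show "cmod (of_real (beta s * z0 ^ (2 * s)) * (integral I (f s) - (\<Sum>m<N. (- 1) ^ m * saddle_g (a s) (2 * m) * of_real (gauss L m)))) \<le> \<dots>" .
  qed
  also have "\<dots> = 5/4 * G * (\<Sum>s\<le>r + 1. \<bar>beta s\<bar> * (144 * z0\<^sup>2) ^ s)" by (rule sum_distrib_left[symmetric])
  also have "\<dots> \<le> 5/4 * (4920 * unit_err) * (101/100)"
  proof (rule mult_mono[OF mult_left_mono beta_sum_small])
    show "G \<le> 4920 * unit_err" unfolding G_def by (rule gauss_remainder_bound) (rule L_def)
    show "0 \<le> (\<Sum>s\<le>r + 1. \<bar>beta s\<bar> * (144 * z0\<^sup>2) ^ s)" by (intro sum_nonneg) simp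
  qed (use unit_err_nonneg in auto)
  finally show ?thesis using unit_err_nonneg by (simp add: I_def)
qed

lemma integrand_integral:
  "(integrand has_integral of_real (2 * pi * real (PL n))) {- pi..pi}"
  unfolding integrand_def[abs_def] by (rule PL_integral[OF z0])

lemma arc_integral:
  "cmod (integral {- (z0/10)..z0/10} integrand - of_real (z0 * scale * main_sum)) \<le> z0 * scale * (6302 * unit_err)"
proof -
  define I where "I = {- (1/10::real)..1/10}"
  define M where "M \<tau> = kernel \<tau> * (\<Sum>s\<le>r + 1. of_real (beta s) * ((of_real z0 * vline \<tau>)\<^sup>2) ^ s)" for \<tau>
  define Q where "Q \<tau> = kernel \<tau> * correction \<tau>" for \<tau>
  have sc: "scale > 0" using z0 by (simp add: scale_def)
  have "z0 / 10 \<le> pi" using z0_small pi_gt3 by simp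
  hence "integrand integrable_on {- (z0/10)..z0/10}"
    using z0 by (intro integrable_subinterval_real[OF has_integral_integrable[OF integrand_integral]]) auto
  hence "(integrand has_integral integral {- (z0/10)..z0/10} integrand) (cbox (- (z0/10)) (z0/10))" by (simp add: integrable_integral)
  from has_integral_affinity'[OF this z0, of 0]
  have "((\<lambda>\<tau>. integrand (z0 * \<tau>)) has_integral integral {- (z0/10)..z0/10} integrand /\<^sub>R z0) I"
    using z0 by (simp add: I_def)
  from has_integral_mult_right[OF this, of "1 / of_real scale"]
  have Q: "(Q has_integral 1 / of_real scale * (integral {- (z0/10)..z0/10} integrand /\<^sub>R z0)) I"
    unfolding integrand_arc using sc by (simp add: Q_def[abs_def])
  have M: "M integrable_on I"
    unfolding I_def M_def[abs_def] by (intro integrable_continuous_interval continuous_intros continuous_kernel)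
  have "((\<lambda>\<tau>. Q \<tau> - M \<tau>) has_integral 1 / of_real scale * (integral {- (z0/10)..z0/10} integrand /\<^sub>R z0) - integral I M) {- (1/10)..1/10}"
    using has_integral_diff[OF Q integrable_integral[OF M]] by (simp add: I_def)
  hence "cmod (1 / of_real scale * (integral {- (z0/10)..z0/10} integrand /\<^sub>R z0) - integral I M) \<le> 2 * (2 * unit_err) * (1/10 - - (1/10))"
  proof (rule has_integral_norm_bound)
    fix \<tau> :: real assume "\<tau> \<in> {- (1/10)..1/10}"
    hence t: "\<bar>\<tau>\<bar> \<le> 1/10" by auto
    have "Q \<tau> - M \<tau> = kernel \<tau> * (correction \<tau> - (\<Sum>s\<le>r + 1. of_real (beta s) * ((of_real z0 * vline \<tau>)\<^sup>2) ^ s))"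
      by (simp add: Q_def M_def right_diff_distrib)
    thus "cmod (Q \<tau> - M \<tau>) \<le> 2 * (2 * unit_err)"
      unfolding norm_mult using kernel_le[OF t] correction_approx[OF t] by (simp only: norm_mult) (intro mult_mono, auto)
  qed (use unit_err_nonneg in auto)
  hence "cmod (1 / of_real scale * (integral {- (z0/10)..z0/10} integrand /\<^sub>R z0) - integral I M) \<le> unit_err"
    using unit_err_nonneg by simp
  from norm_triangle_mono[OF this main_term_integral[folded I_def M_def]]
  have b: "cmod (1 / of_real scale * (integral {- (z0/10)..z0/10} integrand /\<^sub>R z0) - of_real main_sum) \<le> 6302 * unit_err"
    using unit_err_nonneg by simp
  have "integral {- (z0/10)..z0/10} integrand - of_real (z0 * scale * main_sum) = of_real (z0 * scale) * (1 / of_real scale * (integral {- (z0/10)..z0/10} integrand /\<^sub>R z0) - of_real main_sum)"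
    using sc z0 by (simp add: right_diff_distrib scaleR_conv_of_real)
  hence "cmod (integral {- (z0/10)..z0/10} integrand - of_real (z0 * scale * main_sum)) = z0 * scale * cmod (1 / of_real scale * (integral {- (z0/10)..z0/10} integrand /\<^sub>R z0) - of_real main_sum)"
    using sc z0 by (simp only: norm_mult norm_of_real) simp
  also have "\<dots> \<le> z0 * scale * (6302 * unit_err)" using b sc z0 by (intro mult_left_mono) auto
  finally show ?thesis .
qed

text \<open>The comparison value is the integrand at \<open>y = 0\<close>. It lies on the arc, where
  its size is already known through \<open>integrand_arc\<close>.\<close>

lemma integrand_minor:
  assumes "z0 / 10 \<le> \<bar>y\<bar>" "\<bar>y\<bar> \<le> pi"
  shows "cmod (integrand y) \<le> 6 * scale * exp (- (85/10000 * (1 / z0)\<^sup>2))"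
proof -
  define g where "g = 85/10000 * (1 / z0)\<^sup>2"
  define q0 where "q0 = exp (- z0)"
  have q0: "0 < q0" "q0 < 1" using z0 by (auto simp: q0_def)
  have "cmod (exp (log_gf (exp (- (of_real z0 + \<i> * of_real y))))) \<le> exp (log_gf q0 - g)"
    by (rule minor_arc_bound) (use q0 minor_arc_gain[OF z0 z0_small(4) assms] in \<open>auto simp: q0_def g_def\<close>)
  hence "exp (real n * z0) * cmod (exp (log_gf (exp (- (of_real z0 + \<i> * of_real y))))) \<le> exp (real n * z0) * exp (log_gf q0 - g)"
    by (intro mult_left_mono) auto
  hence "cmod (integrand y) \<le> exp (real n * z0 + log_gf q0) * exp (- g)"
    by (simp add: integrand_def exp_add norm_mult flip: exp_add)
  also have "exp (real n * z0 + log_gf q0) = cmod (integrand 0)"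
  proof -
    have "integrand 0 = of_real (exp (real n * z0 + log_gf q0))"
      using log_gf_of_real[of q0] q0 by (simp add: integrand_def q0_def exp_of_real flip: exp_of_real)
    thus ?thesis by simp
  qed
  also have "\<dots> \<le> 6 * scale"
  proof -
    have "kernel 0 = 1" by (simp add: kernel_def vline_def saddle_v_def)
    hence "integrand 0 = of_real scale * correction 0" using integrand_arc[of 0] by simp
    hence "cmod (integrand 0) = scale * cmod (correction 0)" by (simp add: norm_mult scale_def)
    also have "\<dots> \<le> scale * 6" by (intro mult_left_mono correction_le) (auto simp: scale_def)
    finally show ?thesis by simp
  qed
  finally show ?thesis by (simp add: g_def)
qed

lemma PL_approx: "\<bar>2 * pi * real (PL n) - z0 * scale * main_sum\<bar> \<le> z0 * scale * (7000 * unit_err)"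
proof -
  define b where "b = z0 / 10"
  define B where "B = 6 * scale * exp (- (85/10000 * (1 / z0)\<^sup>2))"
  have b: "0 < b" "b \<le> pi" using z0 z0_small pi_gt3 by (simp_all add: b_def)
  have sc: "scale > 0" using z0 by (simp add: scale_def)
  have B: "B \<ge> 0" using sc by (simp add: B_def)
  note int = has_integral_integrable[OF integrand_integral]
  have sub: "integrand integrable_on {x..y}" if "- pi \<le> x" "y \<le> pi" for x y
    by (rule integrable_subinterval_real[OF int]) (use that in auto)
  have tail: "cmod (integral {x..y} integrand) \<le> B * pi" if "- pi \<le> x" "x \<le> y" "y \<le> pi" "y - x \<le> pi" "\<And>t. t \<in> {x..y} \<Longrightarrow> b \<le> \<bar>t\<bar>" for x y
  proof -
    have "cmod (integral {x..y} integrand) \<le> B * (y - x)"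
    proof (rule has_integral_norm_bound[OF integrable_integral])
      show "integrand integrable_on {x..y}" using sub that by auto
      fix t assume "t \<in> {x..y}"
      hence "b \<le> \<bar>t\<bar>" "\<bar>t\<bar> \<le> pi" using that by auto
      thus "cmod (integrand t) \<le> B" unfolding B_def by (intro integrand_minor) (auto simp: b_def)
    qed (use that B in auto)
    also have "\<dots> \<le> B * pi" using B that by (intro mult_left_mono) auto
    finally show ?thesis .
  qed
  have "of_real (2 * pi * real (PL n)) = integral {- pi..pi} integrand" using integrand_integral by (simp add: integral_unique)
  also have "\<dots> = integral {- pi..- b} integrand + integral {- b..pi} integrand"
    using b sub by (intro Henstock_Kurzweil_Integration.integral_combine[symmetric]) auto
  also have "integral {- b..pi} integrand = integral {- b..b} integrand + integral {b..pi} integrand"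
    using b sub by (intro Henstock_Kurzweil_Integration.integral_combine[symmetric]) auto
  finally have "of_real (2 * pi * real (PL n)) - of_real (z0 * scale * main_sum) =
     (integral {- b..b} integrand - of_real (z0 * scale * main_sum)) + (integral {- pi..- b} integrand + integral {b..pi} integrand)" by simp
  hence "\<bar>2 * pi * real (PL n) - z0 * scale * main_sum\<bar> = cmod ((integral {- b..b} integrand - of_real (z0 * scale * main_sum)) + (integral {- pi..- b} integrand + integral {b..pi} integrand))"
    by (metis norm_of_real of_real_diff)
  also have "\<dots> \<le> z0 * scale * (6302 * unit_err) + (B * pi + B * pi)"
    by (intro norm_triangle_mono) (use arc_integral b in \<open>auto simp: b_def intro!: tail[unfolded b_def]\<close>)
  also have "B * pi + B * pi \<le> z0 * scale * (280 * unit_err)"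
  proof -
    \<comment> \<open>Each of the two outer pieces has length at most \<open>pi\<close>, and
      \<open>12 pi\<close> is below 40.\<close>
    have "B * pi + B * pi = (12 * pi) * (scale * exp (- (85/10000 * (1 / z0)\<^sup>2)))" by (simp add: B_def)
    also have "\<dots> \<le> 40 * (scale * exp (- (85/10000 * (1 / z0)\<^sup>2)))"
      using pi_approx sc by (intro mult_right_mono) auto
    also have "\<dots> = z0 * scale * (40 * (1 / z0) * exp (- (85/10000 * (1 / z0)\<^sup>2)))" using z0 by simp
    also have "\<dots> \<le> z0 * scale * (280 * unit_err)" using minor_arc_small z0 sc by (intro mult_left_mono) auto
    finally show ?thesis .
  qed
  finally have "\<bar>2 * pi * real (PL n) - z0 * scale * main_sum\<bar> \<le> z0 * scale * (6582 * unit_err)"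
    by (simp add: algebra_simps)
  also have "\<dots> \<le> z0 * scale * (7000 * unit_err)" using z0 sc unit_err_nonneg by (intro mult_left_mono) auto
  finally show ?thesis .
qed

end

section \<open>From the parameter w to the scale z0\<close>

lemma w_of_pos: "n \<ge> 1 \<Longrightarrow> w_of n > 0"
  using A_const_ge by (simp add: w_of_def)

text \<open>The saddle point equation: the derivative of \<open>n z + A / z^2\<close> vanishes at
  \<open>z0 = sqrt (3 A) w\<close>.\<close>

lemma w_of_cube: "n \<ge> 1 \<Longrightarrow> real n * (sqrt (3 * A_const) * w_of n) ^ 3 = 2 * A_const"
proof -
  assume n: "n \<ge> 1"
  have A: "A_const > 0" using A_const_ge by simp
  have cube: "(x powr (1/3)) ^ 3 = x" if "x > 0" for x :: real
    using that by (simp add: powr_powr flip: powr_realpow)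
  have sixth: "(A_const powr (1/6)) ^ 3 = sqrt A_const"
    using A by (simp add: powr_powr powr_half_sqrt flip: powr_realpow)
  have s3: "sqrt 3 ^ 3 = 3 * sqrt (3::real)" "sqrt A_const ^ 3 = A_const * sqrt A_const"
    using A by (simp_all add: power3_eq_cube)
  have "(sqrt (3 * A_const) * w_of n) ^ 3 = sqrt 3 ^ 3 * sqrt A_const ^ 3 * ((2 powr (1/3)) ^ 3 / (sqrt 3 ^ 3 * (A_const powr (1/6)) ^ 3 * (real n powr (1/3)) ^ 3))"
    by (simp add: w_of_def real_sqrt_mult power_mult_distrib power_divide)
  also have "\<dots> = 3 * sqrt 3 * (A_const * sqrt A_const) * (2 / (3 * sqrt 3 * sqrt A_const * real n))"
    unfolding s3 sixth using cube[of 2] cube[of "real n"] n by simp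
  finally show ?thesis using A n by simp
qed

text \<open>Only the last two factors of \<open>eps r d\<close> matter: all others, including the dependence on \<open>d\<close>, are at
  most 1.\<close>

lemma eps_cube_bound:
  assumes d: "d \<ge> 1" and w: "0 \<le> w" "w \<le> eps r d"
  shows "w ^ 3 * ((6 * A_const) ^ r * (real r + 1)) * (0.1485 * 2 ^ 14 * (3 * A_const) ^ 3 * pi ^ 3) \<le> 1"
proof -
  have A: "12/10 \<le> A_const" "A_const \<le> 2" using A_const_ge zeta_nat_bounds(2)[of 3] by (auto simp: A_const_def)
  define k where "k = real d * (real d - 1)"
  have k: "0 \<le> k" using d by (simp add: k_def)
  define X where "X = (6 * A_const) ^ r * (real r + 1)"
  define Y where "Y = 0.1485 * 2 ^ 14 * (3 * A_const) ^ 3 * pi ^ 3"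
  define Z where "Z = exp (Gamma (2 * real d ^ 2) / (2 * pi) ^ (2 * d ^ 2 + 2)) * 6 powr (2 * real d - 2)"
  have X: "X > 0" using A by (simp add: X_def)
  have Y: "Y > 0" using A by (simp add: Y_def)
  have neg: "b powr - e \<le> 1" if "1 \<le> b" "0 \<le> e" for b e :: real
    using that powr_mono[of "- e" 0 b] by simp
  have "Z \<ge> 1 * 1" unfolding Z_def
  proof (rule mult_mono)
    have "0 \<le> Gamma (2 * real d ^ 2)" by (rule less_imp_le, rule Gamma_real_pos) (use d in simp)
    thus "1 \<le> exp (Gamma (2 * real d ^ 2) / (2 * pi) ^ (2 * d ^ 2 + 2))" by simp
    show "1 \<le> 6 powr (2 * real d - 2)" using d by (intro ge_one_powr_ge_zero) auto
  qed auto
  hence XZ: "X \<le> Z * X" using X by simp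
  have inv3: "(x powr (- 1/3)) ^ 3 = 1 / x" if "x > 0" for x :: real
  proof -
    have "(x powr (- 1/3)) ^ 3 = (x powr (- 1/3)) powr real 3" using that by (intro powr_realpow[symmetric]) simp
    also have "\<dots> = x powr (- 1)" by (simp add: powr_powr)
    finally show ?thesis using that by (simp add: powr_minus_divide)
  qed
  have f1: "real d powr (- (2 * real d)) \<le> 1" using d by (intro neg) auto
  have f2: "2 powr (- k) \<le> 1" using k by (intro neg) auto
  have f3: "(4 * exp 1 / sqrt (3 * A_const)) powr (- k) \<le> 1"
  proof (rule neg[OF _ k])
    have "sqrt (3 * A_const) \<le> 4" using A by (intro real_le_lsqrt) auto
    also have "4 * 1 \<le> 4 * exp (1::real)" by (intro mult_left_mono) auto
    finally show "1 \<le> 4 * exp 1 / sqrt (3 * A_const)" using A by (simp add: le_divide_eq)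
  qed
  have f4: "(Z * X) powr (- 1/3) \<le> X powr (- 1/3)" using X XZ by (intro powr_mono2') auto
  have "eps r d = real d powr (- (2 * real d)) * 2 powr (- k) * (4 * exp 1 / sqrt (3 * A_const)) powr (- k) * (Z * X) powr (- 1/3) * Y powr (- 1/3)"
    by (simp add: eps_def k_def X_def Y_def Z_def mult.assoc)
  also have "\<dots> \<le> 1 * 1 * 1 * X powr (- 1/3) * Y powr (- 1/3)"
    by (intro mult_mono mult_nonneg_nonneg f1 f2 f3 f4) auto
  finally have "w \<le> X powr (- 1/3) * Y powr (- 1/3)" using w by simp
  hence "w ^ 3 \<le> (X powr (- 1/3) * Y powr (- 1/3)) ^ 3" using w by (intro power_mono) auto
  also have "\<dots> = (X powr (- 1/3)) ^ 3 * (Y powr (- 1/3)) ^ 3" by (rule power_mult_distrib)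
  also have "\<dots> = 1 / X * (1 / Y)" unfolding inv3[OF X] inv3[OF Y] ..
  finally have "w ^ 3 \<le> 1 / X * (1 / Y)" .
  hence "w ^ 3 * (X * Y) \<le> 1 / X * (1 / Y) * (X * Y)" using X Y by (intro mult_right_mono) auto
  also have "\<dots> = 1" using X Y by simp
  finally show ?thesis unfolding X_def[symmetric] Y_def[symmetric] by (simp add: mult.assoc)
qed

text \<open>The condition from \<open>eps\<close> is cubic in \<open>w\<close>, so it is compared
  with the cube of the claim. \<open>6 * A_const\<close> dominates \<open>1.93 ^ 3\<close>, and the
  numerical factors leave \<open>68/10 * 130000\<close>, which exceeds the cube of 80.\<close>

lemma z0_bound:
  assumes d: "d \<ge> 1" and r: "r \<ge> 1" and w: "0 < w" "w \<le> eps r d"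
  shows "sqrt (3 * A_const) * w * (193/100) ^ r \<le> 1 / 80"
proof -
  define a where "a = sqrt (3 * A_const)"
  have A: "12/10 \<le> A_const" "A_const \<le> 2" using A_const_ge zeta_nat_bounds(2)[of 3] by (auto simp: A_const_def)
  have a2: "a\<^sup>2 = 3 * A_const" using A by (simp add: a_def)
  have a: "0 < a" "a \<le> 245/100" "36/10 \<le> a\<^sup>2"
  proof -
    show "0 < a" using A by (simp add: a_def)
    show "a \<le> 245/100" unfolding a_def using A by (intro real_le_lsqrt) (auto simp: power2_eq_square)
    show "36/10 \<le> a\<^sup>2" unfolding a2 using A by simp
  qed
  define p where "p = (193/100::real) ^ r"
  \<comment> \<open>The last factor 2 is the lower bound for \<open>r + 1\<close>.\<close>
  define c where "c = 0.1485 * 2 ^ 14 * pi ^ 3 * (2::real)"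
  have p: "p > 0" by (simp add: p_def)
  have p3: "p ^ 3 \<le> (6 * A_const) ^ r"
  proof -
    have "p ^ 3 = ((193/100) ^ 3) ^ r" unfolding p_def by (simp flip: power_mult add: mult.commute)
    also have "\<dots> \<le> (6 * A_const) ^ r" using A by (intro power_mono) (auto simp: power3_eq_cube)
    finally show ?thesis .
  qed
  have c: "130000 \<le> c"
  proof -
    have "3 ^ 3 \<le> pi ^ 3" using pi_gt3 by (intro power_mono) auto
    thus ?thesis by (simp add: c_def)
  qed
  have "w ^ 3 * (p ^ 3 * 2) * (0.1485 * 2 ^ 14 * (a\<^sup>2) ^ 3 * pi ^ 3) \<le> w ^ 3 * ((6 * A_const) ^ r * (real r + 1)) * (0.1485 * 2 ^ 14 * (3 * A_const) ^ 3 * pi ^ 3)"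
    unfolding a2 using w r p p3 A by (intro mult_right_mono mult_left_mono mult_mono) auto
  also have "\<dots> \<le> 1" by (rule eps_cube_bound[OF d less_imp_le[OF w(1)] w(2)])
  finally have "w ^ 3 * (p ^ 3 * 2) * (0.1485 * 2 ^ 14 * (a\<^sup>2) ^ 3 * pi ^ 3) \<le> 1" .
  also have "w ^ 3 * (p ^ 3 * 2) * (0.1485 * 2 ^ 14 * (a\<^sup>2) ^ 3 * pi ^ 3) = (a * w * p) ^ 3 * a ^ 3 * c"
    by (simp add: c_def power_mult_distrib flip: power_mult power_add)
  finally have 1: "(a * w * p) ^ 3 * (a ^ 3 * c) \<le> 1" by (simp add: mult.assoc)
  have "68/10 * 130000 \<le> a ^ 3 * c"
  proof (rule mult_mono[OF _ c])
    have "189/100 \<le> a" by (rule power2_le_imp_le) (use a in \<open>auto simp: power2_eq_square\<close>)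
    hence "36/10 * (189/100) \<le> a\<^sup>2 * a" using a by (intro mult_mono) auto
    thus "68/10 \<le> a ^ 3" by (simp add: power3_eq_cube power2_eq_square)
  qed (use a in auto)
  hence "(a * w * p) ^ 3 * (68/10 * 130000) \<le> (a * w * p) ^ 3 * (a ^ 3 * c)" using a w p by (intro mult_left_mono) auto
  with 1 have "(a * w * p) ^ 3 \<le> (1/80) ^ 3" by (simp add: power3_eq_cube)
  hence "a * w * p \<le> 1/80" by (subst (asm) power_mono_iff) (use a w p in auto)
  thus ?thesis by (simp add: a_def p_def)
qed

lemma w_of_inj:
  assumes "n \<ge> 1" "m \<ge> 1" "w_of n = w_of m"
  shows "n = m"
proof -
  have "(sqrt (3 * A_const) * w_of n) ^ 3 \<noteq> 0" using w_of_pos[OF assms(1)] A_const_ge by simp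
  thus ?thesis using w_of_cube[OF assms(1)] w_of_cube[OF assms(2)] assms(3) by (metis mult_right_cancel of_nat_eq_iff)
qed

lemma main_estimate:
  assumes r: "r \<ge> 1" and d: "d \<ge> 1" and n: "n \<ge> 1" and w: "w_of n \<le> eps r d"
  shows "\<bar>real (PL n) - PL_hat r (w_of n)\<bar> \<le> error_bound r (w_of n)"
proof -
  define w where "w = w_of n"
  define z0 where "z0 = sqrt (3 * A_const) * w"
  have A: "A_const > 0" using A_const_ge by simp
  have w0: "w > 0" unfolding w_def by (rule w_of_pos[OF n])
  interpret saddle_arc r z0 n
  proof
    show "0 < z0" using A w0 by (simp add: z0_def)
    show "z0 * (193/100) ^ r \<le> 1/80" unfolding z0_def by (rule z0_bound[OF d r w0]) (use w in \<open>simp add: w_def\<close>)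
    show "r \<ge> 1" by (rule r)
    show "real n * z0 ^ 3 = 2 * A_const" unfolding z0_def w_def by (rule w_of_cube[OF n])
  qed
  have z2: "z0\<^sup>2 = 3 * A_const * w\<^sup>2" using A by (simp add: z0_def power_mult_distrib)
  have z02: "z0 ^ (2 * k) = 3 ^ k * A_const ^ k * w ^ (2 * k)" for k
    by (simp add: power_mult z2 power_mult_distrib)
  have Lw: "L = 1 / (3 * w\<^sup>2)" unfolding L_def power_divide z2 using A by simp
  have Lp: "L > 0" using w0 by (simp add: Lw)
  have zp: "z0 powr a = 3 powr (a / 2) * A_const powr (a / 2) * w powr a" for a
  proof -
    have "z0 powr a = (sqrt (3 * A_const)) powr a * w powr a" unfolding z0_def by (rule powr_mult)
    also have "sqrt (3 * A_const) = (3 * A_const) powr (1/2)" using A by (simp add: powr_half_sqrt)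
    also have "\<dots> powr a = (3 * A_const) powr (a / 2)" by (simp add: powr_powr)
    also have "\<dots> = 3 powr (a / 2) * A_const powr (a / 2)" by (rule powr_mult)
    finally show ?thesis .
  qed
  define K where "K = exp (c_const + 1 / w\<^sup>2)"
  have scale: "z0 * scale = K * z0 powr (13/12)"
  proof -
    have "z0 powr (13/12) = z0 powr (1 + 1/12)" by simp
    also have "\<dots> = z0 powr 1 * z0 powr (1/12)" by (rule powr_add)
    finally have "z0 powr (13/12) = z0 * z0 powr (1/12)" using z0 by simp
    thus ?thesis by (simp add: scale_def K_def Lw)
  qed
  have "PL_hat r w = z0 * scale * main_sum / (2 * pi)"
  proof -
    \<comment> \<open>The Gaussian moment supplies \<open>3 ^ m * w ^ (2 * m)\<close> and
      \<open>sqrt 3 * w\<close>. The root completes \<open>3 powr (13/24)\<close> to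
      \<open>3 powr (25/24)\<close>, and the factor \<open>w\<close> completes
      \<open>w powr (13/12)\<close> to \<open>w powr (25/12)\<close>.\<close>
    have term_eq: "w powr (25/12) * ((- 1) ^ m * beta s * b_coeff s m * Gamma (real m + 1 / 2) * 3 powr (real s + real m + 25 / 24) * A_const powr (real s + 13 / 24) * w ^ (2 * s + 2 * m))
       = z0 powr (13/12) * ((- 1) ^ m * beta s * b_coeff s m * z0 ^ (2 * s) * gauss L m)" for s m
    proof -
      have g: "gauss L m = Gamma (real m + 1/2) * (3 ^ m * w ^ (2 * m) * (sqrt 3 * w))"
      proof -
        have "L ^ m * sqrt L = 1 / (3 ^ m * w ^ (2 * m) * (sqrt 3 * w))"
          unfolding Lw using w0 by (simp add: power_divide power_mult_distrib power_mult real_sqrt_divide real_sqrt_mult)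
        thus ?thesis unfolding gauss_def powr_minus_half_nat[OF Lp] by simp
      qed
      have "(3::real) powr (real s + real m + 25/24) = 3 powr real s * 3 powr real m * 3 powr (13/24 + 1/2)"
        unfolding powr_add[symmetric] by simp
      also have "(3::real) powr (13/24 + 1/2) = 3 powr (13/24) * sqrt 3" unfolding powr_add by (simp add: powr_half_sqrt)
      also have "(3::real) powr real s * 3 powr real m = 3 ^ s * 3 ^ m" by (simp add: powr_realpow)
      finally have t3: "(3::real) powr (real s + real m + 25/24) = 3 ^ s * 3 ^ m * (3 powr (13/24) * sqrt 3)" .
      have tA: "A_const powr (real s + 13/24) = A_const ^ s * A_const powr (13/24)" using A by (simp add: powr_add powr_realpow)
      have "w powr (25/12) = w powr (13/12 + 1)" by simp
      also have "\<dots> = w powr (13/12) * w" unfolding powr_add using w0 by simp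
      finally have tw: "w powr (25/12) = w powr (13/12) * w" .
      have tz: "z0 powr (13/12) = 3 powr (13/24) * A_const powr (13/24) * w powr (13/12)" using zp[of "13/12"] by simp
      show ?thesis unfolding g t3 tA tw tz z02 power_add by (simp only: mult_ac)
    qed
    have "(\<Sum>s=0..r + 1. \<Sum>m=0..r + 1. (- 1) ^ m * beta s * b_coeff s m * Gamma (real m + 1 / 2) * 3 powr (real s + real m + 25 / 24) * A_const powr (real s + 13 / 24) * w ^ (2 * s + 2 * m)) * w powr (25/12)
      = z0 powr (13/12) * main_sum"
    proof -
      have "{0..r + 1} = {..r + 1}" "{..<N} = {..r + 1}" by (auto simp: N_def)
      thus ?thesis unfolding main_sum_def sum_distrib_left sum_distrib_right
        by (simp only:) (intro sum.cong refl, subst mult.commute, rule term_eq)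
    qed
    thus ?thesis unfolding PL_hat_def scale by (simp add: K_def mult_ac)
  qed
  hence "\<bar>real (PL n) - PL_hat r w\<bar> = \<bar>2 * pi * real (PL n) - z0 * scale * main_sum\<bar> / (2 * pi)"
  proof -
    assume "PL_hat r w = z0 * scale * main_sum / (2 * pi)"
    hence "real (PL n) - PL_hat r w = (2 * pi * real (PL n) - z0 * scale * main_sum) / (2 * pi)" by (simp add: diff_divide_distrib)
    thus ?thesis by (simp add: abs_divide)
  qed
  also have "\<dots> \<le> z0 * scale * (7000 * unit_err) / (2 * pi)" by (intro divide_right_mono PL_approx) simp
  also have "\<dots> \<le> error_bound r w"
  proof -
    define B where "B = K * C_const r * (real r + 2) * 2 ^ r * z0 powr (13/12) * z0 ^ (2 * r + 4)"
    have "error_bound r w = B * (2 powr (8 + 1/24) * pi\<^sup>2)"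
    proof -
      have "z0 powr (2 * real r + 61/12) = 3 powr (real r + 61/24) * A_const powr (real r + 61/24) * w powr (2 * real r + 61/12)"
        using zp[of "2 * real r + 61/12"] by (simp add: add_divide_distrib)
      also have "3 powr (real r + 61/24) * A_const powr (real r + 61/24) = (3 * A_const) powr (real r + 61/24)"
        by (rule powr_mult[symmetric])
      finally have 1: "(3 * A_const) powr (real r + 61/24) * w powr (2 * real r + 61/12) = z0 powr (2 * real r + 61/12)" ..
      have "z0 powr (2 * real r + 61/12) = z0 powr (real (2 * r + 4) + 13/12)" by (simp add: add_ac)
      also have "\<dots> = z0 ^ (2 * r + 4) * z0 powr (13/12)" unfolding powr_add by (simp only: powr_realpow[OF z0])
      finally have 2: "z0 powr (2 * real r + 61/12) = z0 ^ (2 * r + 4) * z0 powr (13/12)" .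
      have "(2::real) powr (real r + 8 + 1/24) = 2 powr (real r + (8 + 1/24))" by (simp add: add.assoc)
      also have "\<dots> = 2 ^ r * 2 powr (8 + 1/24)" unfolding powr_add by (simp only: powr_realpow zero_less_numeral)
      finally have 3: "(2::real) powr (real r + 8 + 1/24) = 2 ^ r * 2 powr (8 + 1/24)" .
      have "error_bound r w = K * C_const r * 2 powr (real r + 8 + 1/24) * pi\<^sup>2 * (real r + 2) * ((3 * A_const) powr (real r + 61/24) * w powr (2 * real r + 61/12))"
      proof -
        have "2 * real r + 5 + 1/12 = 2 * real r + 61/12" by simp
        thus ?thesis unfolding error_bound_def K_def by (simp only: mult_ac)
      qed
      thus ?thesis unfolding 1 2 3 B_def by (simp only: mult_ac)
    qed
    moreover have "z0 * scale * (7000 * unit_err) / (2 * pi) = B * (3500 / pi)"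
    proof -
      have "2 * N = 2 * r + 4" "real N = real r + 2" by (simp_all add: N_def)
      thus ?thesis unfolding scale unit_err_def B_def by (simp only:) simp
    qed
    \<comment> \<open>Here 3500 is half of the 7000 in \<open>PL_approx\<close>, and the claimed
      constant exceeds the left side by a factor of more than two.\<close>
    moreover have "3500 / pi \<le> 2 powr (8 + 1/24) * pi\<^sup>2"
    proof -
      have "3500 / pi \<le> 3500 / 3" using pi_gt3 by (intro divide_left_mono) auto
      also have "\<dots> \<le> 2 ^ 8 * 3\<^sup>2" by simp
      also have "\<dots> \<le> 2 powr (8 + 1/24) * pi\<^sup>2"
      proof (intro mult_mono power_mono)
        have "(2::real) ^ 8 = 2 powr 8" by simp
        also have "\<dots> \<le> 2 powr (8 + 1/24)" by (intro powr_mono) auto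
        finally show "(2::real) ^ 8 \<le> 2 powr (8 + 1/24)" .
      qed (use pi_gt3 in auto)
      finally show ?thesis .
    qed
    hence "B * (3500 / pi) \<le> B * (2 powr (8 + 1/24) * pi\<^sup>2)"
      by (rule mult_left_mono) (use C_const_ge_2[of r] z0 in \<open>simp add: B_def K_def\<close>)
    ultimately show ?thesis by (simp only:)
  qed
  finally show ?thesis unfolding w_def .
qed

text \<open>\<open>E\<close> is chosen before \<open>d\<close> and \<open>n\<close>: for given
  \<open>r\<close>, a single error function of \<open>w\<close> serves every admissible
  \<open>d\<close> and \<open>n\<close>.\<close>

theorem theorem2p2:
  fixes r :: nat
  assumes "r \<ge> 1"
  shows "\<exists>E :: real \<Rightarrow> real. \<forall>d n :: nat. d \<ge> 1 \<longrightarrow> n \<ge> 1 \<longrightarrow> w_of n \<in> {0..eps r d} \<longrightarrow>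
           real (PL n) = PL_hat r (w_of n) + E (w_of n) \<and>
           \<bar>E (w_of n)\<bar> \<le> error_bound r (w_of n)"
proof -
  \<comment> \<open>the error is a function of \<open>w\<close>, so \<open>n\<close> has to be recovered from it\<close>
  define E where "E w = real (PL (inv_into {1..} w_of w)) - PL_hat r w" for w
  have "inj_on w_of {1..}" by (intro inj_onI w_of_inj) auto
  hence E: "E (w_of n) = real (PL n) - PL_hat r (w_of n)" if "n \<ge> 1" for n
    using that by (simp add: E_def inv_into_f_f)
  show ?thesis
    using E main_estimate[OF assms] by (intro exI[of _ E]) auto
qed

end
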